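(* Let $V$ be a complex vector space of dimension $m+1$ with $m\ge 1$, let $d\geq 3$ be an integer, and let $$\tau:\mathbb{P}(\mathrm{Sym}^d V)\dashrightarrow (\mathbb{P} V)^{(ed_X)},\qquad f\mapsto \mathrm{Eig}(f)$$ be the rational map sending a polynomial $f$ to its locus of eigentensors. Let $f\in \mathbb{P}(\mathrm{Sym}^d V)$ be a general polynomial. Then $$\tau^{-1}(\tau(f))=\begin{cases}\{[f]\}, & \text{if } d \text{ is odd},\\ \{[f+cq^{d/2}] : c\in\mathbb{C}\}, & \text{if } d \text{ is even}.\end{cases}$$ Moreover, the image of $\tau$ has dimension $$\dim(\mathrm{Im}(\tau))=\begin{cases}\binom{d+m}{d}-1, & \text{if } d \text{ is odd},\\ \binom{d+m}{d}-2, & \text{if } d \text{ is even}.\end{cases}$$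
   Context: Fix coordinates $x_0,\dots,x_m$ on $V$ and the quadratic form $q=x_0^2+\dots+x_m^2$, used to identify $V$ with $V^*$; elements of $\mathrm{Sym}^d V$ are homogeneous polynomials of degree $d$ in $x_0,\dots,x_m$. The eigentensors of $f\in \mathrm{Sym}^dV$ are the points $[x]\in\mathbb{P} V$ with $\nabla f(x)=\lambda x$ for some $\lambda\in\mathbb{C}$. $\mathrm{Eig}(f)\subset\mathbb{P} V$ is the scheme of eigentensors, defined by the $2\times 2$ minors of the $2\times(m+1)$ matrix with rows $\left(\frac{\partial f}{\partial x_0},\dots,\frac{\partial f}{\partial x_m}\right)$ and $(x_0,\dots,x_m)$. The integer $ed_X$ is the Euclidean distance degree of the Veronese variety $X\subset\mathbb{P}(\mathrm{Sym}^dV)$, that is, the number of eigentensors of a general $f\in\mathrm{Sym}^dV$. $(\mathbb{P} V)^{(n)}=(\mathbb{P} V)^n/\Sigma_n$ is the symmetric product (unordered $n$-tuples of points). The map $\tau$ is defined at those $[f]$ for which $\mathrm{Eig}(f)$ consists of exactly $ed_X$ points. "General" means: in some nonempty Zariski open subset of the parameter space. *)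

theory Defs
  imports "HOL-Analysis.Analysis" "HOL-Library.Poly_Mapping" "HOL-Library.Multiset"
begin

section \<open>Complex polynomials\<close>

text \<open>A polynomial with variables indexed by \<open>'i\<close> is a finitely supported map from exponent
  vectors to coefficients; the ring operations are those of \<^theory>\<open>HOL-Library.Poly_Mapping\<close>.\<close>

type_synonym 'i cpoly = "('i \<Rightarrow>\<^sub>0 nat) \<Rightarrow>\<^sub>0 complex"

definition const_poly :: "complex \<Rightarrow> 'i cpoly" where
  "const_poly c = Poly_Mapping.single 0 c"

definition peval :: "'i cpoly \<Rightarrow> ('i \<Rightarrow> complex) \<Rightarrow> complex" where
  "peval p v = (\<Sum>a\<in>Poly_Mapping.keys p.
     Poly_Mapping.lookup p a * (\<Prod>i\<in>Poly_Mapping.keys a. v i ^ Poly_Mapping.lookup a i))"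

definition pdiff :: "'i \<Rightarrow> 'i cpoly \<Rightarrow> 'i cpoly" where
  "pdiff i p = (\<Sum>a\<in>Poly_Mapping.keys p.
     Poly_Mapping.single (a - Poly_Mapping.single i 1)
       (of_nat (Poly_Mapping.lookup a i) * Poly_Mapping.lookup p a))"

definition homogeneous :: "nat \<Rightarrow> 'i cpoly \<Rightarrow> bool" where
  "homogeneous d p \<longleftrightarrow>
     (\<forall>a\<in>Poly_Mapping.keys p. (\<Sum>i\<in>Poly_Mapping.keys a. Poly_Mapping.lookup a i) = d)"

definition Sym :: "nat \<Rightarrow> 'i cpoly set" where
  "Sym d = {f. homogeneous d f}"

definition q_form :: "'n::finite cpoly" where
  "q_form = (\<Sum>i\<in>UNIV. Poly_Mapping.single (Poly_Mapping.single i 2) 1)"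


section \<open>Projective spaces and their Zariski topologies\<close>

text \<open>A point of a projective space is a line through the origin, as a set of vectors (so it
  contains \<open>0\<close>). The space \<open>V\<close> is \<^typ>\<open>complex ^ 'n\<close>.\<close>

definition pt :: "complex ^ 'n \<Rightarrow> (complex ^ 'n) set" where
  "pt x = {c *s x | c. True}"

definition form_pt :: "'n cpoly \<Rightarrow> 'n cpoly set" where
  "form_pt f = {const_poly c * f | c. True}"

definition PV :: "(complex ^ 'n) set set" where
  "PV = {pt x | x. x \<noteq> 0}"

definition PSym :: "nat \<Rightarrow> 'n cpoly set set" where
  "PSym d = {form_pt f | f. f \<in> Sym d \<and> f \<noteq> 0}"

text \<open>The homogeneous coordinates of \<open>[f] \<in> \<bbbP>(Sym\<^sup>d V)\<close> are the coefficients of \<open>f\<close>, so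
  homogeneous forms \<open>F\<close> on \<open>Sym\<^sup>d V\<close> have exponent vectors as variables (those of degree other
  than \<open>d\<close> are evaluated at \<open>0\<close>). The sets \<open>F \<noteq> 0\<close> are closed under intersection, so they are a
  base, and the closed sets of the topology are exactly the common zero loci of homogeneous
  forms.\<close>

definition zariski_PSym :: "nat \<Rightarrow> 'n cpoly set topology" where
  "zariski_PSym d = topology_generated_by
     {{P \<in> PSym d. \<forall>f\<in>P - {0}. peval F (Poly_Mapping.lookup f) \<noteq> 0} | F e. homogeneous e F}"

text \<open>Closed subsets of \<open>(\<bbbP> V)\<^sup>n\<close> are the common zero loci of multihomogeneous polynomials, in
  variables \<open>x\<^bsub>k,i\<^esub>\<close> with \<open>k < n\<close> the number of the factor and \<open>i\<close> the coordinate in \<open>V\<close>; here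
  \<open>D k\<close> is the degree in the \<open>k\<close>-th block of variables.\<close>

definition multihomogeneous :: "nat \<Rightarrow> (nat \<times> 'n::finite) cpoly \<Rightarrow> bool" where
  "multihomogeneous n p \<longleftrightarrow> (\<exists>D. (\<forall>k\<ge>n. D k = 0) \<and>
     (\<forall>a\<in>Poly_Mapping.keys p. \<forall>k. (\<Sum>i\<in>UNIV. Poly_Mapping.lookup a (k, i)) = D k))"

definition PV_power :: "nat \<Rightarrow> (complex ^ 'n) set list set" where
  "PV_power n = {Ps. length Ps = n \<and> set Ps \<subseteq> PV}"

definition zariski_PV_power :: "nat \<Rightarrow> (complex ^ 'n::finite) set list topology" where
  "zariski_PV_power n = topology_generated_by
     {{Ps \<in> PV_power n. \<forall>x. (\<forall>k<n. x k \<in> Ps ! k - {0}) \<longrightarrow> peval p (\<lambda>(k, i). x k $ i) \<noteq> 0}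
       | p. multihomogeneous n p}"

text \<open>\<open>(\<bbbP> V)\<^sup>(\<^sup>n\<^sup>) = (\<bbbP> V)\<^sup>n / \<Sigma>\<^sub>n\<close>: an orbit of \<open>\<Sigma>\<^sub>n\<close> is a multiset of size \<open>n\<close>, and the Zariski
  topology is the quotient topology along \<^const>\<open>mset\<close>.\<close>

definition sym_power_PV :: "nat \<Rightarrow> (complex ^ 'n) set multiset set" where
  "sym_power_PV n = mset ` PV_power n"

definition zariski_sym_power_PV :: "nat \<Rightarrow> (complex ^ 'n::finite) set multiset topology" where
  "zariski_sym_power_PV n = topology (\<lambda>U. U \<subseteq> sym_power_PV n \<and>
     openin (zariski_PV_power n) {Ps \<in> PV_power n. mset Ps \<in> U})"

lemma topspace_zariski_PSym [simp]:
  "topspace (zariski_PSym d :: 'n cpoly set topology) = PSym d"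
proof -
  have "homogeneous 0 (1 :: ('n \<Rightarrow>\<^sub>0 nat) cpoly)"
    by (auto simp: homogeneous_def)
  moreover have "PSym d = {P \<in> PSym d. \<forall>f\<in>P - {0}. peval 1 (Poly_Mapping.lookup f) \<noteq> 0}"
    by (auto simp: peval_def)
  ultimately show ?thesis
    unfolding zariski_PSym_def topology_generated_by_topspace by blast
qed

lemma topspace_zariski_PV_power [simp]:
  "topspace (zariski_PV_power n :: (complex ^ 'n::finite) set list topology) = PV_power n"
proof -
  have "multihomogeneous n (1 :: (nat \<times> 'n) cpoly)"
    by (auto simp: multihomogeneous_def intro!: exI[of _ "\<lambda>_. 0"])
  moreover have "PV_power n = {Ps \<in> PV_power n. \<forall>x. (\<forall>k<n. x k \<in> Ps ! k - {0})
      \<longrightarrow> peval 1 (\<lambda>(k, i :: 'n). x k $ i) \<noteq> 0}"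
    by (auto simp: peval_def)
  ultimately show ?thesis
    unfolding zariski_PV_power_def topology_generated_by_topspace by blast
qed

lemma openin_zariski_sym_power_PV:
  fixes U :: "(complex ^ 'n::finite) set multiset set"
  shows "openin (zariski_sym_power_PV n) U \<longleftrightarrow> U \<subseteq> sym_power_PV n \<and>
     openin (zariski_PV_power n) {Ps \<in> PV_power n. mset Ps \<in> U}"
proof -
  let ?pre = "\<lambda>U :: (complex ^ 'n) set multiset set. {Ps \<in> PV_power n. mset Ps \<in> U}"
  have "istopology (\<lambda>U. U \<subseteq> sym_power_PV n \<and> openin (zariski_PV_power n) (?pre U))"
    unfolding istopology_def
  proof (rule conjI; intro allI impI)
    fix S T :: "(complex ^ 'n) set multiset set"
    assume "S \<subseteq> sym_power_PV n \<and> openin (zariski_PV_power n) (?pre S)"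
      and "T \<subseteq> sym_power_PV n \<and> openin (zariski_PV_power n) (?pre T)"
    moreover have "?pre (S \<inter> T) = ?pre S \<inter> ?pre T" by auto
    ultimately show "S \<inter> T \<subseteq> sym_power_PV n \<and> openin (zariski_PV_power n) (?pre (S \<inter> T))"
      by auto
  next
    fix K :: "(complex ^ 'n) set multiset set set"
    assume K: "\<forall>U\<in>K. U \<subseteq> sym_power_PV n \<and> openin (zariski_PV_power n) (?pre U)"
    have "?pre (\<Union>K) = \<Union>(?pre ` K)" by auto
    with K show "\<Union>K \<subseteq> sym_power_PV n \<and> openin (zariski_PV_power n) (?pre (\<Union>K))" by auto
  qed
  then show ?thesis
    by (simp add: zariski_sym_power_PV_def topology_inverse')
qed


section \<open>Dimension\<close>

definition irreducible_closedin :: "'a topology \<Rightarrow> 'a set \<Rightarrow> bool" where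
  "irreducible_closedin X S \<longleftrightarrow> closedin X S \<and> S \<noteq> {} \<and>
     (\<forall>A B. closedin X A \<and> closedin X B \<and> S \<subseteq> A \<union> B \<longrightarrow> S \<subseteq> A \<or> S \<subseteq> B)"

text \<open>Krull dimension; with values in \<^typ>\<open>enat\<close> the empty space gets dimension \<open>0\<close>. For a
  constructible subset of a variety, with the subspace topology, it is the dimension of the
  closure.\<close>

definition krull_dim :: "'a topology \<Rightarrow> enat" where
  "krull_dim X = Sup {enat n | n. \<exists>Z :: nat \<Rightarrow> 'a set.
     (\<forall>i\<le>n. irreducible_closedin X (Z i)) \<and> (\<forall>i<n. Z i \<subset> Z (Suc i))}"


section \<open>Eigentensors and the map tau\<close>

definition grad :: "'n::finite cpoly \<Rightarrow> complex ^ 'n \<Rightarrow> complex ^ 'n" where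
  "grad f x = (\<chi> i. peval (pdiff i f) (\<lambda>j. x $ j))"

definition Eig :: "'n::finite cpoly \<Rightarrow> (complex ^ 'n) set set" where
  "Eig f = {pt x | x. x \<noteq> 0 \<and> (\<exists>l. grad f x = l *s x)}"

lemma Eig_minors:
  "Eig f = {pt x | x. x \<noteq> 0 \<and> (\<forall>i j. grad f x $ i * x $ j - grad f x $ j * x $ i = 0)}"
proof -
  have "(\<exists>l. grad f x = l *s x) \<longleftrightarrow> (\<forall>i j. grad f x $ i * x $ j - grad f x $ j * x $ i = 0)"
    if "x \<noteq> 0" for x
  proof
    assume "\<forall>i j. grad f x $ i * x $ j - grad f x $ j * x $ i = 0"
    moreover from that obtain k where "x $ k \<noteq> 0"
      by (auto simp: vec_eq_iff)
    ultimately have "grad f x = (grad f x $ k / x $ k) *s x"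
      by (auto simp: vec_eq_iff field_simps)
    then show "\<exists>l. grad f x = l *s x" ..
  qed auto
  then show ?thesis unfolding Eig_def by blast
qed

text \<open>``A general \<open>f \<in> Sym\<^sup>d V\<close> satisfies \<open>Q\<close>''.\<close>

definition general_form :: "nat \<Rightarrow> ('n cpoly \<Rightarrow> bool) \<Rightarrow> bool" where
  "general_form d Q \<longleftrightarrow> (\<exists>U. openin (zariski_PSym d) U \<and> U \<noteq> {} \<and>
     (\<forall>f. f \<in> Sym d \<and> f \<noteq> 0 \<and> form_pt f \<in> U \<longrightarrow> Q f))"

definition ed_degree :: "'n::finite itself \<Rightarrow> nat \<Rightarrow> nat" where
  "ed_degree _ d = (THE N. general_form d (\<lambda>f :: 'n cpoly. finite (Eig f) \<and> card (Eig f) = N))"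

text \<open>Only the points of the eigenscheme are recorded. A finite eigenscheme has length
  \<open>ed_degree\<close>, so having exactly that many points forces it to be reduced, and each point occurs
  in \<open>\<tau>(f)\<close> with multiplicity one.\<close>

definition tau_dom :: "nat \<Rightarrow> 'n::finite cpoly set set" where
  "tau_dom d = {form_pt f | f. f \<in> Sym d \<and> f \<noteq> 0 \<and>
     finite (Eig f) \<and> card (Eig f) = ed_degree TYPE('n) d}"

text \<open>The value does not depend on the representative, see \<open>tau_form_pt\<close> below.\<close>

definition tau :: "'n::finite cpoly set \<Rightarrow> (complex ^ 'n) set multiset" where
  "tau P = mset_set (Eig (SOME f. f \<in> P \<and> f \<noteq> 0))"

lemma lookup_const_poly_times:
  "Poly_Mapping.lookup (const_poly c * p) a = c * Poly_Mapping.lookup p a"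
  by (simp add: const_poly_def flip: mult_map_scale_conv_mult)
     (simp add: Poly_Mapping.map.rep_eq when_def)

lemma grad_const_poly_times: "grad (const_poly c * f) x = c *s grad f x"
proof (cases "c = 0")
  case True
  then show ?thesis
    by (simp add: const_poly_def grad_def pdiff_def peval_def vec_eq_iff)
next
  case False
  have keys: "Poly_Mapping.keys (const_poly c * p) = Poly_Mapping.keys p" for p :: "'a cpoly"
    using False by (auto simp: in_keys_iff lookup_const_poly_times)
  have "pdiff i (const_poly c * f) = const_poly c * pdiff i f" for i
    by (simp add: pdiff_def keys lookup_const_poly_times sum_distrib_left)
       (simp add: const_poly_def mult_single mult_ac)
  then show ?thesis
    by (simp add: grad_def peval_def keys lookup_const_poly_times sum_distrib_left vec_eq_iff
        mult_ac)
qed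

lemma Eig_const_poly_times:
  assumes "c \<noteq> 0"
  shows "Eig (const_poly c * f) = Eig f"
proof -
  have "(c * a - c * b = 0) = (a - b = 0)" for a b :: complex
    using assms by simp
  then show ?thesis
    unfolding Eig_minors grad_const_poly_times by (simp add: mult.assoc)
qed

lemma tau_form_pt:
  assumes "f \<noteq> 0"
  shows "tau (form_pt f) = mset_set (Eig f)"
proof -
  define g where "g = (SOME g. g \<in> form_pt f \<and> g \<noteq> 0)"
  have "const_poly 1 * f = f"
    by (simp add: const_poly_def)
  then have "f \<in> form_pt f"
    unfolding form_pt_def by (metis (mono_tags, lifting) mem_Collect_eq)
  with assms have "g \<in> form_pt f \<and> g \<noteq> 0"
    unfolding g_def by (metis (mono_tags, lifting) someI)
  then obtain c where "g = const_poly c * f" "const_poly c * f \<noteq> 0"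
    by (auto simp: form_pt_def)
  moreover from this have "c \<noteq> 0"
    by (auto simp: const_poly_def)
  ultimately have "g = const_poly c * f" "c \<noteq> 0"
    by auto
  then show ?thesis
    by (simp add: tau_def Eig_const_poly_times flip: g_def)
qed

end

theory Submission
  imports Defs "HOL-Computational_Algebra.Fundamental_Theorem_Algebra"
begin

text \<open>The eigenpoints of the Fermat form \<open>\<Sum> x\<^sub>i\<^sup>d\<close> are the points of the grid with coordinates in
  \<open>{0} \<union> \<mu>\<^bsub>d-2\<^esub>\<close>. They are nondegenerate, so near the Fermat form they move continuously with the form,
  by the contraction principle applied to \<open>\<nabla>f(x) = d x\<close>, and their number does not change. A form whose
  \<open>2 \<times> 2\<close> minors vanish on the grid is a combination of the Fermat form and \<open>q\<^bsup>d/2\<^esup>\<close>; this is the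
  injectivity of a linear map, which survives small perturbations. By Chevalley's theorem these properties
  are constructible in the coefficients, so that holding on a Euclidean ball they hold generically. This
  determines \<open>ed_degree\<close> and the general fibre.

  For the dimension, normalise \<open>f\<close> to have no monomial \<open>x\<^sub>k\<^bsup>d-2\<^esup>x\<^sub>l\<^sup>2\<close> if \<open>d\<close> is even, and let \<open>M + 1\<close> be the
  number of remaining coefficients. Adding the monomials to the Fermat form one at a time gives a chain
  of \<open>M + 1\<close> linear families near it, whose images have irreducible closures; these increase strictly, since
  by elimination it is a closed condition on a tuple of points that some nonzero member of a linear family
  has them among its eigenpoints. Conversely, a chain of \<open>k + 1\<close> irreducible closed sets gives \<open>k\<close>
  algebraically independent ratios of symmetric multihomogeneous functions, while the affine coordinates
  of the eigenpoints are algebraic over the \<open>M\<close> affine coefficients of \<open>f\<close>, so that \<open>k \<le> M\<close>.\<close>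

section \<open>Constructible predicates on complex affine spaces\<close>

text \<open>The properties wanted of a general form are verified on a Euclidean ball around one
  explicit form, and such a ball is not Zariski open. The bridge is a zero-one law: a constructible
  predicate or its negation holds wherever some nonzero polynomial does not vanish, and such a locus
  meets every ball. Hence the properties are phrased by polynomial equations and quantifiers over
  complex variables, and polynomials are treated as functions of assignments, so that new variables
  can be adjoined by \<open>case_sum\<close>.

  The monomial x_k^(d-2) x_l^2 serves for the normalisation because its coefficient is nonzero in
  q^(d/2) and zero in the Fermat form, which therefore remains among the normalised forms.

  For the upper bound, algebraic independence is contradicted by counting dimensions of spaces of
  functions, in place of an appeal to transcendence degree. The functions attached to a chain must
  be symmetric and of equal degree in all points, because their vanishing then makes sense for
  unordered tuples.\<close>

inductive polyfun :: "(('v \<Rightarrow> complex) \<Rightarrow> complex) \<Rightarrow> bool" where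
  polyfun_const [intro, simp]: "polyfun (\<lambda>\<phi>. c)"
| polyfun_var [intro, simp]: "polyfun (\<lambda>\<phi>. \<phi> v)"
| polyfun_add [intro]: "polyfun p \<Longrightarrow> polyfun q \<Longrightarrow> polyfun (\<lambda>\<phi>. p \<phi> + q \<phi>)"
| polyfun_mult [intro]: "polyfun p \<Longrightarrow> polyfun q \<Longrightarrow> polyfun (\<lambda>\<phi>. p \<phi> * q \<phi>)"

lemma polyfun_uminus [intro]: "polyfun p \<Longrightarrow> polyfun (\<lambda>\<phi>. - p \<phi>)"
  using polyfun_mult[OF polyfun_const[of "-1"], of p] by simp

lemma polyfun_diff [intro]: "polyfun p \<Longrightarrow> polyfun q \<Longrightarrow> polyfun (\<lambda>\<phi>. p \<phi> - q \<phi>)"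
  using polyfun_add[OF _ polyfun_uminus, of p q] by simp

lemma polyfun_sum [intro]: "(\<And>i. i \<in> I \<Longrightarrow> polyfun (p i)) \<Longrightarrow> polyfun (\<lambda>\<phi>. \<Sum>i\<in>I. p i \<phi>)"
  by (induction I rule: infinite_finite_induct) auto

lemma polyfun_prod [intro]: "(\<And>i. i \<in> I \<Longrightarrow> polyfun (p i)) \<Longrightarrow> polyfun (\<lambda>\<phi>. \<Prod>i\<in>I. p i \<phi>)"
  by (induction I rule: infinite_finite_induct) auto

lemma polyfun_power [intro]: "polyfun p \<Longrightarrow> polyfun (\<lambda>\<phi>. p \<phi> ^ k)"
  by (induction k) auto

lemma polyfun_subst: "polyfun p \<Longrightarrow> (\<And>w. polyfun (t w)) \<Longrightarrow> polyfun (\<lambda>\<phi>. p (\<lambda>w. t w \<phi>))"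
  by (induction rule: polyfun.induct) auto

lemma polyfun_finite_support:
  "polyfun p \<Longrightarrow> \<exists>V. finite V \<and> (\<forall>\<phi> \<psi>. (\<forall>v\<in>V. \<phi> v = \<psi> v) \<longrightarrow> p \<phi> = p \<psi>)"
proof (induction rule: polyfun.induct)
  case (polyfun_const c)
  then show ?case by auto
next
  case (polyfun_var v)
  show ?case by (rule exI[of _ "{v}"]) auto
next
  case (polyfun_add p q)
  then obtain V W where "finite V" "\<forall>\<phi> \<psi>. (\<forall>v\<in>V. \<phi> v = \<psi> v) \<longrightarrow> p \<phi> = p \<psi>"
    "finite W" "\<forall>\<phi> \<psi>. (\<forall>v\<in>W. \<phi> v = \<psi> v) \<longrightarrow> q \<phi> = q \<psi>" by blast
  then show ?case by (intro exI[of _ "V \<union> W"]) (metis UnCI finite_Un)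
next
  case (polyfun_mult p q)
  then obtain V W where "finite V" "\<forall>\<phi> \<psi>. (\<forall>v\<in>V. \<phi> v = \<psi> v) \<longrightarrow> p \<phi> = p \<psi>"
    "finite W" "\<forall>\<phi> \<psi>. (\<forall>v\<in>W. \<phi> v = \<psi> v) \<longrightarrow> q \<phi> = q \<psi>" by blast
  then show ?case by (intro exI[of _ "V \<union> W"]) (metis UnCI finite_Un)
qed

text \<open>Here n is a formal bound: coefficients from n on vanish, but the true degree may drop
  further at special parameters. The case distinctions of the elimination below are therefore on the
  coefficient of index n - 1, not on the degree.\<close>

definition polyfam :: "nat \<Rightarrow> (('v \<Rightarrow> complex) \<Rightarrow> complex poly) \<Rightarrow> bool" where
  "polyfam n A \<longleftrightarrow> (\<forall>\<phi> i. i \<ge> n \<longrightarrow> poly.coeff (A \<phi>) i = 0)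
     \<and> (\<forall>i. polyfun (\<lambda>\<phi>. poly.coeff (A \<phi>) i))"

lemma polyfam_coeff [intro]: "polyfam n A \<Longrightarrow> polyfun (\<lambda>\<phi>. poly.coeff (A \<phi>) i)"
  by (auto simp: polyfam_def)

lemma polyfam_mono: "polyfam n A \<Longrightarrow> n \<le> m \<Longrightarrow> polyfam m A"
  by (auto simp: polyfam_def)

lemma polyfam_add: "polyfam n A \<Longrightarrow> polyfam n B \<Longrightarrow> polyfam n (\<lambda>\<phi>. A \<phi> + B \<phi>)"
  by (auto simp: polyfam_def)

lemma polyfam_mult:
  assumes "polyfam n A" "polyfam m B"
  shows "polyfam (n + m) (\<lambda>\<phi>. A \<phi> * B \<phi>)"
proof -
  have "poly.coeff (A \<phi>) i * poly.coeff (B \<phi>) (k - i) = 0" if "k \<ge> n + m" for k \<phi> i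
    using assms that by (cases "i \<ge> n") (auto simp: polyfam_def)
  moreover have "polyfun (\<lambda>\<phi>. \<Sum>i\<le>k. poly.coeff (A \<phi>) i * poly.coeff (B \<phi>) (k - i))" for k
    using assms unfolding polyfam_def by (intro polyfun_sum polyfun_mult) blast+
  ultimately show ?thesis
    unfolding polyfam_def coeff_mult by (simp add: sum.neutral)
qed

lemma polyfam_const: "polyfam 1 (\<lambda>\<phi>. [:c:])"
  by (auto simp: polyfam_def coeff_pCons split: nat.splits)

lemma polyfam_power: "polyfam n A \<Longrightarrow> \<exists>m. polyfam m (\<lambda>\<phi>. A \<phi> ^ k)"
proof (induction k)
  case 0
  then show ?case using polyfam_const[of 1] by (auto simp: one_pCons)
next
  case (Suc k)
  then obtain m where "polyfam m (\<lambda>\<phi>. A \<phi> ^ k)" by blast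
  then show ?case using polyfam_mult[OF Suc.prems] by auto
qed

text \<open>Currying in the variable v: an existential quantifier over v becomes a question about
  roots of univariate polynomials with parameters.\<close>

lemma polyfun_as_polyfam:
  assumes "polyfun p"
  obtains n A where "polyfam n A" "\<And>\<phi> c. p (\<phi>(v := c)) = poly (A \<phi>) c"
    "\<And>\<phi> c. A (\<phi>(v := c)) = A \<phi>"
proof -
  from assms have "\<exists>n A. polyfam n A \<and> (\<forall>\<phi> c. p (\<phi>(v := c)) = poly (A \<phi>) c)
      \<and> (\<forall>\<phi> c. A (\<phi>(v := c)) = A \<phi>)"
  proof (induction rule: polyfun.induct)
    case (polyfun_const c)
    then show ?case using polyfam_const[of c] by (intro exI[of _ 1] exI[of _ "\<lambda>\<phi>. [:c:]"]) auto
  next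
    case (polyfun_var w)
    show ?case
    proof (cases "w = v")
      case True
      then show ?thesis
        by (intro exI[of _ 2] exI[of _ "\<lambda>\<phi>. [:0, 1:]"])
           (auto simp: polyfam_def coeff_pCons split: nat.splits)
    next
      case False
      have "polyfun (\<lambda>\<phi>. poly.coeff [:\<phi> w:] i)" for i
        by (cases i) auto
      with False show ?thesis
        by (intro exI[of _ 1] exI[of _ "\<lambda>\<phi>. [:\<phi> w:]"])
           (auto simp: polyfam_def coeff_pCons split: nat.splits)
    qed
  next
    case (polyfun_add p q)
    then obtain n A m B where AB: "polyfam n A" "\<forall>\<phi> c. p (\<phi>(v := c)) = poly (A \<phi>) c"
      "\<forall>\<phi> c. A (\<phi>(v := c)) = A \<phi>"
      "polyfam m B" "\<forall>\<phi> c. q (\<phi>(v := c)) = poly (B \<phi>) c" "\<forall>\<phi> c. B (\<phi>(v := c)) = B \<phi>" by blast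
    then show ?case
      by (intro exI[of _ "max n m"] exI[of _ "\<lambda>\<phi>. A \<phi> + B \<phi>"])
         (use AB in \<open>simp add: polyfam_add polyfam_mono del: fun_upd_apply\<close>)
  next
    case (polyfun_mult p q)
    then obtain n A m B where AB: "polyfam n A" "\<forall>\<phi> c. p (\<phi>(v := c)) = poly (A \<phi>) c"
      "\<forall>\<phi> c. A (\<phi>(v := c)) = A \<phi>"
      "polyfam m B" "\<forall>\<phi> c. q (\<phi>(v := c)) = poly (B \<phi>) c" "\<forall>\<phi> c. B (\<phi>(v := c)) = B \<phi>" by blast
    then show ?case
      by (intro exI[of _ "n + m"] exI[of _ "\<lambda>\<phi>. A \<phi> * B \<phi>"]) (use AB in \<open>simp add: polyfam_mult del: fun_upd_apply\<close>)
  qed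
  then show ?thesis using that by blast
qed

section \<open>Boolean combinations of polynomial equations\<close>

definition basic_set ::
    "(('v \<Rightarrow> complex) \<Rightarrow> complex) list \<Rightarrow> (('v \<Rightarrow> complex) \<Rightarrow> complex) \<Rightarrow> ('v \<Rightarrow> complex) \<Rightarrow> bool" where
  "basic_set ps q \<phi> \<longleftrightarrow> (\<forall>p\<in>set ps. p \<phi> = 0) \<and> q \<phi> \<noteq> 0"

text \<open>One inequation per piece suffices, since finitely many inequations multiply into
  one.\<close>

definition constructible :: "(('v \<Rightarrow> complex) \<Rightarrow> bool) \<Rightarrow> bool" where
  "constructible P \<longleftrightarrow> (\<exists>L. (\<forall>(ps, q)\<in>set L. (\<forall>p\<in>set ps. polyfun p) \<and> polyfun q) \<and>
     (\<forall>\<phi>. P \<phi> \<longleftrightarrow> (\<exists>(ps, q)\<in>set L. basic_set ps q \<phi>)))"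

lemma constructible_basic:
  "(\<And>p. p \<in> set ps \<Longrightarrow> polyfun p) \<Longrightarrow> polyfun q \<Longrightarrow> constructible (basic_set ps q)"
  unfolding constructible_def by (rule exI[of _ "[(ps, q)]"]) auto

lemma constructible_eq0 [intro]: "polyfun p \<Longrightarrow> constructible (\<lambda>\<phi>. p \<phi> = 0)"
  using constructible_basic[of "[p]" "\<lambda>_. 1"] by (simp add: basic_set_def[abs_def])

lemma constructible_neq0: "polyfun p \<Longrightarrow> constructible (\<lambda>\<phi>. p \<phi> \<noteq> 0)"
  using constructible_basic[of "[]" p] by (simp add: basic_set_def[abs_def])

lemma constructible_const [simp, intro]: "constructible (\<lambda>\<phi>. b)"
  using constructible_eq0[of "\<lambda>_. 0"] constructible_eq0[of "\<lambda>_. 1"] by (cases b) auto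

lemma constructible_disj [intro]:
  assumes "constructible P" "constructible Q"
  shows "constructible (\<lambda>\<phi>. P \<phi> \<or> Q \<phi>)"
proof -
  from assms obtain L M where
    "\<forall>(ps, q)\<in>set L. (\<forall>p\<in>set ps. polyfun p) \<and> polyfun q"
    "\<forall>\<phi>. P \<phi> \<longleftrightarrow> (\<exists>(ps, q)\<in>set L. basic_set ps q \<phi>)"
    "\<forall>(ps, q)\<in>set M. (\<forall>p\<in>set ps. polyfun p) \<and> polyfun q"
    "\<forall>\<phi>. Q \<phi> \<longleftrightarrow> (\<exists>(ps, q)\<in>set M. basic_set ps q \<phi>)"
    unfolding constructible_def by blast
  then show ?thesis
    unfolding constructible_def by (intro exI[of _ "L @ M"]) auto
qed

lemma constructible_conj [intro]:
  assumes "constructible P" "constructible Q"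
  shows "constructible (\<lambda>\<phi>. P \<phi> \<and> Q \<phi>)"
proof -
  from assms obtain L M where
    LM: "\<forall>(ps, q)\<in>set L. (\<forall>p\<in>set ps. polyfun p) \<and> polyfun q"
    "\<forall>\<phi>. P \<phi> \<longleftrightarrow> (\<exists>(ps, q)\<in>set L. basic_set ps q \<phi>)"
    "\<forall>(ps, q)\<in>set M. (\<forall>p\<in>set ps. polyfun p) \<and> polyfun q"
    "\<forall>\<phi>. Q \<phi> \<longleftrightarrow> (\<exists>(ps, q)\<in>set M. basic_set ps q \<phi>)"
    unfolding constructible_def by blast
  define f where "f = (\<lambda>((ps :: (('a \<Rightarrow> complex) \<Rightarrow> complex) list, q), (ps', q')).
    (ps @ ps', \<lambda>\<phi> :: 'a \<Rightarrow> complex. q \<phi> * q' \<phi> :: complex))"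
  have bex_prod: "(\<exists>z\<in>A \<times> B. R z) \<longleftrightarrow> (\<exists>x\<in>A. \<exists>y\<in>B. R (x, y))" for A B and R :: "'b \<times> 'c \<Rightarrow> bool"
    by auto
  have "basic_set (fst (f (x, y))) (snd (f (x, y))) \<phi> \<longleftrightarrow>
      basic_set (fst x) (snd x) \<phi> \<and> basic_set (fst y) (snd y) \<phi>" for x y \<phi>
    by (auto simp: f_def basic_set_def split: prod.splits)
  then have "(\<exists>z\<in>set L \<times> set M. basic_set (fst (f z)) (snd (f z)) \<phi>) \<longleftrightarrow>
      (\<exists>x\<in>set L. basic_set (fst x) (snd x) \<phi>) \<and> (\<exists>y\<in>set M. basic_set (fst y) (snd y) \<phi>)" for \<phi>
    unfolding bex_prod by simp
  moreover have "(\<forall>p\<in>set (fst (f z)). polyfun p) \<and> polyfun (snd (f z))" if "z \<in> set L \<times> set M" for z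
    using LM that by (auto simp: f_def split: prod.splits)
  ultimately show ?thesis
    unfolding constructible_def using LM
    by (intro exI[of _ "map f (List.product L M)"]) (auto simp: case_prod_beta)
qed

lemma constructible_Bex [intro]:
  assumes "finite I" "\<And>i. i \<in> I \<Longrightarrow> constructible (P i)"
  shows "constructible (\<lambda>\<phi>. \<exists>i\<in>I. P i \<phi>)"
  using assms by (induction I rule: finite_induct) auto

lemma constructible_Ball [intro]:
  assumes "finite I" "\<And>i. i \<in> I \<Longrightarrow> constructible (P i)"
  shows "constructible (\<lambda>\<phi>. \<forall>i\<in>I. P i \<phi>)"
  using assms by (induction I rule: finite_induct) auto

lemma constructible_not [intro]:
  assumes "constructible P"
  shows "constructible (\<lambda>\<phi>. \<not> P \<phi>)"
proof -
  from assms obtain L where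
    L: "\<forall>(ps, q)\<in>set L. (\<forall>p\<in>set ps. polyfun p) \<and> polyfun q"
    "\<forall>\<phi>. P \<phi> \<longleftrightarrow> (\<exists>(ps, q)\<in>set L. basic_set ps q \<phi>)"
    unfolding constructible_def by blast
  have *: "(\<lambda>\<phi>. \<not> P \<phi>) = (\<lambda>\<phi>. \<forall>x\<in>set L. (\<exists>p\<in>set (fst x). p \<phi> \<noteq> 0) \<or> snd x \<phi> = 0)"
    using L(2) by (simp add: basic_set_def case_prod_beta)
  show ?thesis
    unfolding * using L(1) by (intro constructible_Ball constructible_disj constructible_Bex
        constructible_neq0 constructible_eq0) auto
qed

lemma constructible_imp [intro]:
  "constructible P \<Longrightarrow> constructible Q \<Longrightarrow> constructible (\<lambda>\<phi>. P \<phi> \<longrightarrow> Q \<phi>)"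
  unfolding imp_conv_disj by (intro constructible_disj constructible_not)

lemma constructible_eq [intro]: "polyfun p \<Longrightarrow> polyfun q \<Longrightarrow> constructible (\<lambda>\<phi>. p \<phi> = q \<phi>)"
  using constructible_eq0[OF polyfun_diff, of p q] by simp

lemma constructible_subst:
  assumes "constructible P" "\<And>w. polyfun (t w)"
  shows "constructible (\<lambda>\<phi>. P (\<lambda>w. t w \<phi>))"
proof -
  from assms obtain L where
    L: "\<forall>(ps, q)\<in>set L. (\<forall>p\<in>set ps. polyfun p) \<and> polyfun q"
    "\<forall>\<phi>. P \<phi> \<longleftrightarrow> (\<exists>(ps, q)\<in>set L. basic_set ps q \<phi>)"
    unfolding constructible_def by blast
  have *: "(\<lambda>\<phi>. P (\<lambda>w. t w \<phi>)) = (\<lambda>\<phi>. \<exists>x\<in>set L. (\<forall>p\<in>set (fst x). p (\<lambda>w. t w \<phi>) = 0) \<and> snd x (\<lambda>w. t w \<phi>) \<noteq> 0)"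
    using L(2) by (simp add: basic_set_def case_prod_beta)
  have pf: "polyfun (\<lambda>\<phi>. p (\<lambda>w. t w \<phi>))" if "polyfun p" for p
    using that assms(2) by (rule polyfun_subst)
  show ?thesis
    unfolding *
  proof (intro constructible_Bex constructible_conj constructible_Ball constructible_neq0 constructible_eq0)
    fix x assume "x \<in> set L"
    then show "polyfun (\<lambda>\<phi>. snd x (\<lambda>w. t w \<phi>))" using L(1) by (intro pf) auto
    fix p assume "p \<in> set (fst x)"
    then show "polyfun (\<lambda>\<phi>. p (\<lambda>w. t w \<phi>))" using L(1) \<open>x \<in> set L\<close> by (intro pf) auto
  qed auto
qed

text \<open>Pseudo-division: with \<open>n - 1\<close> the degree of \<open>A\<close>, cancelling the top coefficient of \<open>B\<close>
  against that of \<open>A\<close>.\<close>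

definition pseudo_step :: "nat \<Rightarrow> complex poly \<Rightarrow> nat \<Rightarrow> complex poly \<Rightarrow> complex poly" where
  "pseudo_step n A m B = smult (poly.coeff A (n - 1)) B - monom (poly.coeff B (m - 1)) (m - n) * A"

lemma polyfam_pseudo_step:
  assumes A: "polyfam n A" and B: "polyfam m B" and "0 < n" "n \<le> m"
  shows "polyfam (m - 1) (\<lambda>\<phi>. pseudo_step n (A \<phi>) m (B \<phi>))"
  unfolding polyfam_def
proof (intro conjI allI impI)
  fix \<phi> i assume i: "m - 1 \<le> i"
  show "poly.coeff (pseudo_step n (A \<phi>) m (B \<phi>)) i = 0"
  proof (cases "i = m - 1")
    case True
    have "m - 1 - (m - n) = n - 1" using assms by auto
    then show ?thesis using True assms by (auto simp: pseudo_step_def coeff_monom_mult)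
  next
    case False
    with i have "i \<ge> m" "i - (m - n) \<ge> n" using assms by auto
    then show ?thesis using A B by (auto simp: pseudo_step_def coeff_monom_mult polyfam_def)
  qed
next
  fix i
  show "polyfun (\<lambda>\<phi>. poly.coeff (pseudo_step n (A \<phi>) m (B \<phi>)) i)"
  proof (cases "i < m - n")
    case True
    then show ?thesis using A B by (auto simp: pseudo_step_def coeff_monom_mult)
  next
    case False
    then show ?thesis using A B
      by (simp add: pseudo_step_def coeff_monom_mult) (intro polyfun_diff polyfun_mult polyfam_coeff)
  qed
qed

text \<open>Repeated pseudo-division lowers the formal degree of R below that of A without affecting
  divisibility, as the multiplier is the nonzero top coefficient of A. There divisibility means that
  R vanishes, which is a condition on coefficients.\<close>

lemma constructible_dvd:
  assumes A: "polyfam n A" and "0 < n" and "polyfam r R"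
  shows "constructible (\<lambda>\<phi>. poly.coeff (A \<phi>) (n - 1) \<noteq> 0 \<and> A \<phi> dvd R \<phi>)"
  using \<open>polyfam r R\<close>
proof (induction r arbitrary: R rule: less_induct)
  case (less r)
  show ?case
  proof (cases "r < n")
    case True
    have *: "A \<phi> dvd R \<phi> \<longleftrightarrow> (\<forall>j\<in>{..<r}. poly.coeff (R \<phi>) j = 0)" if "poly.coeff (A \<phi>) (n - 1) \<noteq> 0" for \<phi>
    proof
      assume d: "A \<phi> dvd R \<phi>"
      show "\<forall>j\<in>{..<r}. poly.coeff (R \<phi>) j = 0"
      proof (rule ccontr)
        assume "\<not> ?thesis"
        then have "R \<phi> \<noteq> 0" by auto
        with d have "degree (A \<phi>) \<le> degree (R \<phi>)" by (rule dvd_imp_degree_le)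
        moreover have "n - 1 \<le> degree (A \<phi>)" using that by (rule le_degree)
        ultimately have "poly.coeff (R \<phi>) (degree (R \<phi>)) = 0"
          using less.prems True by (auto simp: polyfam_def simp del: leading_coeff_0_iff)
        with \<open>R \<phi> \<noteq> 0\<close> show False by simp
      qed
    next
      assume "\<forall>j\<in>{..<r}. poly.coeff (R \<phi>) j = 0"
      then have "R \<phi> = 0" using less.prems by (intro poly_eqI) (metis coeff_0 lessThan_iff not_le polyfam_def)
      then show "A \<phi> dvd R \<phi>" by simp
    qed
    have "(\<lambda>\<phi>. poly.coeff (A \<phi>) (n - 1) \<noteq> 0 \<and> A \<phi> dvd R \<phi>) =
       (\<lambda>\<phi>. poly.coeff (A \<phi>) (n - 1) \<noteq> 0 \<and> (\<forall>j\<in>{..<r}. poly.coeff (R \<phi>) j = 0))"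
      by (rule ext) (use * in blast)
    then show ?thesis using A less.prems
      by (auto intro!: constructible_conj constructible_neq0 constructible_Ball constructible_eq0)
  next
    case False
    let ?R = "\<lambda>\<phi>. pseudo_step n (A \<phi>) r (R \<phi>)"
    have "polyfam (r - 1) ?R" using A less.prems \<open>0 < n\<close> False by (intro polyfam_pseudo_step) auto
    then have "constructible (\<lambda>\<phi>. poly.coeff (A \<phi>) (n - 1) \<noteq> 0 \<and> A \<phi> dvd ?R \<phi>)"
      using less.IH[of "r - 1"] False \<open>0 < n\<close> by auto
    moreover have "A \<phi> dvd ?R \<phi> \<longleftrightarrow> A \<phi> dvd R \<phi>" if "poly.coeff (A \<phi>) (n - 1) \<noteq> 0" for \<phi>
    proof -
      have "A \<phi> dvd ?R \<phi> \<longleftrightarrow> A \<phi> dvd smult (poly.coeff (A \<phi>) (n - 1)) (R \<phi>)"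
        unfolding pseudo_step_def by (metis dvd_diff_left_iff dvd_triv_right)
      with that show ?thesis by (simp add: dvd_smult_iff)
    qed
    then have "(\<lambda>\<phi>. poly.coeff (A \<phi>) (n - 1) \<noteq> 0 \<and> A \<phi> dvd ?R \<phi>) =
        (\<lambda>\<phi>. poly.coeff (A \<phi>) (n - 1) \<noteq> 0 \<and> A \<phi> dvd R \<phi>)" by blast
    ultimately show ?thesis by simp
  qed
qed

text \<open>Euclid's algorithm with parameters, by induction on the sum of the formal degrees. A
  member of least positive bound is either truncated, where its top coefficient vanishes, or used to
  pseudo-divide another member, where it does not. With one member left, the quantifier is a
  divisibility question.\<close>

lemma constructible_ex_root_aux:
  fixes A :: "'i \<Rightarrow> ('v \<Rightarrow> complex) \<Rightarrow> complex poly"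
  assumes "finite I" "\<And>i. i \<in> I \<Longrightarrow> polyfam (n i) (A i)" and Q: "polyfam k Q"
  shows "constructible (\<lambda>\<phi>. \<exists>c. (\<forall>i\<in>I. poly (A i \<phi>) c = 0) \<and> poly (Q \<phi>) c \<noteq> 0)"
  using assms(2)
proof (induction "sum n I" arbitrary: n A rule: less_induct)
  case less
  show ?case
  proof (cases "\<forall>i\<in>I. n i = 0")
    case True
    then have "A i \<phi> = 0" if "i \<in> I" for i \<phi>
      using less.prems[OF that] True that by (intro poly_eqI) (auto simp: polyfam_def)
    moreover have "(\<exists>c. poly (Q \<phi>) c \<noteq> 0) \<longleftrightarrow> (\<exists>j\<in>{..<k}. poly.coeff (Q \<phi>) j \<noteq> 0)" for \<phi>
    proof -
      have "(\<exists>c. poly (Q \<phi>) c \<noteq> 0) \<longleftrightarrow> Q \<phi> \<noteq> 0" using poly_all_0_iff_0 by blast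
      also have "\<dots> \<longleftrightarrow> (\<exists>j\<in>{..<k}. poly.coeff (Q \<phi>) j \<noteq> 0)"
        using Q by (metis coeff_0 lessThan_iff linorder_not_le poly_eqI polyfam_def)
      finally show ?thesis .
    qed
    ultimately have "(\<lambda>\<phi>. \<exists>c. (\<forall>i\<in>I. poly (A i \<phi>) c = 0) \<and> poly (Q \<phi>) c \<noteq> 0) =
        (\<lambda>\<phi>. \<exists>j\<in>{..<k}. poly.coeff (Q \<phi>) j \<noteq> 0)"
      by auto
    then show ?thesis using Q by (auto intro!: constructible_Bex constructible_neq0)
  next
    case False
    then have "\<exists>i. i \<in> I \<and> n i > 0" by auto
    then obtain i0 where "is_arg_min n (\<lambda>i. i \<in> I \<and> n i > 0) i0"
      using ex_is_arg_min_if_finite[of "{i \<in> I. n i > 0}" n] \<open>finite I\<close> by (auto simp: is_arg_min_def)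
    then have i0: "i0 \<in> I" "n i0 > 0" and min: "\<And>i. i \<in> I \<Longrightarrow> n i > 0 \<Longrightarrow> n i0 \<le> n i"
      by (auto simp: is_arg_min_linorder)
    define lc where "lc = (\<lambda>\<phi>. poly.coeff (A i0 \<phi>) (n i0 - 1))"
    have pf: "polyfam (n i0) (A i0)" using less.prems i0 by auto
    have lc: "polyfun lc" unfolding lc_def using pf by auto
    have lc_monom: "polyfun (\<lambda>\<phi>. poly.coeff (A i0 \<phi>) j - (if k = j then poly.coeff (A i0 \<phi>) (n i0 - Suc 0) else 0))" for j k
      using pf by (cases "k = j") auto
    have sum_less: "sum (n(i := n i - 1)) I < sum n I" if "i \<in> I" "n i > 0" for i
      using that \<open>finite I\<close> by (intro sum_strict_mono_ex1) auto
    let ?E = "\<lambda>A \<phi>. \<exists>c. (\<forall>i\<in>I. poly (A i \<phi>) c = 0) \<and> poly (Q \<phi>) c \<noteq> 0"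
    \<comment> \<open>Where the formal top coefficient vanishes, dropping the top term leaves the
      polynomial as it is and lowers the bound.\<close>
    define T where "T = A(i0 := \<lambda>\<phi>. A i0 \<phi> - monom (lc \<phi>) (n i0 - 1))"
    have "constructible (?E T)"
    proof (rule less.hyps)
      show "sum (n(i0 := n i0 - 1)) I < sum n I" using sum_less i0 by blast
      fix i assume "i \<in> I"
      then show "polyfam ((n(i0 := n i0 - 1)) i) (T i)"
        using less.prems[OF \<open>i \<in> I\<close>] lc_monom
        by (auto simp: polyfam_def T_def lc_def)
    qed
    moreover have "?E T \<phi> \<longleftrightarrow> ?E A \<phi>" if "lc \<phi> = 0" for \<phi>
    proof -
      have "T i \<phi> = A i \<phi>" for i using that by (auto simp: T_def)
      then show ?thesis by simp
    qed
    moreover have "constructible (\<lambda>\<phi>. lc \<phi> \<noteq> 0 \<and> ?E A \<phi>)"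
    proof (cases "\<exists>i\<in>I. i \<noteq> i0 \<and> n i > 0")
      case True
      then obtain i where i: "i \<in> I" "i \<noteq> i0" "n i > 0" by auto
      \<comment> \<open>At a root of \<open>A i0\<close> the pseudo-remainder is a nonzero multiple
        of \<open>A i\<close>, so the common roots stay the same.\<close>
      define S where "S = A(i := \<lambda>\<phi>. pseudo_step (n i0) (A i0 \<phi>) (n i) (A i \<phi>))"
      have "constructible (?E S)"
      proof (rule less.hyps)
        show "sum (n(i := n i - 1)) I < sum n I" using sum_less i by blast
        fix j assume "j \<in> I"
        then show "polyfam ((n(i := n i - 1)) j) (S j)"
          using less.prems polyfam_pseudo_step[OF less.prems[OF i0(1)] less.prems[OF i(1)]] i0 i min[of i]
          by (auto simp: S_def)
      qed
      moreover have "?E S \<phi> \<longleftrightarrow> ?E A \<phi>" if "lc \<phi> \<noteq> 0" for \<phi>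
      proof -
        have "(\<forall>j\<in>I. poly (S j \<phi>) c = 0) \<longleftrightarrow> (\<forall>j\<in>I. poly (A j \<phi>) c = 0)" for c
        proof -
          have "poly (S i \<phi>) c = 0 \<longleftrightarrow> poly (A i \<phi>) c = 0" if "poly (A i0 \<phi>) c = 0"
            using that \<open>lc \<phi> \<noteq> 0\<close> by (simp add: S_def pseudo_step_def lc_def)
          moreover have "S j = A j" if "j \<noteq> i" for j using that by (simp add: S_def)
          ultimately show ?thesis using i i0 by metis
        qed
        then show ?thesis by simp
      qed
      moreover have "constructible (\<lambda>\<phi>. lc \<phi> \<noteq> 0 \<and> ?E S \<phi>)"
        using calculation(1) lc by (intro constructible_conj constructible_neq0)
      moreover have "(\<lambda>\<phi>. lc \<phi> \<noteq> 0 \<and> ?E S \<phi>) = (\<lambda>\<phi>. lc \<phi> \<noteq> 0 \<and> ?E A \<phi>)"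
        by (intro ext conj_cong refl) (rule calculation(2))
      ultimately show ?thesis by simp
    next
      case False
      have z: "A i \<phi> = 0" if "i \<in> I" "i \<noteq> i0" for i \<phi>
        using less.prems[OF that(1)] False that by (intro poly_eqI) (auto simp: polyfam_def)
      obtain r where r: "polyfam r (\<lambda>\<phi>. Q \<phi> ^ (n i0 - 1))" using polyfam_power[OF Q] by blast
      \<comment> \<open>All other members are zero. Every root of \<open>A i0\<close> is a root of Q
        exactly if \<open>A i0\<close> divides Q to the power of its degree, which here is
        \<open>n i0 - 1\<close>.\<close>
      have "?E A \<phi> \<longleftrightarrow> \<not> A i0 \<phi> dvd Q \<phi> ^ (n i0 - 1)" if "lc \<phi> \<noteq> 0" for \<phi>
      proof -
        have "degree (A i0 \<phi>) \<le> n i0 - 1"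
          using pf by (intro degree_le) (auto simp: polyfam_def)
        moreover have "n i0 - 1 \<le> degree (A i0 \<phi>)" using that by (auto simp: lc_def intro: le_degree)
        ultimately have deg: "degree (A i0 \<phi>) = n i0 - 1" by simp
        have "A i0 \<phi> \<noteq> 0" using that by (auto simp: lc_def)
        then have "(\<forall>x. poly (A i0 \<phi>) x = 0 \<longrightarrow> poly (Q \<phi>) x = 0) \<longleftrightarrow> A i0 \<phi> dvd Q \<phi> ^ (n i0 - 1)"
          using nullstellensatz_univariate[of "A i0 \<phi>" "Q \<phi>"] deg by auto
        moreover have "?E A \<phi> \<longleftrightarrow> \<not> (\<forall>x. poly (A i0 \<phi>) x = 0 \<longrightarrow> poly (Q \<phi>) x = 0)"
          using z i0 by (metis poly_0)
        ultimately show ?thesis by blast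
      qed
      then have eq: "lc \<phi> \<noteq> 0 \<and> ?E A \<phi> \<longleftrightarrow>
          lc \<phi> \<noteq> 0 \<and> \<not> (lc \<phi> \<noteq> 0 \<and> A i0 \<phi> dvd Q \<phi> ^ (n i0 - 1))" for \<phi>
        by (cases "lc \<phi> = 0") simp_all
      have "constructible (\<lambda>\<phi>. lc \<phi> \<noteq> 0 \<and> A i0 \<phi> dvd Q \<phi> ^ (n i0 - 1))"
        using constructible_dvd[OF pf i0(2) r] unfolding lc_def .
      from constructible_conj[OF constructible_neq0[OF lc] constructible_not[OF this]]
      show ?thesis unfolding eq .
    qed
    moreover have "constructible (\<lambda>\<phi>. lc \<phi> = 0 \<and> ?E T \<phi>)"
      using calculation(1) lc by (intro constructible_conj constructible_eq0)
    ultimately have "constructible (\<lambda>\<phi>. (lc \<phi> = 0 \<and> ?E T \<phi>) \<or> (lc \<phi> \<noteq> 0 \<and> ?E A \<phi>))"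
      by (intro constructible_disj)
    also have "(\<lambda>\<phi>. (lc \<phi> = 0 \<and> ?E T \<phi>) \<or> (lc \<phi> \<noteq> 0 \<and> ?E A \<phi>)) = ?E A"
    proof (rule ext)
      fix \<phi>
      show "(lc \<phi> = 0 \<and> ?E T \<phi>) \<or> (lc \<phi> \<noteq> 0 \<and> ?E A \<phi>) \<longleftrightarrow> ?E A \<phi>"
        using \<open>\<And>\<phi>. lc \<phi> = 0 \<Longrightarrow> ?E T \<phi> \<longleftrightarrow> ?E A \<phi>\<close>[of \<phi>] by (cases "lc \<phi> = 0") simp_all
    qed
    finally show ?thesis .
  qed
qed

lemma constructible_ex_upd:
  assumes "constructible P"
  shows "constructible (\<lambda>\<phi>. \<exists>c. P (\<phi>(v := c)))"
proof -
  from assms obtain L where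
    L: "\<forall>(ps, q)\<in>set L. (\<forall>p\<in>set ps. polyfun p) \<and> polyfun q"
    "\<forall>\<phi>. P \<phi> \<longleftrightarrow> (\<exists>(ps, q)\<in>set L. basic_set ps q \<phi>)"
    unfolding constructible_def by blast
  have "constructible (\<lambda>\<phi>. \<exists>c. basic_set ps q (\<phi>(v := c)))" if "(ps, q) \<in> set L" for ps q
  proof -
    have "\<exists>n A. polyfam n A \<and> (\<forall>\<phi> c. p (\<phi>(v := c)) = poly (A \<phi>) c)" if "polyfun p" for p
      using polyfun_as_polyfam[OF that] by metis
    then obtain n A where A: "\<And>p. polyfun p \<Longrightarrow> polyfam (n p) (A p)"
      "\<And>p \<phi> c. polyfun p \<Longrightarrow> p (\<phi>(v := c)) = poly (A p \<phi>) c" by metis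
    have pf: "\<And>p. p \<in> set ps \<Longrightarrow> polyfun p" "polyfun q" using L that by auto
    have "constructible (\<lambda>\<phi>. \<exists>c. (\<forall>p\<in>set ps. poly (A p \<phi>) c = 0) \<and> poly (A q \<phi>) c \<noteq> 0)"
      using pf A(1) by (intro constructible_ex_root_aux) auto
    then show ?thesis using pf A(2) by (simp add: basic_set_def)
  qed
  then have "constructible (\<lambda>\<phi>. \<exists>x\<in>set L. \<exists>c. basic_set (fst x) (snd x) (\<phi>(v := c)))"
    by (intro constructible_Bex) auto
  also have "(\<lambda>\<phi>. \<exists>x\<in>set L. \<exists>c. basic_set (fst x) (snd x) (\<phi>(v := c))) = (\<lambda>\<phi>. \<exists>c. P (\<phi>(v := c)))"
    using L(2) by (auto simp: case_prod_beta)
  finally show ?thesis .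
qed

text \<open>The variables may be infinite in number, for instance all exponent vectors. Since a
  constructible predicate sees only finitely many, a quantifier over a whole assignment reduces to
  finitely many quantifiers over one variable.\<close>

lemma constructible_finite_support:
  fixes P :: "('v \<Rightarrow> complex) \<Rightarrow> bool"
  assumes "constructible P"
  shows "\<exists>V. finite V \<and> (\<forall>\<phi> \<psi>. (\<forall>v\<in>V. \<phi> v = \<psi> v) \<longrightarrow> P \<phi> = P \<psi>)"
proof -
  from assms obtain L where
    L: "\<forall>(ps, q)\<in>set L. (\<forall>p\<in>set ps. polyfun p) \<and> polyfun q"
    "\<forall>\<phi>. P \<phi> \<longleftrightarrow> (\<exists>(ps, q)\<in>set L. basic_set ps q \<phi>)"
    unfolding constructible_def by blast
  obtain V where V: "\<And>p :: ('v \<Rightarrow> complex) \<Rightarrow> complex. polyfun p \<Longrightarrow> finite (V p)"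
    "\<And>p \<phi> \<psi>. polyfun p \<Longrightarrow> (\<forall>v\<in>V p. \<phi> v = \<psi> v) \<Longrightarrow> p \<phi> = p \<psi>"
    using polyfun_finite_support by metis
  let ?W = "\<Union>(ps, q)\<in>set L. V q \<union> (\<Union>p\<in>set ps. V p)"
  have "finite ?W" using L V(1) by fastforce
  moreover have "P \<phi> = P \<psi>" if "\<forall>v\<in>?W. \<phi> v = \<psi> v" for \<phi> \<psi>
  proof -
    have "basic_set ps q \<phi> = basic_set ps q \<psi>" if "(ps, q) \<in> set L" for ps q
    proof -
      have pf: "\<And>p. p \<in> set ps \<Longrightarrow> polyfun p" "polyfun q" using L(1) that by auto
      have sub: "V q \<union> (\<Union>p\<in>set ps. V p) \<subseteq> ?W" using that by force
      have "p \<phi> = p \<psi>" if "p \<in> set ps" for p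
        using pf(1)[OF that] that sub \<open>\<forall>v\<in>?W. \<phi> v = \<psi> v\<close> by (intro V(2)[of p]) blast+
      moreover have "q \<phi> = q \<psi>"
        using pf(2) sub \<open>\<forall>v\<in>?W. \<phi> v = \<psi> v\<close> by (intro V(2)[of q]) blast+
      ultimately show ?thesis unfolding basic_set_def by metis
    qed
    then show ?thesis using L(2) by auto
  qed
  ultimately show ?thesis by blast
qed

text \<open>Chevalley's theorem for the projection that forgets the second block of variables; the
  finitely many relevant ones are eliminated one at a time.\<close>

theorem constructible_ex:
  fixes P :: "('v + 'w \<Rightarrow> complex) \<Rightarrow> bool"
  assumes "constructible P"
  shows "constructible (\<lambda>\<phi>. \<exists>\<psi>. P (case_sum \<phi> \<psi>))"
proof -
  obtain V where V: "finite V" "\<And>\<phi> \<psi>. (\<forall>v\<in>V. \<phi> v = \<psi> v) \<Longrightarrow> P \<phi> = P \<psi>"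
    using constructible_finite_support[OF assms] by blast
  define W where "W = {w. Inr w \<in> V}"
  have "finite W" unfolding W_def using V(1) by (simp add: finite_vimageI[of V Inr, unfolded vimage_def])
  have "constructible (\<lambda>\<phi>. \<exists>\<psi>. (\<forall>v. v \<notin> Inr ` U \<longrightarrow> \<psi> v = \<phi> v) \<and> P \<psi>)" if "finite U" for U
    using that
  proof (induction U rule: finite_induct)
    case empty
    have "(\<lambda>\<phi>. \<exists>\<psi>. (\<forall>v. v \<notin> Inr ` {} \<longrightarrow> \<psi> v = \<phi> v) \<and> P \<psi>) = P"
      by (simp add: fun_eq_iff[symmetric])
    then show ?case using assms by simp
  next
    case (insert u U)
    have "constructible (\<lambda>\<phi>. \<exists>c. \<exists>\<psi>. (\<forall>v. v \<notin> Inr ` U \<longrightarrow> \<psi> v = (\<phi>(Inr u := c)) v) \<and> P \<psi>)"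
      using constructible_ex_upd[OF insert.IH, of "Inr u"] .
    moreover have "(\<exists>c. \<exists>\<psi>. (\<forall>v. v \<notin> Inr ` U \<longrightarrow> \<psi> v = (\<phi>(Inr u := c)) v) \<and> P \<psi>) \<longleftrightarrow>
        (\<exists>\<psi>. (\<forall>v. v \<notin> Inr ` insert u U \<longrightarrow> \<psi> v = \<phi> v) \<and> P \<psi>)" (is "?l \<longleftrightarrow> ?r") for \<phi>
    proof
      assume ?l
      then obtain c \<psi> where "\<forall>v. v \<notin> Inr ` U \<longrightarrow> \<psi> v = (\<phi>(Inr u := c)) v" "P \<psi>" by blast
      then show ?r by (intro exI[of _ \<psi>]) auto
    next
      assume ?r
      then obtain \<psi> where "\<forall>v. v \<notin> Inr ` insert u U \<longrightarrow> \<psi> v = \<phi> v" "P \<psi>" by blast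
      then show ?l by (intro exI[of _ "\<psi> (Inr u)"] exI[of _ \<psi>]) auto
    qed
    ultimately show ?case by simp
  qed
  \<comment> \<open>The second block must not survive as parameters. Substituting 0 for it leaves a
    predicate in the first block alone: variables in W are quantified, and the others are invisible
    to P.\<close>
  from constructible_subst[OF this[OF \<open>finite W\<close>], of "case_sum (\<lambda>v \<phi>. \<phi> v) (\<lambda>w \<phi>. 0)"]
  have "constructible (\<lambda>\<phi>. \<exists>\<psi>. (\<forall>v. v \<notin> Inr ` W \<longrightarrow>
      \<psi> v = case_sum (\<lambda>v \<phi>. \<phi> v) (\<lambda>w \<phi>. 0) v \<phi>) \<and> P \<psi>)"
    by (simp split: sum.splits)
  moreover have "(\<exists>\<psi>. (\<forall>v. v \<notin> Inr ` W \<longrightarrow> \<psi> v = case_sum (\<lambda>v \<phi>. \<phi> v) (\<lambda>w \<phi>. 0) v \<phi>) \<and> P \<psi>)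
      \<longleftrightarrow> (\<exists>\<psi>. P (case_sum \<phi> \<psi>))" (is "?l \<longleftrightarrow> ?r") for \<phi>
  proof
    assume ?l
    then obtain \<psi> where \<psi>: "\<forall>v. v \<notin> Inr ` W \<longrightarrow> \<psi> v = case_sum (\<lambda>v \<phi>. \<phi> v) (\<lambda>w \<phi>. 0) v \<phi>" "P \<psi>" by blast
    have "\<psi> v = case_sum \<phi> (\<lambda>w. \<psi> (Inr w)) v" for v
      using \<psi>(1) by (cases v) auto
    then have "\<psi> = case_sum \<phi> (\<lambda>w. \<psi> (Inr w))" by (rule ext)
    from subst[OF this, of P, OF \<psi>(2)] show ?r by blast
  next
    assume ?r
    then obtain \<psi> where \<psi>: "P (case_sum \<phi> \<psi>)" by blast
    let ?\<psi> = "case_sum \<phi> (\<lambda>w. if w \<in> W then \<psi> w else 0)"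
    have "P ?\<psi> = P (case_sum \<phi> \<psi>)"
      by (rule V(2)) (auto simp: W_def split: sum.splits)
    moreover have "\<forall>v. v \<notin> Inr ` W \<longrightarrow> ?\<psi> v = case_sum (\<lambda>v \<phi>. \<phi> v) (\<lambda>w \<phi>. 0) v \<phi>"
      by (auto split: sum.splits)
    ultimately show ?l using \<psi> by (intro exI[of _ ?\<psi>]) simp
  qed
  ultimately show ?thesis by simp
qed

lemma constructible_all:
  fixes P :: "('v + 'w \<Rightarrow> complex) \<Rightarrow> bool"
  assumes "constructible P"
  shows "constructible (\<lambda>\<phi>. \<forall>\<psi>. P (case_sum \<phi> \<psi>))"
  using constructible_not[OF constructible_ex[OF constructible_not[OF assms]]] by simp

section \<open>Restriction to lines and the zero-one law\<close>

lemma polyfun_on_line: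
  assumes "polyfun p"
  shows "\<exists>A. \<forall>t. p (\<lambda>v. \<phi> v + t * \<psi> v) = poly A t"
  using assms
proof (induction rule: polyfun.induct)
  case (polyfun_const c)
  show ?case by (rule exI[of _ "[:c:]"]) simp
next
  case (polyfun_var v)
  show ?case by (rule exI[of _ "[:\<phi> v, \<psi> v:]"]) simp
next
  case (polyfun_add p q)
  then obtain A B where "\<forall>t. p (\<lambda>v. \<phi> v + t * \<psi> v) = poly A t"
    "\<forall>t. q (\<lambda>v. \<phi> v + t * \<psi> v) = poly B t" by blast
  then show ?case by (intro exI[of _ "A + B"]) simp
next
  case (polyfun_mult p q)
  then obtain A B where "\<forall>t. p (\<lambda>v. \<phi> v + t * \<psi> v) = poly A t"
    "\<forall>t. q (\<lambda>v. \<phi> v + t * \<psi> v) = poly B t" by blast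
  then show ?case by (intro exI[of _ "A * B"]) simp
qed

lemma polyfun_line_finite:
  assumes "polyfun p" "p (\<lambda>v. \<phi> v + t0 * \<psi> v) \<noteq> 0"
  shows "finite {t. p (\<lambda>v. \<phi> v + t * \<psi> v) = 0}"
proof -
  obtain A where A: "\<forall>t. p (\<lambda>v. \<phi> v + t * \<psi> v) = poly A t"
    using polyfun_on_line[OF assms(1)] by blast
  with assms(2) have "A \<noteq> 0" by auto
  then show ?thesis using A poly_roots_finite[of A] by simp
qed

text \<open>Irreducibility of affine space: on the line through the two points each polynomial has
  only finitely many zeros.\<close>

lemma polyfun_mult_nonzero:
  assumes "polyfun p" "polyfun q" "p \<phi> \<noteq> 0" "q \<psi> \<noteq> 0"
  shows "\<exists>t. p (\<lambda>v. \<phi> v + t * (\<psi> v - \<phi> v)) \<noteq> 0 \<and> q (\<lambda>v. \<phi> v + t * (\<psi> v - \<phi> v)) \<noteq> 0"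
proof -
  have "finite {t. p (\<lambda>v. \<phi> v + t * (\<psi> v - \<phi> v)) = 0}"
    using polyfun_line_finite[OF assms(1), of \<phi> 0] assms(3) by simp
  moreover have "finite {t. q (\<lambda>v. \<phi> v + t * (\<psi> v - \<phi> v)) = 0}"
    using polyfun_line_finite[OF assms(2), of \<phi> 1] assms(4) by simp
  ultimately have "finite ({t. p (\<lambda>v. \<phi> v + t * (\<psi> v - \<phi> v)) = 0} \<union> {t. q (\<lambda>v. \<phi> v + t * (\<psi> v - \<phi> v)) = 0})" (is "finite ?S")
    by simp
  then obtain t where "t \<notin> ?S" using ex_new_if_finite[OF infinite_UNIV_char_0] by blast
  then show ?thesis by auto
qed

text \<open>The zero-one law. An equation p = 0 satisfies it with F = p, or with F = 1 if p is
  identically zero; negation exchanges the alternatives, and for a conjunction the two witnesses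
  multiply to a polynomial that is again nonzero.\<close>

lemma constructible_generic:
  assumes "constructible P"
  shows "\<exists>F. polyfun F \<and> (\<exists>\<phi>. F \<phi> \<noteq> 0) \<and> ((\<forall>\<phi>. F \<phi> \<noteq> 0 \<longrightarrow> P \<phi>) \<or> (\<forall>\<phi>. F \<phi> \<noteq> 0 \<longrightarrow> \<not> P \<phi>))"
proof -
  let ?G = "\<lambda>P. \<exists>F. polyfun F \<and> (\<exists>\<phi>. F \<phi> \<noteq> 0) \<and> ((\<forall>\<phi>. F \<phi> \<noteq> 0 \<longrightarrow> P \<phi>) \<or> (\<forall>\<phi>. F \<phi> \<noteq> 0 \<longrightarrow> \<not> P \<phi>))"
  have true: "?G (\<lambda>\<phi>. b)" for b
    by (intro exI[of _ "\<lambda>_. 1"]) auto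
  have conj: "?G (\<lambda>\<phi>. P \<phi> \<and> Q \<phi>)" if "?G P" "?G Q" for P Q
  proof -
    from that obtain F G where FG: "polyfun F" "polyfun G" "\<exists>\<phi>. F \<phi> \<noteq> 0" "\<exists>\<phi>. G \<phi> \<noteq> 0"
      and P: "(\<forall>\<phi>. F \<phi> \<noteq> 0 \<longrightarrow> P \<phi>) \<or> (\<forall>\<phi>. F \<phi> \<noteq> 0 \<longrightarrow> \<not> P \<phi>)"
      and Q: "(\<forall>\<phi>. G \<phi> \<noteq> 0 \<longrightarrow> Q \<phi>) \<or> (\<forall>\<phi>. G \<phi> \<noteq> 0 \<longrightarrow> \<not> Q \<phi>)" by blast
    obtain \<phi> where "F \<phi> * G \<phi> \<noteq> 0" using polyfun_mult_nonzero[OF FG(1,2)] FG(3,4) by (metis mult_eq_0_iff)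
    moreover have "(\<forall>\<phi>. F \<phi> * G \<phi> \<noteq> 0 \<longrightarrow> P \<phi> \<and> Q \<phi>) \<or> (\<forall>\<phi>. F \<phi> * G \<phi> \<noteq> 0 \<longrightarrow> \<not> (P \<phi> \<and> Q \<phi>))"
      using P Q by auto
    ultimately show ?thesis using FG by (intro exI[of _ "\<lambda>\<phi>. F \<phi> * G \<phi>"]) blast
  qed
  have neg: "?G (\<lambda>\<phi>. \<not> P \<phi>)" if "?G P" for P using that by auto
  have eq: "?G (\<lambda>\<phi>. p \<phi> = 0)" if "polyfun p" for p
  proof (cases "\<forall>\<phi>. p \<phi> = 0")
    case True
    then show ?thesis using true[of True] by simp
  next
    case False
    then show ?thesis using that by blast
  qed
  have ball: "?G (\<lambda>\<phi>. \<forall>i\<in>set I. R i \<phi>)" if "\<And>i. i \<in> set I \<Longrightarrow> ?G (R i)" for I :: "'i list" and R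
    using that
  proof (induction I)
    case Nil
    then show ?case using true[of True] by simp
  next
    case (Cons i I)
    then show ?case using conj[of "R i" "\<lambda>\<phi>. \<forall>i\<in>set I. R i \<phi>"] by simp
  qed
  have ballL: "?G (\<lambda>\<phi>. \<forall>i\<in>set I. R i \<phi>)" if "\<And>i. i \<in> set I \<Longrightarrow> ?G (R i)"
    for I :: "((('a \<Rightarrow> complex) \<Rightarrow> complex) list \<times> (('a \<Rightarrow> complex) \<Rightarrow> complex)) list" and R
    using that
  proof (induction I)
    case Nil
    then show ?case using true[of True] by simp
  next
    case (Cons i I)
    then show ?case using conj[of "R i" "\<lambda>\<phi>. \<forall>i\<in>set I. R i \<phi>"] by simp
  qed
  from assms obtain L where
    L: "\<forall>(ps, q)\<in>set L. (\<forall>p\<in>set ps. polyfun p) \<and> polyfun q"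
    "\<forall>\<phi>. P \<phi> \<longleftrightarrow> (\<exists>(ps, q)\<in>set L. basic_set ps q \<phi>)"
    unfolding constructible_def by blast
  have "?G (basic_set ps q)" if "(ps, q) \<in> set L" for ps q
  proof -
    have "?G (\<lambda>\<phi>. \<forall>p\<in>set ps. p \<phi> = 0)" using L(1) that by (intro ball eq) auto
    moreover have "?G (\<lambda>\<phi>. \<not> q \<phi> = 0)" using L(1) that by (intro neg eq) auto
    ultimately show ?thesis unfolding basic_set_def[abs_def] by (rule conj)
  qed
  then have "?G (\<lambda>\<phi>. \<not> (\<forall>x\<in>set L. \<not> basic_set (fst x) (snd x) \<phi>))"
    by (intro neg ballL) auto
  then show ?thesis using L(2) by (simp add: case_prod_beta)
qed

section \<open>General forms\<close>

definition mev :: "('v \<Rightarrow>\<^sub>0 nat) \<Rightarrow> ('v \<Rightarrow> complex) \<Rightarrow> complex" where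
  "mev a v = (\<Prod>i\<in>Poly_Mapping.keys a. v i ^ Poly_Mapping.lookup a i)"

lemma mev_superset:
  assumes "finite K" "Poly_Mapping.keys a \<subseteq> K"
  shows "mev a v = (\<Prod>i\<in>K. v i ^ Poly_Mapping.lookup a i)"
  unfolding mev_def using assms by (intro prod.mono_neutral_left) (auto simp: in_keys_iff)

lemma mev_add: "mev (a + b) v = mev a v * mev b v"
proof -
  let ?K = "Poly_Mapping.keys a \<union> Poly_Mapping.keys b"
  have "Poly_Mapping.keys (a + b) \<subseteq> ?K" by (rule Poly_Mapping.keys_add)
  then show ?thesis
    using mev_superset[of ?K a v] mev_superset[of ?K b v] mev_superset[of ?K "a + b" v]
    by (simp add: Poly_Mapping.lookup_add power_add prod.distrib)
qed

lemma mev_0 [simp]: "mev 0 v = 1"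
  by (simp add: mev_def)

lemma peval_superset:
  assumes "finite K" "Poly_Mapping.keys p \<subseteq> K"
  shows "peval p v = (\<Sum>a\<in>K. Poly_Mapping.lookup p a * mev a v)"
  unfolding peval_def mev_def[symmetric] using assms
  by (intro sum.mono_neutral_left) (auto simp: in_keys_iff)

lemma peval_add: "peval (p + q) v = peval p v + peval q v"
proof -
  let ?K = "Poly_Mapping.keys p \<union> Poly_Mapping.keys q"
  have "Poly_Mapping.keys (p + q) \<subseteq> ?K" by (rule Poly_Mapping.keys_add)
  then show ?thesis
    using peval_superset[of ?K p v] peval_superset[of ?K q v] peval_superset[of ?K "p + q" v]
    by (simp add: Poly_Mapping.lookup_add ring_distribs sum.distrib)
qed

lemma peval_0 [simp]: "peval 0 v = 0"
  by (simp add: peval_def)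

lemma peval_single: "peval (Poly_Mapping.single a c) v = c * mev a v"
  by (simp add: peval_superset[of "{a}"])

lemma peval_sum: "peval (\<Sum>i\<in>I. p i) v = (\<Sum>i\<in>I. peval (p i) v)"
  by (induction I rule: infinite_finite_induct) (auto simp: peval_add)

lemma poly_mapping_expand:
  "p = (\<Sum>a\<in>Poly_Mapping.keys p. Poly_Mapping.single a (Poly_Mapping.lookup p a))"
proof (rule poly_mapping_eqI)
  fix k
  show "Poly_Mapping.lookup p k = Poly_Mapping.lookup (\<Sum>a\<in>Poly_Mapping.keys p. Poly_Mapping.single a (Poly_Mapping.lookup p a)) k"
    by (simp add: Poly_Mapping.lookup_sum lookup_single when_def in_keys_iff)
qed

lemma peval_mult: "peval (p * q) v = peval p v * peval q v"
proof -
  have "p * q = (\<Sum>a\<in>Poly_Mapping.keys p. \<Sum>b\<in>Poly_Mapping.keys q.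
      Poly_Mapping.single (a + b) (Poly_Mapping.lookup p a * Poly_Mapping.lookup q b))"
    by (subst (1) poly_mapping_expand[of p], subst (1) poly_mapping_expand[of q])
       (simp add: sum_product mult_single)
  then have "peval (p * q) v = (\<Sum>a\<in>Poly_Mapping.keys p. \<Sum>b\<in>Poly_Mapping.keys q.
      (Poly_Mapping.lookup p a * mev a v) * (Poly_Mapping.lookup q b * mev b v))"
    by (simp add: peval_sum peval_single mev_add mult_ac)
  also have "\<dots> = peval p v * peval q v"
    by (simp add: peval_superset[of "Poly_Mapping.keys p" p] peval_superset[of "Poly_Mapping.keys q" q] sum_product)
  finally show ?thesis .
qed

lemma peval_const [simp]: "peval (const_poly c) v = c"
  by (simp add: const_poly_def peval_single)

lemma peval_1 [simp]: "peval 1 v = 1"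
  by (simp add: peval_def)

lemma peval_power: "peval (p ^ k) v = peval p v ^ k"
  by (induction k) (auto simp: peval_mult)

lemma polyfun_peval: "polyfun (peval p)"
  unfolding peval_def[abs_def] by (intro polyfun_sum polyfun_mult polyfun_prod polyfun_power polyfun_const polyfun_var)

lemma polyfun_imp_peval: "polyfun F \<Longrightarrow> \<exists>p. \<forall>\<phi>. F \<phi> = peval p \<phi>"
proof (induction rule: polyfun.induct)
  case (polyfun_const c)
  show ?case by (rule exI[of _ "const_poly c"]) simp
next
  case (polyfun_var v)
  show ?case by (rule exI[of _ "Poly_Mapping.single (Poly_Mapping.single v 1) 1"]) (simp add: peval_single mev_def)
next
  case (polyfun_add p q)
  then show ?case by (metis peval_add)
next
  case (polyfun_mult p q)
  then show ?case by (metis peval_mult)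
qed

definition pdeg :: "('v \<Rightarrow>\<^sub>0 nat) \<Rightarrow> nat" where
  "pdeg a = (\<Sum>i\<in>Poly_Mapping.keys a. Poly_Mapping.lookup a i)"

lemma mev_scale: "mev a (\<lambda>v. t * \<phi> v) = t ^ pdeg a * mev a \<phi>"
  by (simp add: mev_def pdeg_def power_mult_distrib prod.distrib power_sum)

lemma homogeneous_altdef: "homogeneous e p \<longleftrightarrow> (\<forall>a\<in>Poly_Mapping.keys p. pdeg a = e)"
  by (simp add: homogeneous_def pdeg_def)

lemma peval_scale_homogeneous:
  assumes "homogeneous e p"
  shows "peval p (\<lambda>v. t * \<phi> v) = t ^ e * peval p \<phi>"
  using assms
  by (simp add: peval_superset[of "Poly_Mapping.keys p" p] mev_scale homogeneous_altdef sum_distrib_left mult_ac)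

lemma pdeg_add: "pdeg (a + b) = pdeg a + pdeg b"
proof -
  have *: "pdeg a = (\<Sum>i\<in>K. Poly_Mapping.lookup a i)"
    if "finite K" "Poly_Mapping.keys a \<subseteq> K" for K and a :: "'a \<Rightarrow>\<^sub>0 nat"
    unfolding pdeg_def using that by (intro sum.mono_neutral_left) (auto simp: in_keys_iff)
  let ?K = "Poly_Mapping.keys a \<union> Poly_Mapping.keys b"
  have "Poly_Mapping.keys (a + b) \<subseteq> ?K" by (rule Poly_Mapping.keys_add)
  then show ?thesis
    using *[of ?K a] *[of ?K b] *[of ?K "a + b"]
    by (simp add: Poly_Mapping.lookup_add sum.distrib)
qed

lemma homogeneous_mult:
  "homogeneous e p \<Longrightarrow> homogeneous e' q \<Longrightarrow> homogeneous (e + e') (p * q)"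
  unfolding homogeneous_altdef using Poly_Mapping.keys_mult[of p q] by (fastforce simp: pdeg_add)

definition hcomp :: "nat \<Rightarrow> 'v cpoly \<Rightarrow> 'v cpoly" where
  "hcomp e p = (\<Sum>a\<in>{a\<in>Poly_Mapping.keys p. pdeg a = e}. Poly_Mapping.single a (Poly_Mapping.lookup p a))"

lemma homogeneous_hcomp: "homogeneous e (hcomp e p)"
proof -
  have "Poly_Mapping.keys (hcomp e p) \<subseteq> {a\<in>Poly_Mapping.keys p. pdeg a = e}"
    unfolding hcomp_def by (rule order_trans[OF Poly_Mapping.keys_sum]) auto
  then show ?thesis by (auto simp: homogeneous_altdef)
qed

lemma peval_hcomp: "peval (hcomp e p) \<phi> =
  (\<Sum>a\<in>{a\<in>Poly_Mapping.keys p. pdeg a = e}. Poly_Mapping.lookup p a * mev a \<phi>)"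
  by (simp add: hcomp_def peval_sum peval_single)

lemma peval_scale:
  "peval p (\<lambda>v. t * \<phi> v) = poly (\<Sum>a\<in>Poly_Mapping.keys p. monom (Poly_Mapping.lookup p a * mev a \<phi>) (pdeg a)) t"
  by (simp add: peval_superset[of "Poly_Mapping.keys p" p] mev_scale poly_sum poly_monom mult_ac)

text \<open>Along the ray through \<phi> the value of p is a polynomial in t, and the value of
  \<open>hcomp e p\<close> is its coefficient at t^e. This trades a nonhomogeneous witness of
  genericity for a homogeneous one, at the price of a rescaling.\<close>

lemma hcomp_nonzero_scale:
  assumes "peval (hcomp e p) \<phi> \<noteq> 0"
  shows "\<exists>t. t \<noteq> 0 \<and> peval p (\<lambda>v. t * \<phi> v) \<noteq> 0"
proof -
  let ?A = "\<Sum>a\<in>Poly_Mapping.keys p. monom (Poly_Mapping.lookup p a * mev a \<phi>) (pdeg a)"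
  have "poly.coeff ?A e = peval (hcomp e p) \<phi>"
    by (simp add: coeff_sum peval_hcomp sum.inter_filter[symmetric])
  with assms have "?A \<noteq> 0" by auto
  then have "finite {t. poly ?A t = 0}" by (rule poly_roots_finite)
  then have "finite (insert 0 {t. poly ?A t = 0})" by simp
  then obtain t where "t \<notin> insert 0 {t. poly ?A t = 0}"
    using ex_new_if_finite[OF infinite_UNIV_char_0] by blast
  then show ?thesis by (auto simp: peval_scale)
qed

lemma hcomp_exists:
  assumes "peval p \<phi> \<noteq> 0"
  shows "\<exists>e. peval (hcomp e p) \<phi> \<noteq> 0"
proof (rule ccontr)
  assume *: "\<not> ?thesis"
  have "peval p \<phi> = (\<Sum>e\<in>pdeg ` Poly_Mapping.keys p. peval (hcomp e p) \<phi>)"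
    by (simp add: peval_hcomp peval_superset[of "Poly_Mapping.keys p" p] sum.group)
  with * assms show False by simp
qed

section \<open>Monomials of degree d and coefficient vectors of forms\<close>

definition Mon :: "nat \<Rightarrow> ('n::finite \<Rightarrow>\<^sub>0 nat) set" where
  "Mon d = {a. (\<Sum>i\<in>UNIV. Poly_Mapping.lookup a i) = d}"

lemma pdeg_UNIV: "pdeg a = (\<Sum>i\<in>UNIV. Poly_Mapping.lookup a i)" for a :: "'n::finite \<Rightarrow>\<^sub>0 nat"
  unfolding pdeg_def by (intro sum.mono_neutral_left) (auto simp: in_keys_iff)

lemma mev_UNIV: "mev a v = (\<Prod>i\<in>UNIV. v i ^ Poly_Mapping.lookup a i)" for a :: "'n::finite \<Rightarrow>\<^sub>0 nat"
  by (rule mev_superset) auto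

lemma Mon_iff: "a \<in> Mon d \<longleftrightarrow> pdeg a = d"
  by (simp add: Mon_def pdeg_UNIV)

lemma lookup_Abs_finite [simp]:
  "Poly_Mapping.lookup (Poly_Mapping.Abs_poly_mapping (f :: 'n::finite \<Rightarrow> _)) = f"
  by (rule lookup_Abs_poly_mapping) simp

text \<open>Enumerating the variables turns exponent vectors into lists of naturals with prescribed
  length and sum, which are counted by stars and bars.\<close>

lemma bij_Mon_lists:
  obtains h :: "('n::finite \<Rightarrow>\<^sub>0 nat) \<Rightarrow> nat list"
  where "bij_betw h (Mon d) {l. length l = CARD('n) \<and> sum_list l = d}"
proof -
  obtain u :: "nat \<Rightarrow> 'n" where u: "bij_betw u {0..<CARD('n)} UNIV"
    using ex_bij_betw_nat_finite[of "UNIV :: 'n set"] by auto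
  define w where "w = inv_into {0..<CARD('n)} u"
  have w: "\<And>i. w i < CARD('n)" "\<And>i. u (w i) = i" "\<And>k. k < CARD('n) \<Longrightarrow> w (u k) = k"
    using u inv_into_into[of _ u "{0..<CARD('n)}"] f_inv_into_f[of _ u "{0..<CARD('n)}"]
    by (auto simp: w_def bij_betw_def intro: inv_into_f_f)
  let ?h = "\<lambda>a. map (\<lambda>k. Poly_Mapping.lookup a (u k)) [0..<CARD('n)]"
  let ?g = "\<lambda>l. Poly_Mapping.Abs_poly_mapping (\<lambda>i. l ! w i)"
  have sum: "(\<Sum>i\<in>UNIV. f i) = (\<Sum>k = 0..<CARD('n). f (u k))" for f :: "'n \<Rightarrow> nat"
    using sum.reindex_bij_betw[OF u, of f] by simp
  have "bij_betw ?h (Mon d) {l. length l = CARD('n) \<and> sum_list l = d}"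
  proof (rule bij_betwI[where g = ?g])
    show "?h \<in> Mon d \<rightarrow> {l. length l = CARD('n) \<and> sum_list l = d}"
      by (auto simp: Mon_def sum sum_list_sum_nth)
    show "?g \<in> {l. length l = CARD('n) \<and> sum_list l = d} \<rightarrow> Mon d"
      by (auto simp: Mon_def sum w sum_list_sum_nth)
    show "?g (?h a) = a" if "a \<in> Mon d" for a
      by (rule poly_mapping_eqI) (simp add: w)
    show "?h (?g l) = l" if "l \<in> {l. length l = CARD('n) \<and> sum_list l = d}" for l
      using that by (intro nth_equalityI) (auto simp: w)
  qed
  then show ?thesis using that by blast
qed

lemma card_Mon: "card (Mon d :: ('n::finite \<Rightarrow>\<^sub>0 nat) set) = (d + CARD('n) - 1) choose d"
proof -
  obtain h :: "('n \<Rightarrow>\<^sub>0 nat) \<Rightarrow> nat list"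
    where h: "bij_betw h (Mon d) {l. length l = CARD('n) \<and> sum_list l = d}" by (rule bij_Mon_lists)
  show ?thesis using card_length_sum_list[of "CARD('n)" d] bij_betw_same_card[OF h] by simp
qed

lemma finite_Mon [simp, intro]: "finite (Mon d :: ('n::finite \<Rightarrow>\<^sub>0 nat) set)"
proof (rule card_ge_0_finite)
  have "d \<le> d + CARD('n) - 1" using zero_less_card_finite[where 'a = 'n] by linarith
  then show "0 < card (Mon d :: ('n \<Rightarrow>\<^sub>0 nat) set)" by (simp add: card_Mon)
qed

lemma Sym_iff: "f \<in> Sym d \<longleftrightarrow> (\<forall>a. a \<notin> Mon d \<longrightarrow> Poly_Mapping.lookup f a = 0)"
  for f :: "'n::finite cpoly"
  by (auto simp: Sym_def homogeneous_altdef Mon_iff in_keys_iff)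

lemma Sym_from_coeffs:
  fixes \<phi> :: "('n::finite \<Rightarrow>\<^sub>0 nat) \<Rightarrow> complex"
  assumes "\<And>a. a \<notin> Mon d \<Longrightarrow> \<phi> a = 0"
  obtains f where "f \<in> Sym d" "Poly_Mapping.lookup f = \<phi>"
proof
  have "finite {a. \<phi> a \<noteq> 0}" by (rule finite_subset[OF _ finite_Mon[of d]]) (use assms in auto)
  then show *: "Poly_Mapping.lookup (Poly_Mapping.Abs_poly_mapping \<phi>) = \<phi>" by simp
  show "Poly_Mapping.Abs_poly_mapping \<phi> \<in> Sym d" using assms by (simp add: Sym_iff *)
qed

section \<open>Basic Zariski open sets of the space of forms\<close>

lemma openin_generated_base:
  assumes "openin (topology_generated_by \<B>) U" "x \<in> U"
    and "\<And>A B. A \<in> \<B> \<Longrightarrow> B \<in> \<B> \<Longrightarrow> A \<inter> B \<in> \<B>"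
  shows "\<exists>B\<in>\<B>. x \<in> B \<and> B \<subseteq> U"
proof -
  have "generate_topology_on \<B> U" using assms(1) by (simp add: openin_topology_generated_by_iff)
  then show ?thesis using assms(2)
  proof (induction arbitrary: x rule: generate_topology_on.induct)
    case (Int a b)
    then obtain A B where "A \<in> \<B>" "x \<in> A" "A \<subseteq> a" "B \<in> \<B>" "x \<in> B" "B \<subseteq> b"
      by (metis IntE)
    then show ?case using assms(3)[of A B] by (intro bexI[of _ "A \<inter> B"]) auto
  next
    case (UN K)
    then obtain k where "k \<in> K" "x \<in> k" by blast
    then show ?case using UN.IH[of k x] by blast
  next
    case Empty
    then show ?case by simp
  next
    case (Basis s)
    then show ?case by (intro bexI[of _ s]) auto
  qed
qed

definition zbase :: "nat \<Rightarrow> ('n \<Rightarrow>\<^sub>0 nat) cpoly \<Rightarrow> 'n cpoly set set" where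
  "zbase d F = {P \<in> PSym d. \<forall>f\<in>P - {0}. peval F (Poly_Mapping.lookup f) \<noteq> 0}"

lemma zariski_PSym_altdef:
  "zariski_PSym d = topology_generated_by {zbase d F | F e. homogeneous e F}"
  by (simp add: zariski_PSym_def zbase_def)

lemma form_pt_self: "f \<in> form_pt f"
  unfolding form_pt_def by (rule CollectI, rule exI[of _ 1]) (simp add: const_poly_def)

lemma openin_zbase: "homogeneous e F \<Longrightarrow> openin (zariski_PSym d) (zbase d F)"
  unfolding zariski_PSym_altdef by (rule topology_generated_by_Basis) blast

lemma zariski_PSym_base:
  fixes U :: "'n cpoly set set"
  assumes "openin (zariski_PSym d) U" "P \<in> U"
  shows "\<exists>F e. homogeneous e F \<and> P \<in> zbase d F \<and> zbase d F \<subseteq> U"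
proof -
  have "\<exists>B\<in>{zbase d F | F e. homogeneous e F}. P \<in> B \<and> B \<subseteq> U"
  proof (rule openin_generated_base[OF _ assms(2)])
    show "openin (topology_generated_by {zbase d F | F e. homogeneous e F}) U"
      using assms(1) by (simp add: zariski_PSym_altdef)
    fix A B :: "'n cpoly set set" assume "A \<in> {zbase d F | F e. homogeneous e F}" "B \<in> {zbase d F | F e. homogeneous e F}"
    then obtain F e G e' where *: "homogeneous e F" "homogeneous e' G" "A = zbase d F" "B = zbase d G" by blast
    then have "A \<inter> B = zbase d (F * G)" by (auto simp: zbase_def peval_mult)
    then show "A \<inter> B \<in> {zbase d F | F e. homogeneous e F}" using homogeneous_mult[OF *(1,2)] by blast
  qed
  then show ?thesis by blast
qed

text \<open>By homogeneity one representative decides for the whole line.\<close>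

lemma zbase_form_pt:
  assumes "homogeneous e F" "f \<in> Sym d" "f \<noteq> 0"
  shows "form_pt f \<in> zbase d F \<longleftrightarrow> peval F (Poly_Mapping.lookup f) \<noteq> 0"
proof
  assume "form_pt f \<in> zbase d F"
  then show "peval F (Poly_Mapping.lookup f) \<noteq> 0" using form_pt_self[of f] assms(3) by (auto simp: zbase_def)
next
  assume *: "peval F (Poly_Mapping.lookup f) \<noteq> 0"
  have "peval F (Poly_Mapping.lookup g) \<noteq> 0" if "g \<in> form_pt f - {0}" for g
  proof -
    from that obtain c where c: "g = const_poly c * f" "g \<noteq> 0" by (auto simp: form_pt_def)
    then have "c \<noteq> 0" by (auto simp: const_poly_def)
    have "Poly_Mapping.lookup g = (\<lambda>a. c * Poly_Mapping.lookup f a)"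
      using c by (auto simp: lookup_const_poly_times)
    with * \<open>c \<noteq> 0\<close> show ?thesis by (simp add: peval_scale_homogeneous[OF assms(1)])
  qed
  moreover have "form_pt f \<in> PSym d" using assms by (auto simp: PSym_def)
  ultimately show "form_pt f \<in> zbase d F" by (auto simp: zbase_def)
qed

text \<open>Both open sets meet the line joining a member of one to a member of the other, and each
  misses only finitely many of its points. The definite description in \<open>ed_degree\<close>
  becomes unique this way.\<close>

lemma general_form_meet:
  assumes "general_form d Q" "general_form d R"
  shows "\<exists>f \<in> Sym d. f \<noteq> (0 :: 'n::finite cpoly) \<and> Q f \<and> R f"
proof -
  have *: "\<exists>F e f. homogeneous e F \<and> f \<in> Sym d \<and> peval F (Poly_Mapping.lookup f) \<noteq> 0 \<and>
      (\<forall>f. f \<in> Sym d \<and> f \<noteq> 0 \<and> peval F (Poly_Mapping.lookup f) \<noteq> 0 \<longrightarrow> Q f) \<and> f \<noteq> 0"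
    if gen: "general_form d Q" for Q :: "'n cpoly \<Rightarrow> bool"
  proof -
    from gen obtain U P where U: "openin (zariski_PSym d) U" "P \<in> U"
      "\<forall>f. f \<in> Sym d \<and> f \<noteq> 0 \<and> form_pt f \<in> U \<longrightarrow> Q f" using that unfolding general_form_def by (metis all_not_in_conv)
    obtain F e where F: "homogeneous e F" "P \<in> zbase d F" "zbase d F \<subseteq> U"
      using zariski_PSym_base[OF U(1,2)] by blast
    from F(2) obtain f where f: "f \<in> Sym d" "f \<noteq> 0" "P = form_pt f" by (auto simp: zbase_def PSym_def)
    then show ?thesis using F zbase_form_pt[OF F(1)] U(3) by blast
  qed
  obtain F e f where F: "f \<in> Sym d" "peval F (Poly_Mapping.lookup f) \<noteq> 0" "f \<noteq> 0"
      "\<forall>f. f \<in> Sym d \<and> f \<noteq> 0 \<and> peval F (Poly_Mapping.lookup f) \<noteq> 0 \<longrightarrow> Q f"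
    using *[OF assms(1)] by metis
  obtain G e' g where G: "g \<in> Sym d" "peval G (Poly_Mapping.lookup g) \<noteq> 0"
      "\<forall>f. f \<in> Sym d \<and> f \<noteq> 0 \<and> peval G (Poly_Mapping.lookup f) \<noteq> 0 \<longrightarrow> R f"
    using *[OF assms(2)] by metis
  from F(3) obtain a0 where a0: "Poly_Mapping.lookup f a0 \<noteq> 0" by (metis lookup_zero poly_mapping_eqI)
  \<comment> \<open>The factor \<open>\<phi> a0\<close> keeps the form found on the line nonzero; a
    constant F alone would not.\<close>
  let ?F = "\<lambda>\<phi>. peval F \<phi> * \<phi> a0"
  have "\<exists>t. ?F (\<lambda>v. Poly_Mapping.lookup f v + t * (Poly_Mapping.lookup g v - Poly_Mapping.lookup f v)) \<noteq> 0 \<and>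
     peval G (\<lambda>v. Poly_Mapping.lookup f v + t * (Poly_Mapping.lookup g v - Poly_Mapping.lookup f v)) \<noteq> 0"
    by (rule polyfun_mult_nonzero[of ?F "peval G"])
       (use F(2) G(2) a0 in \<open>auto intro!: polyfun_peval polyfun_mult\<close>)
  then obtain t where t: "?F (\<lambda>v. Poly_Mapping.lookup f v + t * (Poly_Mapping.lookup g v - Poly_Mapping.lookup f v)) \<noteq> 0"
     "peval G (\<lambda>v. Poly_Mapping.lookup f v + t * (Poly_Mapping.lookup g v - Poly_Mapping.lookup f v)) \<noteq> 0"
    by (elim exE conjE)
  define \<phi> where "\<phi> = (\<lambda>v. Poly_Mapping.lookup f v + t * (Poly_Mapping.lookup g v - Poly_Mapping.lookup f v))"
  obtain h where h: "h \<in> Sym d" "Poly_Mapping.lookup h = \<phi>"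
    by (rule Sym_from_coeffs[of d \<phi>]) (use F(1) G(1) in \<open>auto simp: \<phi>_def Sym_iff\<close>)
  with t have "h \<noteq> 0" "peval F (Poly_Mapping.lookup h) \<noteq> 0" "peval G (Poly_Mapping.lookup h) \<noteq> 0"
  proof -
    have "\<phi> a0 \<noteq> 0" using t(1) by (simp add: \<phi>_def)
    then show "h \<noteq> 0" using h(2) by auto
  qed (use t h(2) in \<open>auto simp: \<phi>_def[symmetric]\<close>)
  with h F(4) G(3) show ?thesis by blast
qed

text \<open>The zero-one law inside the affine subspace through \<xi> with directions B. The
  negative alternative is impossible, since a nonzero polynomial cannot vanish on a small piece of a
  line inside the box.\<close>

lemma constructible_box_generic:
  assumes "constructible P" "finite B" "\<delta> > 0"
    and box: "\<And>\<phi>. (\<And>a. a \<in> B \<Longrightarrow> norm (\<phi> a - \<xi> a) < \<delta>) \<Longrightarrow> (\<And>a. a \<notin> B \<Longrightarrow> \<phi> a = \<xi> a) \<Longrightarrow> P \<phi>"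
  shows "\<exists>F. polyfun F \<and> (\<exists>\<phi>. (\<forall>a. a \<notin> B \<longrightarrow> \<phi> a = \<xi> a) \<and> F \<phi> \<noteq> 0) \<and>
     (\<forall>\<phi>. (\<forall>a. a \<notin> B \<longrightarrow> \<phi> a = \<xi> a) \<longrightarrow> F \<phi> \<noteq> 0 \<longrightarrow> P \<phi>)"
proof -
  let ?r = "\<lambda>\<psi> \<phi> a. if a \<in> B then \<phi> a else \<psi> a"
  have r: "polyfun (\<lambda>\<phi>. ?r \<psi> \<phi> a)" for \<psi> :: "'a \<Rightarrow> complex" and a
    by (cases "a \<in> B") simp_all
  have sub: "polyfun (\<lambda>\<phi>. p (?r \<psi> \<phi>))" if "polyfun p" for p and \<psi> :: "'a \<Rightarrow> complex"
    using that r by (rule polyfun_subst)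
  have "constructible (\<lambda>\<phi>. P (?r \<xi> \<phi>))"
    using assms(1) r by (rule constructible_subst)
  from constructible_generic[OF this] obtain F \<phi>1 where F: "polyfun F" "F \<phi>1 \<noteq> 0" and
    gen: "(\<forall>\<phi>. F \<phi> \<noteq> 0 \<longrightarrow> P (?r \<xi> \<phi>)) \<or> (\<forall>\<phi>. F \<phi> \<noteq> 0 \<longrightarrow> \<not> P (?r \<xi> \<phi>))" by blast
  \<comment> \<open>F may depend on coordinates outside B. Freezing these at \<open>\<phi>1\<close>,
    where F is nonzero, gives a polynomial in the coordinates of B that can be tested on the
    subspace through \<xi>.\<close>
  define G where "G = (\<lambda>\<phi>. F (?r \<phi>1 \<phi>))"
  have G: "polyfun G" unfolding G_def by (rule sub[OF F(1)])
  have rr: "?r \<phi>1 (?r \<xi> \<phi>) = ?r \<phi>1 \<phi>" "?r \<xi> (?r \<phi>1 \<phi>) = ?r \<xi> \<phi>" for \<phi> by auto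
  have "G (\<lambda>a. \<xi> a + 1 * (?r \<xi> \<phi>1 a - \<xi> a)) \<noteq> 0"
  proof -
    have "?r \<phi>1 (\<lambda>a. \<xi> a + 1 * (?r \<xi> \<phi>1 a - \<xi> a)) = \<phi>1" by auto
    then show ?thesis using F(2) unfolding G_def by simp
  qed
  from polyfun_line_finite[OF G this]
  have fin: "finite {t. G (\<lambda>a. \<xi> a + t * (?r \<xi> \<phi>1 a - \<xi> a)) = 0}" .
  \<comment> \<open>Exceeds the length of the direction from \<xi>, so that the infinitely many
    parameters \<delta> / (C (1 + n)) stay in the box; only finitely many of them are zeros of
    G.\<close>
  define C where "C = 1 + (\<Sum>a\<in>B. norm (?r \<xi> \<phi>1 a - \<xi> a))"
  have "C > 0" unfolding C_def by (intro add_pos_nonneg sum_nonneg) auto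
  have "infinite ((\<lambda>n. complex_of_real (\<delta> / (C * (1 + real n)))) ` UNIV)"
  proof -
    have "inj (\<lambda>n. complex_of_real (\<delta> / (C * (1 + real n))))"
      using \<open>C > 0\<close> assms(3) by (intro injI) (simp add: divide_simps del: of_real_divide)
    then show ?thesis by (rule range_inj_infinite)
  qed
  moreover define g where "g = (\<lambda>t. G (\<lambda>a. \<xi> a + t * (?r \<xi> \<phi>1 a - \<xi> a)))"
  moreover have "finite {t. g t = 0}" using fin unfolding g_def .
  ultimately have "\<not> range (\<lambda>n. complex_of_real (\<delta> / (C * (1 + real n)))) \<subseteq> {t. g t = 0}"
    using finite_subset by blast
  then obtain n where "g (complex_of_real (\<delta> / (C * (1 + real n)))) \<noteq> 0" by blast
  then have n: "G (\<lambda>a. \<xi> a + complex_of_real (\<delta> / (C * (1 + real n))) * (?r \<xi> \<phi>1 a - \<xi> a)) \<noteq> 0"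
    unfolding g_def .
  define t where "t = complex_of_real (\<delta> / (C * (1 + real n)))"
  define \<phi>2 where "\<phi>2 = (\<lambda>a. \<xi> a + t * (?r \<xi> \<phi>1 a - \<xi> a))"
  have "G \<phi>2 \<noteq> 0" using n unfolding \<phi>2_def t_def .
  have out: "\<phi>2 a = \<xi> a" if "a \<notin> B" for a using that by (simp add: \<phi>2_def)
  have "P \<phi>2"
  proof (rule box[OF _ out])
    fix a assume a: "a \<in> B"
    have "norm (?r \<xi> \<phi>1 a - \<xi> a) < C"
      unfolding C_def using member_le_sum[OF a, of "\<lambda>a. norm (?r \<xi> \<phi>1 a - \<xi> a)"] \<open>finite B\<close> by simp
    moreover have "norm t \<le> \<delta> / C"
      unfolding t_def norm_of_real using \<open>C > 0\<close> assms(3) by (auto simp: divide_simps)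
    moreover have "norm t * norm (?r \<xi> \<phi>1 a - \<xi> a) < (\<delta> / C) * C"
    proof (rule mult_le_less_imp_less)
      show "norm t > 0" unfolding t_def norm_of_real using \<open>C > 0\<close> assms(3) by (simp add: add_pos_nonneg)
    qed (use calculation in auto)
    ultimately show "norm (\<phi>2 a - \<xi> a) < \<delta>"
      using \<open>C > 0\<close> by (simp add: \<phi>2_def norm_mult)
  qed
  have "?r \<xi> (?r \<phi>1 \<phi>2) = \<phi>2" using out by auto
  with gen \<open>G \<phi>2 \<noteq> 0\<close> \<open>P \<phi>2\<close> have pos: "\<forall>\<phi>. F \<phi> \<noteq> 0 \<longrightarrow> P (?r \<xi> \<phi>)" unfolding G_def by metis
  have "P \<phi>" if "\<forall>a. a \<notin> B \<longrightarrow> \<phi> a = \<xi> a" "G \<phi> \<noteq> 0" for \<phi>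
  proof -
    have "?r \<xi> (?r \<phi>1 \<phi>) = \<phi>" using that(1) by auto
    then show ?thesis using pos that(2) unfolding G_def by metis
  qed
  then show ?thesis using G \<open>G \<phi>2 \<noteq> 0\<close> out
    by (intro exI[of _ G] conjI exI[of _ \<phi>2]) auto
qed

text \<open>The criterion through which general properties are obtained. Invariance under scaling
  undoes the rescaling that comes with passing to a homogeneous component; the coordinate a0 makes
  the base point a nonzero form, so that the open set found is nonempty.\<close>

lemma general_formI:
  fixes P :: "(('n::finite \<Rightarrow>\<^sub>0 nat) \<Rightarrow> complex) \<Rightarrow> bool"
  assumes "constructible P"
    and scale: "\<And>c \<phi>. c \<noteq> 0 \<Longrightarrow> P (\<lambda>a. c * \<phi> a) \<Longrightarrow> P \<phi>"
    and "\<delta> > 0" "\<xi> a0 \<noteq> 0" "\<And>a. a \<notin> Mon d \<Longrightarrow> \<xi> a = 0"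
    and box: "\<And>\<phi>. (\<And>a. a \<in> Mon d \<Longrightarrow> norm (\<phi> a - \<xi> a) < \<delta>) \<Longrightarrow> (\<And>a. a \<notin> Mon d \<Longrightarrow> \<phi> a = 0) \<Longrightarrow> P \<phi>"
  shows "general_form d (\<lambda>f. P (Poly_Mapping.lookup f))"
proof -
  have "\<exists>F. polyfun F \<and> (\<exists>\<phi>. (\<forall>a. a \<notin> Mon d \<longrightarrow> \<phi> a = \<xi> a) \<and> F \<phi> \<noteq> 0) \<and>
     (\<forall>\<phi>. (\<forall>a. a \<notin> Mon d \<longrightarrow> \<phi> a = \<xi> a) \<longrightarrow> F \<phi> \<noteq> 0 \<longrightarrow> P \<phi>)"
  proof (rule constructible_box_generic[OF assms(1) finite_Mon \<open>\<delta> > 0\<close>])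
    fix \<phi> assume 1: "\<And>a. a \<in> Mon d \<Longrightarrow> norm (\<phi> a - \<xi> a) < \<delta>" and 2: "\<And>a. a \<notin> Mon d \<Longrightarrow> \<phi> a = \<xi> a"
    show "P \<phi>" by (rule box[OF 1]) (simp_all add: 2 assms(5))
  qed
  then obtain F \<phi>1 where F: "polyfun F" "\<forall>a. a \<notin> Mon d \<longrightarrow> \<phi>1 a = \<xi> a" "F \<phi>1 \<noteq> 0"
     "\<forall>\<phi>. (\<forall>a. a \<notin> Mon d \<longrightarrow> \<phi> a = \<xi> a) \<longrightarrow> F \<phi> \<noteq> 0 \<longrightarrow> P \<phi>"
    by (elim exE conjE)
  \<comment> \<open>A point on the line from \<open>\<phi>1\<close> to \<xi> where F and the
    coordinate a0 are both nonzero.\<close>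
  obtain t where t: "F (\<lambda>v. \<phi>1 v + t * (\<xi> v - \<phi>1 v)) \<noteq> 0 \<and> \<phi>1 a0 + t * (\<xi> a0 - \<phi>1 a0) \<noteq> 0"
    using polyfun_mult_nonzero[of F "\<lambda>\<phi>. \<phi> a0" \<phi>1 \<xi>, OF F(1) polyfun_var F(3) assms(4)] by (elim exE)
  define \<psi> where "\<psi> = (\<lambda>v. \<phi>1 v + t * (\<xi> v - \<phi>1 v))"
  have \<psi>: "F \<psi> \<noteq> 0" "\<psi> a0 \<noteq> 0" using t by (auto simp: \<psi>_def)
  have \<psi>0: "\<psi> a = 0" if "a \<notin> Mon d" for a using that F(2) assms(5) by (simp add: \<psi>_def)
  obtain p where p: "\<And>\<phi>. F \<phi> = peval p \<phi>" using polyfun_imp_peval[OF F(1)] by blast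
  obtain e where e: "peval (hcomp e p) \<psi> \<noteq> 0" using hcomp_exists[of p \<psi>] \<psi> p by auto
  obtain f where f: "f \<in> Sym d" "Poly_Mapping.lookup f = \<psi>" using Sym_from_coeffs[of d \<psi>] \<psi>0 by blast
  have "f \<noteq> 0" using f \<psi> by auto
  have "form_pt f \<in> zbase d (hcomp e p)"
    using zbase_form_pt[OF homogeneous_hcomp f(1) \<open>f \<noteq> 0\<close>] e f(2) by simp
  moreover have "P (Poly_Mapping.lookup g)"
    if "g \<in> Sym d" "g \<noteq> 0" "form_pt g \<in> zbase d (hcomp e p)" for g
  proof -
    have "peval (hcomp e p) (Poly_Mapping.lookup g) \<noteq> 0"
      using zbase_form_pt[OF homogeneous_hcomp that(1,2)] that(3) by simp
    from hcomp_nonzero_scale[OF this] obtain c where c: "c \<noteq> 0" "peval p (\<lambda>v. c * Poly_Mapping.lookup g v) \<noteq> 0" by blast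
    then have "P (\<lambda>v. c * Poly_Mapping.lookup g v)"
      using F(4) p that(1) assms(5) by (simp add: Sym_iff)
    then show ?thesis using scale c(1) by blast
  qed
  ultimately show ?thesis
    unfolding general_form_def
    by (intro exI[of _ "zbase d (hcomp e p)"] conjI openin_zbase[OF homogeneous_hcomp]) auto
qed

section \<open>Gradients and eigenvectors in terms of coefficients\<close>

definition gradc :: "nat \<Rightarrow> (('n::finite \<Rightarrow>\<^sub>0 nat) \<Rightarrow> complex) \<Rightarrow> ('n \<Rightarrow> complex) \<Rightarrow> 'n \<Rightarrow> complex" where
  "gradc d \<phi> x i = (\<Sum>a\<in>Mon d. \<phi> a * (of_nat (Poly_Mapping.lookup a i) * mev (a - Poly_Mapping.single i 1) x))"

definition eigc :: "nat \<Rightarrow> (('n::finite \<Rightarrow>\<^sub>0 nat) \<Rightarrow> complex) \<Rightarrow> ('n \<Rightarrow> complex) \<Rightarrow> bool" where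
  "eigc d \<phi> x \<longleftrightarrow> (\<forall>i j. gradc d \<phi> x i * x j = gradc d \<phi> x j * x i)"

lemma peval_pdiff: "peval (pdiff i f) x =
  (\<Sum>a\<in>Poly_Mapping.keys f. Poly_Mapping.lookup f a * (of_nat (Poly_Mapping.lookup a i) * mev (a - Poly_Mapping.single i 1) x))"
  by (simp add: pdiff_def peval_sum peval_single mult_ac)

lemma peval_pdiff_Sym:
  assumes "f \<in> Sym d"
  shows "peval (pdiff i f) x = gradc d (Poly_Mapping.lookup f) x i"
  unfolding peval_pdiff gradc_def using assms
  by (intro sum.mono_neutral_left) (auto simp: Sym_iff in_keys_iff)

lemma grad_Sym: "f \<in> Sym d \<Longrightarrow> grad f x $ i = gradc d (Poly_Mapping.lookup f) (($) x) i"
  by (simp add: grad_def peval_pdiff_Sym)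

lemma Eig_Sym: "f \<in> Sym d \<Longrightarrow> Eig f = {pt x | x. x \<noteq> 0 \<and> eigc d (Poly_Mapping.lookup f) (($) x)}"
  by (simp add: Eig_minors grad_Sym eigc_def)

lemma gradc_add: "gradc d (\<lambda>a. \<phi> a + \<psi> a) x i = gradc d \<phi> x i + gradc d \<psi> x i"
  by (simp add: gradc_def ring_distribs sum.distrib)

lemma gradc_diff: "gradc d (\<lambda>a. \<phi> a - \<psi> a) x i = gradc d \<phi> x i - gradc d \<psi> x i"
  by (simp add: gradc_def ring_distribs sum_subtractf)

lemma gradc_cmult: "gradc d (\<lambda>a. c * \<phi> a) x i = c * gradc d \<phi> x i"
  by (simp add: gradc_def sum_distrib_left mult_ac)

lemma pdeg_diff_single:
  assumes "Poly_Mapping.lookup a i \<noteq> 0"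
  shows "pdeg (a - Poly_Mapping.single i 1) = pdeg a - 1"
proof -
  have "a - Poly_Mapping.single i 1 + Poly_Mapping.single i 1 = a"
    using assms by (intro poly_mapping_eqI)
      (auto simp: Poly_Mapping.lookup_add Poly_Mapping.lookup_minus lookup_single when_def)
  then have "pdeg a = pdeg (a - Poly_Mapping.single i 1) + pdeg (Poly_Mapping.single i (1 :: nat))"
    by (metis pdeg_add)
  then show ?thesis by (simp add: pdeg_def)
qed

text \<open>The subtraction in the exponent is truncated and fails to lower the degree where x_i
  does not occur; there the factor \<open>lookup a i\<close> is 0.\<close>

lemma gradc_scale: "gradc d \<phi> (\<lambda>j. c * x j) i = c ^ (d - 1) * gradc d \<phi> x i"
proof -
  have "of_nat (Poly_Mapping.lookup a i) * mev (a - Poly_Mapping.single i 1) (\<lambda>j. c * x j) =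
     c ^ (d - 1) * (of_nat (Poly_Mapping.lookup a i) * mev (a - Poly_Mapping.single i 1) x)" if "a \<in> Mon d" for a
    using that pdeg_diff_single[of a i]
    by (cases "Poly_Mapping.lookup a i = 0") (auto simp: mev_scale Mon_iff)
  then show ?thesis
    unfolding gradc_def sum_distrib_left by (intro sum.cong refl) (simp add: mult_ac)
qed

lemma eigc_scale:
  assumes "eigc d \<phi> x" shows "eigc d \<phi> (\<lambda>j. c * x j)"
  unfolding eigc_def gradc_scale
proof (intro allI)
  fix i j
  have "gradc d \<phi> x i * x j = gradc d \<phi> x j * x i" using assms by (auto simp: eigc_def)
  then show "c ^ (d - 1) * gradc d \<phi> x i * (c * x j) = c ^ (d - 1) * gradc d \<phi> x j * (c * x i)"
    by (simp add: mult_ac)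
qed

lemma eigc_cmult_iff: "c \<noteq> 0 \<Longrightarrow> eigc d (\<lambda>a. c * \<phi> a) x \<longleftrightarrow> eigc d \<phi> x"
  by (simp add: eigc_def gradc_cmult mult.assoc)

lemma nth_scaleC: "($) (c *s x) = (\<lambda>j. c * x $ j)"
  by auto

lemma pt_self: "x \<in> pt x"
  unfolding pt_def by (rule CollectI, rule exI[of _ 1]) simp

lemma pt_eq_iff:
  assumes "x \<noteq> 0" "y \<noteq> 0"
  shows "pt x = pt y \<longleftrightarrow> (\<exists>c. c \<noteq> 0 \<and> y = c *s x)"
proof
  assume "pt x = pt y"
  then have "y \<in> pt x" using pt_self by blast
  then obtain c where "y = c *s x" by (auto simp: pt_def)
  with assms(2) show "\<exists>c. c \<noteq> 0 \<and> y = c *s x" by (intro exI[of _ c]) auto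
next
  assume "\<exists>c. c \<noteq> 0 \<and> y = c *s x"
  then obtain c where c: "c \<noteq> 0" "y = c *s x" by blast
  have "e *s x = (e / c) *s y" for e using c by (simp add: vector_smult_assoc)
  moreover have "e *s y = (e * c) *s x" for e using c by (simp add: vector_smult_assoc)
  ultimately show "pt x = pt y" unfolding pt_def by blast
qed

lemma pt_minus_0_iff: "x \<noteq> 0 \<Longrightarrow> z \<in> pt x - {0} \<longleftrightarrow> (\<exists>c. c \<noteq> 0 \<and> z = c *s x)"
  by (auto simp: pt_def)

lemma eigc_pt_cong:
  assumes "z \<in> pt x" "eigc d \<phi> (($) x)" shows "eigc d \<phi> (($) z)"
  using assms by (auto simp: pt_def nth_scaleC intro: eigc_scale)

lemma mev_upd_deriv:
  "((\<lambda>t. mev a (x(i := t))) has_field_derivative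
     of_nat (Poly_Mapping.lookup a i) * mev (a - Poly_Mapping.single i 1) (x(i := t))) (at t)"
  for a :: "'n::finite \<Rightarrow>\<^sub>0 nat"
proof -
  let ?C = "\<Prod>j\<in>UNIV - {i}. x j ^ Poly_Mapping.lookup a j"
  have 1: "mev a (x(i := t)) = t ^ Poly_Mapping.lookup a i * ?C" for t
    unfolding mev_UNIV by (subst prod.remove[of _ i]) (auto intro!: prod.cong)
  have 2: "mev (a - Poly_Mapping.single i 1) (x(i := t)) = t ^ (Poly_Mapping.lookup a i - 1) * ?C" for t
    unfolding mev_UNIV by (subst prod.remove[of _ i])
      (auto intro!: prod.cong simp: Poly_Mapping.lookup_minus lookup_single when_def)
  show ?thesis unfolding 1 2
    by (auto intro!: derivative_eq_intros)
qed

lemma peval_upd_deriv: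
  fixes f :: "'n::finite cpoly"
  shows "((\<lambda>t. peval f (x(i := t))) has_field_derivative peval (pdiff i f) (x(i := t))) (at t)"
  unfolding peval_pdiff
  by (subst peval_superset[of "Poly_Mapping.keys f"]) (auto intro!: DERIV_sum DERIV_cmult mev_upd_deriv[simplified])

lemma homogeneous_sum: "(\<And>i. i \<in> I \<Longrightarrow> homogeneous e (p i)) \<Longrightarrow> homogeneous e (\<Sum>i\<in>I. p i)"
  unfolding homogeneous_altdef using Poly_Mapping.keys_sum[of p I] by blast

lemma homogeneous_power: "homogeneous e p \<Longrightarrow> homogeneous (e * k) (p ^ k)"
proof (induction k)
  case 0
  then show ?case by (auto simp: homogeneous_altdef pdeg_def)
next
  case (Suc k)
  then show ?case using homogeneous_mult[of e p "e * k" "p ^ k"] by simp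
qed

lemma peval_q_form: "peval q_form x = (\<Sum>j\<in>UNIV. x j ^ 2)"
  by (simp add: q_form_def peval_sum peval_single mev_def)

lemma q_power_Sym:
  assumes "even d" shows "(q_form ^ (d div 2) :: 'n::finite cpoly) \<in> Sym d"
proof -
  have "homogeneous 2 (q_form :: 'n cpoly)"
    unfolding q_form_def by (rule homogeneous_sum) (auto simp: homogeneous_altdef pdeg_def)
  from homogeneous_power[OF this, of "d div 2"] assms show ?thesis by (simp add: Sym_def)
qed

text \<open>The formal partial derivative is the analytic one, so the chain rule in the single
  variable x_i replaces an expansion of the power. That this gradient is a multiple of x is the
  source of the even case: adding multiples of q^(d/2) does not move eigentensors.\<close>

lemma gradc_q_power:
  fixes x :: "'n::finite \<Rightarrow> complex"
  assumes "even d" "d > 0"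
  shows "gradc d (Poly_Mapping.lookup (q_form ^ (d div 2))) x i =
     of_nat d * (\<Sum>j\<in>UNIV. x j ^ 2) ^ (d div 2 - 1) * x i"
proof -
  let ?f = "q_form ^ (d div 2) :: 'n cpoly"
  let ?C = "\<Sum>j\<in>UNIV - {i}. x j ^ 2"
  have eq: "peval ?f (x(i := t)) = (t ^ 2 + ?C) ^ (d div 2)" for t
  proof -
    have "(\<Sum>j\<in>UNIV. (x(i := t)) j ^ 2) = t ^ 2 + ?C"
      by (subst sum.remove[of _ i]) (auto intro!: sum.cong)
    then show ?thesis by (simp add: peval_power peval_q_form)
  qed
  have "((\<lambda>t. peval ?f (x(i := t))) has_field_derivative peval (pdiff i ?f) (x(i := x i))) (at (x i))"
    by (rule peval_upd_deriv)
  moreover have "((\<lambda>t. peval ?f (x(i := t))) has_field_derivative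
      of_nat (d div 2) * (x i ^ 2 + ?C) ^ (d div 2 - 1) * (2 * x i)) (at (x i))"
    unfolding eq by (auto intro!: derivative_eq_intros)
  ultimately have "peval (pdiff i ?f) x = of_nat (d div 2) * (x i ^ 2 + ?C) ^ (d div 2 - 1) * (2 * x i)"
    using DERIV_unique by fastforce
  moreover have "x i ^ 2 + ?C = (\<Sum>j\<in>UNIV. x j ^ 2)"
    by (subst (2) sum.remove[of _ i]) auto
  moreover have "of_nat (d div 2) * 2 = (of_nat d :: complex)"
    using assms(1) by (metis dvd_div_mult_self of_nat_mult of_nat_numeral)
  ultimately show ?thesis
    using peval_pdiff_Sym[OF q_power_Sym[OF assms(1)], of i x] by (simp add: mult_ac)
qed

lemma eigc_q_power: "even d \<Longrightarrow> d > 0 \<Longrightarrow> eigc d (Poly_Mapping.lookup (q_form ^ (d div 2))) x"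
  by (simp add: eigc_def gradc_q_power)

lemma eigc_add_q_power:
  assumes "even d" "d > 0"
  shows "eigc d (\<lambda>a. \<phi> a + c * Poly_Mapping.lookup (q_form ^ (d div 2)) a) x \<longleftrightarrow> eigc d \<phi> x"
  using assms by (simp add: eigc_def gradc_add gradc_cmult gradc_q_power ring_distribs)

section \<open>The Fermat form and the grid of its eigenvectors\<close>

definition fermat :: "nat \<Rightarrow> ('n::finite \<Rightarrow>\<^sub>0 nat) \<Rightarrow> complex" where
  "fermat d a = (if \<exists>k. a = Poly_Mapping.single k d then 1 else 0)"

lemma single_in_Mon: "Poly_Mapping.single k d \<in> Mon d"
  by (simp add: Mon_iff pdeg_def)

lemma fermat_outside: "a \<notin> Mon d \<Longrightarrow> fermat d a = 0"
  using single_in_Mon by (auto simp: fermat_def)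

lemma gradc_fermat:
  assumes "d > 0"
  shows "gradc d (fermat d) x i = of_nat d * x i ^ (d - 1)"
proof -
  have inj: "inj (\<lambda>k :: 'a. Poly_Mapping.single k d)"
  proof (rule injI)
    fix k l :: 'a assume "Poly_Mapping.single k d = Poly_Mapping.single l d"
    then have "Poly_Mapping.lookup (Poly_Mapping.single k d) k = Poly_Mapping.lookup (Poly_Mapping.single l d) k" by simp
    then show "k = l" using assms by (auto simp: lookup_single when_def split: if_splits)
  qed
  have "gradc d (fermat d) x i = (\<Sum>a\<in>range (\<lambda>k. Poly_Mapping.single k d).
      of_nat (Poly_Mapping.lookup a i) * mev (a - Poly_Mapping.single i 1) x)"
    unfolding gradc_def
    by (rule sum.mono_neutral_cong_right) (auto simp: fermat_def single_in_Mon)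
  also have "\<dots> = (\<Sum>k\<in>UNIV. of_nat (Poly_Mapping.lookup (Poly_Mapping.single k d) i) *
      mev (Poly_Mapping.single k d - Poly_Mapping.single i 1) x)"
    by (simp add: sum.reindex[OF inj])
  also have "\<dots> = (\<Sum>k\<in>UNIV. if k = i then of_nat d * mev (Poly_Mapping.single i d - Poly_Mapping.single i 1) x else 0)"
    by (intro sum.cong) (auto simp: lookup_single)
  also have "\<dots> = of_nat d * x i ^ (d - 1)"
    by (simp add: single_diff[symmetric] mev_def)
  finally show ?thesis .
qed

text \<open>The solutions of z^(d-1) = z. They are the coordinates of the solutions of grad f (x) =
  d x for the Fermat form, whose gradient has the entries d x_i^(d-1).\<close>

definition roots :: "nat \<Rightarrow> complex set" where
  "roots d = insert 0 {z. z ^ (d - 2) = 1}"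

definition grid :: "nat \<Rightarrow> (complex ^ 'n) set" where
  "grid d = {r. \<forall>i. r $ i \<in> roots d}"

lemma finite_roots: "d \<ge> 3 \<Longrightarrow> finite (roots d)"
  using finite_roots_unity[of "d - 2"] by (auto simp: roots_def)

lemma roots_norm: "d \<ge> 3 \<Longrightarrow> z \<in> roots d \<Longrightarrow> z = 0 \<or> norm z = 1"
  using power_eq_1_iff[of z "d - 2"] by (auto simp: roots_def)

lemma roots_iff:
  assumes "d \<ge> 3" shows "z \<in> roots d \<longleftrightarrow> z ^ (d - 1) = z"
proof -
  have "d - 1 = Suc (d - 2)" using assms by simp
  then have "z ^ (d - 1) = z * z ^ (d - 2)" by simp
  then show ?thesis by (auto simp: roots_def)
qed

lemma card_roots: "d \<ge> 3 \<Longrightarrow> card (roots d) = d - 1"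
proof -
  assume d: "d \<ge> 3"
  have "0 \<notin> {z :: complex. z ^ (d - 2) = 1}" using d by (auto simp: power_0_left)
  moreover have "card {z :: complex. z ^ (d - 2) = 1} = d - 2" using d by (intro card_roots_unity_eq) auto
  moreover have "finite {z :: complex. z ^ (d - 2) = 1}" using d by (intro finite_roots_unity) auto
  ultimately have "card (roots d) = Suc (d - 2)" unfolding roots_def using card_insert_disjoint by metis
  then show ?thesis using d by simp
qed

lemma finite_grid:
  assumes "d \<ge> 3" shows "finite (grid d :: (complex ^ 'n::finite) set)"
proof -
  have "finite (PiE (UNIV :: 'n set) (\<lambda>_. roots d))"
    using assms by (intro finite_PiE finite_roots) auto
  then have "finite (vec_lambda ` PiE (UNIV :: 'n set) (\<lambda>_. roots d))" by (rule finite_imageI)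
  moreover have "grid d \<subseteq> vec_lambda ` PiE (UNIV :: 'n set) (\<lambda>_. roots d)"
  proof
    fix r :: "complex ^ 'n" assume "r \<in> grid d"
    then show "r \<in> vec_lambda ` PiE UNIV (\<lambda>_. roots d)"
      by (intro image_eqI[of _ _ "($) r"]) (auto simp: grid_def PiE_def)
  qed
  ultimately show ?thesis by (rule finite_subset[rotated])
qed

section \<open>Perturbing the Fermat form\<close>

text \<open>Bounded and Lipschitz on a ball with a common constant, a class closed under products
  and hence containing the monomials.\<close>

definition blip :: "real \<Rightarrow> (complex ^ 'n::finite \<Rightarrow> complex) \<Rightarrow> bool" where
  "blip K g \<longleftrightarrow> (\<exists>B\<ge>0. \<forall>x\<in>cball 0 K. \<forall>y\<in>cball 0 K. norm (g x) \<le> B \<and> norm (g x - g y) \<le> B * dist x y)"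

lemma blip_const: "blip K (\<lambda>x. c)"
  unfolding blip_def by (intro exI[of _ "norm c"]) auto

lemma blip_nth:
  fixes i :: "'n::finite"
  assumes "K \<ge> 0" shows "blip K (\<lambda>x. x $ i)"
  unfolding blip_def
proof (intro exI[of _ "max K 1"] conjI ballI)
  fix x y :: "complex ^ 'n" assume "x \<in> cball 0 K"
  then show "norm (x $ i) \<le> max K 1"
    using Finite_Cartesian_Product.norm_nth_le[of x i] by simp
  have "norm (x $ i - y $ i) \<le> 1 * dist x y"
    using Finite_Cartesian_Product.norm_nth_le[of "x - y" i] by (simp add: dist_norm)
  also have "\<dots> \<le> max K 1 * dist x y" by (intro mult_right_mono) auto
  finally show "norm (x $ i - y $ i) \<le> max K 1 * dist x y" .
qed auto

lemma blip_mult: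
  assumes "blip K f" "blip K g" shows "blip K (\<lambda>x. f x * g x)"
proof -
  from assms obtain B D where
    B: "B \<ge> 0" "\<And>x y. x \<in> cball 0 K \<Longrightarrow> y \<in> cball 0 K \<Longrightarrow> norm (f x) \<le> B \<and> norm (f x - f y) \<le> B * dist x y" and
    D: "D \<ge> 0" "\<And>x y. x \<in> cball 0 K \<Longrightarrow> y \<in> cball 0 K \<Longrightarrow> norm (g x) \<le> D \<and> norm (g x - g y) \<le> D * dist x y"
    unfolding blip_def by blast
  show ?thesis unfolding blip_def
  proof (intro exI[of _ "2 * B * D"] conjI ballI)
    show "0 \<le> 2 * B * D" using B D by simp
    fix x y :: "complex ^ 'a" assume xy: "x \<in> cball 0 K" "y \<in> cball 0 K"
    have "norm (f x * g x) \<le> B * D"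
      using B(2)[OF xy] D(2)[OF xy] B(1) D(1) by (auto simp: norm_mult intro: mult_mono)
    also have "\<dots> \<le> 2 * B * D" using B D by simp
    finally show "norm (f x * g x) \<le> 2 * B * D" .
    have "f x * g x - f y * g y = f x * (g x - g y) + (f x - f y) * g y" by (simp add: algebra_simps)
    then have "norm (f x * g x - f y * g y) \<le> norm (f x) * norm (g x - g y) + norm (f x - f y) * norm (g y)"
      by (metis norm_mult norm_triangle_ineq)
    also have "\<dots> \<le> B * (D * dist x y) + (B * dist x y) * D"
      using B(2)[OF xy] D(2)[OF xy] D(2)[OF xy(2,1)] B(1) D(1) by (intro add_mono mult_mono) auto
    finally show "norm (f x * g x - f y * g y) \<le> 2 * B * D * dist x y" by (simp add: algebra_simps)
  qed
qed

lemma blip_power: "blip K f \<Longrightarrow> blip K (\<lambda>x. f x ^ k)"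
  by (induction k) (auto intro: blip_const blip_mult)

lemma blip_prod: "(\<And>i. i \<in> I \<Longrightarrow> blip K (f i)) \<Longrightarrow> blip K (\<lambda>x. \<Prod>i\<in>I. f i x)"
  by (induction I rule: infinite_finite_induct) (auto intro: blip_const blip_mult)

text \<open>By linearity in the coefficients one constant per monomial suffices, so C is uniform in
  h, in its size \<delta> and in the points of the ball.\<close>

lemma gradc_bound:
  fixes K :: real
  assumes "K \<ge> 0"
  obtains C where "C > 0" "\<And>h \<delta> x y i. (\<And>a. a \<in> Mon d \<Longrightarrow> norm (h a) \<le> \<delta>) \<Longrightarrow>
    x \<in> cball (0 :: complex ^ 'n::finite) K \<Longrightarrow> y \<in> cball 0 K \<Longrightarrow>
    norm (gradc d h (($) x) i) \<le> \<delta> * C \<and>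
    norm (gradc d h (($) x) i - gradc d h (($) y) i) \<le> \<delta> * C * dist x y"
proof -
  let ?g = "\<lambda>a i (x :: complex ^ 'n). of_nat (Poly_Mapping.lookup a i) * mev (a - Poly_Mapping.single i 1) (($) x)"
  have "blip K (?g a i)" for a i
    unfolding mev_def using assms by (intro blip_mult blip_const blip_prod blip_power blip_nth)
  then have "\<exists>B\<ge>0. \<forall>x\<in>cball 0 K. \<forall>y\<in>cball 0 K. norm (?g a i x) \<le> B \<and> norm (?g a i x - ?g a i y) \<le> B * dist x y" for a i
    unfolding blip_def .
  then obtain B where B: "\<And>a i. B a i \<ge> 0"
    "\<And>a i x y. x \<in> cball 0 K \<Longrightarrow> y \<in> cball 0 K \<Longrightarrow> norm (?g a i x) \<le> B a i \<and> norm (?g a i x - ?g a i y) \<le> B a i * dist x y"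
    by metis
  define C where "C = 1 + (\<Sum>i\<in>UNIV. \<Sum>a\<in>Mon d. B a i)"
  have Ci: "(\<Sum>a\<in>Mon d. B a i) \<le> C" for i
  proof -
    have "(\<Sum>a\<in>Mon d. B a i) \<le> (\<Sum>i\<in>UNIV. \<Sum>a\<in>Mon d. B a i)"
      by (rule member_le_sum) (auto intro: sum_nonneg B(1))
    then show ?thesis by (simp add: C_def)
  qed
  show thesis
  proof (rule that[of C])
    show "C > 0" unfolding C_def by (intro add_pos_nonneg sum_nonneg B(1)) auto
    fix h :: "('n \<Rightarrow>\<^sub>0 nat) \<Rightarrow> complex" and \<delta> i and x y :: "complex ^ 'n"
    assume h: "\<And>a. a \<in> Mon d \<Longrightarrow> norm (h a) \<le> \<delta>" and xy: "x \<in> cball 0 K" "y \<in> cball 0 K"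
    have "\<delta> \<ge> 0" using h[OF single_in_Mon] norm_ge_zero order_trans by blast
    have "norm (gradc d h (($) x) i) \<le> (\<Sum>a\<in>Mon d. \<delta> * B a i)"
      unfolding gradc_def
    proof (rule sum_norm_le)
      fix a :: "'n \<Rightarrow>\<^sub>0 nat" assume "a \<in> Mon d"
      then show "norm (h a * ?g a i x) \<le> \<delta> * B a i"
        using h B(2)[OF xy] \<open>\<delta> \<ge> 0\<close> unfolding norm_mult[of "h a"] by (intro mult_mono) auto
    qed
    also have "\<dots> \<le> \<delta> * C" using Ci[of i] \<open>\<delta> \<ge> 0\<close> by (simp add: sum_distrib_left[symmetric] mult_left_mono)
    finally have 1: "norm (gradc d h (($) x) i) \<le> \<delta> * C" .
    have "norm (gradc d h (($) x) i - gradc d h (($) y) i) \<le> (\<Sum>a\<in>Mon d. \<delta> * (B a i * dist x y))"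
      unfolding gradc_def sum_subtractf[symmetric]
    proof (rule sum_norm_le)
      fix a :: "'n \<Rightarrow>\<^sub>0 nat" assume a: "a \<in> Mon d"
      have "h a * ?g a i x - h a * ?g a i y = h a * (?g a i x - ?g a i y)" by (simp only: right_diff_distrib)
      moreover have "norm (h a) * norm (?g a i x - ?g a i y) \<le> \<delta> * (B a i * dist x y)"
        using h[OF a] B(2)[OF xy, of a i] \<open>\<delta> \<ge> 0\<close> by (intro mult_mono) auto
      ultimately show "norm (h a * ?g a i x - h a * ?g a i y) \<le> \<delta> * (B a i * dist x y)"
        by (metis norm_mult)
    qed
    also have "\<dots> = \<delta> * dist x y * (\<Sum>a\<in>Mon d. B a i)" by (simp add: sum_distrib_left mult_ac)
    also have "\<dots> \<le> \<delta> * dist x y * C" using Ci[of i] \<open>\<delta> \<ge> 0\<close> by (intro mult_left_mono) auto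
    finally show "norm (gradc d h (($) x) i) \<le> \<delta> * C \<and>
        norm (gradc d h (($) x) i - gradc d h (($) y) i) \<le> \<delta> * C * dist x y"
      using 1 by (simp add: mult_ac)
  qed
qed

text \<open>The derivative of \<open>z \<mapsto> d z\<^sup>d\<^sup>-\<^sup>1 - d z\<close> at a root \<open>r\<close>.\<close>

definition root_deriv :: "nat \<Rightarrow> complex \<Rightarrow> complex" where
  "root_deriv d r = of_nat d * (of_nat (d - 1) * r ^ (d - 2) - 1)"

lemma norm_root_deriv:
  assumes "d \<ge> 3" "r \<in> roots d" shows "norm (root_deriv d r) \<ge> 1"
proof (cases "r = 0")
  case True
  then show ?thesis using assms by (simp add: root_deriv_def power_0_left)
next
  case False
  then have "r ^ (d - 2) = 1" using assms by (simp add: roots_def)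
  then have "root_deriv d r = of_nat (d * (d - 2))"
    using assms by (simp add: root_deriv_def of_nat_diff algebra_simps)
  then have "norm (root_deriv d r) = real (d * (d - 2))" by (metis norm_of_nat)
  moreover have "1 \<le> d * (d - 2)" using assms by simp
  ultimately show ?thesis by (metis of_nat_1 of_nat_le_iff)
qed

text \<open>The Newton step has derivative 0 at r, hence derivative at most 1/4 near r by
  continuity. The value 1/4 leaves room for an equal contribution of the perturbation within the
  contraction constant 1/2.\<close>

lemma newton_contraction:
  assumes "d \<ge> 3" "r \<in> roots d"
  shows "\<exists>\<rho>>0. \<forall>z w. norm (z - r) \<le> \<rho> \<longrightarrow> norm (w - r) \<le> \<rho> \<longrightarrow>
    norm ((z - (of_nat d * z ^ (d - 1) - of_nat d * z) / root_deriv d r) -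
      (w - (of_nat d * w ^ (d - 1) - of_nat d * w) / root_deriv d r)) \<le> (1 / 4) * norm (z - w)"
proof -
  define A where "A = root_deriv d r"
  have "A \<noteq> 0" using norm_root_deriv[OF assms] by (auto simp: A_def)
  let ?f = "\<lambda>z. z - (of_nat d * z ^ (d - 1) - of_nat d * z) / A"
  let ?f' = "\<lambda>z. 1 - (of_nat d * (of_nat (d - 1) * z ^ (d - 2)) - of_nat d) / A"
  have d2: "d - Suc (Suc 0) = d - 2" by simp
  have deriv: "(?f has_field_derivative ?f' z) (at z within S)" for z S
    using \<open>A \<noteq> 0\<close> by (auto intro!: derivative_eq_intros simp: d2)
  have "of_nat d * (of_nat (d - 1) * r ^ (d - 2)) - of_nat d = A"
    by (simp only: A_def root_deriv_def right_diff_distrib mult_1_right)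
  then have "?f' r = 0" using \<open>A \<noteq> 0\<close> by (simp only: divide_self) simp
  moreover have "isCont ?f' r" using \<open>A \<noteq> 0\<close> by (intro continuous_intros) auto
  ultimately obtain \<rho> where \<rho>: "\<rho> > 0" "\<And>z. dist z r < \<rho> \<Longrightarrow> dist (?f' z) 0 < 1 / 4"
    unfolding continuous_at_eps_delta by (metis zero_less_divide_1_iff zero_less_numeral)
  show ?thesis
  proof (intro exI[of _ "\<rho> / 2"] conjI allI impI)
    show "\<rho> / 2 > 0" using \<rho> by simp
    fix z w assume "norm (z - r) \<le> \<rho> / 2" "norm (w - r) \<le> \<rho> / 2"
    then have zw: "z \<in> cball r (\<rho> / 2)" "w \<in> cball r (\<rho> / 2)" by (auto simp: dist_norm norm_minus_commute)
    have "norm (?f z - ?f w) \<le> 1 / 4 * norm (z - w)"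
    proof (rule field_differentiable_bound[of "cball r (\<rho> / 2)" ?f ?f'])
      fix u assume "u \<in> cball r (\<rho> / 2)"
      then have "dist u r < \<rho>" using \<rho>(1) by (simp add: dist_commute)
      from \<rho>(2)[OF this] show "norm (?f' u) \<le> 1 / 4" by (simp only: dist_0_norm dist_commute[of _ 0])
      show "(?f has_field_derivative ?f' u) (at u within cball r (\<rho> / 2))" by (rule deriv)
    qed (use zw in auto)
    then show "norm ((z - (of_nat d * z ^ (d - 1) - of_nat d * z) / root_deriv d r) -
      (w - (of_nat d * w ^ (d - 1) - of_nat d * w) / root_deriv d r)) \<le> (1 / 4) * norm (z - w)"
      by (simp only: A_def)
  qed
qed

text \<open>Compactness: on the part of the disc away from the roots, |z^(d-1) - z| has a positive
  minimum.\<close>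

lemma near_root:
  assumes "d \<ge> 3" "\<rho> > 0"
  obtains \<kappa> where "\<kappa> > 0"
    "\<And>z. norm z \<le> 2 \<Longrightarrow> norm (z ^ (d - 1) - z) < \<kappa> \<Longrightarrow> \<exists>r\<in>roots d. norm (z - r) < \<rho>"
proof -
  let ?S = "cball 0 2 - (\<Union>r\<in>roots d. ball r \<rho>)"
  have comp: "compact ?S" by (intro compact_diff open_UN) auto
  have S: "z \<in> ?S \<longleftrightarrow> norm z \<le> 2 \<and> \<not> (\<exists>r\<in>roots d. norm (z - r) < \<rho>)" for z
    by (auto simp: dist_norm norm_minus_commute)
  show thesis
  proof (cases "?S = {}")
    case True
    show thesis
    proof (rule that[of 1])
      fix z :: complex assume "norm z \<le> 2"
      moreover have "z \<notin> ?S" by (simp only: True empty_iff) simp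
      ultimately show "\<exists>r\<in>roots d. norm (z - r) < \<rho>" using S by blast
    qed simp
  next
    case False
    have "continuous_on ?S (\<lambda>z. norm (z ^ (d - 1) - z))" by (intro continuous_intros)
    from continuous_attains_inf[OF comp False this]
    obtain z0 where z0: "z0 \<in> ?S" "\<And>z. z \<in> ?S \<Longrightarrow> norm (z0 ^ (d - 1) - z0) \<le> norm (z ^ (d - 1) - z)"
      by (elim bexE) blast
    have "z0 \<notin> roots d" using z0(1) \<open>\<rho> > 0\<close> by (auto simp: dist_norm)
    then have pos: "norm (z0 ^ (d - 1) - z0) > 0" using roots_iff[OF assms(1)] by auto
    show thesis
    proof (rule that[OF pos])
      fix z :: complex assume z: "norm z \<le> 2" "norm (z ^ (d - 1) - z) < norm (z0 ^ (d - 1) - z0)"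
      then have "z \<notin> ?S" using z0(2) by fastforce
      then show "\<exists>r\<in>roots d. norm (z - r) < \<rho>" using S z(1) by blast
    qed
  qed
qed

lemma finite_separated:
  fixes S :: "'a::metric_space set"
  assumes "finite S"
  obtains e where "e > 0" "\<And>x y. x \<in> S \<Longrightarrow> y \<in> S \<Longrightarrow> dist x y < e \<Longrightarrow> x = y"
proof -
  let ?D = "insert 1 ((\<lambda>(x, y). dist x y) ` {(x, y). x \<in> S \<and> y \<in> S \<and> x \<noteq> y})"
  have "{(x, y). x \<in> S \<and> y \<in> S \<and> x \<noteq> y} \<subseteq> S \<times> S" by auto
  then have "finite ?D" using assms by (meson finite.insertI finite_SigmaI finite_imageI finite_subset)
  have "Min ?D > 0" using \<open>finite ?D\<close> by (subst Min_gr_iff) auto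
  moreover have "x = y" if "x \<in> S" "y \<in> S" "dist x y < Min ?D" for x y
  proof (rule ccontr)
    assume "x \<noteq> y"
    then have "dist x y \<in> ?D" using that by force
    then have "Min ?D \<le> dist x y" using \<open>finite ?D\<close> by (rule Min_le[rotated])
    then show False using that(3) by simp
  qed
  ultimately show thesis using that by blast
qed

lemma norm_le_card_mult:
  fixes x :: "complex ^ 'n::finite"
  assumes "\<And>i. norm (x $ i) \<le> b"
  shows "norm x \<le> real CARD('n) * b"
proof -
  have "norm x \<le> (\<Sum>i\<in>UNIV. norm (x $ i))" by (simp add: norm_vec_def L2_set_le_sum)
  also have "\<dots> \<le> (\<Sum>i\<in>(UNIV :: 'n set). b)" using assms by (intro sum_mono) auto
  finally show ?thesis by simp
qed

definition near_fermat :: "nat \<Rightarrow> real \<Rightarrow> (('n::finite \<Rightarrow>\<^sub>0 nat) \<Rightarrow> complex) \<Rightarrow> bool" where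
  "near_fermat d \<delta> \<phi> \<longleftrightarrow> (\<forall>a\<in>Mon d. norm (\<phi> a - fermat d a) < \<delta>)"

text \<open>Scaling an eigenvector so that the eigenvalue becomes \<open>d\<close> turns the eigenvector equation into
  the square system \<open>\<nabla>f(x) = d x\<close>, all of whose solutions are nondegenerate for the Fermat form.\<close>

locale fermat_perturbation =
  fixes d :: nat and \<rho> \<delta> C :: real and ty :: "'n::finite itself"
  assumes ty: "ty = TYPE('n)" and d: "d \<ge> 3" and rho: "0 < \<rho>" "\<rho> \<le> 1 / 2" and delta: "\<delta> > 0" and C: "C > 0"
    and newton: "\<And>r z w. r \<in> roots d \<Longrightarrow> norm (z - r) \<le> \<rho> \<Longrightarrow> norm (w - r) \<le> \<rho> \<Longrightarrow>
       norm ((z - (of_nat d * z ^ (d - 1) - of_nat d * z) / root_deriv d r) -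
        (w - (of_nat d * w ^ (d - 1) - of_nat d * w) / root_deriv d r)) \<le> (1 / 4) * norm (z - w)"
    and separated: "\<And>r s :: complex ^ 'n::finite. r \<in> grid d \<Longrightarrow> s \<in> grid d \<Longrightarrow> dist r s \<le> 2 * \<rho> \<Longrightarrow> r = s"
    and bound: "\<And>h \<epsilon> x y i. (\<And>a. a \<in> Mon d \<Longrightarrow> norm (h a) \<le> \<epsilon>) \<Longrightarrow>
      x \<in> cball (0 :: complex ^ 'n) (2 * real CARD('n) + 2) \<Longrightarrow> y \<in> cball 0 (2 * real CARD('n) + 2) \<Longrightarrow>
      norm (gradc d h (($) x) i) \<le> \<epsilon> * C \<and>
      norm (gradc d h (($) x) i - gradc d h (($) y) i) \<le> \<epsilon> * C * dist x y"
    and small: "real CARD('n) * (\<delta> * C) \<le> 1 / 4" "real CARD('n) * (\<delta> * C) \<le> \<rho> / 2"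
    and near_roots: "\<And>z. norm z \<le> 2 \<Longrightarrow> norm (z ^ (d - 1) - z) \<le> \<delta> * C \<Longrightarrow>
      \<exists>r\<in>roots d. norm (z - r) < \<rho> / real CARD('n)"
begin

text \<open>A simplified Newton step for grad f (x) = d x: it divides by the diagonal Jacobian of
  the unperturbed Fermat system at r in place of the Jacobian of f.\<close>

definition newton_map :: "(('n \<Rightarrow>\<^sub>0 nat) \<Rightarrow> complex) \<Rightarrow> complex ^ 'n \<Rightarrow> complex ^ 'n \<Rightarrow> complex ^ 'n" where
  "newton_map \<phi> r x = (\<chi> i. x $ i - (gradc d \<phi> (($) x) i - of_nat d * x $ i) / root_deriv d (r $ i))"

abbreviation near :: "(('n \<Rightarrow>\<^sub>0 nat) \<Rightarrow> complex) \<Rightarrow> bool" where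
  "near \<equiv> near_fermat d \<delta>"

lemma card_ge_1: "real CARD('n) \<ge> 1"
  using zero_less_card_finite[where 'a = 'n] by linarith

lemma gradc_split:
  "gradc d \<phi> x i = of_nat d * x i ^ (d - 1) + gradc d (\<lambda>a. \<phi> a - fermat d a) x i"
  using d by (simp add: gradc_diff gradc_fermat)

lemma grid_root: "r \<in> grid d \<Longrightarrow> r $ i \<in> roots d"
  by (simp add: grid_def)

lemma deriv_nz: "r \<in> grid d \<Longrightarrow> root_deriv d (r $ i) \<noteq> 0"
  using norm_root_deriv[OF d grid_root[of r i]] by auto

lemma newton_map_fixed_iff:
  assumes "r \<in> grid d"
  shows "newton_map \<phi> r x = x \<longleftrightarrow> (\<forall>i. gradc d \<phi> (($) x) i = of_nat d * x $ i)"
  using deriv_nz[OF assms] by (simp add: newton_map_def vec_eq_iff)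

lemma grid_norm:
  fixes r :: "complex ^ 'n" assumes "r \<in> grid d" shows "norm r \<le> real CARD('n)"
proof -
  have "norm (r $ i) \<le> 1" for i using roots_norm[OF d grid_root[OF assms, of i]] by auto
  from norm_le_card_mult[of r 1, OF this] show ?thesis by simp
qed

lemma grid_nonzero_norm:
  fixes r :: "complex ^ 'n"
  assumes "r \<in> grid d" "r \<noteq> 0" shows "norm r \<ge> 1"
proof -
  from assms(2) obtain i where "r $ i \<noteq> 0" by (auto simp: vec_eq_iff)
  then have "norm (r $ i) = 1" using roots_norm[OF d grid_root[OF assms(1)]] by blast
  then show ?thesis using Finite_Cartesian_Product.norm_nth_le[of r i] by simp
qed

lemma cball_grid_subset:
  fixes r :: "complex ^ 'n"
  assumes "r \<in> grid d" shows "cball r \<rho> \<subseteq> cball 0 (2 * real CARD('n) + 2)"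
proof
  fix x assume "x \<in> cball r \<rho>"
  then have "norm x \<le> norm r + \<rho>"
    by (metis add.commute dist_norm mem_cball norm_minus_commute norm_triangle_sub order_trans add_left_mono)
  then show "x \<in> cball 0 (2 * real CARD('n) + 2)" using grid_norm[OF assms] rho card_ge_1 by simp
qed

lemma near_le: "near \<phi> \<Longrightarrow> a \<in> Mon d \<Longrightarrow> norm (\<phi> a - fermat d a) \<le> \<delta>"
  unfolding near_fermat_def by (simp add: less_imp_le)

lemma norm_divide_deriv:
  assumes "r \<in> grid d" shows "norm (z / root_deriv d (r $ i)) \<le> norm z"
  using norm_root_deriv[OF d grid_root[OF assms, of i]] unfolding norm_divide
  by (metis div_by_1 divide_left_mono mult_pos_pos norm_ge_zero order_less_le_trans zero_less_one)

text \<open>The difference splits into the Fermat part U, contracting by 1/4 in each coordinate, and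
  the perturbation part W, whose Lipschitz constant \<open>CARD('n) * (\<delta> * C)\<close> is at
  most 1/4.\<close>

lemma newton_map_contraction:
  assumes near: "near \<phi>" and r: "r \<in> grid d" and x: "x \<in> cball r \<rho>" and y: "y \<in> cball r \<rho>"
  shows "dist (newton_map \<phi> r x) (newton_map \<phi> r y) \<le> 1 / 2 * dist x y"
proof -
  let ?h = "\<lambda>a. \<phi> a - fermat d a" and ?A = "\<lambda>i. root_deriv d (r $ i)"
  let ?f = "\<lambda>i z. z - (of_nat d * z ^ (d - 1) - of_nat d * z) / ?A i"
  define U :: "complex ^ 'n" where "U = (\<chi> i. ?f i (x $ i) - ?f i (y $ i))"
  define W :: "complex ^ 'n" where "W = (\<chi> i. (gradc d ?h (($) x) i - gradc d ?h (($) y) i) / ?A i)"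
  have "newton_map \<phi> r x - newton_map \<phi> r y = U - W"
    unfolding newton_map_def U_def W_def gradc_split[of \<phi>]
    by (simp add: vec_eq_iff diff_divide_distrib add_divide_distrib)
  then have "dist (newton_map \<phi> r x) (newton_map \<phi> r y) \<le> norm U + norm W"
    by (metis dist_norm norm_triangle_ineq4)
  moreover have "norm U \<le> norm ((1 / 4 :: real) *\<^sub>R (x - y))"
  proof (rule norm_le_componentwise_cart)
    fix i
    have "norm (x $ i - r $ i) \<le> \<rho>" "norm (y $ i - r $ i) \<le> \<rho>"
      using x y Finite_Cartesian_Product.norm_nth_le[of "x - r" i] Finite_Cartesian_Product.norm_nth_le[of "y - r" i]
      by (auto simp: dist_norm norm_minus_commute)
    from newton[OF grid_root[OF r, of i] this]
    show "norm (U $ i) \<le> norm (((1 / 4 :: real) *\<^sub>R (x - y)) $ i)" by (simp add: U_def)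
  qed
  moreover have "norm W \<le> real CARD('n) * (\<delta> * C * dist x y)"
  proof (rule norm_le_card_mult)
    fix i
    have "x \<in> cball 0 (2 * real CARD('n) + 2)" "y \<in> cball 0 (2 * real CARD('n) + 2)"
      using x y cball_grid_subset[OF r] by auto
    with bound[of ?h \<delta> x y i] near_le[OF near]
    have "norm (gradc d ?h (($) x) i - gradc d ?h (($) y) i) \<le> \<delta> * C * dist x y" by blast
    then show "norm (W $ i) \<le> \<delta> * C * dist x y"
      unfolding W_def using norm_divide_deriv[OF r] order_trans by (simp, blast)
  qed
  moreover have "real CARD('n) * (\<delta> * C * dist x y) \<le> 1 / 4 * dist x y"
    using mult_right_mono[OF small(1) zero_le_dist[of x y]] by (simp add: mult_ac)
  ultimately show ?thesis by (simp add: dist_norm)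
qed

lemma newton_map_center:
  assumes near: "near \<phi>" and r: "r \<in> grid d"
  shows "dist (newton_map \<phi> r r) r \<le> \<rho> / 2"
proof -
  let ?h = "\<lambda>a. \<phi> a - fermat d a" and ?A = "\<lambda>i. root_deriv d (r $ i)"
  have "norm ((newton_map \<phi> r r - r) $ i) \<le> \<delta> * C" for i
  proof -
    have "r $ i ^ (d - 1) = r $ i" using grid_root[OF r, of i] roots_iff[OF d] by blast
    then have "(newton_map \<phi> r r - r) $ i = - (gradc d ?h (($) r) i / ?A i)"
      unfolding newton_map_def gradc_split[of \<phi>] by simp
    moreover have "r \<in> cball r \<rho>" using rho by simp
    then have "r \<in> cball 0 (2 * real CARD('n) + 2)" using cball_grid_subset[OF r] by blast
    then have "norm (gradc d ?h (($) r) i) \<le> \<delta> * C" using bound[of ?h \<delta> r r i] near_le[OF near] by blast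
    ultimately show ?thesis using norm_divide_deriv[OF r, of "gradc d ?h (($) r) i" i] by simp
  qed
  from norm_le_card_mult[of "newton_map \<phi> r r - r", OF this] small(2) show ?thesis by (simp add: dist_norm)
qed

text \<open>The centre moves by at most \<rho>/2 and distances to it are halved, so the ball is
  mapped into itself.\<close>

lemma newton_map_fixpoint:
  assumes near: "near \<phi>" and r: "r \<in> grid d"
  shows "\<exists>!x. x \<in> cball r \<rho> \<and> newton_map \<phi> r x = x"
proof (rule Banach_fix[where c = "1 / 2"])
  show "complete (cball r \<rho>)" by (intro compact_imp_complete) simp
  show "cball r \<rho> \<noteq> {}" using rho by simp
  show "newton_map \<phi> r ` cball r \<rho> \<subseteq> cball r \<rho>"
  proof clarify
    fix x assume x: "x \<in> cball r \<rho>"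
    have "dist (newton_map \<phi> r x) (newton_map \<phi> r r) \<le> 1 / 2 * dist x r"
      using newton_map_contraction[OF near r x, of r] rho by simp
    also have "\<dots> \<le> \<rho> / 2" using x by (simp add: dist_commute)
    finally have "dist (newton_map \<phi> r x) r \<le> \<rho>"
      using newton_map_center[OF near r] dist_triangle[of "newton_map \<phi> r x" r "newton_map \<phi> r r"] by linarith
    then show "newton_map \<phi> r x \<in> cball r \<rho>" by (simp add: dist_commute)
  qed
  show "dist (newton_map \<phi> r x) (newton_map \<phi> r y) \<le> 1 / 2 * dist x y"
    if "x \<in> cball r \<rho>" "y \<in> cball r \<rho>" for x y using newton_map_contraction[OF near r that] .
qed auto

definition sol :: "(('n \<Rightarrow>\<^sub>0 nat) \<Rightarrow> complex) \<Rightarrow> complex ^ 'n \<Rightarrow> complex ^ 'n" where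
  "sol \<phi> r = (THE x. x \<in> cball r \<rho> \<and> newton_map \<phi> r x = x)"

lemma sol:
  assumes "near \<phi>" "r \<in> grid d"
  shows "sol \<phi> r \<in> cball r \<rho>" "newton_map \<phi> r (sol \<phi> r) = sol \<phi> r"
    "gradc d \<phi> (($) (sol \<phi> r)) i = of_nat d * sol \<phi> r $ i"
  using theI'[OF newton_map_fixpoint[OF assms]] newton_map_fixed_iff[OF assms(2)]
  unfolding sol_def[symmetric] by auto

lemma sol_unique:
  assumes "near \<phi>" "r \<in> grid d" "x \<in> cball r \<rho>" "\<And>i. gradc d \<phi> (($) x) i = of_nat d * x $ i"
  shows "x = sol \<phi> r"
  using newton_map_fixpoint[OF assms(1,2)] sol[OF assms(1,2)] newton_map_fixed_iff[OF assms(2)] assms(3,4) by blast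

lemma eigc_sol: "near \<phi> \<Longrightarrow> r \<in> grid d \<Longrightarrow> eigc d \<phi> (($) (sol \<phi> r))"
  by (simp add: eigc_def sol)

lemma sol_nonzero:
  assumes "near \<phi>" "r \<in> grid d" "r \<noteq> 0" shows "sol \<phi> r \<noteq> 0"
  using sol(1)[OF assms(1,2)] grid_nonzero_norm[OF assms(2,3)] rho by (auto simp: dist_norm)

lemma grid_0: "0 \<in> grid d"
  by (simp add: grid_def roots_def)

lemma sol_0:
  assumes "near \<phi>" shows "sol \<phi> 0 = 0"
proof -
  have "gradc d \<phi> (($) (0 :: complex ^ 'n)) i = 0" for i
  proof -
    have "($) (0 :: complex ^ 'n) = (\<lambda>j. 0 * (0 :: complex ^ 'n) $ j)" by auto
    moreover have "(0 :: complex) ^ (d - 1) = 0" using d by simp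
    ultimately show ?thesis using gradc_scale[of d \<phi> 0 "($) (0 :: complex ^ 'n)" i] by (metis mult_zero_left)
  qed
  then show ?thesis using sol_unique[OF assms grid_0, of 0] rho by simp
qed

text \<open>Each coordinate satisfies z^(d-1) = z up to \<delta> C and is thus close to a root;
  rounding all coordinates gives a grid point, and uniqueness in its ball identifies y. That grid
  point is nonzero because \<open>sol \<phi> 0 = 0\<close>.\<close>

lemma solution_is_sol:
  assumes "near \<phi>" "y \<noteq> 0" "\<And>i. norm (y $ i) \<le> 2" "\<And>i. gradc d \<phi> (($) y) i = of_nat d * y $ i"
  shows "\<exists>r\<in>grid d - {0}. y = sol \<phi> r"
proof -
  let ?h = "\<lambda>a. \<phi> a - fermat d a"
  have "norm y \<le> real CARD('n) * 2" by (rule norm_le_card_mult) (rule assms(3))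
  then have y: "y \<in> cball 0 (2 * real CARD('n) + 2)" by simp
  have "\<exists>z\<in>roots d. norm (y $ i - z) < \<rho> / real CARD('n)" for i
  proof (rule near_roots[OF assms(3)])
    have "gradc d ?h (($) y) i = of_nat d * (y $ i - y $ i ^ (d - 1))"
      using assms(4)[of i] gradc_split[of \<phi> "($) y" i] by (simp add: algebra_simps)
    then have "norm (of_nat d * (y $ i - y $ i ^ (d - 1))) \<le> \<delta> * C"
      using bound[of ?h \<delta> y y i] near_le[OF assms(1)] y by metis
    then have "real d * norm (y $ i ^ (d - 1) - y $ i) \<le> \<delta> * C" by (simp add: norm_mult norm_minus_commute)
    moreover have "1 * norm (y $ i ^ (d - 1) - y $ i) \<le> real d * norm (y $ i ^ (d - 1) - y $ i)"
      using d by (intro mult_right_mono) auto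
    ultimately show "norm (y $ i ^ (d - 1) - y $ i) \<le> \<delta> * C" by simp
  qed
  then obtain z where z: "\<And>i. z i \<in> roots d" "\<And>i. norm (y $ i - z i) < \<rho> / real CARD('n)" by metis
  define r :: "complex ^ 'n" where "r = (\<chi> i. z i)"
  have r: "r \<in> grid d" using z(1) by (simp add: grid_def r_def)
  have "norm (y - r) \<le> real CARD('n) * (\<rho> / real CARD('n))"
    by (rule norm_le_card_mult) (use z(2) in \<open>simp add: r_def less_imp_le\<close>)
  then have "y \<in> cball r \<rho>" using card_ge_1 by (simp add: dist_norm norm_minus_commute)
  then have "y = sol \<phi> r" by (rule sol_unique[OF assms(1) r _ assms(4)])
  moreover have "r \<noteq> 0" using calculation assms(2) sol_0[OF assms(1)] by auto
  ultimately show ?thesis using r by blast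
qed

text \<open>Dividing by a coordinate of largest modulus lets the eigenvalue l be read off there; it
  is within 1/4 of d. A (d-2)-nd root of d / l then rescales the vector to eigenvalue d, and the
  entries stay at most 2 in modulus.\<close>

lemma eigenvector_is_sol:
  assumes near: "near \<phi>" and "x \<noteq> 0" "eigc d \<phi> (($) x)"
  shows "\<exists>r\<in>grid d - {0}. pt x = pt (sol \<phi> r)"
proof -
  let ?h = "\<lambda>a. \<phi> a - fermat d a"
  obtain k where k: "\<And>i. norm (x $ i) \<le> norm (x $ k)"
  proof -
    have "Max (range (\<lambda>i. norm (x $ i))) \<in> range (\<lambda>i. norm (x $ i))" by (rule Max_in) auto
    then obtain k where "Max (range (\<lambda>i. norm (x $ i))) = norm (x $ k)" by blast
    then show ?thesis using that[of k] Max_ge[of "range (\<lambda>i. norm (x $ i))"] by auto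
  qed
  have xk: "x $ k \<noteq> 0" using k \<open>x \<noteq> 0\<close> by (metis norm_le_zero_iff norm_zero vec_eq_iff zero_index)
  define w where "w = (1 / x $ k) *s x"
  have w: "w $ k = 1" "\<And>i. norm (w $ i) \<le> 1" "w \<noteq> 0"
    using xk k \<open>x \<noteq> 0\<close> by (auto simp: w_def norm_divide divide_le_eq_1 vec_eq_iff)
  have eig: "eigc d \<phi> (($) w)" unfolding w_def nth_scaleC by (rule eigc_scale[OF assms(3)])
  define l where "l = gradc d \<phi> (($) w) k"
  have l: "gradc d \<phi> (($) w) i = l * w $ i" for i
    using eig w(1) unfolding eigc_def l_def by (metis mult.right_neutral)
  have "norm w \<le> real CARD('n) * 1" by (rule norm_le_card_mult) (rule w(2))
  then have "w \<in> cball 0 (2 * real CARD('n) + 2)" by simp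
  then have "norm (gradc d ?h (($) w) k) \<le> \<delta> * C"
    using bound[of ?h \<delta> w w k] near_le[OF near] by blast
  moreover have "l - of_nat d = gradc d ?h (($) w) k" using w(1) by (simp add: l_def gradc_split[of \<phi>])
  moreover have "\<delta> * C \<le> real CARD('n) * (\<delta> * C)" using card_ge_1 delta C by simp
  ultimately have "norm (l - of_nat d) \<le> 1 / 4" using small(1) by (metis order_trans)
  moreover have "real d \<le> norm l + norm (l - of_nat d)"
    by (metis norm_of_nat norm_minus_commute norm_triangle_sub)
  ultimately have norml: "norm l \<ge> real d - 1 / 4" by simp
  moreover have "real d \<ge> 3" using d by simp
  ultimately have "norm l > 0" by linarith
  have "d - 2 \<noteq> 0" using d by simp
  then obtain c where c: "of_nat d / l = c ^ (d - 2)" using exists_complex_root[of "d - 2" "of_nat d / l"] by blast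
  have "c \<noteq> 0"
  proof
    assume "c = 0"
    then have "of_nat d / l = 0" using c \<open>d - 2 \<noteq> 0\<close> by (simp only: power_0_left if_False)
    then show False using \<open>norm l > 0\<close> d by auto
  qed
  \<comment> \<open>Otherwise |c|^(d-2) would be at least 2, whereas d / |l| is at most d / (d -
    1/4).\<close>
  have "norm c \<le> 2"
  proof (rule ccontr)
    assume *: "\<not> norm c \<le> 2"
    moreover have "norm c ^ 1 \<le> norm c ^ (d - 2)"
      using \<open>d - 2 \<noteq> 0\<close> * by (intro power_increasing) auto
    ultimately have "2 \<le> norm c ^ (d - 2)" by simp
    also have "norm c ^ (d - 2) = real d / norm l" using c by (metis norm_divide norm_of_nat norm_power)
    finally show False using norml d \<open>norm l > 0\<close> by (simp add: field_simps)
  qed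
  define y where "y = c *s w"
  have y0: "y \<noteq> 0" using w(3) \<open>c \<noteq> 0\<close> by (auto simp: y_def vec_eq_iff)
  have y2: "norm (y $ i) \<le> 2" for i
    using mult_mono[OF \<open>norm c \<le> 2\<close> w(2)[of i]] by (simp add: y_def norm_mult)
  have yg: "gradc d \<phi> (($) y) i = of_nat d * y $ i" for i
  proof -
    have "d - 1 = Suc (d - 2)" using d by simp
    then have "c ^ (d - 1) = c * c ^ (d - 2)" by (simp only: power_Suc)
    then have "gradc d \<phi> (($) y) i = c * (of_nat d / l) * (l * w $ i)"
      unfolding y_def nth_scaleC gradc_scale using l[of i] c by simp
    then show ?thesis using \<open>norm l > 0\<close> by (simp add: y_def)
  qed
  obtain r where r: "r \<in> grid d - {0}" "y = sol \<phi> r" using solution_is_sol[OF near y0 y2 yg] by blast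
  have "y = (c / x $ k) *s x" by (simp add: y_def w_def vector_smult_assoc)
  then have "pt x = pt y" using pt_eq_iff[OF \<open>x \<noteq> 0\<close> y0] \<open>c \<noteq> 0\<close> xk by (metis divide_eq_0_iff)
  then show ?thesis using r by blast
qed

text \<open>Two proportional solutions of grad f (x) = d x differ by a (d-2)-nd root of unity. Such
  roots act on the grid and, by uniqueness, on the solutions in the same way, so eigenpoints
  correspond to lines through nonzero grid points.\<close>

lemma pt_sol_eq_iff:
  assumes near: "near \<phi>" and r: "r \<in> grid d - {0}" and s: "s \<in> grid d - {0}"
  shows "pt (sol \<phi> r) = pt (sol \<phi> s) \<longleftrightarrow> pt r = pt s"
proof -
  have unit: "c *s r \<in> grid d \<and> sol \<phi> (c *s r) = c *s sol \<phi> r" if c: "c ^ (d - 2) = 1" for c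
  proof -
    have "norm c = 1" using power_eq_1_iff[OF c] d by auto
    have c1: "c ^ (d - 1) = c" using c roots_iff[OF d, of c] by (simp add: roots_def)
    have cr: "c *s r \<in> grid d"
      using r c1 roots_iff[OF d] by (simp add: grid_def power_mult_distrib)
    have "c *s sol \<phi> r = sol \<phi> (c *s r)"
    proof (rule sol_unique[OF near cr])
      have "c *s r - c *s sol \<phi> r = c *s (r - sol \<phi> r)" by (simp add: vec_eq_iff algebra_simps)
      moreover have "norm (c *s v) = norm v" for v :: "complex ^ 'n"
        using \<open>norm c = 1\<close> by (simp add: norm_vec_def norm_mult)
      ultimately have "dist (c *s r) (c *s sol \<phi> r) = dist r (sol \<phi> r)" by (simp only: dist_norm)
      then show "c *s sol \<phi> r \<in> cball (c *s r) \<rho>" using sol(1)[OF near, of r] r by simp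
      show "gradc d \<phi> (($) (c *s sol \<phi> r)) i = of_nat d * (c *s sol \<phi> r) $ i" for i
        unfolding nth_scaleC gradc_scale c1 using sol(3)[OF near, of r i] r by simp
    qed
    then show ?thesis using cr by simp
  qed
  have nz: "sol \<phi> r \<noteq> 0" "sol \<phi> s \<noteq> 0" "r \<noteq> 0" "s \<noteq> 0" using sol_nonzero[OF near] r s by auto
  show ?thesis
  proof
    assume "pt (sol \<phi> r) = pt (sol \<phi> s)"
    then obtain c where c: "c \<noteq> 0" "sol \<phi> s = c *s sol \<phi> r" using pt_eq_iff[OF nz(1,2)] by blast
    obtain i where i: "sol \<phi> r $ i \<noteq> 0" using nz(1) by (auto simp: vec_eq_iff)
    have "gradc d \<phi> (($) (sol \<phi> s)) i = c ^ (d - 1) * gradc d \<phi> (($) (sol \<phi> r)) i"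
      unfolding c(2) nth_scaleC gradc_scale ..
    then have "c ^ (d - 1) = c"
      using sol(3)[OF near, of s i] sol(3)[OF near, of r i] r s c i d by simp
    then have c1: "c ^ (d - 2) = 1" using roots_iff[OF d, of c] c(1) by (simp add: roots_def)
    \<comment> \<open>Both grid points are within \<rho> of the same solution, so the separation of
      the grid identifies them.\<close>
    have "s = c *s r"
    proof (rule separated)
      show "dist s (c *s r) \<le> 2 * \<rho>"
        using sol(1)[OF near, of s] sol(1)[OF near, of "c *s r"] unit[OF c1] s c(2)
          dist_triangle[of s "c *s r" "sol \<phi> s"] by (simp add: dist_commute)
    qed (use unit[OF c1] s in auto)
    then show "pt r = pt s" using pt_eq_iff[OF nz(3,4)] c(1) by blast
  next
    assume "pt r = pt s"
    then obtain c where c: "c \<noteq> 0" "s = c *s r" using pt_eq_iff[OF nz(3,4)] by blast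
    obtain i where i: "r $ i \<noteq> 0" using nz(3) by (auto simp: vec_eq_iff)
    have "s $ i ^ (d - 2) = 1" "r $ i ^ (d - 2) = 1"
      using grid_root[of r i] grid_root[of s i] r s i c by (auto simp: roots_def)
    then have "c ^ (d - 2) = 1" using c(2) by (simp add: power_mult_distrib)
    from unit[OF this] have "sol \<phi> s = c *s sol \<phi> r" using c(2) by simp
    then show "pt (sol \<phi> r) = pt (sol \<phi> s)" using pt_eq_iff[OF nz(1,2)] c(1) by blast
  qed
qed

text \<open>The new map moves the old fixed point by at most
  \<open>CARD('n) * (\<kappa> * C)\<close>, and the fixed point of a 1/2-contraction is at most
  twice that far away.\<close>

lemma sol_lipschitz:
  assumes near: "near \<phi>" "near \<psi>" and r: "r \<in> grid d" and close: "\<And>a. a \<in> Mon d \<Longrightarrow> norm (\<psi> a - \<phi> a) \<le> \<kappa>"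
  shows "dist (sol \<psi> r) (sol \<phi> r) \<le> 2 * (real CARD('n) * (\<kappa> * C))"
proof -
  let ?x = "sol \<phi> r" and ?y = "sol \<psi> r"
  have "norm ((newton_map \<psi> r ?x - newton_map \<phi> r ?x) $ i) \<le> \<kappa> * C" for i
  proof -
    have "(newton_map \<psi> r ?x - newton_map \<phi> r ?x) $ i =
        - (gradc d (\<lambda>a. \<psi> a - \<phi> a) (($) ?x) i / root_deriv d (r $ i))"
      by (simp add: newton_map_def gradc_diff diff_divide_distrib)
    moreover have "?x \<in> cball 0 (2 * real CARD('n) + 2)" using sol(1)[OF near(1) r] cball_grid_subset[OF r] by blast
    then have "norm (gradc d (\<lambda>a. \<psi> a - \<phi> a) (($) ?x) i) \<le> \<kappa> * C"
      using bound[of "\<lambda>a. \<psi> a - \<phi> a" \<kappa> ?x ?x i] close by blast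
    ultimately show ?thesis using norm_divide_deriv[OF r, of "gradc d (\<lambda>a. \<psi> a - \<phi> a) (($) ?x) i" i] by simp
  qed
  from norm_le_card_mult[of "newton_map \<psi> r ?x - newton_map \<phi> r ?x", OF this]
  have "dist (newton_map \<psi> r ?x) ?x \<le> real CARD('n) * (\<kappa> * C)"
    by (simp add: dist_norm sol(2)[OF near(1) r])
  moreover have "dist ?y (newton_map \<psi> r ?x) \<le> 1 / 2 * dist ?y ?x"
    using newton_map_contraction[OF near(2) r sol(1)[OF near(2) r] sol(1)[OF near(1) r]]
    by (simp add: sol(2)[OF near(2) r])
  ultimately show ?thesis using dist_triangle[of ?y ?x "newton_map \<psi> r ?x"] by linarith
qed

end

text \<open>The order of choices matters: \<rho> from the contraction radii and the separation of
  the grid, C for the large ball, \<kappa> from \<rho> by compactness, and last \<delta>, so small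
  that \<open>CARD('n) * (\<delta> * C)\<close> is below every threshold.\<close>

lemma fermat_perturbation_exists:
  assumes d: "d \<ge> 3" and "\<epsilon> > 0"
  obtains \<rho> \<delta> C where "fermat_perturbation d \<rho> \<delta> C TYPE('n::finite)" "\<rho> \<le> \<epsilon>" "\<delta> \<le> \<epsilon>"
proof -
  let ?N = "real CARD('n)"
  have N: "?N \<ge> 1" using zero_less_card_finite[where 'a = 'n] by linarith
  let ?f = "\<lambda>r z. z - (of_nat d * z ^ (d - 1) - of_nat d * z) / root_deriv d r"
  obtain R where R: "\<And>r. r \<in> roots d \<Longrightarrow> R r > 0"
    "\<And>r z w. r \<in> roots d \<Longrightarrow> norm (z - r) \<le> R r \<Longrightarrow> norm (w - r) \<le> R r \<Longrightarrow>
      norm (?f r z - ?f r w) \<le> (1 / 4) * norm (z - w)"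
    using newton_contraction[OF d] by metis
  define \<rho>1 where "\<rho>1 = Min (insert 1 (R ` roots d))"
  have fin: "finite (insert 1 (R ` roots d))" using finite_roots[OF d] by simp
  have \<rho>1: "\<rho>1 > 0" unfolding \<rho>1_def using R(1) fin by (subst Min_gr_iff) auto
  have \<rho>1_le: "\<rho>1 \<le> R r" if "r \<in> roots d" for r
    unfolding \<rho>1_def using that fin by (intro Min_le) auto
  obtain e where e: "e > 0" "\<And>x y :: complex ^ 'n. x \<in> grid d \<Longrightarrow> y \<in> grid d \<Longrightarrow> dist x y < e \<Longrightarrow> x = y"
    using finite_separated[OF finite_grid[OF d]] by blast
  define \<rho> where "\<rho> = min (min \<rho>1 (e / 3)) (min \<epsilon> (1 / 2))"
  have \<rho>: "\<rho> > 0" "\<rho> \<le> \<rho>1" "\<rho> \<le> e / 3" "\<rho> \<le> \<epsilon>" "\<rho> \<le> 1 / 2"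
    using \<rho>1 e(1) assms(2) by (auto simp: \<rho>_def)
  obtain C where C: "C > 0" "\<And>h \<delta> x y i. (\<And>a. a \<in> Mon d \<Longrightarrow> norm (h a) \<le> \<delta>) \<Longrightarrow>
    x \<in> cball (0 :: complex ^ 'n::finite) (2 * ?N + 2) \<Longrightarrow> y \<in> cball 0 (2 * ?N + 2) \<Longrightarrow>
    norm (gradc d h (($) x) i) \<le> \<delta> * C \<and>
    norm (gradc d h (($) x) i - gradc d h (($) y) i) \<le> \<delta> * C * dist x y"
    using gradc_bound[of "2 * ?N + 2" d, where 'n = 'n] N by auto
  obtain \<kappa> where \<kappa>: "\<kappa> > 0"
    "\<And>z. norm z \<le> 2 \<Longrightarrow> norm (z ^ (d - 1) - z) < \<kappa> \<Longrightarrow> \<exists>r\<in>roots d. norm (z - r) < \<rho> / ?N"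
    using near_root[OF d, of "\<rho> / ?N"] \<rho>(1) N by auto
  define m where "m = min (min (1 / 4) (\<rho> / 2)) (min (\<kappa> / 2) (\<epsilon> * C))"
  have m: "m > 0" "m \<le> 1 / 4" "m \<le> \<rho> / 2" "m \<le> \<epsilon> * C"
    using \<rho>(1) \<kappa>(1) C(1) assms(2) by (auto simp: m_def)
  have "m \<le> \<kappa> / 2" by (simp add: m_def)
  then have m\<kappa>: "m < \<kappa>" using \<kappa>(1) by linarith
  define \<delta> where "\<delta> = m / (?N * C)"
  have \<delta>: "\<delta> > 0" "?N * (\<delta> * C) = m" using m(1) C(1) N by (auto simp: \<delta>_def)
  have "\<delta> * C \<le> ?N * (\<delta> * C)" using N \<delta>(1) C(1) by simp
  then have \<delta>C: "\<delta> * C < \<kappa>" and "\<delta> * C \<le> \<epsilon> * C" using \<delta>(2) m(4) m\<kappa> by linarith+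
  then have "\<delta> \<le> \<epsilon>" using C(1) by simp
  have "fermat_perturbation d \<rho> \<delta> C TYPE('n)"
  proof
    show "norm (?f r z - ?f r w) \<le> (1 / 4) * norm (z - w)"
      if "r \<in> roots d" "norm (z - r) \<le> \<rho>" "norm (w - r) \<le> \<rho>" for r z w
      using R(2)[OF that(1)] \<rho>1_le[OF that(1)] that \<rho>(2) by (meson order_trans)
    show "r = s" if "r \<in> grid d" "s \<in> grid d" "dist r s \<le> 2 * \<rho>" for r s :: "complex ^ 'n"
      using e(2)[OF that(1,2)] that(3) \<rho>(3) e(1) by linarith
    show "\<exists>r\<in>roots d. norm (z - r) < \<rho> / ?N" if "norm z \<le> 2" "norm (z ^ (d - 1) - z) \<le> \<delta> * C" for z
      using \<kappa>(2)[OF that(1)] that(2) \<delta>C by linarith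
    show "norm (gradc d h (($) x) i) \<le> \<epsilon> * C \<and>
      norm (gradc d h (($) x) i - gradc d h (($) y) i) \<le> \<epsilon> * C * dist x y"
      if "\<And>a. a \<in> Mon d \<Longrightarrow> norm (h a) \<le> \<epsilon>" "x \<in> cball (0 :: complex ^ 'n) (2 * ?N + 2)"
        "y \<in> cball 0 (2 * ?N + 2)" for h \<epsilon> x y i
      using C(2)[OF that] .
  qed (use d \<rho> \<delta> C(1) m in auto)
  then show thesis using that \<rho>(4) \<open>\<delta> \<le> \<epsilon>\<close> by blast
qed

section \<open>Forms with prescribed eigenpoints\<close>

lemma poly_vanishing_on_set:
  fixes a :: "nat \<Rightarrow> complex"
  assumes "finite R" "card R = k" "\<And>t. t \<in> R \<Longrightarrow> (\<Sum>e<k. a e * t ^ e) = 0" "e < k"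
  shows "a e = 0"
proof -
  define p where "p = (\<Sum>e<k. monom (a e) e)"
  have coeff: "poly.coeff p j = (if j < k then a j else 0)" for j
    by (simp add: p_def coeff_sum)
  have "p = 0"
  proof (rule ccontr)
    assume "p \<noteq> 0"
    have "R \<subseteq> {t. poly p t = 0}" using assms(3) by (auto simp: p_def poly_sum poly_monom)
    then have "card R \<le> card {t. poly p t = 0}" by (intro card_mono poly_roots_finite \<open>p \<noteq> 0\<close>)
    also have "\<dots> \<le> degree p" by (rule card_poly_roots_bound[OF \<open>p \<noteq> 0\<close>])
    finally have "k \<le> degree p" using assms(2) by simp
    then have "poly.coeff p (degree p) = 0" by (simp add: coeff)
    then show False using \<open>p \<noteq> 0\<close> by simp
  qed
  then show ?thesis using coeff[of e] assms(4) by simp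
qed

text \<open>A polynomial with exponents below |R| in each variable that vanishes on R^n has zero
  coefficients. Terms with equal exponents are deliberately not merged: reduction of exponents will
  produce such terms, and only the sums of their coefficients are determined.\<close>

lemma grid_vanishing:
  fixes ex :: "'i \<Rightarrow> 'n::finite \<Rightarrow> nat" and c :: "'i \<Rightarrow> complex"
  assumes R: "finite R" "card R = k" and "finite I" and ex: "\<And>l i. l \<in> I \<Longrightarrow> ex l i < k"
    and zero: "\<And>x. (\<And>i. x i \<in> R) \<Longrightarrow> (\<Sum>l\<in>I. c l * (\<Prod>i\<in>UNIV. x i ^ ex l i)) = 0"
  shows "(\<Sum>l\<in>{l\<in>I. ex l = \<beta>}. c l) = 0"
proof -
  \<comment> \<open>The exponents at the variables in S have already been separated. One more
    variable is separated by viewing the sum as a polynomial in it with more zeros than its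
    degree.\<close>
  have "(\<Sum>l\<in>{l\<in>I. \<forall>i\<in>S. ex l i = \<beta> i}. c l * (\<Prod>i\<in>UNIV - S. x i ^ ex l i)) = 0"
    if "\<And>i. x i \<in> R" for S \<beta> x
    using finite[of S] that
  proof (induction S arbitrary: \<beta> x rule: finite_induct)
    case empty
    then show ?case using zero[of x] by simp
  next
    case (insert j S)
    let ?I = "\<lambda>S \<beta>. {l\<in>I. \<forall>i\<in>S. ex l i = \<beta> i}"
    define a where "a = (\<lambda>e. \<Sum>l\<in>?I (insert j S) (\<beta>(j := e)). c l * (\<Prod>i\<in>UNIV - insert j S. x i ^ ex l i))"
    have same: "?I S (\<beta>(j := e)) = ?I S \<beta>" for e using insert.hyps by auto
    have "(\<Sum>e<k. a e * t ^ e) = 0" if "t \<in> R" for t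
    proof -
      have "0 = (\<Sum>l\<in>?I S \<beta>. c l * (\<Prod>i\<in>UNIV - S. (x(j := t)) i ^ ex l i))"
        using insert.IH[of "x(j := t)" \<beta>] insert.prems that by simp
      also have "\<dots> = (\<Sum>l\<in>?I S \<beta>. c l * (t ^ ex l j * (\<Prod>i\<in>UNIV - insert j S. x i ^ ex l i)))"
      proof (intro sum.cong refl arg_cong2[where f = "(*)"])
        fix l
        have "UNIV - insert j S = (UNIV - S) - {j}" by auto
        moreover have "(\<Prod>i\<in>UNIV - S. (x(j := t)) i ^ ex l i) =
            t ^ ex l j * (\<Prod>i\<in>(UNIV - S) - {j}. (x(j := t)) i ^ ex l i)"
          using insert.hyps by (subst prod.remove[of _ j]) auto
        moreover have "(\<Prod>i\<in>(UNIV - S) - {j}. (x(j := t)) i ^ ex l i) = (\<Prod>i\<in>(UNIV - S) - {j}. x i ^ ex l i)"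
          by (intro prod.cong) auto
        ultimately show "(\<Prod>i\<in>UNIV - S. (x(j := t)) i ^ ex l i) = t ^ ex l j * (\<Prod>i\<in>UNIV - insert j S. x i ^ ex l i)"
          by simp
      qed
      also have "\<dots> = (\<Sum>e<k. \<Sum>l\<in>{l\<in>?I S \<beta>. ex l j = e}. c l * (t ^ ex l j * (\<Prod>i\<in>UNIV - insert j S. x i ^ ex l i)))"
        using \<open>finite I\<close> ex by (intro sum.group[symmetric]) auto
      also have "\<dots> = (\<Sum>e<k. a e * t ^ e)"
      proof (intro sum.cong refl)
        fix e
        have "{l\<in>?I S \<beta>. ex l j = e} = ?I (insert j S) (\<beta>(j := e))" using insert.hyps by auto
        then show "(\<Sum>l\<in>{l\<in>?I S \<beta>. ex l j = e}. c l * (t ^ ex l j * (\<Prod>i\<in>UNIV - insert j S. x i ^ ex l i))) = a e * t ^ e"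
          unfolding a_def sum_distrib_right by (intro sum.cong) (auto simp: mult_ac)
      qed
      finally show ?thesis by simp
    qed
    note va = poly_vanishing_on_set[OF R this]
    show ?case
    proof (cases "\<beta> j < k")
      case True
      then show ?thesis using va[of "\<beta> j"] unfolding a_def by simp
    next
      case False
      then have "\<not> (\<forall>i\<in>insert j S. ex l i = \<beta> i)" if "l \<in> I" for l using ex[OF that, of j] by auto
      then have "?I (insert j S) \<beta> = {}" by blast
      then show ?thesis by (simp only: sum.empty)
    qed
  qed
  from this[of "\<lambda>_. SOME z. z \<in> R" UNIV \<beta>]
  have *: "R \<noteq> {} \<Longrightarrow> (\<Sum>l\<in>{l\<in>I. \<forall>i. ex l i = \<beta> i}. c l) = 0"
    using some_in_eq[of R] by (simp del: some_in_eq)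
  show ?thesis
  proof (cases "R = {}")
    case True
    then have "I = {}" using ex R by fastforce
    then show ?thesis by simp
  next
    case False
    then show ?thesis using * by (simp add: fun_eq_iff)
  qed
qed

text \<open>Up to the scalar factor, the effect of x_j d/dx_i on a monomial.\<close>

definition shift :: "'n \<Rightarrow> 'n \<Rightarrow> ('n \<Rightarrow>\<^sub>0 nat) \<Rightarrow> ('n \<Rightarrow>\<^sub>0 nat)" where
  "shift i j a = a - Poly_Mapping.single i 1 + Poly_Mapping.single j 1"

lemma lookup_shift:
  "Poly_Mapping.lookup (shift i j a) k =
     Poly_Mapping.lookup a k - (if k = i then 1 else 0) + (if k = j then 1 else 0)"
  by (auto simp: shift_def Poly_Mapping.lookup_add Poly_Mapping.lookup_minus lookup_single when_def)

lemma shift_shift: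
  assumes "i \<noteq> j" "Poly_Mapping.lookup a i \<ge> 1" shows "shift j i (shift i j a) = a"
  using assms by (intro poly_mapping_eqI) (auto simp: lookup_shift)

lemma pdeg_shift:
  assumes "Poly_Mapping.lookup a i \<ge> 1" shows "pdeg (shift i j a) = pdeg a"
proof -
  have "a = (a - Poly_Mapping.single i 1) + Poly_Mapping.single i 1"
    using assms by (intro poly_mapping_eqI)
      (auto simp: Poly_Mapping.lookup_add Poly_Mapping.lookup_minus lookup_single when_def)
  then have "pdeg a = pdeg (a - Poly_Mapping.single i 1) + pdeg (Poly_Mapping.single i (1 :: nat))"
    by (metis pdeg_add)
  then show ?thesis unfolding shift_def pdeg_add by (simp add: pdeg_def)
qed

section \<open>The 2 x 2 minors and their coefficients\<close>

definition minor :: "nat \<Rightarrow> (('n::finite \<Rightarrow>\<^sub>0 nat) \<Rightarrow> complex) \<Rightarrow> 'n \<Rightarrow> 'n \<Rightarrow> ('n \<Rightarrow> complex) \<Rightarrow> complex" where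
  "minor d \<gamma> i j x = gradc d \<gamma> x i * x j - gradc d \<gamma> x j * x i"

lemma eigc_minor: "eigc d \<gamma> x \<longleftrightarrow> (\<forall>i j. minor d \<gamma> i j x = 0)"
  by (simp add: eigc_def minor_def)

text \<open>The coefficient of x^b in x_j df/dx_i - x_i df/dx_j. Each of the two operators reaches
  x^b from a single monomial, and only if the variable it multiplies by occurs in b.\<close>

definition minor_coeff :: "(('n \<Rightarrow>\<^sub>0 nat) \<Rightarrow> complex) \<Rightarrow> 'n \<Rightarrow> 'n \<Rightarrow> ('n \<Rightarrow>\<^sub>0 nat) \<Rightarrow> complex" where
  "minor_coeff \<gamma> i j b =
     (if Poly_Mapping.lookup b j \<ge> 1 then \<gamma> (shift j i b) * of_nat (Poly_Mapping.lookup b i + 1) else 0) -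
     (if Poly_Mapping.lookup b i \<ge> 1 then \<gamma> (shift i j b) * of_nat (Poly_Mapping.lookup b j + 1) else 0)"

lemma gradc_times_var:
  assumes "i \<noteq> j"
  shows "gradc d \<gamma> x i * x j = (\<Sum>b\<in>Mon d. (if Poly_Mapping.lookup b j \<ge> 1
     then \<gamma> (shift j i b) * of_nat (Poly_Mapping.lookup b i + 1) else 0) * mev b x)"
proof -
  have "gradc d \<gamma> x i * x j = (\<Sum>a\<in>Mon d. \<gamma> a * of_nat (Poly_Mapping.lookup a i) * mev (shift i j a) x)"
  proof -
    have "mev (shift i j a) x = mev (a - Poly_Mapping.single i 1) x * x j" for a
      unfolding shift_def mev_add by (simp add: mev_def)
    then show ?thesis unfolding gradc_def sum_distrib_right by (simp add: mult_ac)
  qed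
  also have "\<dots> = (\<Sum>a\<in>{a\<in>Mon d. Poly_Mapping.lookup a i \<ge> 1}. \<gamma> a * of_nat (Poly_Mapping.lookup a i) * mev (shift i j a) x)"
    by (intro sum.mono_neutral_right) (auto simp: Suc_le_eq)
  also have "\<dots> = (\<Sum>b\<in>{b\<in>Mon d. Poly_Mapping.lookup b j \<ge> 1}. \<gamma> (shift j i b) * of_nat (Poly_Mapping.lookup b i + 1) * mev b x)"
    using assms
    by (intro sum.reindex_bij_witness[where i = "shift j i" and j = "shift i j"])
       (auto simp: shift_shift Mon_iff pdeg_shift lookup_shift)
  also have "\<dots> = (\<Sum>b\<in>Mon d. (if Poly_Mapping.lookup b j \<ge> 1
     then \<gamma> (shift j i b) * of_nat (Poly_Mapping.lookup b i + 1) else 0) * mev b x)"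
    by (intro sum.mono_neutral_cong_left) auto
  finally show ?thesis .
qed

lemma minor_expand:
  assumes "i \<noteq> j"
  shows "minor d \<gamma> i j x = (\<Sum>b\<in>Mon d. minor_coeff \<gamma> i j b * mev b x)"
  unfolding minor_def gradc_times_var[OF assms] gradc_times_var[OF assms[symmetric]] minor_coeff_def
  by (simp add: sum_subtractf left_diff_distrib)

text \<open>On \<open>roots d\<close> positive exponents count modulo d - 2, with representatives 1,
  ..., d - 2. Exponent 0 stays apart, because the root 0 tells it from the others.\<close>

definition red :: "nat \<Rightarrow> nat \<Rightarrow> nat" where
  "red d e = (if e = 0 then 0 else (e - 1) mod (d - 2) + 1)"

lemma red_less:
  assumes "d \<ge> 3" shows "red d e < d - 1"
proof -
  have "(e - 1) mod (d - 2) < d - 2" using assms by (intro mod_less_divisor) simp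
  then have "(e - 1) mod (d - 2) + 1 < d - 1" using assms by linarith
  then show ?thesis using assms unfolding red_def by (simp del: One_nat_def)
qed

lemma red_le: "red d e \<le> e"
  using mod_less_eq_dividend[of "e - 1" "d - 2"] by (auto simp: red_def simp del: mod_less_eq_dividend)

lemma red_small: "d \<ge> 3 \<Longrightarrow> e \<le> d - 2 \<Longrightarrow> red d e = e"
  by (auto simp: red_def)

lemma red_eq_0_iff: "red d e = 0 \<longleftrightarrow> e = 0"
  by (auto simp: red_def)

lemma root_power_red:
  assumes "d \<ge> 3" "z \<in> roots d" shows "z ^ e = z ^ red d e"
proof (cases "e = 0 \<or> z = 0")
  case True
  then show ?thesis by (auto simp: red_def power_0_left)
next
  case False
  then have z: "z ^ (d - 2) = 1" using assms by (auto simp: roots_def)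
  have "e = Suc ((d - 2) * ((e - 1) div (d - 2)) + (e - 1) mod (d - 2))" using False by simp
  then have "z ^ e = z * ((z ^ (d - 2)) ^ ((e - 1) div (d - 2)) * z ^ ((e - 1) mod (d - 2)))"
    by (metis power_Suc power_add power_mult)
  then show ?thesis using z False by (simp add: red_def)
qed

section \<open>Forms whose minors vanish on the grid\<close>

context
  fixes d :: nat and \<gamma> :: "('n::finite \<Rightarrow>\<^sub>0 nat) \<Rightarrow> complex"
  assumes d: "d \<ge> 3"
    and vanish: "\<And>r i j. r \<in> grid d \<Longrightarrow> minor d \<gamma> i j (($) r) = 0"
begin

text \<open>As functions on the grid, monomials with equal reduced exponents coincide, so vanishing
  there determines only sums over such classes. What follows finds the classes in degree d.\<close>

lemma minor_coeff_class:
  assumes "i \<noteq> j"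
  shows "(\<Sum>b\<in>{b\<in>Mon d. (\<lambda>k. red d (Poly_Mapping.lookup b k)) = \<beta>}. minor_coeff \<gamma> i j b) = 0"
proof (rule grid_vanishing[OF finite_roots[OF d] card_roots[OF d]])
  show "red d (Poly_Mapping.lookup b k) < d - 1" for b :: "'n \<Rightarrow>\<^sub>0 nat" and k using red_less[OF d] .
  fix x :: "'n \<Rightarrow> complex" assume x: "\<And>i. x i \<in> roots d"
  have "(\<chi> i. x i) \<in> grid d" using x by (simp add: grid_def)
  moreover have "($) (\<chi> i. x i) = x" by auto
  ultimately have "minor d \<gamma> i j x = 0" using vanish[of "\<chi> i. x i"] by simp
  then show "(\<Sum>b\<in>Mon d. minor_coeff \<gamma> i j b * (\<Prod>k\<in>UNIV. x k ^ red d (Poly_Mapping.lookup b k))) = 0"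
    unfolding minor_expand[OF assms] mev_UNIV using root_power_red[OF d x] by simp
qed auto

text \<open>Exponents up to d - 2 are reduced; any other member of the class would have exponents at
  least as large with the same sum, so the class is a singleton.\<close>

lemma minor_coeff_small:
  assumes "i \<noteq> j" "b \<in> Mon d" "\<And>k. Poly_Mapping.lookup b k \<le> d - 2"
  shows "minor_coeff \<gamma> i j b = 0"
proof -
  have "{b'\<in>Mon d. (\<lambda>k. red d (Poly_Mapping.lookup b' k)) = Poly_Mapping.lookup b} = {b}"
  proof (intro equalityI subsetI)
    fix b' assume "b' \<in> {b'\<in>Mon d. (\<lambda>k. red d (Poly_Mapping.lookup b' k)) = Poly_Mapping.lookup b}"
    then have b': "b' \<in> Mon d" "\<And>k. red d (Poly_Mapping.lookup b' k) = Poly_Mapping.lookup b k" by (auto simp: fun_eq_iff)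
    have le: "Poly_Mapping.lookup b k \<le> Poly_Mapping.lookup b' k" for k using b'(2)[of k] red_le by metis
    have "(\<Sum>k\<in>UNIV. Poly_Mapping.lookup b k) = (\<Sum>k\<in>UNIV. Poly_Mapping.lookup b' k)"
      using assms(2) b'(1) by (simp add: Mon_def)
    then have "Poly_Mapping.lookup b k = Poly_Mapping.lookup b' k" for k
      using sum_mono_inv[of "Poly_Mapping.lookup b" UNIV "Poly_Mapping.lookup b'" k] le by auto
    then show "b' \<in> {b}" by (auto intro: poly_mapping_eqI)
  qed (use assms red_small[OF d] in \<open>auto simp: fun_eq_iff\<close>)
  then show ?thesis using minor_coeff_class[OF assms(1), of "Poly_Mapping.lookup b"] by simp
qed

text \<open>Reduction preserves the set of variables that occur, so x_k^d is alone in its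
  class.\<close>

lemma minor_coeff_pure:
  assumes "i \<noteq> j" shows "minor_coeff \<gamma> i j (Poly_Mapping.single k d) = 0"
proof -
  let ?b = "Poly_Mapping.single k d"
  have "{b\<in>Mon d. (\<lambda>l. red d (Poly_Mapping.lookup b l)) = (\<lambda>l. red d (Poly_Mapping.lookup ?b l))} = {?b}"
  proof (intro equalityI subsetI)
    fix b assume "b \<in> {b\<in>Mon d. (\<lambda>l. red d (Poly_Mapping.lookup b l)) = (\<lambda>l. red d (Poly_Mapping.lookup ?b l))}"
    then have b: "b \<in> Mon d" "\<And>l. red d (Poly_Mapping.lookup b l) = red d (Poly_Mapping.lookup ?b l)"
      by (auto simp: fun_eq_iff)
    have z: "Poly_Mapping.lookup b l = 0" if "l \<noteq> k" for l
    proof -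
      have "red d (Poly_Mapping.lookup ?b l) = 0" using that by (simp add: lookup_single red_def)
      then show ?thesis using b(2)[of l] red_eq_0_iff by metis
    qed
    have "(\<Sum>l\<in>UNIV. Poly_Mapping.lookup b l) = Poly_Mapping.lookup b k"
      by (subst sum.remove[of _ k]) (auto simp: z)
    then have "Poly_Mapping.lookup b k = d" using b(1) by (simp add: Mon_def)
    then have "b = ?b" using z by (intro poly_mapping_eqI) (auto simp: lookup_single when_def)
    then show "b \<in> {?b}" by simp
  qed (simp add: single_in_Mon)
  then show ?thesis
    using minor_coeff_class[OF assms, of "\<lambda>l. red d (Poly_Mapping.lookup ?b l)"] by simp
qed

definition spec :: "'n \<Rightarrow> 'n \<Rightarrow> ('n \<Rightarrow>\<^sub>0 nat)" where
  "spec k l = Poly_Mapping.single k (d - 1) + Poly_Mapping.single l 1"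

lemma lookup_spec: "Poly_Mapping.lookup (spec k l) m = (if m = k then d - 1 else 0) + (if m = l then 1 else 0)"
  by (auto simp: spec_def Poly_Mapping.lookup_add lookup_single when_def)

lemma spec_in_Mon: "spec k l \<in> Mon d"
  using d by (simp add: spec_def Mon_iff pdeg_add) (simp add: pdeg_def)

text \<open>The monomials x_k^(d-1) x_l and x_k x_l^(d-1) both reduce to x_k x_l and form one class,
  so the grid sees only the sum of their coefficients. This is the only ambiguity.\<close>

lemma minor_coeff_spec:
  assumes "i \<noteq> j" "k \<noteq> l"
  shows "minor_coeff \<gamma> i j (spec k l) + minor_coeff \<gamma> i j (spec l k) = 0"
proof -
  let ?\<beta> = "\<lambda>m. if m = k \<or> m = l then 1 else 0"
  have "d - 1 - 1 = d - 2" by simp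
  then have red1: "red d (d - 1) = 1" "red d 1 = 1" "red d 0 = 0"
    unfolding red_def using d by (simp_all del: One_nat_def)
  have "{b\<in>Mon d. (\<lambda>m. red d (Poly_Mapping.lookup b m)) = ?\<beta>} = {spec k l, spec l k}"
  proof (intro equalityI subsetI)
    fix b assume "b \<in> {b\<in>Mon d. (\<lambda>m. red d (Poly_Mapping.lookup b m)) = ?\<beta>}"
    then have b: "b \<in> Mon d" "\<And>m. red d (Poly_Mapping.lookup b m) = ?\<beta> m" by (auto simp: fun_eq_iff)
    have z: "Poly_Mapping.lookup b m = 0" if "m \<noteq> k" "m \<noteq> l" for m using b(2)[of m] that by (simp add: red_eq_0_iff)
    have "(\<Sum>m\<in>UNIV. Poly_Mapping.lookup b m) = Poly_Mapping.lookup b k + Poly_Mapping.lookup b l"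
    proof -
      have "(\<Sum>m\<in>UNIV. Poly_Mapping.lookup b m) = (\<Sum>m\<in>{k, l}. Poly_Mapping.lookup b m)"
        by (rule sum.mono_neutral_right) (auto simp: z)
      then show ?thesis using assms(2) by simp
    qed
    then have s: "Poly_Mapping.lookup b k + Poly_Mapping.lookup b l = d" using b(1) by (simp add: Mon_def)
    have kl: "Poly_Mapping.lookup b k \<noteq> 0" "Poly_Mapping.lookup b l \<noteq> 0"
      using b(2)[of k] b(2)[of l] by (auto simp: red_def split: if_splits)
    have "(Poly_Mapping.lookup b k - 1) mod (d - 2) = 0" using b(2)[of k] kl by (simp add: red_def)
    then have "(d - 2) dvd (Poly_Mapping.lookup b k - 1)" by auto
    then obtain q where q: "Poly_Mapping.lookup b k - 1 = (d - 2) * q" by (auto simp: dvd_def)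
    have "Poly_Mapping.lookup b k - 1 \<le> d - 2" using s kl by linarith
    have "q \<le> 1"
    proof (rule ccontr)
      assume "\<not> q \<le> 1"
      then have "(d - 2) * 2 \<le> (d - 2) * q" by (intro mult_le_mono2) simp
      then show False using q \<open>Poly_Mapping.lookup b k - 1 \<le> d - 2\<close> d by linarith
    qed
    then have "q = 0 \<or> q = 1" by auto
    then show "b \<in> {spec k l, spec l k}"
    proof
      assume "q = 1"
      then have "Poly_Mapping.lookup b k = d - 1" "Poly_Mapping.lookup b l = 1" using q s kl d by auto
      then have "b = spec k l" using z assms(2) by (intro poly_mapping_eqI) (auto simp: lookup_spec)
      then show ?thesis by simp
    next
      assume "q = 0"
      then have "Poly_Mapping.lookup b k = 1" "Poly_Mapping.lookup b l = d - 1" using q s kl d by auto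
      then have "b = spec l k" using z assms(2) by (intro poly_mapping_eqI) (auto simp: lookup_spec)
      then show ?thesis by simp
    qed
  next
    fix b assume "b \<in> {spec k l, spec l k}"
    then show "b \<in> {b\<in>Mon d. (\<lambda>m. red d (Poly_Mapping.lookup b m)) = ?\<beta>}"
      using spec_in_Mon red1 assms(2) by (auto simp: lookup_spec fun_eq_iff)
  qed
  moreover have "spec k l \<noteq> spec l k"
  proof
    assume "spec k l = spec l k"
    then have "Poly_Mapping.lookup (spec k l) k = Poly_Mapping.lookup (spec l k) k" by simp
    then show False using assms(2) d by (simp add: lookup_spec)
  qed
  ultimately show ?thesis using minor_coeff_class[OF assms(1), of ?\<beta>] by simp
qed

text \<open>In the minor of the variables l and k the coefficient of x_k^d receives a single term,
  because x_l does not occur in that monomial.\<close>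

lemma coeff_spec_zero:
  assumes "k \<noteq> l" shows "\<gamma> (spec k l) = 0"
proof -
  have "shift k l (Poly_Mapping.single k d) = spec k l"
    using assms d by (intro poly_mapping_eqI) (auto simp: lookup_shift lookup_spec lookup_single)
  then show ?thesis using minor_coeff_pure[of l k k] assms d by (simp add: minor_coeff_def lookup_single)
qed

text \<open>These are the monomials of degree d whose exponents are not all reduced; they account
  for all exceptions below.\<close>

lemma large_entry:
  assumes "b \<in> Mon d" "Poly_Mapping.lookup b s \<ge> d - 1"
  shows "b = Poly_Mapping.single s d \<or> (\<exists>t. t \<noteq> s \<and> b = spec s t)"
proof -
  have sum: "Poly_Mapping.lookup b s + (\<Sum>k\<in>UNIV - {s}. Poly_Mapping.lookup b k) = d"
    using assms(1) unfolding Mon_def by (subst sum.remove[symmetric]) auto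
  show ?thesis
  proof (cases "\<exists>t. t \<noteq> s \<and> Poly_Mapping.lookup b t \<noteq> 0")
    case True
    then obtain t where t: "t \<noteq> s" "Poly_Mapping.lookup b t \<noteq> 0" by blast
    have sum2: "Poly_Mapping.lookup b s + (Poly_Mapping.lookup b t + (\<Sum>k\<in>UNIV - {s} - {t}. Poly_Mapping.lookup b k)) = d"
      using sum t(1) by (subst (asm) sum.remove[of _ t]) auto
    then have "(\<Sum>k\<in>UNIV - {s} - {t}. Poly_Mapping.lookup b k) = 0" and st: "Poly_Mapping.lookup b t = 1" "Poly_Mapping.lookup b s = d - 1"
      using assms(2) t(2) d by linarith+
    then have "Poly_Mapping.lookup b k = 0" if "k \<noteq> s" "k \<noteq> t" for k using that by auto
    then have "b = spec s t" using st t(1) by (intro poly_mapping_eqI) (auto simp: lookup_spec)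
    then show ?thesis using t(1) by blast
  next
    case False
    then have "(\<Sum>k\<in>UNIV - {s}. Poly_Mapping.lookup b k) = 0" by (intro sum.neutral) auto
    then have "Poly_Mapping.lookup b s = d" using sum by simp
    then have "b = Poly_Mapping.single s d" using False by (intro poly_mapping_eqI) (auto simp: lookup_single when_def)
    then show ?thesis by simp
  qed
qed

text \<open>Moving one unit from x_l to x_k leads to a monomial b whose minor coefficient ties
  \<open>\<gamma> a\<close> to a coefficient with exponent of x_l smaller by two; at exponent 1
  there is no second term. Hence induction on the odd exponent. Care is due when b is some
  \<open>spec s t\<close>, where minor coefficients are known only in pairs.\<close>

lemma coeff_odd_zero:
  assumes "CARD('n) \<ge> 2" "a \<in> Mon d" "\<And>k. a \<noteq> Poly_Mapping.single k d" "odd (Poly_Mapping.lookup a l)"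
  shows "\<gamma> a = 0"
  using assms(2-4)
proof (induction "Poly_Mapping.lookup a l" arbitrary: a rule: less_induct)
  case less
  have "\<exists>k. k \<noteq> l"
  proof (rule ccontr)
    assume "\<not> ?thesis"
    then have "UNIV = {l}" by auto
    then have "CARD('n) = 1" by (metis card.empty card.insert empty_iff finite.emptyI One_nat_def)
    then show False using assms(1) by simp
  qed
  then obtain k where k: "k \<noteq> l" by blast
  have al: "Poly_Mapping.lookup a l \<ge> 1" using less.prems(3) by (cases "Poly_Mapping.lookup a l") auto
  define b where "b = shift l k a"
  have b: "b \<in> Mon d" using less.prems(1) al by (simp add: b_def Mon_iff pdeg_shift)
  have ba: "shift k l b = a" using al k by (simp add: b_def shift_shift)
  have bk: "Poly_Mapping.lookup b k \<ge> 1" "Poly_Mapping.lookup b l = Poly_Mapping.lookup a l - 1"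
    using k by (auto simp: b_def lookup_shift)
  have second: "\<gamma> (shift l k b) = 0" if "Poly_Mapping.lookup b l \<ge> 1"
  proof (rule less.hyps)
    have "Poly_Mapping.lookup (shift l k b) l = Poly_Mapping.lookup a l - 2"
      using k bk(2) by (simp add: lookup_shift)
    moreover have "Poly_Mapping.lookup a l \<ge> 3" using that bk(2) less.prems(3) by (cases "Poly_Mapping.lookup a l = 2") auto
    ultimately show "Poly_Mapping.lookup (shift l k b) l < Poly_Mapping.lookup a l"
        "odd (Poly_Mapping.lookup (shift l k b) l)" using less.prems(3) by auto
    then have "Poly_Mapping.lookup (shift l k b) l \<noteq> 0" by (metis even_zero)
    moreover have "Poly_Mapping.lookup (shift l k b) k \<noteq> 0" using k by (simp add: lookup_shift)
    ultimately show "shift l k b \<noteq> Poly_Mapping.single m d" for m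
      using k by (metis lookup_single_not_eq)
    show "shift l k b \<in> Mon d" using b that by (simp add: Mon_iff pdeg_shift)
  qed
  have key: "minor_coeff \<gamma> l k b = \<gamma> a * of_nat (Poly_Mapping.lookup a l)"
  proof -
    have "Poly_Mapping.lookup b l + 1 = Poly_Mapping.lookup a l" using bk(2) al by simp
    then show ?thesis unfolding minor_coeff_def using bk(1) ba second by simp
  qed
  show ?case
  proof (cases "minor_coeff \<gamma> l k b = 0")
    case True
    then show ?thesis using key al by simp
  next
    case False
    then have "\<not> (\<forall>s. Poly_Mapping.lookup b s \<le> d - 2)" using minor_coeff_small[of l k b] b k by auto
    then obtain s where "\<not> Poly_Mapping.lookup b s \<le> d - 2" by blast
    then have s: "Poly_Mapping.lookup b s \<ge> d - 1" by linarith
    have "b \<noteq> Poly_Mapping.single s d" using False minor_coeff_pure[of l k] k by auto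
    then obtain t where t: "t \<noteq> s" "b = spec s t" using large_entry[OF b s] by blast
    have "s \<noteq> l"
    proof
      assume "s = l"
      then have "Poly_Mapping.lookup a l = d" using t bk(2) d al by (simp add: lookup_spec)
      then obtain t' where "t' \<noteq> l" "a = spec l t'"
        using large_entry[OF less.prems(1), of l] less.prems(2) by auto
      then show False using \<open>Poly_Mapping.lookup a l = d\<close> d by (simp add: lookup_spec)
    qed
    have "t \<noteq> l"
    proof
      assume "t = l"
      then have "Poly_Mapping.lookup b l = 1" using t \<open>s \<noteq> l\<close> by (simp add: lookup_spec)
      then have "Poly_Mapping.lookup a l = 2" using bk(2) al by linarith
      then show False using less.prems(3) by simp
    qed
    have "k = s \<or> k = t" using bk(1) t by (auto simp: lookup_spec split: if_splits)
    then show ?thesis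
    proof
      assume "k = t"
      then have "a = spec s l" using ba t k \<open>s \<noteq> l\<close> \<open>t \<noteq> l\<close>
        by (intro poly_mapping_eqI) (auto simp: lookup_shift lookup_spec)
      then show ?thesis using coeff_spec_zero[of s l] \<open>s \<noteq> l\<close> by simp
    next
      assume "k = s"
      \<comment> \<open>In the pair \<open>spec s t\<close>, \<open>spec t s\<close> the minor
        coefficient of the partner is a single value of \<gamma> already known to be 0, so both
        vanish.\<close>
      have "minor_coeff \<gamma> l s (spec t s) = \<gamma> (shift s l (spec t s))"
        using \<open>t \<noteq> l\<close> \<open>s \<noteq> l\<close> by (simp add: minor_coeff_def lookup_spec)
      also have "shift s l (spec t s) = spec t l"
        using \<open>t \<noteq> l\<close> \<open>s \<noteq> l\<close> t(1) by (intro poly_mapping_eqI) (auto simp: lookup_shift lookup_spec)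
      also have "\<gamma> (spec t l) = 0" using coeff_spec_zero[of t l] \<open>t \<noteq> l\<close> by simp
      finally have "minor_coeff \<gamma> l s (spec s t) = 0"
        using minor_coeff_spec[of l s s t] \<open>s \<noteq> l\<close> t(1) by simp
      then show ?thesis using False \<open>k = s\<close> t(2) by simp
    qed
  qed
qed

text \<open>Prescribing the coefficient of x_o^d removes the Fermat form and, for even d, that of
  x_o^(d-2) x_p^2 removes q^(d/2). Mixed monomials with all exponents even are linked by shifting
  two units between variables; the pure powers come last, from the paired minor
  coefficients.\<close>

lemma coeff_zero:
  assumes "o' \<noteq> p" and o: "\<gamma> (Poly_Mapping.single o' d) = 0"
    and op: "even d \<Longrightarrow> \<gamma> (Poly_Mapping.single o' (d - 2) + Poly_Mapping.single p 2) = 0"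
    and a: "a \<in> Mon d"
  shows "\<gamma> a = 0"
proof -
  have card: "CARD('n) \<ge> 2"
  proof -
    have "card {o', p} \<le> CARD('n)" by (intro card_mono) auto
    then show ?thesis using assms(1) by simp
  qed
  \<comment> \<open>The monomial halfway has odd exponents exactly at x_i and x_j; since neither end
    is a pure power, it lies in a singleton class.\<close>
  have move: "\<gamma> a = 0"
    if "even d" "a \<in> Mon d" "\<And>k. a \<noteq> Poly_Mapping.single k d" "\<And>l. even (Poly_Mapping.lookup a l)"
      "i \<noteq> j" "Poly_Mapping.lookup a i \<ge> 2" "\<And>k. shift i j (shift i j a) \<noteq> Poly_Mapping.single k d"
      "\<gamma> (shift i j (shift i j a)) = 0" for a i j
  proof -
    define b where "b = shift i j a"
    have b: "b \<in> Mon d" using that by (simp add: b_def Mon_iff pdeg_shift)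
    have ba: "shift j i b = a" using that by (simp add: b_def shift_shift)
    have lb: "Poly_Mapping.lookup b i = Poly_Mapping.lookup a i - 1" "Poly_Mapping.lookup b j = Poly_Mapping.lookup a j + 1"
      using that(5) by (auto simp: b_def lookup_shift)
    have oddb: "odd (Poly_Mapping.lookup b i)" "odd (Poly_Mapping.lookup b j)"
      using that(4)[of i] that(4)[of j] that(6) lb by auto
    have evenb: "even (Poly_Mapping.lookup b k)" if "k \<noteq> i" "k \<noteq> j" for k
      using that \<open>\<And>l. even (Poly_Mapping.lookup a l)\<close>[of k] by (simp add: b_def lookup_shift)
    have "Poly_Mapping.lookup b s \<le> d - 2" for s
    proof (rule ccontr)
      assume "\<not> ?thesis"
      then have "Poly_Mapping.lookup b s \<ge> d - 1" by linarith
      then consider "b = Poly_Mapping.single s d" | t where "t \<noteq> s" "b = spec s t"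
        using large_entry[OF b] by blast
      then show False
      proof cases
        case 1
        then show ?thesis using oddb that(5) by (metis even_zero lookup_single_not_eq)
      next
        case 2
        have "odd (Poly_Mapping.lookup b s)" "odd (Poly_Mapping.lookup b t)"
          using 2 that(1) d by (auto simp: lookup_spec)
        then have st: "s = i \<or> s = j" "t = i \<or> t = j" using evenb by blast+
        then consider "s = i" "t = j" | "s = j" "t = i" using 2(1) by blast
        then show ?thesis
        proof cases
          case 1
          have "a = Poly_Mapping.single i d"
            unfolding ba[symmetric] 2(2) using 1 that(5) d
            by (intro poly_mapping_eqI) (auto simp: lookup_shift lookup_spec lookup_single when_def)
          then show ?thesis using that(3) by blast
        next
          case b: 2
          have "shift i j (shift i j a) = Poly_Mapping.single j d"
            unfolding b_def[symmetric] 2(2) using b that(5) d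
            by (intro poly_mapping_eqI) (auto simp: lookup_shift lookup_spec lookup_single when_def)
          then show ?thesis using that(7) by blast
        qed
      qed
    qed
    then have "minor_coeff \<gamma> i j b = 0" by (intro minor_coeff_small that(5) b)
    moreover have "minor_coeff \<gamma> i j b = \<gamma> a * of_nat (Poly_Mapping.lookup b i + 1)"
      unfolding minor_coeff_def using ba lb that(8) unfolding b_def[symmetric] by simp
    moreover have "of_nat (Poly_Mapping.lookup b i + 1) \<noteq> (0 :: complex)" by (simp only: of_nat_eq_0_iff add_is_0 one_neq_zero simp_thms)
    ultimately show ?thesis by (metis mult_eq_0_iff)
  qed
  \<comment> \<open>Units are moved to x_o two at a time until its exponent is d - 2; then the last
    two are moved to x_p.\<close>
  have evens: "\<gamma> a = 0"
    if "even d" "a \<in> Mon d" "\<And>k. a \<noteq> Poly_Mapping.single k d" "\<And>l. even (Poly_Mapping.lookup a l)" for a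
    using that(2-4)
  proof (induction "d - Poly_Mapping.lookup a o'" arbitrary: a rule: less_induct)
    case less
    have tot: "(\<Sum>k\<in>UNIV. Poly_Mapping.lookup a k) = d" using less.prems(1) by (simp add: Mon_def)
    have so: "Poly_Mapping.lookup a o' + (\<Sum>k\<in>UNIV - {o'}. Poly_Mapping.lookup a k) = d"
      using tot by (subst (asm) sum.remove[of _ o']) auto
    have "\<exists>i. i \<noteq> o' \<and> Poly_Mapping.lookup a i \<noteq> 0"
    proof (rule ccontr)
      assume *: "\<not> ?thesis"
      then have "(\<Sum>k\<in>UNIV - {o'}. Poly_Mapping.lookup a k) = 0" by (intro sum.neutral) auto
      then have "Poly_Mapping.lookup a o' = d" using so by simp
      then have "a = Poly_Mapping.single o' d" using * by (intro poly_mapping_eqI) (auto simp: lookup_single when_def)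
      then show False using less.prems(2) by blast
    qed
    then obtain i where i: "i \<noteq> o'" "Poly_Mapping.lookup a i \<noteq> 0" by blast
    then have i2: "Poly_Mapping.lookup a i \<ge> 2" using less.prems(3)[of i] by (cases "Poly_Mapping.lookup a i = 1") auto
    have so2: "Poly_Mapping.lookup a o' + (Poly_Mapping.lookup a i + (\<Sum>k\<in>UNIV - {o'} - {i}. Poly_Mapping.lookup a k)) = d"
      using so i(1) by (subst (asm) sum.remove[of _ i]) auto
    show ?case
    proof (cases "Poly_Mapping.lookup a o' = d - 2")
      case True
      then have "Poly_Mapping.lookup a i = 2" "(\<Sum>k\<in>UNIV - {o'} - {i}. Poly_Mapping.lookup a k) = 0"
        using so2 i2 d by linarith+
      then have aeq: "a = Poly_Mapping.single o' (d - 2) + Poly_Mapping.single i 2"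
        using True i(1) by (intro poly_mapping_eqI) (auto simp: Poly_Mapping.lookup_add lookup_single when_def)
      show ?thesis
      proof (cases "i = p")
        case True
        then show ?thesis using op[OF that(1)] aeq by simp
      next
        case False
        have sh: "shift i p (shift i p a) = Poly_Mapping.single o' (d - 2) + Poly_Mapping.single p 2"
          unfolding aeq using False i(1) assms(1)
          by (intro poly_mapping_eqI) (auto simp: lookup_shift Poly_Mapping.lookup_add lookup_single when_def)
        show ?thesis
        proof (rule move[OF that(1) less.prems False i2])
          show "\<gamma> (shift i p (shift i p a)) = 0" using op[OF that(1)] sh by simp
          fix k
          have "Poly_Mapping.lookup (shift i p (shift i p a)) o' \<noteq> 0" "Poly_Mapping.lookup (shift i p (shift i p a)) p \<noteq> 0"
            unfolding sh using assms(1) d by (auto simp: Poly_Mapping.lookup_add lookup_single when_def)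
          then show "shift i p (shift i p a) \<noteq> Poly_Mapping.single k d" using assms(1) by (metis lookup_single_not_eq)
        qed
      qed
    next
      case False
      have lt: "Poly_Mapping.lookup a o' + 2 < d" using so2 i2 False by linarith
      let ?a = "shift i o' (shift i o' a)"
      have lo: "Poly_Mapping.lookup ?a o' = Poly_Mapping.lookup a o' + 2" using i(1) by (simp add: lookup_shift)
      have np: "?a \<noteq> Poly_Mapping.single k d" for k
        using lo lt by (metis add_is_0 less_irrefl lookup_single_eq lookup_single_not_eq zero_neq_numeral)
      have "1 \<le> Poly_Mapping.lookup a i" "1 \<le> Poly_Mapping.lookup (shift i o' a) i"
        using i2 i(1) by (auto simp: lookup_shift)
      then have "?a \<in> Mon d" using less.prems(1) by (simp add: Mon_iff pdeg_shift)
      moreover have "even (Poly_Mapping.lookup ?a l)" for l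
        using less.prems(3)[of l] i2 by (auto simp: lookup_shift)
      ultimately have "\<gamma> ?a = 0" using less.hyps[of ?a] lo lt np by auto
      then show ?thesis by (intro move[OF that(1) less.prems i(1) i2 np])
    qed
  qed
  have nonpure: "\<gamma> a = 0" if "a \<in> Mon d" "\<And>k. a \<noteq> Poly_Mapping.single k d" for a
  proof (cases "\<exists>l. odd (Poly_Mapping.lookup a l)")
    case True
    then show ?thesis using coeff_odd_zero[OF card that] by blast
  next
    case False
    have "even (\<Sum>k\<in>UNIV. Poly_Mapping.lookup a k)" using False by (intro dvd_sum) auto
    then have "even d" using that(1) by (simp add: Mon_def)
    then show ?thesis using evens[OF _ that] False by blast
  qed
  have mixed: "\<gamma> (Poly_Mapping.single k (d - 2) + Poly_Mapping.single l 2) = 0" if "k \<noteq> l" for k l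
  proof (rule nonpure)
    show "Poly_Mapping.single k (d - 2) + Poly_Mapping.single l 2 \<in> Mon d"
      using d by (simp add: Mon_iff pdeg_add) (simp add: pdeg_def)
    fix m
    have "Poly_Mapping.lookup (Poly_Mapping.single k (d - 2) + Poly_Mapping.single l 2) k \<noteq> (0 :: nat)"
      "Poly_Mapping.lookup (Poly_Mapping.single k (d - 2) + Poly_Mapping.single l 2) l \<noteq> (0 :: nat)"
      using d by (auto simp: Poly_Mapping.lookup_add lookup_single when_def)
    then show "Poly_Mapping.single k (d - 2) + Poly_Mapping.single l 2 \<noteq> Poly_Mapping.single m d"
      using that by (metis lookup_single_not_eq)
  qed
  \<comment> \<open>The minor coefficients at \<open>spec o' k\<close> and \<open>spec k o'\<close>
    add up to 0. The first is a combination of known zeros, and the second is -d times the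
    coefficient of x_k^d.\<close>
  have pure: "\<gamma> (Poly_Mapping.single k d) = 0" for k
  proof (cases "k = o'")
    case True
    then show ?thesis using o by simp
  next
    case False
    have 1: "shift k o' (spec o' k) = Poly_Mapping.single o' d" "shift o' k (spec k o') = Poly_Mapping.single k d"
      "shift o' k (spec o' k) = Poly_Mapping.single o' (d - 2) + Poly_Mapping.single k 2"
      "shift k o' (spec k o') = Poly_Mapping.single k (d - 2) + Poly_Mapping.single o' 2"
      using False d by (auto intro!: poly_mapping_eqI simp: lookup_shift lookup_spec Poly_Mapping.lookup_add lookup_single when_def)
    have "minor_coeff \<gamma> o' k (spec o' k) = 0"
      unfolding minor_coeff_def 1 using o mixed[of o' k] False by simp
    then have "minor_coeff \<gamma> o' k (spec k o') = 0" using minor_coeff_spec[of o' k o' k] False by simp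
    moreover have "minor_coeff \<gamma> o' k (spec k o') = - (\<gamma> (Poly_Mapping.single k d) * of_nat d)"
      unfolding minor_coeff_def 1 using mixed[of k o'] False d by (simp add: lookup_spec)
    ultimately show ?thesis using d by simp
  qed
  show ?thesis using nonpure[OF a] pure by metis
qed

end

section \<open>Quantitative injectivity of linear maps\<close>

lemma functional_span:
  fixes f :: "'j \<Rightarrow> ('b \<Rightarrow> complex) \<Rightarrow> complex"
  assumes "finite J" and f: "\<And>j u v c. f j (\<lambda>b. u b + c * v b) = f j u + c * f j v"
    and "\<And>u v c. g (\<lambda>b. u b + c * v b) = g u + c * g v"
    and "\<And>v. (\<And>j. j \<in> J \<Longrightarrow> f j v = 0) \<Longrightarrow> g v = 0"
  shows "\<exists>c. \<forall>v. g v = (\<Sum>j\<in>J. c j * f j v)"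
  using assms(1,3,4)
proof (induction J arbitrary: g rule: finite_induct)
  case empty
  then show ?case by simp
next
  case (insert j J)
  show ?case
  proof (cases "\<exists>w. (\<forall>i\<in>J. f i w = 0) \<and> f j w \<noteq> 0")
    case True
    then obtain w where w: "\<And>i. i \<in> J \<Longrightarrow> f i w = 0" "f j w \<noteq> 0" by blast
    define k where "k = g w / f j w"
    have "\<exists>c. \<forall>v. g v - k * f j v = (\<Sum>i\<in>J. c i * f i v)"
    proof (rule insert.IH)
      show "g (\<lambda>b. u b + c * v b) - k * f j (\<lambda>b. u b + c * v b) =
          g u - k * f j u + c * (g v - k * f j v)" for u v c
        unfolding insert.prems(1) f by (simp add: algebra_simps)
      fix v assume v: "\<And>i. i \<in> J \<Longrightarrow> f i v = 0"
      let ?u = "\<lambda>b. v b + (- f j v / f j w) * w b"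
      have "g ?u = 0"
      proof (rule insert.prems(2))
        fix i assume "i \<in> insert j J"
        then show "f i ?u = 0" unfolding f using v w by auto
      qed
      then show "g v - k * f j v = 0" unfolding insert.prems(1) k_def by (simp add: field_simps)
    qed
    then obtain c where c: "\<And>v. g v - k * f j v = (\<Sum>i\<in>J. c i * f i v)" by blast
    have "g v = (\<Sum>i\<in>insert j J. (c(j := k)) i * f i v)" for v
    proof -
      have "(\<Sum>i\<in>J. (c(j := k)) i * f i v) = (\<Sum>i\<in>J. c i * f i v)"
        using insert.hyps by (intro sum.cong) auto
      then show ?thesis using insert.hyps c[of v] by (simp add: algebra_simps)
    qed
    then show ?thesis by blast
  next
    case False
    have "\<exists>c. \<forall>v. g v = (\<Sum>i\<in>J. c i * f i v)"
    proof (rule insert.IH)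
      fix v assume "\<And>i. i \<in> J \<Longrightarrow> f i v = 0"
      then show "g v = 0" using False insert.prems(2)[of v] by blast
    qed (rule insert.prems(1))
    then obtain c where c: "\<And>v. g v = (\<Sum>i\<in>J. c i * f i v)" by blast
    have "g v = (\<Sum>i\<in>insert j J. (c(j := 0)) i * f i v)" for v
    proof -
      have "(\<Sum>i\<in>J. (c(j := 0)) i * f i v) = (\<Sum>i\<in>J. c i * f i v)"
        using insert.hyps by (intro sum.cong) auto
      then show ?thesis using insert.hyps c[of v] by simp
    qed
    then show ?thesis by blast
  qed
qed

text \<open>Injectivity writes each coordinate on B as a combination of the functionals
  \<open>f j\<close>, with coefficients bounded by T. The factor 1/2 in the conclusion is aimed at
  self-improvement: if \<mu> is the maximum of the |v b|, it gives \<mu> \<le> \<mu>/2 and hence v =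
  0.\<close>

lemma injective_bounded_below:
  fixes f :: "'j \<Rightarrow> ('b \<Rightarrow> complex) \<Rightarrow> complex"
  assumes "finite J" "finite B" and f: "\<And>j u v c. f j (\<lambda>b. u b + c * v b) = f j u + c * f j v"
    and inj: "\<And>v. (\<And>b. b \<notin> B \<Longrightarrow> v b = 0) \<Longrightarrow> (\<And>j. j \<in> J \<Longrightarrow> f j v = 0) \<Longrightarrow> (\<forall>b\<in>B. v b = 0)"
  obtains \<eta> where "\<eta> > 0" "\<And>v \<mu>. (\<And>b. b \<notin> B \<Longrightarrow> v b = 0) \<Longrightarrow> (\<And>j. j \<in> J \<Longrightarrow> norm (f j v) \<le> \<eta> * \<mu>) \<Longrightarrow>
     \<mu> \<ge> 0 \<Longrightarrow> (\<forall>b\<in>B. norm (v b) \<le> \<mu> / 2)"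
proof -
  let ?r = "\<lambda>v b. if b \<in> B then v b else 0"
  have "\<exists>c. \<forall>v. v b = (\<Sum>j\<in>J. c j * f j (?r v))" if "b \<in> B" for b
  proof (rule functional_span[OF assms(1), of "\<lambda>j v. f j (?r v)" "\<lambda>v. v b"])
    fix j u v and c :: complex
    have "?r (\<lambda>b. u b + c * v b) = (\<lambda>b. ?r u b + c * ?r v b)" by auto
    then show "f j (?r (\<lambda>b. u b + c * v b)) = f j (?r u) + c * f j (?r v)" by (simp only: f)
  next
    fix v assume "\<And>j. j \<in> J \<Longrightarrow> f j (?r v) = 0"
    then have "\<forall>b\<in>B. ?r v b = 0" by (intro inj) auto
    then show "v b = 0" using that by auto
  qed simp
  then obtain E where E: "\<And>b v. b \<in> B \<Longrightarrow> v b = (\<Sum>j\<in>J. E b j * f j (?r v))" by metis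
  define T where "T = 1 + (\<Sum>b\<in>B. \<Sum>j\<in>J. norm (E b j))"
  have T: "T > 0" unfolding T_def by (intro add_pos_nonneg sum_nonneg) auto
  show thesis
  proof (rule that[of "1 / (2 * T)"])
    show "1 / (2 * T) > 0" using T by simp
    fix v and \<mu> :: real assume v: "\<And>b. b \<notin> B \<Longrightarrow> v b = 0" "\<And>j. j \<in> J \<Longrightarrow> norm (f j v) \<le> 1 / (2 * T) * \<mu>" "\<mu> \<ge> 0"
    have rv: "?r v = v" using v(1) by auto
    show "\<forall>b\<in>B. norm (v b) \<le> \<mu> / 2"
    proof
      fix b assume b: "b \<in> B"
      have "norm (v b) \<le> (\<Sum>j\<in>J. norm (E b j) * (1 / (2 * T) * \<mu>))"
        unfolding E[OF b, of v] rv
        by (rule sum_norm_le, simp only: norm_mult) (intro mult_left_mono v(2) norm_ge_zero)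
      also have "\<dots> = (\<Sum>j\<in>J. norm (E b j)) * (1 / (2 * T) * \<mu>)" by (simp only: sum_distrib_right)
      also have "\<dots> \<le> T * (1 / (2 * T) * \<mu>)"
      proof (rule mult_right_mono)
        have "(\<Sum>j\<in>J. norm (E b j)) \<le> (\<Sum>b\<in>B. \<Sum>j\<in>J. norm (E b j))"
          by (rule member_le_sum[OF b]) (auto intro: sum_nonneg assms(2))
        then show "(\<Sum>j\<in>J. norm (E b j)) \<le> T" by (simp add: T_def)
      qed (use T v(3) in auto)
      also have "\<dots> = \<mu> / 2" using T by simp
      finally show "norm (v b) \<le> \<mu> / 2" .
    qed
  qed
qed

text \<open>Set to 0 for odd d, so that one statement covers both parities.\<close>

definition qcoeff :: "nat \<Rightarrow> ('n::finite \<Rightarrow>\<^sub>0 nat) \<Rightarrow> complex" where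
  "qcoeff d a = (if even d then Poly_Mapping.lookup (q_form ^ (d div 2)) a else 0)"

lemma qcoeff_outside: "a \<notin> Mon d \<Longrightarrow> qcoeff d a = 0"
  using q_power_Sym[of d] by (auto simp: qcoeff_def Sym_iff)

lemma minor_lin: "minor d (\<lambda>a. u a + c * v a) i j x = minor d u i j x + c * minor d v i j x"
  by (simp add: minor_def gradc_add gradc_cmult algebra_simps)

lemma minor_qcoeff: "d > 0 \<Longrightarrow> minor d (qcoeff d) i j x = 0"
proof (cases "even d")
  case True
  assume "d > 0"
  moreover have "qcoeff d = Poly_Mapping.lookup (q_form ^ (d div 2) :: 'a cpoly)" using True by (simp add: qcoeff_def[abs_def])
  ultimately show ?thesis using eigc_q_power[OF True, of x] by (simp add: eigc_minor)
next
  case False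
  then show ?thesis by (simp add: minor_def gradc_def qcoeff_def)
qed

lemma minor_fermat: "d > 0 \<Longrightarrow> minor d (fermat d) i j x = of_nat d * (x i ^ (d - 1) * x j - x j ^ (d - 1) * x i)"
  by (simp add: minor_def gradc_fermat algebra_simps)

lemma minor_fermat_grid:
  assumes "d \<ge> 3" "r \<in> grid d" shows "minor d (fermat d) i j (($) r) = 0"
proof -
  have "r $ k ^ (d - 1) = r $ k" for k using assms roots_iff[of d "r $ k"] by (simp add: grid_def)
  then show ?thesis using assms(1) by (simp add: minor_fermat)
qed

abbreviation mixed_mon :: "nat \<Rightarrow> 'n \<Rightarrow> 'n \<Rightarrow> ('n \<Rightarrow>\<^sub>0 nat)" where
  "mixed_mon d k l \<equiv> Poly_Mapping.single k (d - 2) + Poly_Mapping.single l 2"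

lemma mixed_mon_in_Mon: "d \<ge> 3 \<Longrightarrow> mixed_mon d k l \<in> Mon d"
  by (simp add: Mon_iff pdeg_add) (simp add: pdeg_def)

lemma mixed_mon_neq:
  assumes "d \<ge> 3" "k \<noteq> l" shows "mixed_mon d k l \<noteq> Poly_Mapping.single m d"
proof -
  have "Poly_Mapping.lookup (mixed_mon d k l) k \<noteq> 0" "Poly_Mapping.lookup (mixed_mon d k l) l \<noteq> 0"
    using assms by (auto simp: Poly_Mapping.lookup_add lookup_single when_def)
  then show ?thesis using assms(2) by (metis lookup_single_not_eq)
qed

lemma fermat_mixed: "d \<ge> 3 \<Longrightarrow> k \<noteq> l \<Longrightarrow> fermat d (mixed_mon d k l) = 0"
  by (simp add: fermat_def mixed_mon_neq)

lemma fermat_single: "fermat d (Poly_Mapping.single k d) = 1"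
  by (auto simp: fermat_def)

text \<open>Proved without expanding the power: if the coefficient were 0, \<open>coeff_zero\<close>
  would make q^(d/2) a multiple of the Fermat form. As the latter has vectors that are not
  eigenvectors, the multiple would be 0.\<close>

lemma qcoeff_mixed_nonzero:
  assumes "even d" "d \<ge> 3" "(k :: 'n::finite) \<noteq> l"
  shows "qcoeff d (mixed_mon d k l) \<noteq> 0"
proof
  assume z: "qcoeff d (mixed_mon d k l) = 0"
  define c where "c = qcoeff d (Poly_Mapping.single k d)"
  let ?g = "\<lambda>a :: 'n \<Rightarrow>\<^sub>0 nat. qcoeff d a + (- c) * fermat d a"
  have zero: "?g a = 0" if "a \<in> Mon d" for a
  proof (rule coeff_zero[where d = d and \<gamma> = ?g and o' = k and p = l])
    show "minor d ?g i j (($) r) = 0" if "r \<in> grid d" for r i j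
      unfolding minor_lin using assms minor_qcoeff[of d] minor_fermat_grid[OF _ that] by simp
    show "?g (Poly_Mapping.single k d) = 0" by (simp add: fermat_single c_def)
    show "?g (mixed_mon d k l) = 0" using z fermat_mixed[OF assms(2,3)] by simp
  qed (use assms that in auto)
  \<comment> \<open>Not an eigenvector of the Fermat form, since 2^(d-1) differs from 2.\<close>
  let ?x = "\<lambda>i. if i = k then 1 else if i = l then 2 else (0 :: complex)"
  have "minor d ?g k l ?x = 0"
  proof -
    have "gradc d ?g ?x i = 0" for i unfolding gradc_def using zero by (intro sum.neutral) auto
    then show ?thesis by (simp add: minor_def)
  qed
  then have "c * (of_nat d * (2 - 2 ^ (d - 1))) = 0"
    unfolding minor_lin using minor_qcoeff[of d k l ?x] minor_fermat[of d k l ?x] assms by simp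
  moreover have "(2 :: complex) - 2 ^ (d - 1) \<noteq> 0"
  proof
    assume "(2 :: complex) - 2 ^ (d - 1) = 0"
    then have "(2 :: complex) ^ (d - 1) = 2 ^ 1" by simp
    then have "norm ((2 :: complex) ^ (d - 1)) = norm ((2 :: complex) ^ 1)" by simp
    then have "(2 :: real) ^ (d - 1) = 2 ^ 1" by (simp add: norm_power)
    then have "d - 1 = 1" using power_inject_exp[of "2 :: real" "d - 1" 1] by simp
    then show False using assms(2) by simp
  qed
  ultimately have "c = 0" using assms(2) by auto
  then have qz: "qcoeff d a = 0" if "a \<in> Mon d" for a :: "'n \<Rightarrow>\<^sub>0 nat" using zero[OF that] by simp
  \<comment> \<open>Here q = 1, so the gradient of q^(d/2) is not 0.\<close>
  let ?y = "\<lambda>i. if i = k then 1 else (0 :: complex)"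
  have "gradc d (qcoeff d) ?y k = 0" unfolding gradc_def using qz by (intro sum.neutral) auto
  moreover have "qcoeff d = Poly_Mapping.lookup (q_form ^ (d div 2) :: 'n cpoly)" using assms(1) by (simp add: qcoeff_def[abs_def])
  moreover have "(\<Sum>j\<in>UNIV. ?y j ^ 2) = 1"
    by (subst sum.remove[of _ k]) auto
  ultimately show False using gradc_q_power[OF assms(1), of ?y k] assms(2) by simp
qed

text \<open>Transferring injectivity from the grid to the perturbed eigenvectors requires \<rho> and
  \<delta> to be small compared with the constant of that linear problem, hence a second
  locale.\<close>

locale fermat_star = fermat_perturbation d \<rho> \<delta> C "TYPE('n::finite)" for d :: nat and \<rho> \<delta> C :: real +
  assumes star: "\<And>\<phi> \<gamma>. near_fermat d \<delta> \<phi> \<Longrightarrow> (\<And>r. r \<in> grid d \<Longrightarrow> eigc d \<gamma> (($) (sol \<phi> r :: complex ^ 'n)))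
    \<Longrightarrow> \<exists>\<alpha> \<beta>. \<forall>a\<in>Mon d. \<gamma> a = \<alpha> * \<phi> a + \<beta> * qcoeff d a"

lemma minor_close:
  fixes x y :: "complex ^ 'n::finite"
  assumes C: "\<And>x y i. x \<in> cball (0 :: complex ^ 'n) K \<Longrightarrow> y \<in> cball 0 K \<Longrightarrow>
      norm (gradc d h (($) x) i) \<le> \<mu> * C \<and> norm (gradc d h (($) x) i - gradc d h (($) y) i) \<le> \<mu> * C * dist x y"
    and xy: "x \<in> cball 0 K" "y \<in> cball 0 K" and pos: "\<mu> \<ge> 0" "C \<ge> 0"
  shows "norm (minor d h i j (($) x) - minor d h i j (($) y)) \<le> 2 * (K + 1) * C * dist x y * \<mu>"
proof -
  have one: "norm (gradc d h (($) x) i * x $ j - gradc d h (($) y) i * y $ j) \<le> (K + 1) * C * dist x y * \<mu>" for i j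
  proof -
    have "gradc d h (($) x) i * x $ j - gradc d h (($) y) i * y $ j =
        (gradc d h (($) x) i - gradc d h (($) y) i) * x $ j + gradc d h (($) y) i * (x - y) $ j"
      by (simp add: algebra_simps)
    also have "norm \<dots> \<le> (\<mu> * C * dist x y) * K + (\<mu> * C) * dist x y"
    proof (rule norm_triangle_le, rule add_mono)
      have "norm (x $ j) \<le> K" using xy(1) Finite_Cartesian_Product.norm_nth_le[of x j] by simp
      then show "norm ((gradc d h (($) x) i - gradc d h (($) y) i) * x $ j) \<le> (\<mu> * C * dist x y) * K"
        unfolding norm_mult using C[OF xy, of i] pos by (intro mult_mono) auto
      have "norm ((x - y) $ j) \<le> dist x y" using Finite_Cartesian_Product.norm_nth_le[of "x - y" j] by (simp only: dist_norm)
      then show "norm (gradc d h (($) y) i * (x - y) $ j) \<le> (\<mu> * C) * dist x y"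
        unfolding norm_mult using C[OF xy(2,1), of i] pos by (intro mult_mono) auto
    qed
    finally show ?thesis by (simp add: algebra_simps)
  qed
  have "minor d h i j (($) x) - minor d h i j (($) y) =
      (gradc d h (($) x) i * x $ j - gradc d h (($) y) i * y $ j) - (gradc d h (($) x) j * x $ i - gradc d h (($) y) j * y $ i)"
    by (simp add: minor_def)
  then have "norm (minor d h i j (($) x) - minor d h i j (($) y)) \<le>
      (K + 1) * C * dist x y * \<mu> + (K + 1) * C * dist x y * \<mu>"
    by (simp only:) (rule order_trans[OF norm_triangle_ineq4 add_mono[OF one one]])
  then show ?thesis by (simp add: algebra_simps)
qed

text \<open>Near the Fermat form the coefficients of \<phi> at x_k^d and x_k^(d-2) x_l^2 are close
  to 1 and 0. For even d the last hypothesis then makes the 2 x 2 determinant nonzero, since it is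
  close to the coefficient of q^(d/2) at the second monomial.\<close>

lemma normalise_coeffs:
  fixes \<phi> :: "('n::finite \<Rightarrow>\<^sub>0 nat) \<Rightarrow> complex"
  assumes "d \<ge> 3" "k \<noteq> l" and near: "near_fermat d \<delta> \<phi>" and "\<delta> \<le> 1 / 2"
    and \<delta>: "even d \<Longrightarrow> \<delta> * (norm (qcoeff d (mixed_mon d k l)) + norm (qcoeff d (Poly_Mapping.single k d))) < norm (qcoeff d (mixed_mon d k l))"
  shows "\<exists>\<alpha> \<beta>. \<gamma> (Poly_Mapping.single k d) = \<alpha> * \<phi> (Poly_Mapping.single k d) + \<beta> * qcoeff d (Poly_Mapping.single k d) \<and>
     (even d \<longrightarrow> \<gamma> (mixed_mon d k l) = \<alpha> * \<phi> (mixed_mon d k l) + \<beta> * qcoeff d (mixed_mon d k l))"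
proof -
  define p q r s where "p = \<phi> (Poly_Mapping.single k d)" "q = qcoeff d (Poly_Mapping.single k d)"
    "r = \<phi> (mixed_mon d k l)" "s = qcoeff d (mixed_mon d k l)"
  have n: "norm (p - 1) < \<delta>" "norm r < \<delta>"
    using near single_in_Mon[of k d] mixed_mon_in_Mon[OF assms(1), of k l] fermat_mixed[OF assms(1,2)]
    unfolding near_fermat_def p_q_r_s_def by (metis fermat_single, metis diff_zero)
  have "p \<noteq> 0" using n(1) assms(4) by auto
  show ?thesis
  proof (cases "even d")
    case False
    then have "q = 0" by (simp add: p_q_r_s_def qcoeff_def)
    then show ?thesis unfolding p_q_r_s_def[symmetric] using False \<open>p \<noteq> 0\<close>
      by (intro exI[of _ "\<gamma> (Poly_Mapping.single k d) / p"] exI[of _ 0]) simp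
  next
    case True
    have "s \<noteq> 0" unfolding p_q_r_s_def by (rule qcoeff_mixed_nonzero[OF True assms(1,2)])
    have det: "p * s - r * q \<noteq> 0"
    proof
      assume "p * s - r * q = 0"
      then have "s = r * q - (p - 1) * s" by (simp add: algebra_simps)
      then have "norm s \<le> norm r * norm q + norm (p - 1) * norm s" by (metis norm_mult norm_triangle_ineq4)
      also have "\<dots> \<le> \<delta> * norm q + \<delta> * norm s" using n by (intro add_mono mult_right_mono) auto
      also have "\<dots> = \<delta> * (norm s + norm q)" by (simp add: algebra_simps)
      finally show False using \<delta>[OF True] unfolding p_q_r_s_def by simp
    qed
    let ?u = "\<gamma> (Poly_Mapping.single k d)" and ?v = "\<gamma> (mixed_mon d k l)"
    have "?u = ((?u * s - ?v * q) / (p * s - r * q)) * p + ((p * ?v - r * ?u) / (p * s - r * q)) * q"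
      "?v = ((?u * s - ?v * q) / (p * s - r * q)) * r + ((p * ?v - r * ?u) / (p * s - r * q)) * s"
      using det by (simp_all add: divide_simps) (simp_all add: algebra_simps)
    then show ?thesis unfolding p_q_r_s_def[symmetric] by blast
  qed
qed

text \<open>Subtract from \<gamma> a combination of \<phi> and q^(d/2) so that the normalising
  coefficients vanish. The minors of the remainder h are 0 at the solutions and therefore at most
  \<eta> max|h| at the nearby grid points; the bound from injectivity then halves max|h|, so h =
  0.\<close>

lemma fermat_star_exists:
  assumes d: "d \<ge> 3" and n: "CARD('n::finite) \<ge> 2"
  obtains \<rho> \<delta> C where "fermat_star TYPE('n) d \<rho> \<delta> C"
proof -
  obtain k l :: 'n where kl: "k \<noteq> l"
    using n by (metis (full_types) One_nat_def card_1_singleton_iff card_gt_0_iff UNIV_I UNIV_eq_I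
        card.infinite finite le_antisym nat_le_linear not_numeral_le_zero numeral_le_one_iff semiring_norm(69) singletonI zero_less_card_finite)
  define B where "B = Mon d - {Poly_Mapping.single k d} - (if even d then {mixed_mon d k l} else {})"
  define J where "J = (grid d :: (complex ^ 'n) set) \<times> (UNIV :: 'n set) \<times> (UNIV :: 'n set)"
  let ?f = "\<lambda>(r, i, j) v. minor d v i j (($) (r :: complex ^ 'n))"
  have "finite J" unfolding J_def using finite_grid[OF d] by (intro finite_SigmaI) auto
  moreover have "finite B" unfolding B_def by simp
  moreover have "?f t (\<lambda>b. u b + c * v b) = ?f t u + c * ?f t v" for t u v c
    by (cases t) (simp add: minor_lin)
  moreover have "\<forall>b\<in>B. v b = 0" if v: "\<And>b. b \<notin> B \<Longrightarrow> v b = 0" and z: "\<And>t. t \<in> J \<Longrightarrow> ?f t v = 0" for v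
  proof
    fix b assume "b \<in> B"
    show "v b = 0"
    proof (rule coeff_zero[where d = d and \<gamma> = v and o' = k and p = l])
      show "minor d v i j (($) r) = 0" if "r \<in> grid d" for r i j
        using z[of "(r, i, j)"] that by (simp add: J_def)
    qed (use v \<open>b \<in> B\<close> d kl in \<open>auto simp: B_def\<close>)
  qed
  ultimately obtain \<eta> where \<eta>: "\<eta> > 0" "\<And>v \<mu>. (\<And>b. b \<notin> B \<Longrightarrow> v b = 0) \<Longrightarrow>
      (\<And>t. t \<in> J \<Longrightarrow> norm (?f t v) \<le> \<eta> * \<mu>) \<Longrightarrow> \<mu> \<ge> 0 \<Longrightarrow> (\<forall>b\<in>B. norm (v b) \<le> \<mu> / 2)"
    by (rule injective_bounded_below[of J B ?f]) blast+
  let ?K = "2 * real CARD('n) + 2"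
  obtain C' where C': "C' > 0" "\<And>h \<delta> x y i. (\<And>a. a \<in> Mon d \<Longrightarrow> norm (h a) \<le> \<delta>) \<Longrightarrow>
    x \<in> cball (0 :: complex ^ 'n::finite) ?K \<Longrightarrow> y \<in> cball 0 ?K \<Longrightarrow>
    norm (gradc d h (($) x) i) \<le> \<delta> * C' \<and>
    norm (gradc d h (($) x) i - gradc d h (($) y) i) \<le> \<delta> * C' * dist x y"
    using gradc_bound[of ?K d, where 'n = 'n] by auto
  let ?s = "norm (qcoeff d (mixed_mon d k l))" and ?q = "norm (qcoeff d (Poly_Mapping.single k d))"
  \<comment> \<open>The first term bounds the change of a minor between a grid point and its
    solution by \<eta> times the size of the coefficients; the other two provide the hypotheses of
    \<open>normalise_coeffs\<close>.\<close>
  define \<epsilon> where "\<epsilon> = min (\<eta> / (2 * (?K + 1) * C')) (min (1 / 2) (if even d then ?s / (2 * (?s + ?q)) else 1))"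
  have s: "even d \<Longrightarrow> ?s > 0" using qcoeff_mixed_nonzero[OF _ d kl] by simp
  have "\<epsilon> > 0" unfolding \<epsilon>_def using \<eta>(1) C'(1) s by (auto simp: add_pos_nonneg intro!: divide_pos_pos mult_pos_pos)
  have "\<epsilon> \<le> \<eta> / (2 * (?K + 1) * C')" by (simp add: \<epsilon>_def)
  moreover have "2 * (?K + 1) * C' > 0" using C'(1) by (intro mult_pos_pos) auto
  ultimately have \<epsilon>1: "2 * (?K + 1) * C' * \<epsilon> \<le> \<eta>" by (simp add: pos_le_divide_eq mult_ac)
  obtain \<rho> \<delta> C where pert: "fermat_perturbation d \<rho> \<delta> C TYPE('n)" and \<rho>: "\<rho> \<le> \<epsilon>" "\<delta> \<le> \<epsilon>"
    using fermat_perturbation_exists[OF d \<open>\<epsilon> > 0\<close>] by blast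
  interpret fermat_perturbation d \<rho> \<delta> C "TYPE('n)" by (rule pert)
  have \<delta>s: "\<delta> * (?s + ?q) < ?s" if "even d"
  proof -
    have "\<delta> \<le> ?s / (2 * (?s + ?q))" using \<rho>(2) that by (simp add: \<epsilon>_def)
    then have "\<delta> * (?s + ?q) \<le> ?s / (2 * (?s + ?q)) * (?s + ?q)" by (intro mult_right_mono) auto
    also have "\<dots> = ?s / 2"
    proof -
      have "x / (2 * y) * y = x / 2" if "y \<noteq> 0" for x y :: real using that by simp
      moreover have "?s + ?q \<noteq> 0" using s[OF that] norm_ge_zero[of "qcoeff d (Poly_Mapping.single k d)"] by linarith
      ultimately show ?thesis by blast
    qed
    also have "\<dots> < ?s" using s[OF that] by simp
    finally show ?thesis .
  qed
  have "fermat_star TYPE('n) d \<rho> \<delta> C"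
  proof
    fix \<phi> \<gamma> :: "('n \<Rightarrow>\<^sub>0 nat) \<Rightarrow> complex"
    assume near: "near \<phi>" and eig: "\<And>r :: complex ^ 'n. r \<in> grid d \<Longrightarrow> eigc d \<gamma> (($) (sol \<phi> r))"
    have "\<delta> \<le> 1 / 2" using \<rho>(2) by (simp add: \<epsilon>_def)
    obtain \<alpha> \<beta> where ab: "\<gamma> (Poly_Mapping.single k d) = \<alpha> * \<phi> (Poly_Mapping.single k d) + \<beta> * qcoeff d (Poly_Mapping.single k d)"
      "even d \<Longrightarrow> \<gamma> (mixed_mon d k l) = \<alpha> * \<phi> (mixed_mon d k l) + \<beta> * qcoeff d (mixed_mon d k l)"
      using normalise_coeffs[OF d kl near \<open>\<delta> \<le> 1 / 2\<close> \<delta>s, of \<gamma>] by blast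
    \<comment> \<open>Cut off outside \<open>Mon d\<close>, so that the vector is supported on
      B.\<close>
    define h where "h = (\<lambda>a. if a \<in> Mon d then (\<gamma> a + (- \<alpha>) * \<phi> a) + (- \<beta>) * qcoeff d a else 0)"
    have hB: "h a = 0" if "a \<notin> B" for a
      using that ab by (auto simp: h_def B_def split: if_splits)
    define \<mu> where "\<mu> = Max (insert 0 ((\<lambda>b. norm (h b)) ` Mon d))"
    have \<mu>: "\<mu> \<ge> 0" "\<And>a. a \<in> Mon d \<Longrightarrow> norm (h a) \<le> \<mu>" by (auto simp: \<mu>_def)
    have gh: "gradc d h x i = gradc d (\<lambda>a. (\<gamma> a + (- \<alpha>) * \<phi> a) + (- \<beta>) * qcoeff d a) x i" for x i
      unfolding gradc_def by (intro sum.cong) (auto simp: h_def)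
    have mh: "minor d h i j x = minor d (\<lambda>a. (\<gamma> a + (- \<alpha>) * \<phi> a) + (- \<beta>) * qcoeff d a) i j x" for i j x
      unfolding minor_def gh ..
    have "norm (?f t h) \<le> \<eta> * \<mu>" if "t \<in> J" for t
    proof -
      obtain r i j where t: "t = (r, i, j)" by (cases t)
      have r: "r \<in> grid d" using that by (simp add: t J_def)
      have mz: "minor d h i j (($) (sol \<phi> r)) = 0"
        unfolding mh minor_lin using eig[OF r] eigc_sol[OF near r] d by (simp add: eigc_minor minor_qcoeff)
      have "r \<in> cball r \<rho>" using rho by simp
      then have K: "r \<in> cball 0 ?K" "sol \<phi> r \<in> cball 0 ?K"
        using cball_grid_subset[OF r] sol(1)[OF near r] by blast+
      have "norm (minor d h i j (($) r) - minor d h i j (($) (sol \<phi> r))) \<le> 2 * (?K + 1) * C' * dist r (sol \<phi> r) * \<mu>"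
        using C'(2)[of h \<mu>] \<mu> C'(1) by (intro minor_close[OF _ K]) auto
      also have "\<dots> \<le> 2 * (?K + 1) * C' * \<epsilon> * \<mu>"
        using sol(1)[OF near r] \<rho>(1) C'(1) \<mu>(1) by (intro mult_right_mono mult_left_mono) auto
      also have "\<dots> \<le> \<eta> * \<mu>" using \<epsilon>1 \<mu>(1) by (rule mult_right_mono)
      finally show ?thesis using mz by (simp add: t)
    qed
    from \<eta>(2)[OF hB this \<mu>(1)] have half: "\<forall>b\<in>B. norm (h b) \<le> \<mu> / 2" by blast
    have "norm (h b) \<le> \<mu> / 2" for b using half hB[of b] \<mu>(1) by (cases "b \<in> B") auto
    then have "\<mu> \<le> \<mu> / 2" unfolding \<mu>_def using \<mu>(1)[unfolded \<mu>_def] by (subst Max_le_iff) auto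
    then have "\<mu> = 0" using \<mu>(1) by simp
    then have "h a = 0" if "a \<in> Mon d" for a using \<mu>(2)[OF that] by simp
    then have "\<gamma> a = \<alpha> * \<phi> a + \<beta> * qcoeff d a" if "a \<in> Mon d" for a
      using that by (simp add: h_def algebra_simps)
    then show "\<exists>\<alpha> \<beta>. \<forall>a\<in>Mon d. \<gamma> a = \<alpha> * \<phi> a + \<beta> * qcoeff d a" by blast
  qed
  then show thesis by (rule that)
qed

section \<open>The general fibre\<close>

lemma polyfun_mev: "(\<And>j. polyfun (X j)) \<Longrightarrow> polyfun (\<lambda>\<Phi>. mev a (\<lambda>j. X j \<Phi>))"
  unfolding mev_def by (intro polyfun_prod polyfun_power)

lemma polyfun_gradc:
  assumes "\<And>a. polyfun (A a)" "\<And>j. polyfun (X j)"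
  shows "polyfun (\<lambda>\<Phi>. gradc d (\<lambda>a. A a \<Phi>) (\<lambda>j. X j \<Phi>) i)"
  unfolding gradc_def by (intro polyfun_sum polyfun_mult polyfun_const polyfun_mev assms)

lemma constructible_eigc:
  assumes "\<And>a. polyfun (A a)" "\<And>j. polyfun (X j)"
  shows "constructible (\<lambda>\<Phi>. eigc d (\<lambda>a. A a \<Phi>) (\<lambda>j. X j \<Phi>))"
proof -
  have "constructible (\<lambda>\<Phi>. \<forall>i\<in>UNIV. \<forall>j\<in>UNIV. gradc d (\<lambda>a. A a \<Phi>) (\<lambda>j. X j \<Phi>) i * X j \<Phi> =
      gradc d (\<lambda>a. A a \<Phi>) (\<lambda>j. X j \<Phi>) j * X i \<Phi>)"
    by (intro constructible_Ball constructible_eq polyfun_mult polyfun_gradc assms) auto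
  then show ?thesis by (simp add: eigc_def)
qed

definition eig_lines :: "nat \<Rightarrow> (('n::finite \<Rightarrow>\<^sub>0 nat) \<Rightarrow> complex) \<Rightarrow> (complex ^ 'n) set set" where
  "eig_lines d \<phi> = {pt x | x. x \<noteq> 0 \<and> eigc d \<phi> (($) x)}"

lemma Eig_eig_lines: "f \<in> Sym d \<Longrightarrow> Eig f = eig_lines d (Poly_Mapping.lookup f)"
  by (simp add: eig_lines_def Eig_Sym)

lemma pt_in_eig_lines: "x \<noteq> 0 \<Longrightarrow> pt x \<in> eig_lines d \<phi> \<longleftrightarrow> eigc d \<phi> (($) x)"
  unfolding eig_lines_def using eigc_pt_cong pt_self by blast

lemma parallel_iff:
  fixes x y :: "complex ^ 'n"
  assumes "x \<noteq> 0" "y \<noteq> 0"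
  shows "pt x = pt y \<longleftrightarrow> (\<forall>i j. x $ i * y $ j = x $ j * y $ i)"
proof
  assume "pt x = pt y"
  then obtain c where "y = c *s x" using pt_eq_iff[OF assms] by blast
  then show "\<forall>i j. x $ i * y $ j = x $ j * y $ i" by simp
next
  assume *: "\<forall>i j. x $ i * y $ j = x $ j * y $ i"
  obtain k where k: "x $ k \<noteq> 0" using assms(1) by (auto simp: vec_eq_iff)
  have "y = (y $ k / x $ k) *s x"
    unfolding vec_eq_iff
  proof
    fix i
    have "x $ k * y $ i = x $ i * y $ k" using * by blast
    then show "y $ i = ((y $ k / x $ k) *s x) $ i" using k by (simp add: field_simps)
  qed
  moreover from this have "y $ k / x $ k \<noteq> 0" using assms(2) by auto
  ultimately show "pt x = pt y" using pt_eq_iff[OF assms] by blast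
qed

text \<open>Coordinates of K pairwise distinct eigenpoints. Distinctness is nonproportionality of
  the coordinate vectors, so everything is a finite combination of polynomial conditions.\<close>

definition eig_tuple :: "nat \<Rightarrow> nat \<Rightarrow> (('n::finite \<Rightarrow>\<^sub>0 nat) \<Rightarrow> complex) \<Rightarrow> (nat \<times> 'n \<Rightarrow> complex) \<Rightarrow> bool" where
  "eig_tuple d K \<phi> \<psi> \<longleftrightarrow> (\<forall>k\<in>{..<K}. (\<exists>i\<in>UNIV. \<psi> (k, i) \<noteq> 0) \<and> eigc d \<phi> (\<lambda>j. \<psi> (k, j)) \<and>
     (\<forall>l\<in>{..<k}. \<exists>i\<in>UNIV. \<exists>j\<in>UNIV. \<psi> (k, i) * \<psi> (l, j) \<noteq> \<psi> (k, j) * \<psi> (l, i)))"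

lemma constructible_eig_tuple:
  assumes A: "\<And>a. polyfun (A a)" and X: "\<And>v. polyfun (X v)"
  shows "constructible (\<lambda>\<Phi>. eig_tuple d K (\<lambda>a. A a \<Phi>) (\<lambda>v. X v \<Phi>))"
proof -
  have "constructible (\<lambda>\<Phi>. \<exists>i\<in>UNIV. X (k, i) \<Phi> \<noteq> 0)" for k
    using X by (intro constructible_Bex constructible_neq0) auto
  moreover have "constructible (\<lambda>\<Phi>. eigc d (\<lambda>a. A a \<Phi>) (\<lambda>j. X (k, j) \<Phi>))" for k
    using A X by (intro constructible_eigc)
  moreover have "constructible (\<lambda>\<Phi>. \<forall>l\<in>{..<k}. \<exists>i\<in>UNIV. \<exists>j\<in>UNIV.
      X (k, i) \<Phi> * X (l, j) \<Phi> \<noteq> X (k, j) \<Phi> * X (l, i) \<Phi>)" for k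
    using X by (intro constructible_Ball constructible_Bex constructible_not constructible_eq polyfun_mult) auto
  ultimately show ?thesis
    unfolding eig_tuple_def by (intro constructible_Ball[OF finite_lessThan[of K]] constructible_conj)
qed

lemma eig_tuple_lines:
  assumes "eig_tuple d K \<phi> \<psi>" "k < K"
  shows "(\<chi> i. \<psi> (k, i)) \<noteq> 0" "pt (\<chi> i. \<psi> (k, i)) \<in> eig_lines d \<phi>"
    "l < k \<Longrightarrow> pt (\<chi> i. \<psi> (k, i)) \<noteq> pt (\<chi> i. \<psi> (l, i))"
proof -
  have nz: "(\<chi> i. \<psi> (k, i)) \<noteq> 0" if "k < K" for k
    using assms(1) that by (auto simp: eig_tuple_def vec_eq_iff)
  show "(\<chi> i. \<psi> (k, i)) \<noteq> 0" using nz assms(2) .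
  have "($) (\<chi> i. \<psi> (k, i)) = (\<lambda>j. \<psi> (k, j))" by auto
  then show "pt (\<chi> i. \<psi> (k, i)) \<in> eig_lines d \<phi>"
    using pt_in_eig_lines[OF nz[OF assms(2)]] assms by (simp add: eig_tuple_def)
  show "pt (\<chi> i. \<psi> (k, i)) \<noteq> pt (\<chi> i. \<psi> (l, i))" if "l < k"
    using parallel_iff[OF nz[OF assms(2)] nz[of l]] assms that by (auto simp: eig_tuple_def)
qed

lemma eig_tuple_inj:
  assumes "eig_tuple d K \<phi> \<psi>" shows "inj_on (\<lambda>k. pt (\<chi> i. \<psi> (k, i))) {..<K}"
proof (rule inj_onI)
  let ?L = "\<lambda>k. pt (\<chi> i. \<psi> (k, i))"
  fix k l assume "k \<in> {..<K}" "l \<in> {..<K}" "?L k = ?L l"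
  then show "k = l"
    using eig_tuple_lines(3)[OF assms, of k l] eig_tuple_lines(3)[OF assms, of l k] by (cases k l rule: linorder_cases) auto
qed

lemma eig_tuple_exists:
  fixes \<phi> :: "('n::finite \<Rightarrow>\<^sub>0 nat) \<Rightarrow> complex"
  assumes inj: "inj_on L {..<K}" and L: "\<And>k. k < K \<Longrightarrow> L k \<in> eig_lines d \<phi>"
  obtains \<psi> where "eig_tuple d K \<phi> \<psi>" "\<And>k. k < K \<Longrightarrow> L k = pt (\<chi> i. \<psi> (k, i))"
proof -
  have "\<forall>k\<in>{..<K}. \<exists>x :: complex ^ 'n. x \<noteq> 0 \<and> eigc d \<phi> (($) x) \<and> L k = pt x"
    using L by (auto simp: eig_lines_def)
  then obtain x :: "nat \<Rightarrow> complex ^ 'n" where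
    x: "\<And>k. k < K \<Longrightarrow> x k \<noteq> 0" "\<And>k. k < K \<Longrightarrow> eigc d \<phi> (($) (x k))" "\<And>k. k < K \<Longrightarrow> L k = pt (x k)"
    by (metis lessThan_iff)
  define \<psi> where "\<psi> = (\<lambda>(k, i). x k $ i)"
  have "eig_tuple d K \<phi> \<psi>"
    unfolding eig_tuple_def
  proof (intro ballI conjI)
    fix k assume "k \<in> {..<K}"
    then have k: "k < K" by simp
    show "\<exists>i\<in>UNIV. \<psi> (k, i) \<noteq> 0" using x(1)[OF k] by (auto simp: \<psi>_def vec_eq_iff)
    show "eigc d \<phi> (\<lambda>j. \<psi> (k, j))" using x(2)[OF k] by (simp add: \<psi>_def)
    fix l assume "l \<in> {..<k}"
    then have l: "l < K" "l \<noteq> k" using k by auto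
    then have "pt (x k) \<noteq> pt (x l)" using inj k x(3) by (metis inj_onD lessThan_iff)
    then show "\<exists>i\<in>UNIV. \<exists>j\<in>UNIV. \<psi> (k, i) * \<psi> (l, j) \<noteq> \<psi> (k, j) * \<psi> (l, i)"
      using parallel_iff[OF x(1)[OF k] x(1)[OF l(1)]] by (auto simp: \<psi>_def)
  qed
  moreover have "L k = pt (\<chi> i. \<psi> (k, i))" if "k < K" for k
    using x(3)[OF that] by (simp add: \<psi>_def)
  ultimately show thesis by (rule that)
qed

definition atleast :: "nat \<Rightarrow> nat \<Rightarrow> (('n::finite \<Rightarrow>\<^sub>0 nat) \<Rightarrow> complex) \<Rightarrow> bool" where
  "atleast d K \<phi> \<longleftrightarrow> (\<exists>\<psi>. eig_tuple d K \<phi> \<psi>)"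

lemma constructible_atleast: "constructible (atleast d K)"
  unfolding atleast_def[abs_def]
  using constructible_ex[OF constructible_eig_tuple[of "\<lambda>a \<Phi>. \<Phi> (Inl a)" "\<lambda>v \<Phi>. \<Phi> (Inr v)" d K]] by simp

lemma atleast_iff:
  "atleast d K \<phi> \<longleftrightarrow> infinite (eig_lines d \<phi>) \<or> K \<le> card (eig_lines d \<phi>)"
proof
  assume "atleast d K \<phi>"
  then obtain \<psi> where \<psi>: "eig_tuple d K \<phi> \<psi>" by (auto simp: atleast_def)
  let ?L = "\<lambda>k. pt (\<chi> i. \<psi> (k, i))"
  have "inj_on ?L {..<K}" by (rule eig_tuple_inj[OF \<psi>])
  moreover have "?L ` {..<K} \<subseteq> eig_lines d \<phi>" using eig_tuple_lines(2)[OF \<psi>] by auto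
  ultimately show "infinite (eig_lines d \<phi>) \<or> K \<le> card (eig_lines d \<phi>)"
    using card_inj_on_le[of ?L "{..<K}" "eig_lines d \<phi>"] by auto
next
  assume *: "infinite (eig_lines d \<phi>) \<or> K \<le> card (eig_lines d \<phi>)"
  obtain T where T: "finite T" "card T = K" "T \<subseteq> eig_lines d \<phi>"
  proof (cases "finite (eig_lines d \<phi>)")
    case True
    with * obtain T where "T \<subseteq> eig_lines d \<phi>" "card T = K" "finite T"
      using obtain_subset_with_card_n by blast
    then show ?thesis using that by blast
  next
    case False
    then show ?thesis using infinite_arbitrarily_large[OF False, of K] that by blast
  qed
  obtain L where "bij_betw L {0..<card T} T" using ex_bij_betw_nat_finite[OF T(1)] by blast
  then have L: "inj_on L {..<K}" "L ` {..<K} = T" using T(2) by (auto simp: bij_betw_def atLeast0LessThan)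
  obtain \<psi> where "eig_tuple d K \<phi> \<psi>" by (rule eig_tuple_exists[OF L(1), of d \<phi>]) (use L(2) T(3) in auto)
  then show "atleast d K \<phi>" by (auto simp: atleast_def)
qed

definition exactly :: "nat \<Rightarrow> nat \<Rightarrow> (('n::finite \<Rightarrow>\<^sub>0 nat) \<Rightarrow> complex) \<Rightarrow> bool" where
  "exactly d K \<phi> \<longleftrightarrow> finite (eig_lines d \<phi>) \<and> card (eig_lines d \<phi>) = K"

text \<open>A cardinality is expressible by quantifiers over coordinates: there are K distinct
  eigenpoints but not K + 1.\<close>

lemma constructible_exactly: "constructible (exactly d K :: (('n::finite \<Rightarrow>\<^sub>0 nat) \<Rightarrow> complex) \<Rightarrow> bool)"
proof -
  have "exactly d K \<phi> \<longleftrightarrow> atleast d K \<phi> \<and> \<not> atleast d (K + 1) \<phi>" for \<phi> :: "('n \<Rightarrow>\<^sub>0 nat) \<Rightarrow> complex"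
    unfolding exactly_def atleast_iff by auto
  then have eq: "exactly d K = (\<lambda>\<phi> :: ('n \<Rightarrow>\<^sub>0 nat) \<Rightarrow> complex. atleast d K \<phi> \<and> \<not> atleast d (K + 1) \<phi>)" by (intro ext)
  show ?thesis unfolding eq by (intro constructible_conj constructible_not constructible_atleast)
qed

text \<open>The two scalars form an assignment indexed by \<open>bool\<close>, and \<gamma> and x
  are assignments too, so that Chevalley's theorem applies to each quantifier.\<close>

definition determined :: "nat \<Rightarrow> (('n::finite \<Rightarrow>\<^sub>0 nat) \<Rightarrow> complex) \<Rightarrow> bool" where
  "determined d \<phi> \<longleftrightarrow> (\<forall>\<gamma>. (\<forall>x. eigc d \<phi> x \<longrightarrow> eigc d \<gamma> x) \<longrightarrow>
     (\<exists>c :: bool \<Rightarrow> complex. \<forall>a\<in>Mon d. \<gamma> a = c True * \<phi> a + c False * qcoeff d a))"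

lemma constructible_determined: "constructible (determined d :: (('n::finite \<Rightarrow>\<^sub>0 nat) \<Rightarrow> complex) \<Rightarrow> bool)"
proof -
  let ?M = "\<lambda>_ :: ('n \<Rightarrow>\<^sub>0 nat). True"
  have 1: "constructible (\<lambda>\<Phi> :: ('n \<Rightarrow>\<^sub>0 nat) + ('n \<Rightarrow>\<^sub>0 nat) \<Rightarrow> complex.
      \<forall>x. eigc d (\<lambda>a. \<Phi> (Inl a)) x \<longrightarrow> eigc d (\<lambda>a. \<Phi> (Inr a)) x)"
  proof -
    have "constructible (\<lambda>\<Psi> :: (('n \<Rightarrow>\<^sub>0 nat) + ('n \<Rightarrow>\<^sub>0 nat)) + 'n \<Rightarrow> complex.
        eigc d (\<lambda>a. \<Psi> (Inl (Inl a))) (\<lambda>j. \<Psi> (Inr j)) \<longrightarrow> eigc d (\<lambda>a. \<Psi> (Inl (Inr a))) (\<lambda>j. \<Psi> (Inr j)))"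
      by (intro constructible_imp constructible_eigc polyfun_var)
    from constructible_all[OF this] show ?thesis by simp
  qed
  have 2: "constructible (\<lambda>\<Phi> :: ('n \<Rightarrow>\<^sub>0 nat) + ('n \<Rightarrow>\<^sub>0 nat) \<Rightarrow> complex.
      \<exists>c :: bool \<Rightarrow> complex. \<forall>a\<in>Mon d. \<Phi> (Inr a) = c True * \<Phi> (Inl a) + c False * qcoeff d a)"
  proof -
    have "constructible (\<lambda>\<Psi> :: (('n \<Rightarrow>\<^sub>0 nat) + ('n \<Rightarrow>\<^sub>0 nat)) + bool \<Rightarrow> complex.
        \<forall>a\<in>Mon d. \<Psi> (Inl (Inr a)) = \<Psi> (Inr True) * \<Psi> (Inl (Inl a)) + \<Psi> (Inr False) * qcoeff d a)"
      by (intro constructible_Ball finite_Mon constructible_eq polyfun_add polyfun_mult polyfun_var polyfun_const)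
    from constructible_ex[OF this] show ?thesis by simp
  qed
  from constructible_all[OF constructible_imp[OF 1 2]] show ?thesis
    unfolding determined_def[abs_def] by simp
qed

lemma eig_lines_cmult: "c \<noteq> 0 \<Longrightarrow> eig_lines d (\<lambda>a. c * \<phi> a) = eig_lines d \<phi>"
  by (simp add: eig_lines_def eigc_cmult_iff)

lemma determined_cmult:
  assumes "c \<noteq> 0" "determined d (\<lambda>a. c * \<phi> a)" shows "determined d \<phi>"
  unfolding determined_def
proof (intro allI impI)
  fix \<gamma> assume "\<forall>x. eigc d \<phi> x \<longrightarrow> eigc d \<gamma> x"
  then have "eigc d (\<lambda>a. c * \<phi> a) x \<longrightarrow> eigc d \<gamma> x" for x using assms(1) by (simp add: eigc_cmult_iff)
  then obtain e :: "bool \<Rightarrow> complex" where e: "\<forall>a\<in>Mon d. \<gamma> a = e True * (c * \<phi> a) + e False * qcoeff d a"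
    using assms(2)[unfolded determined_def, rule_format, of \<gamma>] by blast
  then show "\<exists>e :: bool \<Rightarrow> complex. \<forall>a\<in>Mon d. \<gamma> a = e True * \<phi> a + e False * qcoeff d a"
    by (intro exI[of _ "\<lambda>b. if b then e True * c else e False"]) simp
qed

text \<open>The number of eigenpoints of the Fermat form: in n variables there are (d-1)^n - 1
  nonzero grid points, with d - 2 of them on each line.\<close>

definition num_eig :: "'n::finite itself \<Rightarrow> nat \<Rightarrow> nat" where
  "num_eig _ d = card (pt ` (grid d - {0} :: (complex ^ 'n) set))"

context fermat_star
begin

lemma eig_lines_near:
  assumes "near \<phi>" shows "eig_lines d \<phi> = (\<lambda>r. pt (sol \<phi> r)) ` (grid d - {0})"
proof (intro equalityI subsetI)
  fix L assume "L \<in> eig_lines d \<phi>"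
  then obtain x where "x \<noteq> 0" "eigc d \<phi> (($) x)" "L = pt x" by (auto simp: eig_lines_def)
  then show "L \<in> (\<lambda>r. pt (sol \<phi> r)) ` (grid d - {0})" using eigenvector_is_sol[OF assms] by blast
next
  fix L assume "L \<in> (\<lambda>r. pt (sol \<phi> r)) ` (grid d - {0})"
  then obtain r where r: "r \<in> grid d" "r \<noteq> 0" "L = pt (sol \<phi> r)" by blast
  then show "L \<in> eig_lines d \<phi>"
    using eigc_sol[OF assms r(1)] pt_in_eig_lines[OF sol_nonzero[OF assms r(1,2)]] by simp
qed

text \<open>The solution map descends to lines and is injective on them, both by
  \<open>pt_sol_eq_iff\<close>.\<close>

lemma exactly_near:
  assumes "near \<phi>" shows "exactly d (num_eig TYPE('n) d) \<phi>"
proof -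
  let ?G = "grid d - {0} :: (complex ^ 'n) set"
  have fin: "finite ?G" using finite_grid[OF d] by simp
  have "bij_betw (\<lambda>L. pt (sol \<phi> (inv_into ?G pt L))) (pt ` ?G) (eig_lines d \<phi>)"
  proof -
    let ?s = "inv_into ?G pt"
    have s: "?s L \<in> ?G \<and> pt (?s L) = L" if "L \<in> pt ` ?G" for L using inv_into_into[OF that] f_inv_into_f[OF that] by blast
    have inj: "inj_on (\<lambda>L. pt (sol \<phi> (?s L))) (pt ` ?G)"
    proof (rule inj_onI)
      fix L M assume LM: "L \<in> pt ` ?G" "M \<in> pt ` ?G" "pt (sol \<phi> (?s L)) = pt (sol \<phi> (?s M))"
      then have "pt (?s L) = pt (?s M)"
        using pt_sol_eq_iff[OF assms, of "?s L" "?s M"] s[OF LM(1)] s[OF LM(2)] by (simp only:)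
      then show "L = M" using s[OF LM(1)] s[OF LM(2)] by (simp only:)
    qed
    have "pt (sol \<phi> r) = pt (sol \<phi> (?s (pt r)))" if "r \<in> ?G" for r
      using pt_sol_eq_iff[OF assms that, of "?s (pt r)"] s[of "pt r"] that by auto
    then have "(\<lambda>L. pt (sol \<phi> (?s L))) ` (pt ` ?G) = (\<lambda>r. pt (sol \<phi> r)) ` ?G"
      by (auto simp: image_image intro!: image_cong)
    with inj show ?thesis by (simp add: bij_betw_def eig_lines_near[OF assms])
  qed
  then have "card (eig_lines d \<phi>) = num_eig TYPE('n) d" unfolding num_eig_def by (metis bij_betw_same_card)
  moreover have "finite (eig_lines d \<phi>)" using fin by (simp add: eig_lines_near[OF assms])
  ultimately show ?thesis by (simp add: exactly_def)
qed

lemma determined_near: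
  assumes "near \<phi>" shows "determined d \<phi>"
  unfolding determined_def
proof (intro allI impI)
  fix \<gamma> assume "\<forall>x. eigc d \<phi> x \<longrightarrow> eigc d \<gamma> x"
  then have "eigc d \<gamma> (($) (sol \<phi> r))" if "r \<in> grid d" for r using eigc_sol[OF assms that] by blast
  from star[OF assms this] obtain \<alpha> \<beta> where "\<forall>a\<in>Mon d. \<gamma> a = \<alpha> * \<phi> a + \<beta> * qcoeff d a" by blast
  then show "\<exists>c :: bool \<Rightarrow> complex. \<forall>a\<in>Mon d. \<gamma> a = c True * \<phi> a + c False * qcoeff d a"
    by (intro exI[of _ "\<lambda>b. if b then \<alpha> else \<beta>"]) simp
qed

text \<open>Both predicates hold on the whole \<delta>-box around the Fermat form, so the criterion
  applies with that form as base point.\<close>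

lemma general_exactly_determined:
  "general_form d (\<lambda>f :: 'n cpoly. exactly d (num_eig TYPE('n) d) (Poly_Mapping.lookup f) \<and> determined d (Poly_Mapping.lookup f))"
proof (rule general_formI[where \<delta> = \<delta> and \<xi> = "fermat d" and ?a0.0 = "Poly_Mapping.single undefined d"])
  show "constructible (\<lambda>\<phi> :: ('n \<Rightarrow>\<^sub>0 nat) \<Rightarrow> complex. exactly d (num_eig TYPE('n) d) \<phi> \<and> determined d \<phi>)"
    by (intro constructible_conj constructible_exactly constructible_determined)
  show "exactly d (num_eig TYPE('n) d) \<phi> \<and> determined d \<phi>"
    if "c \<noteq> 0" "exactly d (num_eig TYPE('n) d) (\<lambda>a. c * \<phi> a) \<and> determined d (\<lambda>a. c * \<phi> a)"
    for c and \<phi> :: "('n \<Rightarrow>\<^sub>0 nat) \<Rightarrow> complex"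
    using that determined_cmult by (auto simp: exactly_def eig_lines_cmult)
  show "exactly d (num_eig TYPE('n) d) \<phi> \<and> determined d \<phi>"
    if "\<And>a. a \<in> Mon d \<Longrightarrow> norm (\<phi> a - fermat d a) < \<delta>" for \<phi> :: "('n \<Rightarrow>\<^sub>0 nat) \<Rightarrow> complex"
    using that exactly_near determined_near by (simp add: near_fermat_def)
qed (use delta in \<open>auto simp: fermat_single fermat_outside\<close>)

end

lemma general_form_mono:
  assumes "general_form d Q" "\<And>f. f \<in> Sym d \<Longrightarrow> f \<noteq> 0 \<Longrightarrow> Q f \<Longrightarrow> R f"
  shows "general_form d R"
proof -
  from assms(1) obtain U where "openin (zariski_PSym d) U" "U \<noteq> {}"
     "\<forall>f. f \<in> Sym d \<and> f \<noteq> 0 \<and> form_pt f \<in> U \<longrightarrow> Q f" unfolding general_form_def by (elim exE conjE)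
  then show ?thesis unfolding general_form_def using assms(2) by (intro exI[of _ U]) auto
qed

lemma general_exactly_determined:
  assumes "d \<ge> 3" "CARD('n::finite) \<ge> 2"
  shows "general_form d (\<lambda>f :: 'n cpoly. exactly d (num_eig TYPE('n) d) (Poly_Mapping.lookup f) \<and> determined d (Poly_Mapping.lookup f))"
proof -
  obtain \<rho> \<delta> C where "fermat_star TYPE('n) d \<rho> \<delta> C" using fermat_star_exists[OF assms] .
  then show ?thesis by (rule fermat_star.general_exactly_determined)
qed

text \<open>The general number exists by the count near the Fermat form, and it is unique because
  two general properties hold for a common form.\<close>

lemma ed_degree_eq:
  assumes "d \<ge> 3" "CARD('n::finite) \<ge> 2"
  shows "ed_degree TYPE('n) d = num_eig TYPE('n) d"
  unfolding ed_degree_def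
proof (rule the_equality)
  show gen: "general_form d (\<lambda>f :: 'n cpoly. finite (Eig f) \<and> card (Eig f) = num_eig TYPE('n) d)"
    by (rule general_form_mono[OF general_exactly_determined[OF assms]]) (simp add: Eig_eig_lines exactly_def)
  fix N assume "general_form d (\<lambda>f :: 'n cpoly. finite (Eig f) \<and> card (Eig f) = N)"
  from general_form_meet[OF gen this] show "N = num_eig TYPE('n) d" by auto
qed

lemma tau_dom_iff:
  assumes "d \<ge> 3" "CARD('n::finite) \<ge> 2"
  shows "P \<in> (tau_dom d :: 'n cpoly set set) \<longleftrightarrow>
    (\<exists>f. P = form_pt f \<and> f \<in> Sym d \<and> f \<noteq> 0 \<and> exactly d (num_eig TYPE('n) d) (Poly_Mapping.lookup f))"
  unfolding tau_dom_def ed_degree_eq[OF assms] exactly_def by (auto simp: Eig_eig_lines)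

lemma infinite_PV:
  assumes "CARD('n::finite) \<ge> 2"
  shows "infinite {pt x | x :: complex ^ 'n. x \<noteq> 0}"
proof -
  obtain k l :: 'n where kl: "k \<noteq> l"
  proof -
    have "\<not> (\<forall>k l :: 'n. k = l)"
    proof
      assume "\<forall>k l :: 'n. k = l"
      then have "UNIV = {undefined :: 'n}" by blast
      then have "CARD('n) = card {undefined :: 'n}" by (rule arg_cong)
      then show False using assms by simp
    qed
    then show ?thesis using that by blast
  qed
  let ?x = "\<lambda>t :: complex. (\<chi> i. if i = k then 1 else if i = l then t else 0) :: complex ^ 'n"
  have nz: "?x t \<noteq> 0" for t by (auto simp: vec_eq_iff intro!: exI[of _ k])
  have "inj (\<lambda>t. pt (?x t))"
  proof (rule injI)
    fix s t assume "pt (?x s) = pt (?x t)"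
    then have "?x s $ k * ?x t $ l = ?x s $ l * ?x t $ k" using parallel_iff[OF nz nz] by blast
    then show "s = t" using kl by simp
  qed
  then have "infinite (range (\<lambda>t. pt (?x t)))" using infinite_UNIV_char_0 finite_imageD by blast
  moreover have "range (\<lambda>t. pt (?x t)) \<subseteq> {pt x | x :: complex ^ 'n. x \<noteq> 0}" using nz by auto
  ultimately show ?thesis by (rule infinite_super[rotated])
qed

text \<open>Excludes from the domain of \<open>tau\<close> the forms with every vector an
  eigenvector, such as the multiples of q^(d/2).\<close>

lemma not_exactly_trivial:
  assumes "CARD('n::finite) \<ge> 2" "\<And>x. eigc d \<phi> x"
  shows "\<not> exactly d N (\<phi> :: ('n \<Rightarrow>\<^sub>0 nat) \<Rightarrow> complex)"
proof -
  have "eig_lines d \<phi> = {pt x | x :: complex ^ 'n. x \<noteq> 0}" using assms(2) by (simp add: eig_lines_def)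
  then show ?thesis using infinite_PV[OF assms(1)] by (simp add: exactly_def)
qed

lemma form_pt_cmult: "c \<noteq> 0 \<Longrightarrow> form_pt (const_poly c * f) = form_pt f"
proof -
  assume c: "c \<noteq> 0"
  have 1: "const_poly e * (const_poly c * f) = const_poly (e * c) * f" for e
    by (rule poly_mapping_eqI) (simp add: lookup_const_poly_times)
  have 2: "const_poly e * f = const_poly (e / c) * (const_poly c * f)" for e
    using c by (intro poly_mapping_eqI) (simp add: lookup_const_poly_times)
  show ?thesis unfolding form_pt_def using 1 2 by blast
qed

lemma eig_lines_subset_imp:
  assumes "eig_lines d \<phi> \<subseteq> eig_lines d \<gamma>" "eigc d \<phi> x" shows "eigc d \<gamma> x"
proof (cases "(\<chi> i. x i) = (0 :: complex ^ 'a)")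
  case True
  then have "x i = 0" for i by (metis vec_lambda_beta zero_index)
  then show ?thesis by (simp add: eigc_def)
next
  case False
  have "($) (\<chi> i. x i) = x" by auto
  then show ?thesis using assms pt_in_eig_lines[OF False, of d] by auto
qed

lemma fibre:
  fixes f :: "'n::finite cpoly"
  assumes d: "d \<ge> 3" and n: "CARD('n) \<ge> 2" and f: "f \<in> Sym d" "f \<noteq> 0"
    and ex: "exactly d (num_eig TYPE('n) d) (Poly_Mapping.lookup f)" and det: "determined d (Poly_Mapping.lookup f)"
  shows "form_pt f \<in> tau_dom d" "{P \<in> tau_dom d. tau P = tau (form_pt f)} =
      (if odd d then {form_pt f} else {form_pt (f + const_poly c * q_form ^ (d div 2)) | c. True})"
proof -
  show dom: "form_pt f \<in> tau_dom d" using tau_dom_iff[OF d n] f ex by blast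
  have fibre_sub: "\<exists>c. (even d \<longrightarrow> P = form_pt (f + const_poly c * q_form ^ (d div 2))) \<and> (odd d \<longrightarrow> P = form_pt f)"
    if P: "P \<in> tau_dom d" "tau P = tau (form_pt f)" for P
  proof -
    obtain g where g: "P = form_pt g" "g \<in> Sym d" "g \<noteq> 0" "exactly d (num_eig TYPE('n) d) (Poly_Mapping.lookup g)"
      using P(1) tau_dom_iff[OF d n] by blast
    have "mset_set (Eig g) = mset_set (Eig f)" using P(2) g(1,3) f(2) by (simp add: tau_form_pt)
    then have "eig_lines d (Poly_Mapping.lookup g) = eig_lines d (Poly_Mapping.lookup f)"
      using g ex f by (metis Eig_eig_lines exactly_def finite_set_mset_mset_set)
    then have "\<forall>x. eigc d (Poly_Mapping.lookup f) x \<longrightarrow> eigc d (Poly_Mapping.lookup g) x"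
      using eig_lines_subset_imp by blast
    then obtain c :: "bool \<Rightarrow> complex" where c: "\<And>a. a \<in> Mon d \<Longrightarrow> Poly_Mapping.lookup g a =
        c True * Poly_Mapping.lookup f a + c False * qcoeff d a"
      using det unfolding determined_def by blast
    then have c': "Poly_Mapping.lookup g a = c True * Poly_Mapping.lookup f a + c False * qcoeff d a" for a
      using f(1) g(2) qcoeff_outside[of a d] by (cases "a \<in> Mon d") (auto simp: Sym_iff)
    \<comment> \<open>Otherwise g would be a multiple of q^(d/2) or 0, with infinitely many
      eigenpoints.\<close>
    have "c True \<noteq> 0"
    proof
      assume "c True = 0"
      then have "Poly_Mapping.lookup g = (\<lambda>a. 0 + c False * qcoeff d a)" using c' by auto
      moreover have "minor d (\<lambda>_. 0) i j x = 0" for i j and x :: "'n \<Rightarrow> complex" by (simp add: minor_def gradc_def)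
      ultimately have "eigc d (Poly_Mapping.lookup g) x" for x
        unfolding eigc_minor using d by (simp only: minor_lin) (simp add: minor_qcoeff)
      then show False using not_exactly_trivial[OF n] g(4) by blast
    qed
    show ?thesis
    proof (cases "even d")
      case True
      have "g = const_poly (c True) * (f + const_poly (c False / c True) * q_form ^ (d div 2))"
        using c' True \<open>c True \<noteq> 0\<close>
        by (intro poly_mapping_eqI) (simp add: lookup_const_poly_times Poly_Mapping.lookup_add qcoeff_def ring_distribs)
      then show ?thesis using True form_pt_cmult[OF \<open>c True \<noteq> 0\<close>] g(1) by auto
    next
      case False
      have "g = const_poly (c True) * f"
        using c' False by (intro poly_mapping_eqI) (simp add: lookup_const_poly_times qcoeff_def)
      then show ?thesis using False form_pt_cmult[OF \<open>c True \<noteq> 0\<close>] g(1) by auto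
    qed
  qed
  have fibre_sup: "form_pt h \<in> tau_dom d \<and> tau (form_pt h) = tau (form_pt f)"
    if "even d" "h = f + const_poly c * q_form ^ (d div 2)" for c h
  proof -
    have h: "h \<in> Sym d" using f(1) q_power_Sym[OF that(1)] unfolding that(2)
      by (auto simp: Sym_iff Poly_Mapping.lookup_add lookup_const_poly_times)
    have lk: "Poly_Mapping.lookup h = (\<lambda>a. Poly_Mapping.lookup f a + c * Poly_Mapping.lookup (q_form ^ (d div 2)) a)"
      unfolding that(2) by (auto simp: Poly_Mapping.lookup_add lookup_const_poly_times)
    have lines: "eig_lines d (Poly_Mapping.lookup h) = eig_lines d (Poly_Mapping.lookup f)"
      unfolding eig_lines_def lk using eigc_add_q_power[OF that(1)] d by auto
    then have exh: "exactly d (num_eig TYPE('n) d) (Poly_Mapping.lookup h)" using ex by (simp add: exactly_def)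
    have "h \<noteq> 0"
    proof
      assume "h = 0"
      then have "eigc d (Poly_Mapping.lookup h) x" for x by (simp add: eigc_def gradc_def)
      then show False using not_exactly_trivial[OF n] exh by blast
    qed
    then show ?thesis using tau_dom_iff[OF d n] exh h lines f
      by (auto simp: tau_form_pt Eig_eig_lines)
  qed
  show "{P \<in> tau_dom d. tau P = tau (form_pt f)} =
      (if odd d then {form_pt f} else {form_pt (f + const_poly c * q_form ^ (d div 2)) | c. True})"
  proof (cases "odd d")
    case True
    then show ?thesis using fibre_sub dom by auto
  next
    case False
    then show ?thesis using fibre_sub fibre_sup by auto
  qed
qed

section \<open>Closed subsets of the symmetric product\<close>

text \<open>That only the first N blocks of variables occur is kept apart, as
  \<open>supp_below\<close>, so that degree functions can be added and permuted freely.\<close>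

definition mhom :: "(nat \<Rightarrow> nat) \<Rightarrow> ((nat \<times> 'n::finite \<Rightarrow> complex) \<Rightarrow> complex) \<Rightarrow> bool" where
  "mhom D G \<longleftrightarrow> (\<exists>p. (\<forall>a\<in>Poly_Mapping.keys p. \<forall>k. (\<Sum>i\<in>UNIV. Poly_Mapping.lookup a (k, i)) = D k) \<and>
     (\<forall>\<psi>. G \<psi> = peval p \<psi>))"

lemma mhom_zero: "mhom D (\<lambda>\<psi>. 0)"
  unfolding mhom_def by (rule exI[of _ 0]) simp

lemma mhom_const: "mhom (\<lambda>_. 0) (\<lambda>\<psi>. c)"
  unfolding mhom_def by (rule exI[of _ "const_poly c"]) (auto simp: const_poly_def peval_single)

lemma mhom_var: "mhom (\<lambda>k. if k = l then 1 else 0) (\<lambda>\<psi>. \<psi> (l, i))"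
  unfolding mhom_def
proof (intro exI[of _ "Poly_Mapping.single (Poly_Mapping.single (l, i) 1) 1"] conjI allI ballI)
  fix a k assume "a \<in> Poly_Mapping.keys (Poly_Mapping.single (Poly_Mapping.single (l, i) (1 :: nat)) (1 :: complex))"
  then have a: "a = Poly_Mapping.single (l, i) 1" by simp
  show "(\<Sum>j\<in>UNIV. Poly_Mapping.lookup a (k, j)) = (if k = l then 1 else 0)"
    by (cases "k = l") (simp_all add: a lookup_single when_def)
qed (simp add: peval_single mev_def)

lemma mhom_add: "mhom D F \<Longrightarrow> mhom D G \<Longrightarrow> mhom D (\<lambda>\<psi>. F \<psi> + G \<psi>)"
proof -
  assume "mhom D F" "mhom D G"
  then obtain p q where
    "\<forall>a\<in>Poly_Mapping.keys p. \<forall>k. (\<Sum>i\<in>UNIV. Poly_Mapping.lookup a (k, i)) = D k" "\<forall>\<psi>. F \<psi> = peval p \<psi>"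
    "\<forall>a\<in>Poly_Mapping.keys q. \<forall>k. (\<Sum>i\<in>UNIV. Poly_Mapping.lookup a (k, i)) = D k" "\<forall>\<psi>. G \<psi> = peval q \<psi>"
    unfolding mhom_def by (elim exE conjE)
  then show ?thesis unfolding mhom_def using Poly_Mapping.keys_add[of p q]
    by (intro exI[of _ "p + q"]) (auto simp: peval_add)
qed

lemma mhom_mult: "mhom D F \<Longrightarrow> mhom D' G \<Longrightarrow> mhom (\<lambda>k. D k + D' k) (\<lambda>\<psi>. F \<psi> * G \<psi>)"
proof -
  assume "mhom D F" "mhom D' G"
  then obtain p q where
    pq: "\<forall>a\<in>Poly_Mapping.keys p. \<forall>k. (\<Sum>i\<in>UNIV. Poly_Mapping.lookup a (k, i)) = D k" "\<forall>\<psi>. F \<psi> = peval p \<psi>"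
    "\<forall>a\<in>Poly_Mapping.keys q. \<forall>k. (\<Sum>i\<in>UNIV. Poly_Mapping.lookup a (k, i)) = D' k" "\<forall>\<psi>. G \<psi> = peval q \<psi>"
    unfolding mhom_def by (elim exE conjE)
  show ?thesis unfolding mhom_def
  proof (intro exI[of _ "p * q"] conjI ballI allI)
    fix a k assume "a \<in> Poly_Mapping.keys (p * q)"
    then obtain b c where "a = b + c" "b \<in> Poly_Mapping.keys p" "c \<in> Poly_Mapping.keys q"
      using Poly_Mapping.keys_mult[of p q] by blast
    then show "(\<Sum>i\<in>UNIV. Poly_Mapping.lookup a (k, i)) = D k + D' k"
      using pq by (simp add: Poly_Mapping.lookup_add sum.distrib)
  qed (use pq in \<open>simp add: peval_mult\<close>)
qed

lemma mhom_cmult: "mhom D G \<Longrightarrow> mhom D (\<lambda>\<psi>. c * G \<psi>)"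
  using mhom_mult[OF mhom_const, of D G c] by simp

lemma mhom_sum: "(\<And>i. i \<in> I \<Longrightarrow> mhom D (G i)) \<Longrightarrow> mhom D (\<lambda>\<psi>. \<Sum>i\<in>I. G i \<psi>)"
  by (induction I rule: infinite_finite_induct) (auto intro: mhom_zero mhom_add)

lemma mhom_prod:
  "finite I \<Longrightarrow> (\<And>i. i \<in> I \<Longrightarrow> mhom (D i) (G i)) \<Longrightarrow> mhom (\<lambda>k. \<Sum>i\<in>I. D i k) (\<lambda>\<psi>. \<Prod>i\<in>I. G i \<psi>)"
  by (induction I rule: finite_induct) (auto intro: mhom_const mhom_mult)

lemma mhom_power: "mhom D G \<Longrightarrow> mhom (\<lambda>k. j * D k) (\<lambda>\<psi>. G \<psi> ^ j)"
proof (induction j)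
  case 0
  then show ?case using mhom_const[of 1] by simp
next
  case (Suc j)
  then show ?case using mhom_mult[of D G "\<lambda>k. j * D k" "\<lambda>\<psi>. G \<psi> ^ j"] by simp
qed

lemma mhom_polyfun: "mhom D G \<Longrightarrow> polyfun G"
  unfolding mhom_def using polyfun_peval by (metis ext)

text \<open>\<open>map_key\<close> pulls exponents back, hence the inverse permutation in the
  degrees.\<close>

lemma mhom_permute:
  fixes G :: "(nat \<times> 'n::finite \<Rightarrow> complex) \<Rightarrow> complex"
  assumes "mhom D G" "bij \<sigma>"
  shows "mhom (\<lambda>k. D (inv \<sigma> k)) (\<lambda>\<psi>. G (\<lambda>(k, i). \<psi> (\<sigma> k, i)))"
proof -
  obtain p where p: "\<forall>a\<in>Poly_Mapping.keys p. \<forall>k. (\<Sum>i\<in>UNIV. Poly_Mapping.lookup a (k, i)) = D k" "\<forall>\<psi>. G \<psi> = peval p \<psi>"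
    using assms(1) unfolding mhom_def by (elim exE conjE)
  let ?s = "\<lambda>(k, i :: 'n). (inv \<sigma> k, i)"
  have inj: "inj ?s" using assms(2) by (auto intro!: injI simp: bij_is_surj surj_imp_inj_inv inj_eq)
  have lk: "Poly_Mapping.lookup (Poly_Mapping.map_key ?s a) v = Poly_Mapping.lookup a (?s v)" for a :: "nat \<times> 'n \<Rightarrow>\<^sub>0 nat" and v
    using inj by (simp add: Poly_Mapping.map_key.rep_eq)
  have keys: "Poly_Mapping.keys (Poly_Mapping.map_key ?s a) = (\<lambda>(k, i). (\<sigma> k, i)) ` Poly_Mapping.keys a" for a :: "nat \<times> 'n \<Rightarrow>\<^sub>0 nat"
  proof (intro set_eqI)
    fix v :: "nat \<times> 'n"
    show "v \<in> Poly_Mapping.keys (Poly_Mapping.map_key ?s a) \<longleftrightarrow> v \<in> (\<lambda>(k, i). (\<sigma> k, i)) ` Poly_Mapping.keys a"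
    proof
      assume "v \<in> Poly_Mapping.keys (Poly_Mapping.map_key ?s a)"
      then have "?s v \<in> Poly_Mapping.keys a" by (simp add: in_keys_iff lk)
      moreover have "v = (\<lambda>(k, i). (\<sigma> k, i)) (?s v)"
        using assms(2) by (cases v) (simp add: bij_is_surj surj_f_inv_f)
      ultimately show "v \<in> (\<lambda>(k, i). (\<sigma> k, i)) ` Poly_Mapping.keys a" by blast
    next
      assume "v \<in> (\<lambda>(k, i). (\<sigma> k, i)) ` Poly_Mapping.keys a"
      then show "v \<in> Poly_Mapping.keys (Poly_Mapping.map_key ?s a)"
        using assms(2) by (auto simp: in_keys_iff lk bij_is_inj inv_f_f)
    qed
  qed
  have mev: "mev (Poly_Mapping.map_key ?s a) \<psi> = mev a (\<lambda>(k, i). \<psi> (\<sigma> k, i))" for a \<psi>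
  proof -
    have "inj_on (\<lambda>(k, i). (\<sigma> k, i)) (Poly_Mapping.keys a)"
      using assms(2) by (auto intro!: inj_onI simp: bij_is_inj inj_eq)
    then show ?thesis unfolding mev_def keys using assms(2)
      by (subst prod.reindex) (auto intro!: prod.cong simp: lk bij_is_inj inv_f_f)
  qed
  let ?q = "\<Sum>a\<in>Poly_Mapping.keys p. Poly_Mapping.single (Poly_Mapping.map_key ?s a) (Poly_Mapping.lookup p a)"
  show ?thesis unfolding mhom_def
  proof (intro exI[of _ ?q] conjI ballI allI)
    fix b k assume "b \<in> Poly_Mapping.keys ?q"
    then obtain a where "a \<in> Poly_Mapping.keys p" "b = Poly_Mapping.map_key ?s a"
      using Poly_Mapping.keys_sum[of "\<lambda>a. Poly_Mapping.single (Poly_Mapping.map_key ?s a) (Poly_Mapping.lookup p a)" "Poly_Mapping.keys p"]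
      by (fastforce split: if_splits)
    then show "(\<Sum>i\<in>UNIV. Poly_Mapping.lookup b (k, i)) = D (inv \<sigma> k)" using p(1) by (simp add: lk)
  next
    fix \<psi>
    show "G (\<lambda>(k, i). \<psi> (\<sigma> k, i)) = peval ?q \<psi>"
      using p(2) by (simp add: peval_sum peval_single mev peval_superset[of "Poly_Mapping.keys p" p])
  qed
qed

definition supp_below :: "nat \<Rightarrow> (nat \<Rightarrow> nat) \<Rightarrow> bool" where
  "supp_below N D \<longleftrightarrow> (\<forall>k\<ge>N. D k = 0)"

text \<open>Scaling a block by its own factor is felt only through the degree of G in that block;
  blocks from N on do not occur in G, so the two assignments are compared on the first N
  alone.\<close>

lemma mhom_scale:
  fixes G :: "(nat \<times> 'n::finite \<Rightarrow> complex) \<Rightarrow> complex"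
  assumes "mhom D G" "supp_below N D"
    and "\<And>k i. k < N \<Longrightarrow> \<eta> (k, i) = c k * \<psi> (k, i)"
  shows "G \<eta> = (\<Prod>k<N. c k ^ D k) * G \<psi>"
proof -
  obtain p where p: "\<And>a k. a\<in>Poly_Mapping.keys p \<Longrightarrow> (\<Sum>i\<in>UNIV. Poly_Mapping.lookup a (k, i)) = D k" "\<forall>\<psi>. G \<psi> = peval p \<psi>"
    using assms(1) unfolding mhom_def by (elim exE conjE) blast
  have "mev a \<eta> = (\<Prod>k<N. c k ^ D k) * mev a \<psi>" if a: "a \<in> Poly_Mapping.keys p" for a
  proof -
    have "Poly_Mapping.keys a \<subseteq> {..<N} \<times> UNIV"
    proof
      fix v assume v: "v \<in> Poly_Mapping.keys a"
      obtain k i where ki: "v = (k, i)" by (cases v)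
      have "D k \<noteq> 0"
      proof
        assume "D k = 0"
        then have "Poly_Mapping.lookup a (k, i) = 0" using p(1)[OF a, of k] by simp
        then show False using v ki by (simp add: in_keys_iff)
      qed
      then have "k < N" using assms(2) by (meson supp_below_def not_le)
      then show "v \<in> {..<N} \<times> UNIV" using ki by simp
    qed
    then have m: "mev a v = (\<Prod>k<N. \<Prod>i\<in>UNIV. v (k, i) ^ Poly_Mapping.lookup a (k, i))" for v
      by (subst mev_superset[of "{..<N} \<times> UNIV"]) (auto simp: prod.cartesian_product)
    have "mev a \<eta> = (\<Prod>k<N. \<Prod>i\<in>UNIV. c k ^ Poly_Mapping.lookup a (k, i) * \<psi> (k, i) ^ Poly_Mapping.lookup a (k, i))"
      unfolding m using assms(3) by (intro prod.cong refl) (simp add: power_mult_distrib)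
    also have "\<dots> = (\<Prod>k<N. c k ^ D k) * mev a \<psi>"
      unfolding m by (simp add: prod.distrib power_sum[symmetric] p(1)[OF a])
    finally show ?thesis .
  qed
  then show ?thesis using p(2)
    by (simp add: peval_superset[of "Poly_Mapping.keys p" p] sum_distrib_left mult_ac)
qed

section \<open>Homogeneous coordinates for tuples of points\<close>

definition nz :: "nat \<Rightarrow> (nat \<times> 'n \<Rightarrow> complex) \<Rightarrow> bool" where
  "nz N \<psi> \<longleftrightarrow> (\<forall>k<N. \<exists>i. \<psi> (k, i) \<noteq> 0)"

definition tuple :: "nat \<Rightarrow> (nat \<times> 'n::finite \<Rightarrow> complex) \<Rightarrow> (complex ^ 'n) set list" where
  "tuple N \<psi> = map (\<lambda>k. pt (\<chi> i. \<psi> (k, i))) [0..<N]"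

lemma length_tuple [simp]: "length (tuple N \<psi>) = N"
  by (simp add: tuple_def)

lemma nth_tuple [simp]: "k < N \<Longrightarrow> tuple N \<psi> ! k = pt (\<chi> i. \<psi> (k, i))"
  by (simp add: tuple_def)

lemma nz_vec: "nz N \<psi> \<Longrightarrow> k < N \<Longrightarrow> (\<chi> i. \<psi> (k, i)) \<noteq> 0"
  by (auto simp: nz_def vec_eq_iff)

lemma tuple_in_PV_power: "nz N \<psi> \<Longrightarrow> tuple N \<psi> \<in> PV_power N"
  using nz_vec[of N \<psi>] by (auto simp: PV_power_def PV_def tuple_def)

lemma PV_power_tuple:
  assumes "Ps \<in> PV_power N"
  obtains \<psi> where "nz N \<psi>" "Ps = tuple N \<psi>"
proof -
  have "\<forall>k\<in>{..<N}. \<exists>x. x \<noteq> 0 \<and> Ps ! k = pt x"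
    using assms by (auto simp: PV_power_def PV_def subset_iff set_conv_nth)
  from bchoice[OF this] obtain x where x: "\<And>k. k < N \<Longrightarrow> x k \<noteq> 0" "\<And>k. k < N \<Longrightarrow> Ps ! k = pt (x k)"
    by auto
  let ?\<psi> = "\<lambda>(k, i). x k $ i"
  have "nz N ?\<psi>" using x(1) by (auto simp: nz_def vec_eq_iff)
  moreover have "Ps = tuple N ?\<psi>"
    using assms x(2) by (intro nth_equalityI) (auto simp: PV_power_def)
  ultimately show thesis by (rule that)
qed

lemma sym_power_PV_iff: "z \<in> sym_power_PV N \<longleftrightarrow> (\<exists>\<psi>. nz N \<psi> \<and> z = mset (tuple N \<psi>))"
proof
  assume "z \<in> sym_power_PV N"
  then obtain Ps where "Ps \<in> PV_power N" "z = mset Ps" by (auto simp: sym_power_PV_def)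
  then show "\<exists>\<psi>. nz N \<psi> \<and> z = mset (tuple N \<psi>)" using PV_power_tuple[of Ps N] by blast
next
  assume "\<exists>\<psi>. nz N \<psi> \<and> z = mset (tuple N \<psi>)"
  then show "z \<in> sym_power_PV N" using tuple_in_PV_power by (auto simp: sym_power_PV_def)
qed

lemma tuple_eq_scale:
  assumes "nz N \<psi>" "nz N \<eta>" "\<And>k. k < N \<Longrightarrow> pt (\<chi> i. \<psi> (k, i)) = pt (\<chi> i. \<eta> (\<sigma> k, i))" "\<And>k. k < N \<Longrightarrow> \<sigma> k < N"
  obtains c where "\<And>k. k < N \<Longrightarrow> c k \<noteq> 0" "\<And>k i. k < N \<Longrightarrow> \<eta> (\<sigma> k, i) = c k * \<psi> (k, i)"
proof -
  have "\<forall>k\<in>{..<N}. \<exists>c. c \<noteq> 0 \<and> (\<forall>i. \<eta> (\<sigma> k, i) = c * \<psi> (k, i))"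
  proof
    fix k assume "k \<in> {..<N}"
    then have k: "k < N" by simp
    from pt_eq_iff[OF nz_vec[OF assms(1) k] nz_vec[OF assms(2) assms(4)[OF k]]] assms(3)[OF k]
    obtain c where "c \<noteq> 0" "(\<chi> i. \<eta> (\<sigma> k, i)) = c *s (\<chi> i. \<psi> (k, i))" by blast
    then show "\<exists>c. c \<noteq> 0 \<and> (\<forall>i. \<eta> (\<sigma> k, i) = c * \<psi> (k, i))" by (auto simp: vec_eq_iff)
  qed
  from bchoice[OF this] obtain c where "\<forall>k\<in>{..<N}. c k \<noteq> 0 \<and> (\<forall>i. \<eta> (\<sigma> k, i) = c k * \<psi> (k, i))"
    by blast
  then show thesis using that[of c] by simp
qed

lemma mset_tuple_eq_iff:
  assumes "nz N \<psi>" "nz N \<eta>"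
  shows "mset (tuple N \<psi>) = mset (tuple N \<eta>) \<longleftrightarrow>
    (\<exists>\<sigma> c. \<sigma> permutes {..<N} \<and> (\<forall>k<N. c k \<noteq> 0 \<and> (\<forall>i. \<eta> (\<sigma> k, i) = c k * \<psi> (k, i))))"
proof
  assume "mset (tuple N \<psi>) = mset (tuple N \<eta>)"
  then obtain \<sigma> where \<sigma>: "\<sigma> permutes {..<N}" "permute_list \<sigma> (tuple N \<eta>) = tuple N \<psi>"
    using mset_eq_permutation by (metis length_tuple)
  have "pt (\<chi> i. \<psi> (k, i)) = pt (\<chi> i. \<eta> (\<sigma> k, i))" if k: "k < N" for k
  proof -
    have "\<sigma> k < N" using permutes_in_image[OF \<sigma>(1)] k by auto
    have "tuple N \<psi> ! k = tuple N \<eta> ! \<sigma> k"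
      using \<sigma> k by (metis length_tuple permute_list_nth)
    then show ?thesis using k \<open>\<sigma> k < N\<close> by simp
  qed
  moreover have "\<sigma> k < N" if "k < N" for k using permutes_in_image[OF \<sigma>(1)] that by auto
  ultimately obtain c where "\<And>k. k < N \<Longrightarrow> c k \<noteq> 0" "\<And>k i. k < N \<Longrightarrow> \<eta> (\<sigma> k, i) = c k * \<psi> (k, i)"
    using tuple_eq_scale[OF assms, of \<sigma>] by blast
  then show "\<exists>\<sigma> c. \<sigma> permutes {..<N} \<and> (\<forall>k<N. c k \<noteq> 0 \<and> (\<forall>i. \<eta> (\<sigma> k, i) = c k * \<psi> (k, i)))"
    using \<sigma>(1) by (intro exI[of _ \<sigma>] exI[of _ c]) auto
next
  assume "\<exists>\<sigma> c. \<sigma> permutes {..<N} \<and> (\<forall>k<N. c k \<noteq> 0 \<and> (\<forall>i. \<eta> (\<sigma> k, i) = c k * \<psi> (k, i)))"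
  then obtain \<sigma> c where \<sigma>: "\<sigma> permutes {..<N}" "\<And>k. k < N \<Longrightarrow> c k \<noteq> 0" "\<And>k i. k < N \<Longrightarrow> \<eta> (\<sigma> k, i) = c k * \<psi> (k, i)"
    by blast
  have "tuple N \<psi> = permute_list \<sigma> (tuple N \<eta>)"
  proof (rule nth_equalityI)
    fix k assume "k < length (tuple N \<psi>)"
    then have k: "k < N" by simp
    have "\<sigma> k < N" using permutes_in_image[OF \<sigma>(1)] k by auto
    have "(\<chi> i. \<eta> (\<sigma> k, i)) = c k *s (\<chi> i. \<psi> (k, i))" using \<sigma>(3)[OF k] by (simp add: vec_eq_iff)
    then have "pt (\<chi> i. \<psi> (k, i)) = pt (\<chi> i. \<eta> (\<sigma> k, i))"
      using pt_eq_iff[OF nz_vec[OF assms(1) k] nz_vec[OF assms(2) \<open>\<sigma> k < N\<close>]] \<sigma>(2)[OF k] by blast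
    then show "tuple N \<psi> ! k = permute_list \<sigma> (tuple N \<eta>) ! k"
      using k \<open>\<sigma> k < N\<close> \<sigma>(1) by (simp add: permute_list_nth)
  qed simp
  then show "mset (tuple N \<psi>) = mset (tuple N \<eta>)" using \<sigma>(1) by simp
qed

lemma mhom_nonzero_scale:
  assumes "mhom D G" "supp_below N D" "\<And>k. k < N \<Longrightarrow> c k \<noteq> 0"
    "\<And>k i. k < N \<Longrightarrow> \<eta> (k, i) = c k * \<psi> (k, i)"
  shows "G \<eta> = 0 \<longleftrightarrow> G \<psi> = 0"
  using mhom_scale[OF assms(1,2), of \<eta> c \<psi>] assms(3,4) by auto

definition vbase :: "nat \<Rightarrow> (nat \<times> 'n::finite) cpoly \<Rightarrow> (complex ^ 'n) set list set" where
  "vbase N p = {Ps \<in> PV_power N. \<forall>x. (\<forall>k<N. x k \<in> Ps ! k - {0}) \<longrightarrow> peval p (\<lambda>(k, i). x k $ i) \<noteq> 0}"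

lemma zariski_PV_power_altdef:
  "zariski_PV_power N = topology_generated_by {vbase N p | p. multihomogeneous N p}"
  by (simp add: zariski_PV_power_def vbase_def)

lemma multihomogeneous_mhom: "multihomogeneous N p \<Longrightarrow> \<exists>D. supp_below N D \<and> mhom D (peval p)"
  unfolding multihomogeneous_def mhom_def supp_below_def by blast

lemma mhom_multihomogeneous:
  assumes "mhom D G" "supp_below N D" obtains p where "multihomogeneous N p" "G = peval p"
  using assms unfolding multihomogeneous_def mhom_def supp_below_def by (metis ext)

lemma vbase_tuple:
  fixes p :: "(nat \<times> 'n::finite) cpoly"
  assumes "multihomogeneous N p" "nz N \<psi>"
  shows "tuple N \<psi> \<in> vbase N p \<longleftrightarrow> peval p \<psi> \<noteq> 0"
proof -
  obtain D where D: "supp_below N D" "mhom D (peval p)" using multihomogeneous_mhom[OF assms(1)] by blast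
  have A: "peval p (\<lambda>(k, i). x k $ i) = 0 \<longleftrightarrow> peval p \<psi> = 0"
    if x: "\<And>k. k < N \<Longrightarrow> x k \<in> tuple N \<psi> ! k - {0}" for x :: "nat \<Rightarrow> complex ^ 'n"
  proof -
    have "\<forall>k\<in>{..<N}. \<exists>c. c \<noteq> 0 \<and> x k = c *s (\<chi> i. \<psi> (k, i))"
    proof
      fix k assume "k \<in> {..<N}"
      then have k: "k < N" by simp
      then have "x k \<in> pt (\<chi> i. \<psi> (k, i)) - {0}" using x[OF k] by simp
      then show "\<exists>c. c \<noteq> 0 \<and> x k = c *s (\<chi> i. \<psi> (k, i))"
        using pt_minus_0_iff[OF nz_vec[OF assms(2) k]] by blast
    qed
    from bchoice[OF this] obtain c where c: "\<And>k. k < N \<Longrightarrow> c k \<noteq> 0" "\<And>k. k < N \<Longrightarrow> x k = c k *s (\<chi> i. \<psi> (k, i))"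
      by auto
    show ?thesis
      by (rule mhom_nonzero_scale[OF D(2,1), of c]) (use c in auto)
  qed
  have B: "(\<chi> i. \<psi> (k, i)) \<in> tuple N \<psi> ! k - {0}" if "k < N" for k
    using nz_vec[OF assms(2) that] pt_self that by auto
  show ?thesis
  proof
    assume "tuple N \<psi> \<in> vbase N p"
    then have "peval p (\<lambda>(k, i). (\<chi> i. \<psi> (k, i)) $ i) \<noteq> 0"
    proof -
      assume "tuple N \<psi> \<in> vbase N p"
      then have "\<forall>x. (\<forall>k<N. x k \<in> tuple N \<psi> ! k - {0}) \<longrightarrow> peval p (\<lambda>(k, i). x k $ i) \<noteq> 0" by (simp add: vbase_def)
      from spec[OF this, of "\<lambda>k. \<chi> i. \<psi> (k, i)"] show ?thesis using B by simp
    qed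
    then show "peval p \<psi> \<noteq> 0" using A[of "\<lambda>k. \<chi> i. \<psi> (k, i)"] B by simp
  next
    assume *: "peval p \<psi> \<noteq> 0"
    show "tuple N \<psi> \<in> vbase N p"
      unfolding vbase_def
    proof (intro CollectI conjI allI impI tuple_in_PV_power assms(2))
      fix x assume "\<forall>k<N. x k \<in> tuple N \<psi> ! k - {0}"
      then show "peval p (\<lambda>(k, i). x k $ i) \<noteq> 0" using A[of x] * by simp
    qed
  qed
qed

lemma PV_power_vbase:
  fixes U :: "(complex ^ 'n::finite) set list set"
  assumes "openin (zariski_PV_power N) U" "P \<in> U"
  shows "\<exists>p. multihomogeneous N p \<and> P \<in> vbase N p \<and> vbase N p \<subseteq> U"
proof -
  have "\<exists>B\<in>{vbase N p | p. multihomogeneous N p}. P \<in> B \<and> B \<subseteq> U"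
  proof (rule openin_generated_base[OF _ assms(2)])
    show "openin (topology_generated_by {vbase N p | p. multihomogeneous N p}) U"
      using assms(1) by (simp add: zariski_PV_power_altdef)
    fix A B :: "(complex ^ 'n) set list set"
    assume "A \<in> {vbase N p | p. multihomogeneous N p}" "B \<in> {vbase N p | p. multihomogeneous N p}"
    then obtain p q where pq: "multihomogeneous N p" "multihomogeneous N q" "A = vbase N p" "B = vbase N q" by blast
    obtain D D' where D: "supp_below N D" "mhom D (peval p)" "supp_below N D'" "mhom D' (peval q)"
      using multihomogeneous_mhom pq by metis
    have "mhom (\<lambda>k. D k + D' k) (\<lambda>\<psi>. peval p \<psi> * peval q \<psi>)" by (rule mhom_mult[OF D(2,4)])
    then have "mhom (\<lambda>k. D k + D' k) (peval (p * q))" by (simp add: peval_mult[abs_def])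
    moreover have "supp_below N (\<lambda>k. D k + D' k)" using D by (simp add: supp_below_def)
    ultimately obtain r where r: "multihomogeneous N r" "peval (p * q) = peval r"
      by (rule mhom_multihomogeneous)
    have "A \<inter> B = vbase N r"
      unfolding pq vbase_def r(2)[symmetric] peval_mult by auto
    then show "A \<inter> B \<in> {vbase N p | p. multihomogeneous N p}" using r(1) by blast
  qed
  then show ?thesis by blast
qed

lemma topspace_zariski_sym_power [simp]:
  "topspace (zariski_sym_power_PV N :: (complex ^ 'n::finite) set multiset topology) = sym_power_PV N"
proof -
  have "{Ps \<in> PV_power N. mset Ps \<in> (sym_power_PV N :: (complex ^ 'n) set multiset set)} = PV_power N"
    by (auto simp: sym_power_PV_def)
  then have "openin (zariski_sym_power_PV N) (sym_power_PV N :: (complex ^ 'n) set multiset set)"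
    unfolding openin_zariski_sym_power_PV by (metis openin_topspace subset_refl topspace_zariski_PV_power)
  then show ?thesis
    using openin_subset openin_zariski_sym_power_PV[of N] by (metis openin_topspace subset_antisym)
qed

text \<open>In the quotient topology the complement of A pulls back to an open set of ordered
  tuples, which contains a basic neighbourhood of the given one. The function obtained has no
  symmetry yet.\<close>

lemma closed_sym_power_separate:
  assumes "closedin (zariski_sym_power_PV N) A" "nz N \<psi>" "mset (tuple N \<psi>) \<notin> A"
  obtains D G where "supp_below N D" "mhom D G" "G \<psi> \<noteq> 0"
    "\<And>\<eta>. nz N \<eta> \<Longrightarrow> mset (tuple N \<eta>) \<in> A \<Longrightarrow> G \<eta> = 0"
proof -
  define U where "U = sym_power_PV N - A"
  have "openin (zariski_sym_power_PV N) U" using assms(1) by (simp add: closedin_def U_def)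
  then have op: "openin (zariski_PV_power N) {Ps \<in> PV_power N. mset Ps \<in> U}"
    by (simp add: openin_zariski_sym_power_PV)
  have "tuple N \<psi> \<in> {Ps \<in> PV_power N. mset Ps \<in> U}"
    using tuple_in_PV_power[OF assms(2)] assms(3) by (auto simp: U_def sym_power_PV_def)
  from PV_power_vbase[OF op this] obtain p where p: "multihomogeneous N p" "tuple N \<psi> \<in> vbase N p"
    "vbase N p \<subseteq> {Ps \<in> PV_power N. mset Ps \<in> U}" by blast
  obtain D where D: "supp_below N D" "mhom D (peval p)" using multihomogeneous_mhom[OF p(1)] by blast
  show thesis
  proof (rule that[OF D])
    show "peval p \<psi> \<noteq> 0" using p(2) vbase_tuple[OF p(1) assms(2)] by simp
    fix \<eta> assume "nz N \<eta>" "mset (tuple N \<eta>) \<in> A"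
    then show "peval p \<eta> = 0" using p(3) vbase_tuple[OF p(1), of \<eta>] by (auto simp: U_def)
  qed
qed

text \<open>Quantifies over all orderings and scalings, so it is a condition on the unordered tuple
  even for G without symmetry.\<close>

definition vanishes :: "nat \<Rightarrow> ((nat \<times> 'n::finite \<Rightarrow> complex) \<Rightarrow> complex) \<Rightarrow> (complex ^ 'n) set multiset \<Rightarrow> bool" where
  "vanishes N G z \<longleftrightarrow> (\<forall>\<psi>. nz N \<psi> \<longrightarrow> mset (tuple N \<psi>) = z \<longrightarrow> G \<psi> = 0)"

lemma nz_permute:
  assumes "nz N \<psi>" "\<sigma> permutes {..<N}" shows "nz N (\<lambda>(k, i). \<psi> (\<sigma> k, i))"
  using assms(1) permutes_in_image[OF assms(2)] by (auto simp: nz_def)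

lemma mset_tuple_permute:
  assumes "nz N \<psi>" "\<sigma> permutes {..<N}"
  shows "mset (tuple N (\<lambda>(k, i). \<psi> (\<sigma> k, i))) = mset (tuple N \<psi>)"
proof -
  have "\<exists>\<tau> c. \<tau> permutes {..<N} \<and> (\<forall>k<N. c k \<noteq> 0 \<and>
     (\<forall>i. \<psi> (\<tau> k, i) = c k * (\<lambda>(k, i). \<psi> (\<sigma> k, i)) (k, i)))"
    using assms(2) by (intro exI[of _ \<sigma>] exI[of _ "\<lambda>_. 1"]) auto
  then show ?thesis using mset_tuple_eq_iff[OF nz_permute[OF assms] assms(1)] by blast
qed

text \<open>The complement pulls back to the union, over permutations of the blocks, of the basic
  open sets of the permuted functions.\<close>

lemma closedin_vanishes:
  fixes G :: "(nat \<times> 'n::finite \<Rightarrow> complex) \<Rightarrow> complex"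
  assumes "mhom D G" "supp_below N D"
  shows "closedin (zariski_sym_power_PV N) {z \<in> sym_power_PV N. vanishes N G z}"
proof -
  define U where "U = {z \<in> sym_power_PV N. \<not> vanishes N G z}"
  have "\<exists>p. multihomogeneous N p \<and> (\<forall>\<psi>. peval p \<psi> = G (\<lambda>(k, i). \<psi> (\<sigma> k, i)))" if \<sigma>: "\<sigma> permutes {..<N}" for \<sigma>
  proof -
    have "mhom (\<lambda>k. D (inv \<sigma> k)) (\<lambda>\<psi>. G (\<lambda>(k, i). \<psi> (\<sigma> k, i)))"
      by (rule mhom_permute[OF assms(1) permutes_bij[OF \<sigma>]])
    moreover have "supp_below N (\<lambda>k. D (inv \<sigma> k))"
      unfolding supp_below_def
    proof (intro allI impI)
      fix k assume "k \<ge> N"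
      then have "inv \<sigma> k = k" using permutes_not_in[OF permutes_inv[OF \<sigma>], of k] by simp
      then show "D (inv \<sigma> k) = 0" using assms(2) \<open>k \<ge> N\<close> by (simp add: supp_below_def)
    qed
    ultimately obtain p where "multihomogeneous N p" "(\<lambda>\<psi>. G (\<lambda>(k, i). \<psi> (\<sigma> k, i))) = peval p"
      by (rule mhom_multihomogeneous)
    then show ?thesis by (intro exI[of _ p]) (auto simp: fun_eq_iff)
  qed
  then obtain p where p: "\<And>\<sigma>. \<sigma> permutes {..<N} \<Longrightarrow> multihomogeneous N (p \<sigma>)"
    "\<And>\<sigma> \<psi>. \<sigma> permutes {..<N} \<Longrightarrow> peval (p \<sigma>) \<psi> = G (\<lambda>(k, i). \<psi> (\<sigma> k, i))" by metis
  have "{Ps \<in> PV_power N. mset Ps \<in> U} = (\<Union>\<sigma>\<in>{\<sigma>. \<sigma> permutes {..<N}}. vbase N (p \<sigma>))"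
  proof (intro equalityI subsetI)
    fix Ps assume Ps: "Ps \<in> {Ps \<in> PV_power N. mset Ps \<in> U}"
    then obtain \<eta> where \<eta>: "nz N \<eta>" "Ps = tuple N \<eta>" using PV_power_tuple by blast
    obtain \<psi> where \<psi>: "nz N \<psi>" "mset (tuple N \<psi>) = mset (tuple N \<eta>)" "G \<psi> \<noteq> 0"
      using Ps \<eta>(2) unfolding U_def vanishes_def by auto
    obtain \<sigma> c where \<sigma>: "\<sigma> permutes {..<N}" "\<And>k. k < N \<Longrightarrow> c k \<noteq> 0" "\<And>k i. k < N \<Longrightarrow> \<eta> (\<sigma> k, i) = c k * \<psi> (k, i)"
      using mset_tuple_eq_iff[OF \<psi>(1) \<eta>(1)] \<psi>(2) by blast
    have "G (\<lambda>(k, i). \<eta> (\<sigma> k, i)) \<noteq> 0"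
      using mhom_nonzero_scale[OF assms, of c "\<lambda>(k, i). \<eta> (\<sigma> k, i)" \<psi>] \<sigma>(2,3) \<psi>(3) by simp
    then have "Ps \<in> vbase N (p \<sigma>)"
      using vbase_tuple[OF p(1)[OF \<sigma>(1)] \<eta>(1)] p(2)[OF \<sigma>(1)] \<eta>(2) by simp
    then show "Ps \<in> (\<Union>\<sigma>\<in>{\<sigma>. \<sigma> permutes {..<N}}. vbase N (p \<sigma>))" using \<sigma>(1) by blast
  next
    fix Ps assume "Ps \<in> (\<Union>\<sigma>\<in>{\<sigma>. \<sigma> permutes {..<N}}. vbase N (p \<sigma>))"
    then obtain \<sigma> where \<sigma>: "\<sigma> permutes {..<N}" "Ps \<in> vbase N (p \<sigma>)" by blast
    then have "Ps \<in> PV_power N" by (simp add: vbase_def)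
    then obtain \<eta> where \<eta>: "nz N \<eta>" "Ps = tuple N \<eta>" by (rule PV_power_tuple)
    then have "G (\<lambda>(k, i). \<eta> (\<sigma> k, i)) \<noteq> 0" using vbase_tuple[OF p(1)[OF \<sigma>(1)] \<eta>(1)] p(2)[OF \<sigma>(1)] \<sigma>(2) by simp
    then have "\<not> vanishes N G (mset Ps)"
      unfolding vanishes_def using nz_permute[OF \<eta>(1) \<sigma>(1)] mset_tuple_permute[OF \<eta>(1) \<sigma>(1)] \<eta>(2) by blast
    then show "Ps \<in> {Ps \<in> PV_power N. mset Ps \<in> U}"
      using \<open>Ps \<in> PV_power N\<close> by (auto simp: U_def sym_power_PV_def)
  qed
  moreover have "openin (zariski_PV_power N) (\<Union>\<sigma>\<in>{\<sigma>. \<sigma> permutes {..<N}}. vbase N (p \<sigma>))"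
    using p(1) unfolding zariski_PV_power_altdef
    by (intro openin_Union) (auto intro!: topology_generated_by_Basis)
  ultimately have "openin (zariski_sym_power_PV N) U"
    unfolding openin_zariski_sym_power_PV by (auto simp: U_def)
  moreover have "sym_power_PV N - {z \<in> sym_power_PV N. vanishes N G z} = U" by (auto simp: U_def)
  ultimately show ?thesis by (simp add: closedin_def)
qed

text \<open>Equal degrees in all blocks are compatible with permuting the blocks, and the degree of
  products and powers is then tracked by the single number e.\<close>

definition symhom :: "nat \<Rightarrow> nat \<Rightarrow> ((nat \<times> 'n::finite \<Rightarrow> complex) \<Rightarrow> complex) \<Rightarrow> bool" where
  "symhom N e G \<longleftrightarrow> mhom (\<lambda>k. if k < N then e else 0) G \<and>
     (\<forall>\<sigma> \<psi>. \<sigma> permutes {..<N} \<longrightarrow> G (\<lambda>(k, i). \<psi> (\<sigma> k, i)) = G \<psi>)"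

lemma symhom_mult: "symhom N e F \<Longrightarrow> symhom N e' G \<Longrightarrow> symhom N (e + e') (\<lambda>\<psi>. F \<psi> * G \<psi>)"
proof -
  assume "symhom N e F" "symhom N e' G"
  moreover have "(\<lambda>k. (if k < N then e else 0) + (if k < N then e' else 0)) = (\<lambda>k. if k < N then e + e' else 0)" by auto
  ultimately show ?thesis unfolding symhom_def
    using mhom_mult[of "\<lambda>k. if k < N then e else 0" F "\<lambda>k. if k < N then e' else 0" G] by simp
qed

lemma symhom_power: "symhom N e F \<Longrightarrow> symhom N (j * e) (\<lambda>\<psi>. F \<psi> ^ j)"
proof -
  assume "symhom N e F"
  moreover have "(\<lambda>k. j * (if k < N then e else 0)) = (\<lambda>k. if k < N then j * e else 0)" by auto
  ultimately show ?thesis unfolding symhom_def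
    using mhom_power[of "\<lambda>k. if k < N then e else 0" F j] by simp
qed

lemma symhom_cmult: "symhom N e F \<Longrightarrow> symhom N e (\<lambda>\<psi>. c * F \<psi>)"
  by (simp add: symhom_def mhom_cmult)

lemma symhom_sum: "(\<And>i. i \<in> I \<Longrightarrow> symhom N e (F i)) \<Longrightarrow> symhom N e (\<lambda>\<psi>. \<Sum>i\<in>I. F i \<psi>)"
  unfolding symhom_def by (auto intro!: mhom_sum sum.cong)

lemma supp_below_const: "supp_below N (\<lambda>k. if k < N then e else 0)"
  by (simp add: supp_below_def)

lemma symhom_vanishes_iff:
  assumes "symhom N e G" "nz N \<psi>"
  shows "vanishes N G (mset (tuple N \<psi>)) \<longleftrightarrow> G \<psi> = 0"
proof
  assume "G \<psi> = 0"
  show "vanishes N G (mset (tuple N \<psi>))"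
    unfolding vanishes_def
  proof (intro allI impI)
    fix \<eta> assume \<eta>: "nz N \<eta>" "mset (tuple N \<eta>) = mset (tuple N \<psi>)"
    obtain \<sigma> c where \<sigma>: "\<sigma> permutes {..<N}" "\<And>k. k < N \<Longrightarrow> c k \<noteq> 0" "\<And>k i. k < N \<Longrightarrow> \<psi> (\<sigma> k, i) = c k * \<eta> (k, i)"
      using mset_tuple_eq_iff[OF \<eta>(1) assms(2)] \<eta>(2) by blast
    have "G (\<lambda>(k, i). \<psi> (\<sigma> k, i)) = 0 \<longleftrightarrow> G \<eta> = 0"
      by (rule mhom_nonzero_scale[where c = c and N = N and D = "\<lambda>k. if k < N then e else 0"])
         (use assms(1) \<sigma> supp_below_const in \<open>auto simp: symhom_def\<close>)
    then show "G \<eta> = 0" using \<open>G \<psi> = 0\<close> assms(1) \<sigma>(1) by (simp add: symhom_def)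
  qed
qed (use assms in \<open>auto simp: vanishes_def\<close>)

text \<open>If all power sums with j \<ge> 1 vanished, so would the sum of Q (c i) for every
  polynomial Q with Q 0 = 0. Taking Q with zeros at 0 and at all values other than
  \<open>c i0\<close> leaves a positive multiple of its nonzero value at
  \<open>c i0\<close>.\<close>

lemma power_sum_nonzero:
  fixes c :: "'i \<Rightarrow> complex"
  assumes "finite I" "i0 \<in> I" "c i0 \<noteq> 0"
  shows "\<exists>j\<ge>1. (\<Sum>i\<in>I. c i ^ j) \<noteq> 0"
proof (rule ccontr)
  assume *: "\<not> ?thesis"
  define V where "V = insert 0 (c ` I - {c i0})"
  define Q where "Q = (\<Prod>w\<in>V. [:- w, 1:])"
  have "finite V" using assms(1) by (simp add: V_def)
  have Q0: "poly Q w = 0" if "w \<in> V" for w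
    using that \<open>finite V\<close> by (auto simp: Q_def poly_prod)
  have Qv: "poly Q (c i0) \<noteq> 0"
    using \<open>finite V\<close> assms(3) by (auto simp: Q_def poly_prod V_def)
  have "(\<Sum>i\<in>I. poly Q (c i)) = (\<Sum>j\<le>degree Q. poly.coeff Q j * (\<Sum>i\<in>I. c i ^ j))"
    unfolding poly_altdef sum_distrib_left by (rule sum.swap)
  also have "\<dots> = 0"
  proof (rule sum.neutral, intro ballI)
    fix j
    have "poly.coeff Q 0 = 0" using Q0[of 0] by (simp add: V_def poly_0_coeff_0)
    then show "poly.coeff Q j * (\<Sum>i\<in>I. c i ^ j) = 0" using * by (cases "j = 0") auto
  qed
  finally have "(\<Sum>i\<in>I. poly Q (c i)) = 0" .
  moreover have "(\<Sum>i\<in>I. poly Q (c i)) = (\<Sum>i\<in>{i\<in>I. c i = c i0}. poly Q (c i0))"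
  proof -
    have "(\<Sum>i\<in>I. poly Q (c i)) = (\<Sum>i\<in>{i\<in>I. c i = c i0}. poly Q (c i))"
      using assms(1) Q0 by (intro sum.mono_neutral_right) (auto simp: V_def)
    then show ?thesis by simp
  qed
  moreover have "card {i\<in>I. c i = c i0} \<noteq> 0" using assms by auto
  ultimately show False using Qv by simp
qed

text \<open>Symmetrization: a power sum of the translates of \<open>G\<close>, after equalizing its degrees.\<close>

lemma closed_sym_power_separate_symhom:
  fixes \<psi> :: "nat \<times> 'n::finite \<Rightarrow> complex"
  assumes "closedin (zariski_sym_power_PV N) A" "nz N \<psi>" "mset (tuple N \<psi>) \<notin> A"
  obtains e S where "e \<ge> 1" "symhom N e S" "\<not> vanishes N S (mset (tuple N \<psi>))" "\<And>z. z \<in> A \<Longrightarrow> vanishes N S z"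
proof -
  obtain D G where G: "supp_below N D" "mhom D G" "G \<psi> \<noteq> 0"
    "\<And>\<eta>. nz N \<eta> \<Longrightarrow> mset (tuple N \<eta>) \<in> A \<Longrightarrow> G \<eta> = 0"
    using closed_sym_power_separate[OF assms] by blast
  \<comment> \<open>The successor keeps m, and with it the degree e, positive.\<close>
  define m where "m = Suc (\<Sum>k<N. D k)"
  have Dm: "D k \<le> m" if "k < N" for k
    using member_le_sum[of k "{..<N}" D] that by (simp add: m_def)
  obtain i where i: "\<And>k. k < N \<Longrightarrow> \<psi> (k, i k) \<noteq> 0" using assms(2) unfolding nz_def by metis
  \<comment> \<open>Each block gets its missing degree from a power of a coordinate that is nonzero
    at \<psi>.\<close>
  define H where "H = (\<lambda>\<eta>. G \<eta> * (\<Prod>l<N. \<eta> (l, i l) ^ (m - D l)))"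
  have H: "mhom (\<lambda>k. if k < N then m else 0) H"
  proof -
    have "mhom (\<lambda>k. D k + (\<Sum>l<N. (m - D l) * (if k = l then 1 else 0))) H"
      unfolding H_def by (intro mhom_mult G(2) mhom_prod mhom_power mhom_var) auto
    moreover have "(\<lambda>k. D k + (\<Sum>l<N. (m - D l) * (if k = l then 1 else 0))) = (\<lambda>k. if k < N then m else 0)"
      using Dm G(1) by (auto simp: supp_below_def fun_eq_iff if_distrib cong: if_cong)
    ultimately show ?thesis by simp
  qed
  have "H \<psi> \<noteq> 0" using G(3) i by (simp add: H_def)
  let ?P = "{\<sigma>. \<sigma> permutes {..<N}}"
  have fin: "finite ?P" by (rule finite_permutations) simp
  have "id \<in> ?P" by (simp add: permutes_id)
  moreover have "H (\<lambda>(k, i). \<psi> (id k, i)) \<noteq> 0" using \<open>H \<psi> \<noteq> 0\<close> by simp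
  \<comment> \<open>The plain sum over the permutations might cancel at \<psi>; some power sum does
    not.\<close>
  ultimately obtain j where j: "j \<ge> 1" "(\<Sum>\<sigma>\<in>?P. H (\<lambda>(k, i). \<psi> (\<sigma> k, i)) ^ j) \<noteq> 0"
    using power_sum_nonzero[OF fin, of id "\<lambda>\<sigma>. H (\<lambda>(k, i). \<psi> (\<sigma> k, i))"] by blast
  define S where "S = (\<lambda>\<eta>. \<Sum>\<sigma>\<in>?P. H (\<lambda>(k, i). \<eta> (\<sigma> k, i)) ^ j)"
  have sym: "symhom N (j * m) S"
    unfolding symhom_def
  proof (intro conjI allI impI)
    have perm: "mhom (\<lambda>k. if k < N then m else 0) (\<lambda>\<eta>. H (\<lambda>(k, i). \<eta> (\<sigma> k, i)))" if \<sigma>: "\<sigma> permutes {..<N}" for \<sigma>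
    proof -
      have "(\<lambda>k. if inv \<sigma> k < N then m else 0) = (\<lambda>k. if k < N then m else 0)"
        using permutes_in_image[OF permutes_inv[OF \<sigma>]] by auto
      then show ?thesis using mhom_permute[OF H permutes_bij[OF \<sigma>]] by simp
    qed
    have "mhom (\<lambda>k. j * (if k < N then m else 0)) S"
      unfolding S_def by (intro mhom_sum mhom_power perm) simp
    moreover have "(\<lambda>k. j * (if k < N then m else 0)) = (\<lambda>k. if k < N then j * m else 0)" by auto
    ultimately show "mhom (\<lambda>k. if k < N then j * m else 0) S" by simp
    fix \<tau> \<eta> assume \<tau>: "\<tau> permutes {..<N}"
    have "(\<Sum>\<sigma>\<in>?P. H (\<lambda>(k, i). \<eta> (\<tau> (\<sigma> k), i)) ^ j) = (\<Sum>\<sigma>\<in>?P. H (\<lambda>(k, i). \<eta> (\<sigma> k, i)) ^ j)"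
      using sum.reindex_bij_betw[of "(\<circ>) \<tau>" ?P ?P "\<lambda>\<sigma>. H (\<lambda>(k, i). \<eta> (\<sigma> k, i)) ^ j"]
        setum_permutations_compose_left[OF \<tau>, of "\<lambda>\<sigma>. H (\<lambda>(k, i). \<eta> (\<sigma> k, i)) ^ j"]
      by simp
    then show "S (\<lambda>(k, i). \<eta> (\<tau> k, i)) = S \<eta>" by (simp add: S_def case_prod_beta)
  qed
  show thesis
  proof (rule that[OF _ sym])
    show "j * m \<ge> 1" using j(1) by (simp add: m_def)
    show "\<not> vanishes N S (mset (tuple N \<psi>))"
      using j(2) assms(2) unfolding vanishes_def S_def by blast
    fix z assume z: "z \<in> A"
    show "vanishes N S z"
      unfolding vanishes_def
    proof (intro allI impI)
      fix \<eta> assume \<eta>: "nz N \<eta>" "mset (tuple N \<eta>) = z"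
      have "H (\<lambda>(k, i). \<eta> (\<sigma> k, i)) = 0" if "\<sigma> permutes {..<N}" for \<sigma>
        using G(4)[OF nz_permute[OF \<eta>(1) that]] mset_tuple_permute[OF \<eta>(1) that] \<eta>(2) z by (simp add: H_def)
      then show "S \<eta> = 0" unfolding S_def using j(1) by (intro sum.neutral) auto
    qed
  qed
qed

lemma eig_tuple_mset:
  assumes "exactly d N \<phi>" "eig_tuple d N \<phi> \<psi>"
  shows "nz N \<psi>" "mset (tuple N \<psi>) = mset_set (eig_lines d \<phi>)"
proof -
  show "nz N \<psi>" using assms(2) by (auto simp: eig_tuple_def nz_def)
  let ?L = "\<lambda>k. pt (\<chi> i. \<psi> (k, i))"
  have inj: "inj_on ?L {..<N}" by (rule eig_tuple_inj[OF assms(2)])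
  have "?L ` {..<N} = eig_lines d \<phi>"
    using assms(1) eig_tuple_lines(2)[OF assms(2)] card_image[OF inj]
    by (intro card_subset_eq) (auto simp: exactly_def)
  moreover have "mset (tuple N \<psi>) = image_mset ?L (mset_set {..<N})"
    by (simp add: tuple_def mset_map atLeast0LessThan[symmetric])
  ultimately show "mset (tuple N \<psi>) = mset_set (eig_lines d \<phi>)" using image_mset_mset_set[OF inj] by simp
qed

section \<open>Upper bound for the dimension\<close>

text \<open>More unknowns than equations: one equation is used to eliminate one unknown.\<close>

lemma homogeneous_system_nontrivial:
  fixes C :: "'a \<Rightarrow> 'j \<Rightarrow> complex"
  assumes "finite J" "finite A" "card J < card A"
  shows "\<exists>c. (\<exists>\<alpha>\<in>A. c \<alpha> \<noteq> 0) \<and> (\<forall>j\<in>J. (\<Sum>\<alpha>\<in>A. c \<alpha> * C \<alpha> j) = 0)"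
  using assms
proof (induction J arbitrary: A C rule: finite_induct)
  case empty
  then have "A \<noteq> {}" by auto
  then show ?case by (intro exI[of _ "\<lambda>_. 1"]) auto
next
  case (insert j J)
  show ?case
  proof (cases "\<forall>\<alpha>\<in>A. C \<alpha> j = 0")
    case True
    have "card J < card A" using insert by simp
    from insert.IH[OF insert.prems(1) this, of C] obtain c where
      c: "\<exists>\<alpha>\<in>A. c \<alpha> \<noteq> 0" "\<forall>j\<in>J. (\<Sum>\<alpha>\<in>A. c \<alpha> * C \<alpha> j) = 0" by blast
    have "(\<Sum>\<alpha>\<in>A. c \<alpha> * C \<alpha> j) = 0" using True by (intro sum.neutral) auto
    then show ?thesis using c by (intro exI[of _ c]) auto
  next
    case False
    then obtain \<beta> where \<beta>: "\<beta> \<in> A" "C \<beta> j \<noteq> 0" by blast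
    define A' where "A' = A - {\<beta>}"
    have A': "finite A'" "card J < card A'" using insert \<beta>(1) by (auto simp: A'_def)
    define C' where "C' = (\<lambda>\<alpha> i. C \<alpha> i - C \<alpha> j * (C \<beta> i / C \<beta> j))"
    from insert.IH[OF A', of C'] obtain c where
      c: "\<exists>\<alpha>\<in>A'. c \<alpha> \<noteq> 0" "\<forall>i\<in>J. (\<Sum>\<alpha>\<in>A'. c \<alpha> * C' \<alpha> i) = 0" by blast
    define k where "k = - (\<Sum>\<alpha>\<in>A'. c \<alpha> * C \<alpha> j) / C \<beta> j"
    let ?c = "c(\<beta> := k)"
    have sum: "(\<Sum>\<alpha>\<in>A. ?c \<alpha> * C \<alpha> i) = k * C \<beta> i + (\<Sum>\<alpha>\<in>A'. c \<alpha> * C \<alpha> i)" for i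
    proof -
      have "(\<Sum>\<alpha>\<in>A'. ?c \<alpha> * C \<alpha> i) = (\<Sum>\<alpha>\<in>A'. c \<alpha> * C \<alpha> i)" by (intro sum.cong) (auto simp: A'_def)
      then show ?thesis using insert.prems(1) \<beta>(1) unfolding A'_def by (subst sum.remove[of _ \<beta>]) auto
    qed
    have "(\<Sum>\<alpha>\<in>A. ?c \<alpha> * C \<alpha> i) = 0" if "i \<in> insert j J" for i
    proof (cases "i = j")
      case True
      then show ?thesis unfolding sum using \<beta>(2) by (simp add: k_def)
    next
      case False
      then have "(\<Sum>\<alpha>\<in>A'. c \<alpha> * C' \<alpha> i) = 0" using c(2) that by blast
      moreover have "(\<Sum>\<alpha>\<in>A'. c \<alpha> * C' \<alpha> i) =
          (\<Sum>\<alpha>\<in>A'. c \<alpha> * C \<alpha> i) - (\<Sum>\<alpha>\<in>A'. c \<alpha> * C \<alpha> j) * (C \<beta> i / C \<beta> j)"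
        unfolding C'_def right_diff_distrib sum_subtractf sum_distrib_right by (simp only: mult.assoc)
      ultimately have "(\<Sum>\<alpha>\<in>A'. c \<alpha> * C \<alpha> i) = (\<Sum>\<alpha>\<in>A'. c \<alpha> * C \<alpha> j) * (C \<beta> i / C \<beta> j)" by simp
      then show ?thesis unfolding sum by (simp add: k_def)
    qed
    moreover have "\<exists>\<alpha>\<in>A. ?c \<alpha> \<noteq> 0" using c(1) by (auto simp: A'_def)
    ultimately show ?thesis by blast
  qed
qed

section \<open>Spans of functions on a set and Siegel's count\<close>

definition sspan :: "'w set \<Rightarrow> ('w \<Rightarrow> complex) set \<Rightarrow> ('w \<Rightarrow> complex) \<Rightarrow> bool" where
  "sspan \<Omega> B g \<longleftrightarrow> (\<exists>c. \<forall>\<omega>\<in>\<Omega>. g \<omega> = (\<Sum>b\<in>B. c b * b \<omega>))"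

lemma sspan_zero: "sspan \<Omega> B (\<lambda>\<omega>. 0)"
  unfolding sspan_def by (rule exI[of _ "\<lambda>_. 0"]) simp

lemma sspan_add: "sspan \<Omega> B f \<Longrightarrow> sspan \<Omega> B g \<Longrightarrow> sspan \<Omega> B (\<lambda>\<omega>. f \<omega> + g \<omega>)"
proof -
  assume "sspan \<Omega> B f" "sspan \<Omega> B g"
  then obtain c e where "\<forall>\<omega>\<in>\<Omega>. f \<omega> = (\<Sum>b\<in>B. c b * b \<omega>)" "\<forall>\<omega>\<in>\<Omega>. g \<omega> = (\<Sum>b\<in>B. e b * b \<omega>)"
    unfolding sspan_def by (elim exE)
  then show ?thesis unfolding sspan_def
    by (intro exI[of _ "\<lambda>b. c b + e b"]) (simp add: ring_distribs sum.distrib)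
qed

lemma sspan_cmult: "sspan \<Omega> B f \<Longrightarrow> sspan \<Omega> B (\<lambda>\<omega>. k * f \<omega>)"
proof -
  assume "sspan \<Omega> B f"
  then obtain c where "\<forall>\<omega>\<in>\<Omega>. f \<omega> = (\<Sum>b\<in>B. c b * b \<omega>)" unfolding sspan_def by (elim exE)
  then show ?thesis unfolding sspan_def
    by (intro exI[of _ "\<lambda>b. k * c b"]) (simp add: sum_distrib_left mult_ac)
qed

lemma sspan_sum: "(\<And>i. i \<in> I \<Longrightarrow> sspan \<Omega> B (f i)) \<Longrightarrow> sspan \<Omega> B (\<lambda>\<omega>. \<Sum>i\<in>I. f i \<omega>)"
  by (induction I rule: infinite_finite_induct) (auto intro: sspan_zero sspan_add)

lemma sspan_base: "finite B \<Longrightarrow> b \<in> B \<Longrightarrow> sspan \<Omega> B b"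
  unfolding sspan_def
  by (intro exI[of _ "\<lambda>x. if x = b then 1 else 0"]) (auto simp: if_distrib[of "\<lambda>c. c * _"] cong: if_cong)

lemma sspan_cong: "sspan \<Omega> B f \<Longrightarrow> (\<And>\<omega>. \<omega> \<in> \<Omega> \<Longrightarrow> g \<omega> = f \<omega>) \<Longrightarrow> sspan \<Omega> B g"
  unfolding sspan_def by auto

lemma sspan_mono:
  assumes "sspan \<Omega> B f" "finite B'" "B \<subseteq> B'" shows "sspan \<Omega> B' f"
proof -
  obtain c where c: "\<forall>\<omega>\<in>\<Omega>. f \<omega> = (\<Sum>b\<in>B. c b * b \<omega>)" using assms(1) unfolding sspan_def by (elim exE)
  have "sspan \<Omega> B' (\<lambda>\<omega>. \<Sum>b\<in>B. c b * b \<omega>)"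
    using assms(2,3) by (intro sspan_sum sspan_cmult sspan_base) auto
  then show ?thesis by (rule sspan_cong) (use c in simp)
qed

lemma sspan_times:
  assumes "sspan \<Omega> B f" "\<And>b. b \<in> B \<Longrightarrow> sspan \<Omega> B' (\<lambda>\<omega>. \<phi> \<omega> * b \<omega>)"
  shows "sspan \<Omega> B' (\<lambda>\<omega>. \<phi> \<omega> * f \<omega>)"
proof -
  obtain c where c: "\<forall>\<omega>\<in>\<Omega>. f \<omega> = (\<Sum>b\<in>B. c b * b \<omega>)" using assms(1) unfolding sspan_def by (elim exE)
  have "sspan \<Omega> B' (\<lambda>\<omega>. \<Sum>b\<in>B. c b * (\<phi> \<omega> * b \<omega>))"
    by (intro sspan_sum sspan_cmult assms(2))
  then show ?thesis by (rule sspan_cong) (use c in \<open>simp add: sum_distrib_left mult_ac\<close>)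
qed

text \<open>Siegel's counting argument: if each \<open>y v\<close> satisfies an equation of degree \<open>r v\<close> with coefficients
  \<open>a v l\<close> rational in the \<open>b j\<close>, then, up to a common denominator, polynomials of degree \<open>D\<close> in the
  \<open>y v\<close> reduce to a space of dimension \<open>O(D\<^bsup>card B\<^esup>)\<close>.\<close>

locale siegel =
  fixes \<Omega> :: "'w set" and B :: "'j set" and b :: "'j \<Rightarrow> 'w \<Rightarrow> complex"
    and I :: "'v set" and y :: "'v \<Rightarrow> 'w \<Rightarrow> complex" and r :: "'v \<Rightarrow> nat" and a :: "'v \<Rightarrow> nat \<Rightarrow> 'w \<Rightarrow> complex"
  assumes finB: "finite B" and finI: "finite I"
begin

definition sbasis :: "nat \<Rightarrow> ('w \<Rightarrow> complex) set" where
  "sbasis D = (\<lambda>(m, \<beta>) \<omega>. (\<Prod>j\<in>B. b j \<omega> ^ m j) * (\<Prod>v\<in>I. y v \<omega> ^ \<beta> v)) `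
     (PiE B (\<lambda>_. {..D}) \<times> PiE I (\<lambda>v. {..r v}))"

lemma sbasisI:
  "m \<in> PiE B (\<lambda>_. {..D}) \<Longrightarrow> \<beta> \<in> PiE I (\<lambda>v. {..r v}) \<Longrightarrow>
     (\<lambda>\<omega>. (\<Prod>j\<in>B. b j \<omega> ^ m j) * (\<Prod>v\<in>I. y v \<omega> ^ \<beta> v)) \<in> sbasis D"
  unfolding sbasis_def by (rule image_eqI[of _ _ "(m, \<beta>)"]) auto

lemma finite_sbasis: "finite (sbasis D)"
  unfolding sbasis_def using finB finI by (intro finite_imageI finite_cartesian_product finite_PiE) auto

lemma card_sbasis: "card (sbasis D) \<le> (D + 1) ^ card B * (\<Prod>v\<in>I. r v + 1)"
proof -
  have "card (sbasis D) \<le> card (PiE B (\<lambda>_. {..D}) \<times> PiE I (\<lambda>v. {..r v}))"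
    unfolding sbasis_def using finB finI by (intro card_image_le finite_cartesian_product finite_PiE) auto
  also have "\<dots> = (D + 1) ^ card B * (\<Prod>v\<in>I. r v + 1)"
    using finB finI by (simp add: card_cartesian_product card_PiE)
  finally show ?thesis .
qed

lemma sbasis_mono: "D \<le> D' \<Longrightarrow> sbasis D \<subseteq> sbasis D'"
  unfolding sbasis_def by (intro image_mono Sigma_mono PiE_mono) auto

text \<open>Multiplication by \<phi> costs at most t in the degree, uniformly in D. In this form
  costs add under products, and no normal form of a function has to be chosen.\<close>

definition mulby :: "nat \<Rightarrow> ('w \<Rightarrow> complex) \<Rightarrow> bool" where
  "mulby t \<phi> \<longleftrightarrow> (\<forall>D g. sspan \<Omega> (sbasis D) g \<longrightarrow> sspan \<Omega> (sbasis (D + t)) (\<lambda>\<omega>. \<phi> \<omega> * g \<omega>))"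

lemma mulbyI:
  assumes "\<And>D m \<beta>. m \<in> PiE B (\<lambda>_. {..D}) \<Longrightarrow> \<beta> \<in> PiE I (\<lambda>v. {..r v}) \<Longrightarrow>
     sspan \<Omega> (sbasis (D + t)) (\<lambda>\<omega>. \<phi> \<omega> * ((\<Prod>j\<in>B. b j \<omega> ^ m j) * (\<Prod>v\<in>I. y v \<omega> ^ \<beta> v)))"
  shows "mulby t \<phi>"
  unfolding mulby_def
proof (intro allI impI)
  fix D g assume "sspan \<Omega> (sbasis D) g"
  then show "sspan \<Omega> (sbasis (D + t)) (\<lambda>\<omega>. \<phi> \<omega> * g \<omega>)"
  proof (rule sspan_times)
    fix f assume "f \<in> sbasis D"
    then obtain m \<beta> where "m \<in> PiE B (\<lambda>_. {..D})" "\<beta> \<in> PiE I (\<lambda>v. {..r v})"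
      "f = (\<lambda>\<omega>. (\<Prod>j\<in>B. b j \<omega> ^ m j) * (\<Prod>v\<in>I. y v \<omega> ^ \<beta> v))" unfolding sbasis_def by auto
    then show "sspan \<Omega> (sbasis (D + t)) (\<lambda>\<omega>. \<phi> \<omega> * f \<omega>)" using assms by simp
  qed
qed

lemma sspan_sbasis_mono: "sspan \<Omega> (sbasis D) g \<Longrightarrow> D \<le> D' \<Longrightarrow> sspan \<Omega> (sbasis D') g"
  by (rule sspan_mono[OF _ finite_sbasis sbasis_mono])

lemma mulby_mono: "mulby t \<phi> \<Longrightarrow> t \<le> t' \<Longrightarrow> mulby t' \<phi>"
  unfolding mulby_def using sspan_sbasis_mono by (meson add_left_mono)

lemma mulby_cong: "mulby t \<phi> \<Longrightarrow> (\<And>\<omega>. \<omega> \<in> \<Omega> \<Longrightarrow> \<phi>' \<omega> = \<phi> \<omega>) \<Longrightarrow> mulby t \<phi>'"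
  unfolding mulby_def
proof (intro allI impI)
  fix D g assume *: "\<forall>D g. sspan \<Omega> (sbasis D) g \<longrightarrow> sspan \<Omega> (sbasis (D + t)) (\<lambda>\<omega>. \<phi> \<omega> * g \<omega>)"
    and eq: "\<And>\<omega>. \<omega> \<in> \<Omega> \<Longrightarrow> \<phi>' \<omega> = \<phi> \<omega>" and "sspan \<Omega> (sbasis D) g"
  then have "sspan \<Omega> (sbasis (D + t)) (\<lambda>\<omega>. \<phi> \<omega> * g \<omega>)" by blast
  then show "sspan \<Omega> (sbasis (D + t)) (\<lambda>\<omega>. \<phi>' \<omega> * g \<omega>)" by (rule sspan_cong) (simp add: eq)
qed

lemma mulby_const: "mulby 0 (\<lambda>\<omega>. k)"
  unfolding mulby_def by (auto intro: sspan_cmult)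

lemma mulby_mult: "mulby t \<phi> \<Longrightarrow> mulby t' \<psi> \<Longrightarrow> mulby (t + t') (\<lambda>\<omega>. \<phi> \<omega> * \<psi> \<omega>)"
proof -
  assume *: "mulby t \<phi>" "mulby t' \<psi>"
  show ?thesis unfolding mulby_def
  proof (intro allI impI)
    fix D g assume "sspan \<Omega> (sbasis D) g"
    then have "sspan \<Omega> (sbasis (D + t')) (\<lambda>\<omega>. \<psi> \<omega> * g \<omega>)" using * by (simp add: mulby_def)
    then have "sspan \<Omega> (sbasis (D + t' + t)) (\<lambda>\<omega>. \<phi> \<omega> * (\<psi> \<omega> * g \<omega>))" using *(1) unfolding mulby_def by blast
    then show "sspan \<Omega> (sbasis (D + (t + t'))) (\<lambda>\<omega>. \<phi> \<omega> * \<psi> \<omega> * g \<omega>)" by (simp add: mult_ac add_ac)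
  qed
qed

lemma mulby_add: "mulby t \<phi> \<Longrightarrow> mulby t \<psi> \<Longrightarrow> mulby t (\<lambda>\<omega>. \<phi> \<omega> + \<psi> \<omega>)"
  unfolding mulby_def ring_distribs using sspan_add by blast

lemma mulby_power: "mulby t \<phi> \<Longrightarrow> mulby (t * k) (\<lambda>\<omega>. \<phi> \<omega> ^ k)"
proof (induction k)
  case 0
  then show ?case using mulby_const[of 1] by simp
next
  case (Suc k)
  then show ?case using mulby_mult[of t \<phi> "t * k" "\<lambda>\<omega>. \<phi> \<omega> ^ k"] by simp
qed

lemma mulby_prod:
  "finite K \<Longrightarrow> (\<And>i. i \<in> K \<Longrightarrow> mulby (t i) (\<phi> i)) \<Longrightarrow> mulby (\<Sum>i\<in>K. t i) (\<lambda>\<omega>. \<Prod>i\<in>K. \<phi> i \<omega>)"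
proof (induction K rule: finite_induct)
  case empty
  then show ?case using mulby_const[of 1] by simp
next
  case (insert i K)
  then show ?case using mulby_mult[of "t i" "\<phi> i"] by simp
qed

lemma mulby_b:
  assumes "j \<in> B" shows "mulby 1 (b j)"
proof (rule mulbyI)
  fix D and m :: "'j \<Rightarrow> nat" and \<beta> :: "'v \<Rightarrow> nat" assume m: "m \<in> PiE B (\<lambda>_. {..D})" and \<beta>: "\<beta> \<in> PiE I (\<lambda>v. {..r v})"
  have eq: "(\<lambda>\<omega>. b j \<omega> * ((\<Prod>j\<in>B. b j \<omega> ^ m j) * (\<Prod>v\<in>I. y v \<omega> ^ \<beta> v))) =
      (\<lambda>\<omega>. (\<Prod>i\<in>B. b i \<omega> ^ (m(j := Suc (m j))) i) * (\<Prod>v\<in>I. y v \<omega> ^ \<beta> v))"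
  proof
    fix \<omega>
    have "(\<Prod>i\<in>B. b i \<omega> ^ (m(j := Suc (m j))) i) = b j \<omega> ^ Suc (m j) * (\<Prod>i\<in>B - {j}. b i \<omega> ^ m i)"
      using assms finB by (subst prod.remove[of _ j]) (auto intro!: prod.cong)
    also have "\<dots> = b j \<omega> * (\<Prod>i\<in>B. b i \<omega> ^ m i)"
      using assms finB by (subst (2) prod.remove[of _ j]) auto
    finally show "b j \<omega> * ((\<Prod>j\<in>B. b j \<omega> ^ m j) * (\<Prod>v\<in>I. y v \<omega> ^ \<beta> v)) =
      (\<Prod>i\<in>B. b i \<omega> ^ (m(j := Suc (m j))) i) * (\<Prod>v\<in>I. y v \<omega> ^ \<beta> v)" by simp
  qed
  have m': "m(j := Suc (m j)) \<in> PiE B (\<lambda>_. {..D + 1})"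
  proof (rule PiE_I)
    fix i assume "i \<in> B"
    then have "m i \<le> D" using m by (auto simp: PiE_iff)
    then show "(m(j := Suc (m j))) i \<in> {..D + 1}" by auto
  qed (use m assms in \<open>auto simp: PiE_iff extensional_def\<close>)
  show "sspan \<Omega> (sbasis (D + 1)) (\<lambda>\<omega>. b j \<omega> * ((\<Prod>j\<in>B. b j \<omega> ^ m j) * (\<Prod>v\<in>I. y v \<omega> ^ \<beta> v)))"
    unfolding eq by (rule sspan_base[OF finite_sbasis sbasisI[OF m' \<beta>]])
qed

text \<open>The functions of finite multiplication cost; they form an algebra containing the
  \<open>b j\<close>.\<close>

definition rational :: "('w \<Rightarrow> complex) \<Rightarrow> bool" where
  "rational \<phi> \<longleftrightarrow> (\<exists>t. mulby t \<phi>)"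

lemma rational_const: "rational (\<lambda>\<omega>. k)"
  unfolding rational_def using mulby_const by blast

lemma rational_mult: "rational \<phi> \<Longrightarrow> rational \<psi> \<Longrightarrow> rational (\<lambda>\<omega>. \<phi> \<omega> * \<psi> \<omega>)"
  unfolding rational_def using mulby_mult by blast

lemma rational_add:
  assumes "rational \<phi>" "rational \<psi>" shows "rational (\<lambda>\<omega>. \<phi> \<omega> + \<psi> \<omega>)"
proof -
  obtain s t where "mulby s \<phi>" "mulby t \<psi>" using assms unfolding rational_def by blast
  then have "mulby (s + t) \<phi>" "mulby (s + t) \<psi>" by (auto elim: mulby_mono)
  then show ?thesis unfolding rational_def using mulby_add by blast
qed

lemma rational_polyfun: "polyfun p \<Longrightarrow> (\<And>v. rational (x v)) \<Longrightarrow> rational (\<lambda>\<omega>. p (\<lambda>v. x v \<omega>))"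
  by (induction rule: polyfun.induct) (auto intro: rational_const rational_add rational_mult)

lemma rational_prod: "finite K \<Longrightarrow> (\<And>i. i \<in> K \<Longrightarrow> rational (\<phi> i)) \<Longrightarrow> rational (\<lambda>\<omega>. \<Prod>i\<in>K. \<phi> i \<omega>)"
  by (induction K rule: finite_induct) (auto intro: rational_const rational_mult)

lemma rational_power: "rational \<phi> \<Longrightarrow> rational (\<lambda>\<omega>. \<phi> \<omega> ^ k)"
  by (induction k) (auto intro: rational_const rational_mult)

text \<open>On a spanning monomial whose exponent of \<open>y v\<close> is below \<open>r v\<close>,
  the factor \<open>y v\<close> just raises it. At exponent \<open>r v\<close> the equation of
  \<open>y v\<close> rewrites the leading term by lower ones, which is why the leading coefficient
  has to be carried along.\<close>

lemma rational_lead: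
  assumes v: "v \<in> I" and a: "\<And>l. l \<le> r v \<Longrightarrow> rational (a v l)"
    and rel: "\<And>\<omega>. \<omega> \<in> \<Omega> \<Longrightarrow> (\<Sum>l\<le>r v. a v l \<omega> * y v \<omega> ^ l) = 0"
  shows "rational (\<lambda>\<omega>. a v (r v) \<omega> * y v \<omega>)"
proof -
  have "\<forall>l\<in>{..r v}. \<exists>t. mulby t (a v l)" using a by (auto simp: rational_def)
  from bchoice[OF this] obtain T where T: "\<And>l. l \<le> r v \<Longrightarrow> mulby (T l) (a v l)" by auto
  define t where "t = (\<Sum>l\<le>r v. T l)"
  have t: "mulby t (a v l)" if "l \<le> r v" for l
    using T[OF that] that member_le_sum[of l "{..r v}" T] by (auto simp: t_def intro: mulby_mono)
  have "mulby t (\<lambda>\<omega>. a v (r v) \<omega> * y v \<omega>)"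
  proof (rule mulbyI)
    fix D and m :: "'j \<Rightarrow> nat" and \<beta> :: "'v \<Rightarrow> nat" assume m: "m \<in> PiE B (\<lambda>_. {..D})" and \<beta>: "\<beta> \<in> PiE I (\<lambda>v. {..r v})"
    let ?b = "\<lambda>e \<omega>. (\<Prod>j\<in>B. b j \<omega> ^ m j) * (\<Prod>u\<in>I. y u \<omega> ^ (\<beta>(v := e)) u)"
    have split: "?b e \<omega> = y v \<omega> ^ e * ((\<Prod>j\<in>B. b j \<omega> ^ m j) * (\<Prod>u\<in>I - {v}. y u \<omega> ^ \<beta> u))" for e \<omega>
    proof -
      have "(\<Prod>u\<in>I. y u \<omega> ^ (\<beta>(v := e)) u) = y v \<omega> ^ e * (\<Prod>u\<in>I - {v}. y u \<omega> ^ \<beta> u)"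
        using v finI by (subst prod.remove[of _ v]) (auto intro!: prod.cong)
      then show ?thesis by simp
    qed
    have span: "sspan \<Omega> (sbasis (D + t)) (\<lambda>\<omega>. a v l \<omega> * ?b e \<omega>)" if "l \<le> r v" "e \<le> r v" for l e
    proof -
      have "\<beta>(v := e) \<in> PiE I (\<lambda>v. {..r v})" using \<beta> v that(2) by (auto simp: PiE_iff extensional_def)
      then have "sspan \<Omega> (sbasis D) (?b e)"
        by (rule sspan_base[OF finite_sbasis sbasisI[OF m]])
      then show ?thesis using t[OF that(1)] unfolding mulby_def by blast
    qed
    have \<beta>v: "\<beta> v \<le> r v" using \<beta> v by (auto simp: PiE_iff)
    have "\<beta>(v := \<beta> v) = \<beta>" by simp
    then have orig: "(\<Prod>j\<in>B. b j \<omega> ^ m j) * (\<Prod>u\<in>I. y u \<omega> ^ \<beta> u) = ?b (\<beta> v) \<omega>" for \<omega> by simp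
    show "sspan \<Omega> (sbasis (D + t)) (\<lambda>\<omega>. a v (r v) \<omega> * y v \<omega> * ((\<Prod>j\<in>B. b j \<omega> ^ m j) * (\<Prod>u\<in>I. y u \<omega> ^ \<beta> u)))"
    proof (cases "\<beta> v < r v")
      case True
      have "sspan \<Omega> (sbasis (D + t)) (\<lambda>\<omega>. a v (r v) \<omega> * ?b (Suc (\<beta> v)) \<omega>)" using True by (intro span) auto
      then show ?thesis
        by (rule sspan_cong) (simp only: orig split power_Suc mult_ac)
    next
      case False
      then have eq: "\<beta> v = r v" using \<beta>v by simp
      have "sspan \<Omega> (sbasis (D + t)) (\<lambda>\<omega>. - 1 * (\<Sum>l<r v. a v l \<omega> * ?b (Suc l) \<omega>))"
        by (intro sspan_cmult sspan_sum span) auto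
      then show ?thesis
      proof (rule sspan_cong)
        fix \<omega> assume "\<omega> \<in> \<Omega>"
        let ?R = "(\<Prod>j\<in>B. b j \<omega> ^ m j) * (\<Prod>u\<in>I - {v}. y u \<omega> ^ \<beta> u)"
        have "(\<Sum>l<r v. a v l \<omega> * y v \<omega> ^ l) + a v (r v) \<omega> * y v \<omega> ^ r v = 0"
          using rel[OF \<open>\<omega> \<in> \<Omega>\<close>] by (simp add: lessThan_Suc_atMost[symmetric])
        then have "a v (r v) \<omega> * y v \<omega> ^ r v = - (\<Sum>l<r v. a v l \<omega> * y v \<omega> ^ l)"
          by (metis add.commute add_eq_0_iff)
        then have "a v (r v) \<omega> * y v \<omega> ^ r v * (y v \<omega> * ?R) = - (\<Sum>l<r v. a v l \<omega> * y v \<omega> ^ l) * (y v \<omega> * ?R)"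
          by (simp only:)
        also have "\<dots> = - 1 * (\<Sum>l<r v. a v l \<omega> * (y v \<omega> ^ Suc l * ?R))"
          by (simp add: sum_distrib_left sum_distrib_right sum_negf mult_ac)
        finally show "a v (r v) \<omega> * y v \<omega> * ((\<Prod>j\<in>B. b j \<omega> ^ m j) * (\<Prod>u\<in>I. y u \<omega> ^ \<beta> u)) =
            - 1 * (\<Sum>l<r v. a v l \<omega> * ?b (Suc l) \<omega>)"
          unfolding orig split eq by (simp only: mult_ac)
      qed
    qed
  qed
  then show ?thesis unfolding rational_def by blast
qed

end

locale siegel_rel = siegel +
  assumes a: "\<And>v l. v \<in> I \<Longrightarrow> l \<le> r v \<Longrightarrow> rational (a v l)"
    and rel: "\<And>v \<omega>. v \<in> I \<Longrightarrow> \<omega> \<in> \<Omega> \<Longrightarrow> (\<Sum>l\<le>r v. a v l \<omega> * y v \<omega> ^ l) = 0"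
    and lead: "\<And>v \<omega>. v \<in> I \<Longrightarrow> \<omega> \<in> \<Omega> \<Longrightarrow> a v (r v) \<omega> \<noteq> 0"
    and outside: "\<And>v \<omega>. v \<notin> I \<Longrightarrow> \<omega> \<in> \<Omega> \<Longrightarrow> y v \<omega> = 0"
begin

text \<open>A common denominator for all \<open>y v\<close>: the product of the leading coefficients
  is nonzero on \<Omega> and can be cancelled at the end.\<close>

definition denom :: "'a \<Rightarrow> complex" where
  "denom \<omega> = (\<Prod>v\<in>I. a v (r v) \<omega>)"

lemma denom_nonzero: "\<omega> \<in> \<Omega> \<Longrightarrow> denom \<omega> \<noteq> 0"
  using lead finI by (auto simp: denom_def)

lemma rational_denom: "rational denom"
  unfolding denom_def[abs_def] using a by (intro rational_prod finI) auto

lemma rational_denom_y: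
  shows "rational (\<lambda>\<omega>. denom \<omega> * y v \<omega>)"
proof (cases "v \<in> I")
  case True
  have "rational (\<lambda>\<omega>. (\<Prod>u\<in>I - {v}. a u (r u) \<omega>) * (a v (r v) \<omega> * y v \<omega>))"
    using a rel True finI by (intro rational_mult rational_prod rational_lead) auto
  moreover have "denom \<omega> = (\<Prod>u\<in>I - {v}. a u (r u) \<omega>) * a v (r v) \<omega>" for \<omega>
    unfolding denom_def using True finI by (subst prod.remove[of _ v]) (auto simp: mult_ac)
  ultimately show ?thesis by (simp add: mult_ac)
next
  case False
  then show ?thesis
    using mulby_cong[OF mulby_const[of 0], of "\<lambda>\<omega>. denom \<omega> * y v \<omega>"] outside unfolding rational_def by auto
qed

lemma rational_denom_polyfun:
  assumes "polyfun H" shows "\<exists>e. rational (\<lambda>\<omega>. denom \<omega> ^ e * H (\<lambda>v. y v \<omega>))"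
  using assms
proof (induction rule: polyfun.induct)
  case (polyfun_const c)
  then show ?case using rational_const by (intro exI[of _ 0]) simp
next
  case (polyfun_var v)
  then show ?case using rational_denom_y by (intro exI[of _ 1]) simp
next
  case (polyfun_add p q)
  then obtain e e' where e: "rational (\<lambda>\<omega>. denom \<omega> ^ e * p (\<lambda>v. y v \<omega>))" "rational (\<lambda>\<omega>. denom \<omega> ^ e' * q (\<lambda>v. y v \<omega>))" by blast
  have "rational (\<lambda>\<omega>. denom \<omega> ^ e' * (denom \<omega> ^ e * p (\<lambda>v. y v \<omega>)) + denom \<omega> ^ e * (denom \<omega> ^ e' * q (\<lambda>v. y v \<omega>)))"
    by (intro rational_add rational_mult rational_power rational_denom e)
  then show ?case by (intro exI[of _ "e + e'"]) (simp add: power_add algebra_simps)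
next
  case (polyfun_mult p q)
  then obtain e e' where e: "rational (\<lambda>\<omega>. denom \<omega> ^ e * p (\<lambda>v. y v \<omega>))" "rational (\<lambda>\<omega>. denom \<omega> ^ e' * q (\<lambda>v. y v \<omega>))" by blast
  have "rational (\<lambda>\<omega>. (denom \<omega> ^ e * p (\<lambda>v. y v \<omega>)) * (denom \<omega> ^ e' * q (\<lambda>v. y v \<omega>)))"
    by (intro rational_mult e)
  then show ?case by (intro exI[of _ "e + e'"]) (simp add: power_add algebra_simps)
qed

text \<open>There are (L+1)^k monomials of degree k L in the \<open>H i\<close> with exponents of
  \<open>H 1\<close>, ..., \<open>H k\<close> at most L, but after clearing denominators they lie in
  a span of size O(L^(card B)) with card B < k. The power of \<open>H 0\<close> makes the resulting
  relation homogeneous, so that it can be read on tuples of projective points.\<close>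

lemma homogeneous_relation:
  assumes H: "\<And>i. i \<le> k \<Longrightarrow> polyfun (H i)" and k: "card B < k"
  shows "\<exists>L c. (\<exists>\<beta>\<in>PiE {1..k} (\<lambda>_. {..L}). c \<beta> \<noteq> 0) \<and>
    (\<forall>\<omega>\<in>\<Omega>. (\<Sum>\<beta>\<in>PiE {1..k} (\<lambda>_. {..L}). c \<beta> *
       (H 0 (\<lambda>v. y v \<omega>) ^ (k * L - (\<Sum>i\<in>{1..k}. \<beta> i)) * (\<Prod>i\<in>{1..k}. H i (\<lambda>v. y v \<omega>) ^ \<beta> i))) = 0)"
proof -
  have "\<forall>i\<in>{..k}. \<exists>e. rational (\<lambda>\<omega>. denom \<omega> ^ e * H i (\<lambda>v. y v \<omega>))"
    using H rational_denom_polyfun by auto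
  from bchoice[OF this] obtain E where E: "\<And>i. i \<le> k \<Longrightarrow> rational (\<lambda>\<omega>. denom \<omega> ^ E i * H i (\<lambda>v. y v \<omega>))" by auto
  define e where "e = (\<Sum>i\<le>k. E i)"
  define h where "h = (\<lambda>i \<omega>. denom \<omega> ^ e * H i (\<lambda>v. y v \<omega>))"
  have "rational (h i)" if "i \<le> k" for i
  proof -
    have "E i \<le> e" unfolding e_def using that by (intro member_le_sum) auto
    then have "denom \<omega> ^ e = denom \<omega> ^ (e - E i) * denom \<omega> ^ E i" for \<omega> by (simp add: power_add[symmetric])
    then have "h i = (\<lambda>\<omega>. denom \<omega> ^ (e - E i) * (denom \<omega> ^ E i * H i (\<lambda>v. y v \<omega>)))"
      by (simp add: h_def mult_ac)
    then show ?thesis using E[OF that] rational_mult[OF rational_power[OF rational_denom]] by simp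
  qed
  then have "\<forall>i\<in>{..k}. \<exists>t. mulby t (h i)" by (simp add: rational_def)
  from bchoice[OF this] obtain T where T: "\<And>i. i \<le> k \<Longrightarrow> mulby (T i) (h i)" by auto
  define t where "t = (\<Sum>i\<le>k. T i)"
  have t: "mulby t (h i)" if "i \<le> k" for i
    using T[OF that] that member_le_sum[of i "{..k}" T] by (auto simp: t_def intro: mulby_mono)
  define R where "R = (\<Prod>v\<in>I. r v + 1)"
  \<comment> \<open>With this L the size of the span is at most L (L+1)^(card B), less than the
    number (L+1)^k of monomials.\<close>
  define L where "L = R * (t * k + 1) ^ card B"
  let ?A = "PiE {1..k} (\<lambda>_. {..L}) :: (nat \<Rightarrow> nat) set"
  let ?mon = "\<lambda>\<beta> \<omega>. H 0 (\<lambda>v. y v \<omega>) ^ (k * L - (\<Sum>i\<in>{1..k}. \<beta> i)) * (\<Prod>i\<in>{1..k}. H i (\<lambda>v. y v \<omega>) ^ \<beta> i)"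
  have finA: "finite ?A" by (intro finite_PiE) auto
  have "sspan \<Omega> (sbasis (t * (k * L))) (\<lambda>\<omega>. denom \<omega> ^ (e * (k * L)) * ?mon \<beta> \<omega>)" if \<beta>: "\<beta> \<in> ?A" for \<beta>
  proof -
    let ?s = "\<Sum>i\<in>{1..k}. \<beta> i"
    have "?s \<le> (\<Sum>i\<in>{1..k}. L)" using \<beta> by (intro sum_mono) (auto simp: PiE_iff)
    then have s: "?s \<le> k * L" by simp
    have "mulby (t * (k * L - ?s) + (\<Sum>i\<in>{1..k}. t * \<beta> i)) (\<lambda>\<omega>. h 0 \<omega> ^ (k * L - ?s) * (\<Prod>i\<in>{1..k}. h i \<omega> ^ \<beta> i))"
      by (intro mulby_mult mulby_prod mulby_power t) auto
    moreover have "t * (k * L - ?s) + (\<Sum>i\<in>{1..k}. t * \<beta> i) = t * (k * L)"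
      using s by (simp add: sum_distrib_left[symmetric] add_mult_distrib2[symmetric])
    moreover have "(\<lambda>\<omega>. h 0 \<omega> ^ (k * L - ?s) * (\<Prod>i\<in>{1..k}. h i \<omega> ^ \<beta> i)) = (\<lambda>\<omega>. denom \<omega> ^ (e * (k * L)) * ?mon \<beta> \<omega>)"
    proof
      fix \<omega>
      have "denom \<omega> ^ (e * (k * L)) = denom \<omega> ^ (e * (k * L - ?s)) * (\<Prod>i\<in>{1..k}. denom \<omega> ^ (e * \<beta> i))"
        using s by (simp add: power_sum[symmetric] power_add[symmetric] sum_distrib_left[symmetric] add_mult_distrib2[symmetric])
      then show "h 0 \<omega> ^ (k * L - ?s) * (\<Prod>i\<in>{1..k}. h i \<omega> ^ \<beta> i) = denom \<omega> ^ (e * (k * L)) * ?mon \<beta> \<omega>"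
        by (simp add: h_def power_mult_distrib prod.distrib power_mult mult_ac)
    qed
    ultimately have m: "mulby (t * (k * L)) (\<lambda>\<omega>. denom \<omega> ^ (e * (k * L)) * ?mon \<beta> \<omega>)" by simp
    have "sspan \<Omega> (sbasis 0) (\<lambda>\<omega>. 1)"
    proof -
      have "(\<lambda>\<omega>. 1) \<in> sbasis 0"
        unfolding sbasis_def
        by (rule image_eqI[of _ _ "(restrict (\<lambda>_. 0) B, restrict (\<lambda>_. 0) I)"]) (auto simp: fun_eq_iff)
      then show ?thesis by (rule sspan_base[OF finite_sbasis])
    qed
    then show ?thesis using m unfolding mulby_def by fastforce
  qed
  then have "\<forall>\<beta>\<in>?A. \<exists>c. \<forall>\<omega>\<in>\<Omega>. denom \<omega> ^ (e * (k * L)) * ?mon \<beta> \<omega> = (\<Sum>b\<in>sbasis (t * (k * L)). c b * b \<omega>)"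
    unfolding sspan_def by blast
  from bchoice[OF this] obtain C where C: "\<And>\<beta> \<omega>. \<beta> \<in> ?A \<Longrightarrow> \<omega> \<in> \<Omega> \<Longrightarrow>
      denom \<omega> ^ (e * (k * L)) * ?mon \<beta> \<omega> = (\<Sum>b\<in>sbasis (t * (k * L)). C \<beta> b * b \<omega>)" by blast
  have "card (sbasis (t * (k * L))) < card ?A"
  proof -
    have "card (sbasis (t * (k * L))) \<le> (t * (k * L) + 1) ^ card B * R" unfolding R_def by (rule card_sbasis)
    also have "\<dots> \<le> ((t * k + 1) * (L + 1)) ^ card B * R"
      by (intro mult_right_mono power_mono) (auto simp: algebra_simps)
    also have "\<dots> = (R * (t * k + 1) ^ card B) * (L + 1) ^ card B" by (simp only: power_mult_distrib mult_ac)
    also have "\<dots> < (L + 1) * (L + 1) ^ card B" unfolding L_def[symmetric] by simp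
    also have "\<dots> = (L + 1) ^ (card B + 1)" by simp
    also have "\<dots> \<le> (L + 1) ^ k" using k by (intro power_increasing) auto
    also have "\<dots> = card ?A" by (simp add: card_PiE)
    finally show ?thesis .
  qed
  from homogeneous_system_nontrivial[OF finite_sbasis finA this, of C] obtain c where
    c: "\<exists>\<beta>\<in>?A. c \<beta> \<noteq> 0" "\<forall>b\<in>sbasis (t * (k * L)). (\<Sum>\<beta>\<in>?A. c \<beta> * C \<beta> b) = 0" by blast
  have "(\<Sum>\<beta>\<in>?A. c \<beta> * ?mon \<beta> \<omega>) = 0" if "\<omega> \<in> \<Omega>" for \<omega>
  proof -
    have "denom \<omega> ^ (e * (k * L)) * (\<Sum>\<beta>\<in>?A. c \<beta> * ?mon \<beta> \<omega>) =
        (\<Sum>\<beta>\<in>?A. c \<beta> * (denom \<omega> ^ (e * (k * L)) * ?mon \<beta> \<omega>))"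
      unfolding sum_distrib_left by (intro sum.cong refl) (simp only: mult_ac)
    also have "\<dots> = (\<Sum>\<beta>\<in>?A. c \<beta> * (\<Sum>b\<in>sbasis (t * (k * L)). C \<beta> b * b \<omega>))"
      by (intro sum.cong refl) (simp only: C that)
    also have "\<dots> = (\<Sum>\<beta>\<in>?A. \<Sum>b\<in>sbasis (t * (k * L)). c \<beta> * C \<beta> b * b \<omega>)"
      by (simp only: sum_distrib_left mult.assoc)
    also have "\<dots> = (\<Sum>b\<in>sbasis (t * (k * L)). \<Sum>\<beta>\<in>?A. c \<beta> * C \<beta> b * b \<omega>)" by (rule sum.swap)
    also have "\<dots> = (\<Sum>b\<in>sbasis (t * (k * L)). (\<Sum>\<beta>\<in>?A. c \<beta> * C \<beta> b) * b \<omega>)" by (simp only: sum_distrib_right)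
    also have "\<dots> = 0" by (rule sum.neutral) (use c(2) in simp)
    finally show ?thesis using denom_nonzero[OF that] by simp
  qed
  then show ?thesis using c(1) by blast
qed

end

section \<open>Chains of irreducible closed sets and independent functions\<close>

definition zero_on :: "nat \<Rightarrow> (complex ^ 'n) set multiset set \<Rightarrow> ((nat \<times> 'n::finite \<Rightarrow> complex) \<Rightarrow> complex) \<Rightarrow> bool" where
  "zero_on N Z G \<longleftrightarrow> (\<forall>\<psi>. nz N \<psi> \<longrightarrow> mset (tuple N \<psi>) \<in> Z \<longrightarrow> G \<psi> = 0)"

lemma zero_on_vanishes: "zero_on N Z G \<longleftrightarrow> (\<forall>z\<in>Z. vanishes N G z)"
  unfolding zero_on_def vanishes_def by blast

lemma irreducible_finite_cover:
  assumes "irreducible_closedin T Z" "finite I" "\<And>i. i \<in> I \<Longrightarrow> closedin T (A i)" "Z \<subseteq> (\<Union>i\<in>I. A i)"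
  shows "\<exists>i\<in>I. Z \<subseteq> A i"
  using assms(2-4)
proof (induction I rule: finite_induct)
  case empty
  then show ?case using assms(1) by (auto simp: irreducible_closedin_def)
next
  case (insert i I)
  have "closedin T (\<Union>i\<in>I. A i)" using insert by (intro closedin_Union) auto
  moreover have "closedin T (A i)" "Z \<subseteq> A i \<union> (\<Union>i\<in>I. A i)" using insert.prems by auto
  ultimately have "Z \<subseteq> A i \<or> Z \<subseteq> (\<Union>i\<in>I. A i)"
    using assms(1) unfolding irreducible_closedin_def by blast
  then show ?case using insert by blast
qed

locale sym_subspace =
  fixes N :: nat and X :: "(complex ^ 'n::finite) set multiset set"
  assumes X: "X \<subseteq> sym_power_PV N"
begin

definition TX :: "(complex ^ 'n) set multiset topology" where
  "TX = subtopology (zariski_sym_power_PV N) X"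

lemma closedin_TX_subset: "closedin TX Z \<Longrightarrow> Z \<subseteq> X"
  unfolding TX_def closedin_subtopology by blast

lemma closedin_TX_vanishes: "symhom N e G \<Longrightarrow> closedin TX {z \<in> X. vanishes N G z}"
proof -
  assume "symhom N e G"
  then have "closedin (zariski_sym_power_PV N) {z \<in> sym_power_PV N. vanishes N G z}"
    by (intro closedin_vanishes[OF _ supp_below_const]) (auto simp: symhom_def)
  moreover have "{z \<in> X. vanishes N G z} = {z \<in> sym_power_PV N. vanishes N G z} \<inter> X" using X by auto
  ultimately show ?thesis unfolding TX_def closedin_subtopology by (intro exI conjI)
qed

text \<open>Symmetric forms vanishing on an irreducible closed set behave like a prime ideal,
  because the zero loci of both factors are closed.\<close>

lemma irreducible_mult:
  assumes Z: "irreducible_closedin TX Z" and F: "symhom N e F" and G: "symhom N e' G"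
    and zero: "zero_on N Z (\<lambda>\<psi>. F \<psi> * G \<psi>)"
  shows "zero_on N Z F \<or> zero_on N Z G"
proof -
  have ZX: "Z \<subseteq> X" using Z closedin_TX_subset by (auto simp: irreducible_closedin_def)
  have "Z \<subseteq> {z \<in> X. vanishes N F z} \<union> {z \<in> X. vanishes N G z}"
  proof
    fix z assume z: "z \<in> Z"
    then have "z \<in> sym_power_PV N" using ZX X by auto
    then obtain \<psi> where \<psi>: "nz N \<psi>" "z = mset (tuple N \<psi>)" using sym_power_PV_iff by blast
    then have "F \<psi> * G \<psi> = 0" using zero z by (auto simp: zero_on_def)
    then show "z \<in> {z \<in> X. vanishes N F z} \<union> {z \<in> X. vanishes N G z}"
      using symhom_vanishes_iff[OF F \<psi>(1)] symhom_vanishes_iff[OF G \<psi>(1)] z ZX \<psi>(2) by auto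
  qed
  then have "Z \<subseteq> {z \<in> X. vanishes N F z} \<or> Z \<subseteq> {z \<in> X. vanishes N G z}"
    using Z closedin_TX_vanishes[OF F] closedin_TX_vanishes[OF G] unfolding irreducible_closedin_def by blast
  then show ?thesis by (auto simp: zero_on_vanishes)
qed

text \<open>If no piece were dense, functions vanishing on the pieces but not on Z would cover Z by
  finitely many proper closed subsets.\<close>

lemma irreducible_dense_part:
  assumes Z: "irreducible_closedin TX Z" and "finite I" "Z \<subseteq> (\<Union>i\<in>I. W i)"
  shows "\<exists>i\<in>I. \<forall>e G. symhom N e G \<longrightarrow> zero_on N (Z \<inter> W i) G \<longrightarrow> zero_on N Z G"
proof (rule ccontr)
  assume "\<not> ?thesis"
  then have "\<forall>i\<in>I. \<exists>p. symhom N (fst p) (snd p) \<and> zero_on N (Z \<inter> W i) (snd p) \<and> \<not> zero_on N Z (snd p)"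
    by fastforce
  from bchoice[OF this] obtain p where
    p: "\<And>i. i \<in> I \<Longrightarrow> symhom N (fst (p i)) (snd (p i))" "\<And>i. i \<in> I \<Longrightarrow> zero_on N (Z \<inter> W i) (snd (p i))"
      "\<And>i. i \<in> I \<Longrightarrow> \<not> zero_on N Z (snd (p i))" by blast
  have ZX: "Z \<subseteq> X" using Z closedin_TX_subset by (auto simp: irreducible_closedin_def)
  have "Z \<subseteq> (\<Union>i\<in>I. {z \<in> X. vanishes N (snd (p i)) z})"
    using assms(3) p(2) ZX by (fastforce simp: zero_on_vanishes)
  from irreducible_finite_cover[OF Z assms(2) _ this] closedin_TX_vanishes p(1)
  obtain i where "i \<in> I" "Z \<subseteq> {z \<in> X. vanishes N (snd (p i)) z}" by blast
  then show False using p(3) by (auto simp: zero_on_vanishes)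
qed

text \<open>The function with index i + 1 separates \<open>Z (Suc i)\<close> from
  \<open>Z i\<close>, and the first one separates \<open>Z 0\<close> from the empty set. Suitable
  powers bring all degrees to their product e.\<close>

lemma chain_functions:
  assumes irr: "\<And>i. i \<le> k \<Longrightarrow> irreducible_closedin TX (Z i)" and chain: "\<And>i. i < k \<Longrightarrow> Z i \<subset> Z (Suc i)"
  obtains e h where "\<And>i. i \<le> k \<Longrightarrow> symhom N e (h i)" "\<And>i. i \<le> k \<Longrightarrow> \<not> zero_on N (Z i) (h i)"
    "\<And>i. i < k \<Longrightarrow> zero_on N (Z i) (h (Suc i))"
proof -
  have "\<exists>e H. e \<ge> 1 \<and> symhom N e H \<and> \<not> zero_on N (Z i) H \<and> (\<forall>j. i = Suc j \<longrightarrow> zero_on N (Z j) H)"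
    if "i \<le> k" for i
  proof -
    define P where "P = (case i of 0 \<Rightarrow> {} | Suc j \<Rightarrow> Z j)"
    have "closedin TX P" using irr that by (auto simp: P_def irreducible_closedin_def split: nat.split)
    then obtain C where C: "closedin (zariski_sym_power_PV N) C" "P = C \<inter> X"
      unfolding TX_def closedin_subtopology by blast
    have "P \<subset> Z i"
      using chain that irr[OF that] by (auto simp: P_def irreducible_closedin_def split: nat.split)
    then obtain z where z: "z \<in> Z i" "z \<notin> P" by blast
    have "z \<in> X" using z(1) irr[OF that] closedin_TX_subset by (auto simp: irreducible_closedin_def)
    then have "z \<notin> C" "z \<in> sym_power_PV N" using z(2) C(2) X by auto
    then obtain \<psi> where \<psi>: "nz N \<psi>" "z = mset (tuple N \<psi>)" using sym_power_PV_iff by blast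
    obtain e S where "e \<ge> 1" "symhom N e S" "\<not> vanishes N S (mset (tuple N \<psi>))" "\<And>z. z \<in> C \<Longrightarrow> vanishes N S z"
      using closed_sym_power_separate_symhom[OF C(1) \<psi>(1)] \<open>z \<notin> C\<close> \<psi>(2) by blast
    moreover have "zero_on N (Z j) S" if "i = Suc j" for j
      using calculation(4) C(2) that by (auto simp: zero_on_vanishes P_def)
    ultimately show ?thesis using z(1) \<psi>(2) unfolding zero_on_vanishes by blast
  qed
  then have "\<forall>i\<in>{..k}. \<exists>p. fst p \<ge> 1 \<and> symhom N (fst p) (snd p) \<and> \<not> zero_on N (Z i) (snd p) \<and>
      (\<forall>j. i = Suc j \<longrightarrow> zero_on N (Z j) (snd p))" by fastforce
  from bchoice[OF this] obtain p where p: "\<And>i. i \<le> k \<Longrightarrow> fst (p i) \<ge> 1" "\<And>i. i \<le> k \<Longrightarrow> symhom N (fst (p i)) (snd (p i))"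
    "\<And>i. i \<le> k \<Longrightarrow> \<not> zero_on N (Z i) (snd (p i))" "\<And>i. Suc i \<le> k \<Longrightarrow> zero_on N (Z i) (snd (p (Suc i)))"
    by fastforce
  define e where "e = (\<Prod>i\<le>k. fst (p i))"
  define q where "q = (\<lambda>i. \<Prod>j\<in>{..k} - {i}. fst (p j))"
  have eq: "q i * fst (p i) = e" if "i \<le> k" for i
    unfolding e_def q_def using that by (subst prod.remove[of _ i]) auto
  have q1: "q i > 0" for i unfolding q_def using p(1) by (intro prod_pos) (auto simp: Suc_le_eq)
  show thesis
  proof (rule that[of e "\<lambda>i \<psi>. snd (p i) \<psi> ^ q i"])
    show "symhom N e (\<lambda>\<psi>. snd (p i) \<psi> ^ q i)" if "i \<le> k" for i
      using symhom_power[OF p(2)[OF that], of "q i"] eq[OF that] by simp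
    show "\<not> zero_on N (Z i) (\<lambda>\<psi>. snd (p i) \<psi> ^ q i)" if "i \<le> k" for i
      using p(3)[OF that] by (auto simp: zero_on_def)
    show "zero_on N (Z i) (\<lambda>\<psi>. snd (p (Suc i)) \<psi> ^ q (Suc i))" if "i < k" for i
      using p(4)[of i] that q1[of "Suc i"] by (auto simp: zero_on_def)
  qed
qed

definition exps :: "nat \<Rightarrow> nat \<Rightarrow> (nat \<Rightarrow> nat) set" where
  "exps k L = {\<alpha>. (\<forall>i>k. \<alpha> i = 0) \<and> (\<Sum>i\<le>k. \<alpha> i) = L}"

lemma finite_exps: "finite (exps k L)"
proof (rule finite_subset)
  show "exps k L \<subseteq> (\<lambda>f i. if i \<le> k then f i else 0) ` PiE {..k} (\<lambda>_. {..L})"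
  proof
    fix \<alpha> assume \<alpha>: "\<alpha> \<in> exps k L"
    have "\<alpha> i \<le> L" if "i \<le> k" for i
      using \<alpha> that member_le_sum[of i "{..k}" \<alpha>] by (auto simp: exps_def)
    then show "\<alpha> \<in> (\<lambda>f i. if i \<le> k then f i else 0) ` PiE {..k} (\<lambda>_. {..L})"
      using \<alpha> by (intro image_eqI[of _ _ "restrict \<alpha> {..k}"]) (auto simp: exps_def fun_eq_iff)
  qed
qed (intro finite_imageI finite_PiE; simp)

definition hmon :: "(nat \<Rightarrow> (nat \<times> 'n \<Rightarrow> complex) \<Rightarrow> complex) \<Rightarrow> nat \<Rightarrow> (nat \<Rightarrow> nat) \<Rightarrow> (nat \<times> 'n \<Rightarrow> complex) \<Rightarrow> complex" where
  "hmon h k \<alpha> \<psi> = (\<Prod>i\<le>k. h i \<psi> ^ \<alpha> i)"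

lemma symhom_hmon:
  assumes "\<And>i. i \<le> k \<Longrightarrow> symhom N e (h i)" "\<alpha> \<in> exps k L"
  shows "symhom N (L * e) (hmon h k \<alpha>)"
proof -
  have "symhom N ((\<Sum>i\<le>j. \<alpha> i) * e) (\<lambda>\<psi>. \<Prod>i\<le>j. h i \<psi> ^ \<alpha> i)" if "j \<le> k" for j
    using that
  proof (induction j)
    case 0
    then show ?case using symhom_power[OF assms(1)[of 0], of "\<alpha> 0"] by simp
  next
    case (Suc j)
    have "symhom N ((\<Sum>i\<le>j. \<alpha> i) * e + \<alpha> (Suc j) * e) (\<lambda>\<psi>. (\<Prod>i\<le>j. h i \<psi> ^ \<alpha> i) * h (Suc j) \<psi> ^ \<alpha> (Suc j))"
      using Suc by (intro symhom_mult symhom_power assms(1)) auto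
    then show ?case by (simp add: add_mult_distrib)
  qed
  from this[of k] assms(2) show ?thesis by (simp add: hmon_def[abs_def] exps_def)
qed

text \<open>Double induction on k and L. On \<open>Z k\<close> the terms containing
  \<open>h (Suc k)\<close> vanish, so the others have zero coefficients by induction on k. What
  remains is divisible by \<open>h (Suc k)\<close>, which is not zero on the irreducible
  \<open>Z (Suc k)\<close>; dividing it out lowers L.\<close>

lemma chain_independent:
  assumes irr: "\<And>i. i \<le> k \<Longrightarrow> irreducible_closedin TX (Z i)"
    and h: "\<And>i. i \<le> k \<Longrightarrow> symhom N e (h i)" "\<And>i. i \<le> k \<Longrightarrow> \<not> zero_on N (Z i) (h i)"
    and hz: "\<And>i. i < k \<Longrightarrow> zero_on N (Z i) (h (Suc i))" and sub: "\<And>i. i < k \<Longrightarrow> Z i \<subseteq> Z (Suc i)"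
    and rel: "zero_on N (Z k) (\<lambda>\<psi>. \<Sum>\<alpha>\<in>exps k L. c \<alpha> * hmon h k \<alpha> \<psi>)" and \<alpha>: "\<alpha> \<in> exps k L"
  shows "c \<alpha> = 0"
  using assms
proof (induction k arbitrary: L c \<alpha>)
  case 0
  have e: "exps 0 L = {\<lambda>i. if i = 0 then L else 0}"
    by (auto simp: exps_def fun_eq_iff)
  obtain \<psi> where \<psi>: "nz N \<psi>" "mset (tuple N \<psi>) \<in> Z 0" "h 0 \<psi> \<noteq> 0"
    using 0(3)[of 0] by (auto simp: zero_on_def)
  have "c (\<lambda>i. if i = 0 then L else 0) * h 0 \<psi> ^ L = 0"
    using 0(6) \<psi>(1,2) unfolding zero_on_def e by (simp add: hmon_def)
  then show ?case using \<psi>(3) 0(7) e by simp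
next
  case (Suc k)
  note IHk = Suc.IH
  note prems = Suc.prems(1-5)
  from Suc.prems(6,7) show ?case
  proof (induction L arbitrary: c \<alpha>)
    case 0
    have z: "\<alpha> i = 0" if "\<alpha> \<in> exps (Suc k) 0" for \<alpha> i
    proof (cases "i \<le> Suc k")
      case True
      have "(\<Sum>i\<le>Suc k. \<alpha> i) = 0" using that unfolding exps_def by (elim CollectE conjE)
      then show ?thesis using True by (simp del: sum.atMost_Suc)
    next
      case False
      then show ?thesis using that by (simp add: exps_def)
    qed
    have e: "exps (Suc k) 0 = {\<lambda>i. 0}"
    proof (intro equalityI subsetI)
      fix \<alpha> assume "\<alpha> \<in> exps (Suc k) 0"
      from z[OF this] show "\<alpha> \<in> {\<lambda>i. 0}" by (simp only: singleton_iff fun_eq_iff) simp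
    qed (simp add: exps_def)
    obtain \<psi> where \<psi>: "nz N \<psi>" "mset (tuple N \<psi>) \<in> Z (Suc k)"
      using prems(3)[of "Suc k"] by (auto simp: zero_on_def)
    then have "c (\<lambda>i. 0) = 0" using 0(1) unfolding zero_on_def e by (simp add: hmon_def)
    then show ?case using 0(2) e by simp
  next
    case (Suc L)
    let ?A0 = "{\<alpha> \<in> exps (Suc k) (Suc L). \<alpha> (Suc k) = 0}" and ?A1 = "{\<alpha> \<in> exps (Suc k) (Suc L). \<alpha> (Suc k) \<noteq> 0}"
    have A0: "?A0 = exps k (Suc L)"
    proof (intro set_eqI iffI)
      fix \<alpha> :: "nat \<Rightarrow> nat" assume a: "\<alpha> \<in> ?A0"
      have "\<alpha> i = 0" if "i > k" for i using a that by (cases "i = Suc k") (auto simp: exps_def)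
      then show "\<alpha> \<in> exps k (Suc L)" using a by (auto simp: exps_def)
    qed (auto simp: exps_def)
    have mon0: "hmon h (Suc k) \<alpha> \<psi> = hmon h k \<alpha> \<psi>" if "\<alpha> (Suc k) = 0" for \<alpha> \<psi> using that by (simp add: hmon_def)
    let ?up = "\<lambda>\<alpha>. \<alpha>(Suc k := Suc (\<alpha> (Suc k)))"
    have mon1: "hmon h (Suc k) (?up \<alpha>) \<psi> = h (Suc k) \<psi> * hmon h (Suc k) \<alpha> \<psi>" for \<alpha> \<psi>
    proof -
      have "(\<Prod>i\<le>k. h i \<psi> ^ (?up \<alpha>) i) = (\<Prod>i\<le>k. h i \<psi> ^ \<alpha> i)" by (intro prod.cong) auto
      then show ?thesis by (simp add: hmon_def)
    qed
    have bij: "bij_betw ?up (exps (Suc k) L) ?A1"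
    proof (rule bij_betwI[where g = "\<lambda>\<alpha>. \<alpha>(Suc k := \<alpha> (Suc k) - 1)"])
      show "?up \<in> exps (Suc k) L \<rightarrow> ?A1"
      proof
        fix \<alpha> assume a: "\<alpha> \<in> exps (Suc k) L"
        have "(\<Sum>i\<le>k. (?up \<alpha>) i) = (\<Sum>i\<le>k. \<alpha> i)" by (intro sum.cong) auto
        then show "?up \<alpha> \<in> ?A1" using a by (auto simp: exps_def)
      qed
      show "(\<lambda>\<alpha>. \<alpha>(Suc k := \<alpha> (Suc k) - 1)) \<in> ?A1 \<rightarrow> exps (Suc k) L"
      proof
        fix \<alpha> assume a: "\<alpha> \<in> ?A1"
        have "(\<Sum>i\<le>k. (\<alpha>(Suc k := \<alpha> (Suc k) - 1)) i) = (\<Sum>i\<le>k. \<alpha> i)" by (intro sum.cong) auto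
        then show "\<alpha>(Suc k := \<alpha> (Suc k) - 1) \<in> exps (Suc k) L" using a by (auto simp: exps_def)
      qed
    qed auto
    have split: "(\<Sum>\<alpha>\<in>exps (Suc k) (Suc L). c \<alpha> * hmon h (Suc k) \<alpha> \<psi>) =
        (\<Sum>\<alpha>\<in>exps k (Suc L). c \<alpha> * hmon h k \<alpha> \<psi>) +
        h (Suc k) \<psi> * (\<Sum>\<alpha>\<in>exps (Suc k) L. c (?up \<alpha>) * hmon h (Suc k) \<alpha> \<psi>)" for \<psi>
    proof -
      have "exps (Suc k) (Suc L) = ?A0 \<union> ?A1" by auto
      then have "(\<Sum>\<alpha>\<in>exps (Suc k) (Suc L). c \<alpha> * hmon h (Suc k) \<alpha> \<psi>) =
          (\<Sum>\<alpha>\<in>?A0. c \<alpha> * hmon h (Suc k) \<alpha> \<psi>) + (\<Sum>\<alpha>\<in>?A1. c \<alpha> * hmon h (Suc k) \<alpha> \<psi>)"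
        using finite_exps[of "Suc k" "Suc L"] by (subst sum.union_disjoint[symmetric]) auto
      moreover have "(\<Sum>\<alpha>\<in>?A0. c \<alpha> * hmon h (Suc k) \<alpha> \<psi>) = (\<Sum>\<alpha>\<in>exps k (Suc L). c \<alpha> * hmon h k \<alpha> \<psi>)"
        unfolding A0[symmetric] by (intro sum.cong refl) (simp add: mon0)
      moreover have "(\<Sum>\<alpha>\<in>?A1. c \<alpha> * hmon h (Suc k) \<alpha> \<psi>) =
          (\<Sum>\<alpha>\<in>exps (Suc k) L. c (?up \<alpha>) * hmon h (Suc k) (?up \<alpha>) \<psi>)"
        by (rule sum.reindex_bij_betw[OF bij, symmetric])
      ultimately show ?thesis unfolding mon1 sum_distrib_left by (simp add: mult_ac)
    qed
    have "zero_on N (Z k) (\<lambda>\<psi>. \<Sum>\<alpha>\<in>exps k (Suc L). c \<alpha> * hmon h k \<alpha> \<psi>)"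
      unfolding zero_on_def
    proof (intro allI impI)
      fix \<psi> assume \<psi>: "nz N \<psi>" "mset (tuple N \<psi>) \<in> Z k"
      have "h (Suc k) \<psi> = 0" using prems(4)[of k] \<psi> by (simp add: zero_on_def)
      moreover have "mset (tuple N \<psi>) \<in> Z (Suc k)" using prems(5)[of k] \<psi>(2) by auto
      then have "(\<Sum>\<alpha>\<in>exps (Suc k) (Suc L). c \<alpha> * hmon h (Suc k) \<alpha> \<psi>) = 0"
        using Suc.prems(1) \<psi>(1) unfolding zero_on_def by blast
      ultimately show "(\<Sum>\<alpha>\<in>exps k (Suc L). c \<alpha> * hmon h k \<alpha> \<psi>) = 0" unfolding split by simp
    qed
    have c0: "c \<alpha> = 0" if "\<alpha> \<in> exps k (Suc L)" for \<alpha>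
    proof (rule IHk[where L = "Suc L" and c = c])
      show "zero_on N (Z k) (\<lambda>\<psi>. \<Sum>\<alpha>\<in>exps k (Suc L). c \<alpha> * hmon h k \<alpha> \<psi>)" by fact
    qed (use prems that in auto)
    with Suc.prems(1) have "zero_on N (Z (Suc k)) (\<lambda>\<psi>. h (Suc k) \<psi> * (\<Sum>\<alpha>\<in>exps (Suc k) L. c (?up \<alpha>) * hmon h (Suc k) \<alpha> \<psi>))"
      unfolding split by simp
    moreover have "symhom N (L * e) (\<lambda>\<psi>. \<Sum>\<alpha>\<in>exps (Suc k) L. c (?up \<alpha>) * hmon h (Suc k) \<alpha> \<psi>)"
      using prems(2) by (intro symhom_sum symhom_cmult symhom_hmon) auto
    ultimately have zu: "zero_on N (Z (Suc k)) (\<lambda>\<psi>. \<Sum>\<alpha>\<in>exps (Suc k) L. c (?up \<alpha>) * hmon h (Suc k) \<alpha> \<psi>)"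
      using irreducible_mult[OF prems(1)[of "Suc k"] prems(2)[of "Suc k"]] prems(3)[of "Suc k"] by blast
    have c1: "c (?up \<alpha>) = 0" if "\<alpha> \<in> exps (Suc k) L" for \<alpha>
      using Suc.IH[where c = "\<lambda>\<alpha>. c (?up \<alpha>)", OF zu that] .
    show ?case
    proof (cases "\<alpha> (Suc k) = 0")
      case True
      then have "\<alpha> \<in> exps k (Suc L)" using Suc.prems(2) A0 by blast
      then show ?thesis by (rule c0)
    next
      case False
      then have "\<alpha> \<in> ?up ` exps (Suc k) L" using Suc.prems(2) bij by (simp add: bij_betw_def)
      then show ?thesis using c1 by blast
    qed
  qed
qed

end

section \<open>Algebraic dependence of the eigenpoints on the coefficients\<close>

definition extend0 :: "('v \<Rightarrow> complex) \<Rightarrow> 'v option \<Rightarrow> complex" where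
  "extend0 \<phi> v = (case v of None \<Rightarrow> 0 | Some a \<Rightarrow> \<phi> a)"

lemma extend0_simps [simp]: "extend0 \<phi> None = 0" "extend0 \<phi> (Some a) = \<phi> a"
  by (simp_all add: extend0_def)

text \<open>Since there are finitely many eigenpoints, the constructible set of values of one affine
  coordinate is finite, hence cut out by one of the equations in its description.\<close>

lemma coordinate_relation:
  fixes k i :: "'n::finite"
  obtains Q :: "(nat \<times> ((('n \<Rightarrow>\<^sub>0 nat) option \<Rightarrow> complex) \<Rightarrow> complex poly)) set"
  where "finite Q" "\<And>n A. (n, A) \<in> Q \<Longrightarrow> polyfam n A"
    "\<And>\<phi> x. x k = 1 \<Longrightarrow> eigc d \<phi> x \<Longrightarrow> finite (eig_lines d \<phi>) \<Longrightarrow>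
       \<exists>(n, A)\<in>Q. A (extend0 \<phi>) \<noteq> 0 \<and> poly (A (extend0 \<phi>)) (x i) = 0"
proof -
  \<comment> \<open>The slot \<open>None\<close> carries one affine coordinate of an eigenvector
    normalised by \<open>x k = 1\<close>; the other slots carry the coefficients of the
    form.\<close>
  define G :: "(('n \<Rightarrow>\<^sub>0 nat) option \<Rightarrow> complex) \<Rightarrow> bool" where
    "G = (\<lambda>\<Phi>. \<exists>x. x k = 1 \<and> x i = \<Phi> None \<and> eigc d (\<lambda>a. \<Phi> (Some a)) x)"
  have "constructible (\<lambda>\<Psi> :: ('n \<Rightarrow>\<^sub>0 nat) option + 'n \<Rightarrow> complex.
      \<Psi> (Inr k) = 1 \<and> \<Psi> (Inr i) = \<Psi> (Inl None) \<and> eigc d (\<lambda>a. \<Psi> (Inl (Some a))) (\<lambda>j. \<Psi> (Inr j)))"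
    by (intro constructible_conj constructible_eq constructible_eigc polyfun_var polyfun_const)
  from constructible_ex[OF this] have "constructible G" by (simp add: G_def)
  then obtain L where L: "\<forall>(ps, q)\<in>set L. (\<forall>p\<in>set ps. polyfun p) \<and> polyfun q"
    "\<forall>\<Phi>. G \<Phi> \<longleftrightarrow> (\<exists>(ps, q)\<in>set L. basic_set ps q \<Phi>)"
    unfolding constructible_def by (elim exE conjE)
  have "\<exists>z. polyfam (fst z) (snd z) \<and> (\<forall>\<Phi> c. p (\<Phi>(None := c)) = poly ((snd z) \<Phi>) c)"
    if "polyfun p" for p :: "(('n \<Rightarrow>\<^sub>0 nat) option \<Rightarrow> complex) \<Rightarrow> complex"
  proof -
    obtain n A where "polyfam n A" "\<forall>\<Phi> c. p (\<Phi>(None := c)) = poly (A \<Phi>) c"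
      by (rule polyfun_as_polyfam[OF \<open>polyfun p\<close>, of None]) blast
    then show ?thesis by (intro exI[of _ "(n, A)"]) simp
  qed
  then have "\<forall>p \<in> {p :: (('n \<Rightarrow>\<^sub>0 nat) option \<Rightarrow> complex) \<Rightarrow> complex. polyfun p}. \<exists>z. polyfam (fst z) (snd z) \<and> (\<forall>\<Phi> c. p (\<Phi>(None := c)) = poly ((snd z) \<Phi>) c)"
    by simp
  from bchoice[OF this] obtain F where "\<forall>p \<in> {p :: (('n \<Rightarrow>\<^sub>0 nat) option \<Rightarrow> complex) \<Rightarrow> complex. polyfun p}. polyfam (fst (F p)) (snd (F p)) \<and>
    (\<forall>\<Phi> c. p (\<Phi>(None := c)) = poly ((snd (F p)) \<Phi>) c)" ..
  then have F: "\<And>p. polyfun p \<Longrightarrow> polyfam (fst (F p)) (snd (F p))"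
    "\<And>p \<Phi> c. polyfun p \<Longrightarrow> p (\<Phi>(None := c)) = poly ((snd (F p)) \<Phi>) c" by simp_all
  define Q where "Q = (\<Union>z\<in>set L. F ` set (fst z))"
  show thesis
  proof (rule that[of Q])
    show "finite Q" by (simp add: Q_def)
    fix n A assume "(n, A) \<in> Q"
    then obtain ps q p where p: "(ps, q) \<in> set L" "p \<in> set ps" "(n, A) = F p" by (auto simp: Q_def)
    then have "polyfun p" using L(1) by auto
    then show "polyfam n A" using F(1)[of p] p(3) by (metis fst_conv snd_conv)
  next
    fix \<phi> :: "('n \<Rightarrow>\<^sub>0 nat) \<Rightarrow> complex" and x :: "'n \<Rightarrow> complex"
    assume x: "x k = 1" "eigc d \<phi> x" and fin: "finite (eig_lines d \<phi>)"
    \<comment> \<open>The placeholder 0 of \<open>extend0\<close> is overwritten by c. The set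
      injects into the eigenpoints, hence is finite.\<close>
    let ?S = "{c. G ((extend0 \<phi>)(None := c))}"
    have "finite ?S"
    proof -
      have "\<forall>c\<in>?S. \<exists>x. x k = 1 \<and> x i = c \<and> eigc d \<phi> x" by (simp add: G_def)
      from bchoice[OF this] obtain X where X: "\<And>c. c \<in> ?S \<Longrightarrow> X c k = 1" "\<And>c. c \<in> ?S \<Longrightarrow> X c i = c"
        "\<And>c. c \<in> ?S \<Longrightarrow> eigc d \<phi> (X c)" by blast
      let ?p = "\<lambda>c. (\<chi> j. X c j) :: complex ^ 'n"
      have nz: "?p c \<noteq> 0" if "c \<in> ?S" for c using X(1)[OF that] by (auto simp: vec_eq_iff intro!: exI[of _ k])
      have "inj_on (\<lambda>c. pt (?p c)) ?S"
      proof (rule inj_onI)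
        fix c e assume ce: "c \<in> ?S" "e \<in> ?S" "pt (?p c) = pt (?p e)"
        then have "?p c $ k * ?p e $ i = ?p c $ i * ?p e $ k" using parallel_iff[OF nz[OF ce(1)] nz[OF ce(2)]] by blast
        then show "c = e" using X ce by simp
      qed
      moreover have "(\<lambda>c. pt (?p c)) ` ?S \<subseteq> eig_lines d \<phi>"
      proof clarify
        fix c assume c: "G ((extend0 \<phi>)(None := c))"
        have "($) (?p c) = X c" by auto
        then show "pt (?p c) \<in> eig_lines d \<phi>" using pt_in_eig_lines[OF nz, of c d \<phi>] X(3)[of c] c by simp
      qed
      ultimately show ?thesis using fin by (metis finite_imageD finite_subset)
    qed
    have "G ((extend0 \<phi>)(None := x i))" unfolding G_def using x by (intro exI[of _ x]) simp
    then obtain ps q where pq: "(ps, q) \<in> set L" "basic_set ps q ((extend0 \<phi>)(None := x i))" using L(2) by blast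
    have pf: "polyfun q" "\<And>p. p \<in> set ps \<Longrightarrow> polyfun p" using L(1) pq(1) by auto
    \<comment> \<open>If all equations of this piece were trivial in the coordinate, its inequation
      alone would make \<open>?S\<close> cofinite.\<close>
    have "\<exists>p\<in>set ps. snd (F p) (extend0 \<phi>) \<noteq> 0"
    proof (rule ccontr)
      assume *: "\<not> ?thesis"
      have "UNIV \<subseteq> ?S \<union> {c. poly (snd (F q) (extend0 \<phi>)) c = 0}"
      proof
        fix c :: complex
        have "basic_set ps q ((extend0 \<phi>)(None := c))" if "poly (snd (F q) (extend0 \<phi>)) c \<noteq> 0"
          unfolding basic_set_def
        proof (intro conjI ballI)
          show "q ((extend0 \<phi>)(None := c)) \<noteq> 0" using that F(2)[OF pf(1)] by simp
          fix p assume p: "p \<in> set ps"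
          then show "p ((extend0 \<phi>)(None := c)) = 0" using * F(2)[OF pf(2)[OF p]] by simp
        qed
        then show "c \<in> ?S \<union> {c. poly (snd (F q) (extend0 \<phi>)) c = 0}" using L(2) pq(1) by blast
      qed
      moreover have "snd (F q) (extend0 \<phi>) \<noteq> 0"
      proof
        assume "snd (F q) (extend0 \<phi>) = 0"
        then have "q ((extend0 \<phi>)(None := x i)) = 0" using F(2)[OF pf(1)] by simp
        then show False using pq(2) by (simp add: basic_set_def)
      qed
      then have "finite {c. poly (snd (F q) (extend0 \<phi>)) c = 0}" by (rule poly_roots_finite)
      ultimately have "finite (UNIV :: complex set)" using \<open>finite ?S\<close> by (metis finite_Un finite_subset)
      then show False using infinite_UNIV_char_0 by blast
    qed
    then obtain p where p: "p \<in> set ps" "snd (F p) (extend0 \<phi>) \<noteq> 0" by blast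
    have "poly (snd (F p) (extend0 \<phi>)) (x i) = 0"
      unfolding F(2)[OF pf(2)[OF p(1)], symmetric] using pq(2) p(1) unfolding basic_set_def by blast
    moreover have "F p \<in> Q" using pq(1) p(1) by (force simp: Q_def)
    ultimately show "\<exists>(n, A)\<in>Q. A (extend0 \<phi>) \<noteq> 0 \<and> poly (A (extend0 \<phi>)) (x i) = 0"
      using p(2) by (intro bexI[of _ "F p"]) (auto simp: case_prod_beta)
  qed
qed

lemma exactly_tuple:
  assumes "exactly d N \<phi>"
  obtains \<psi> where "eig_tuple d N \<phi> \<psi>" "nz N \<psi>" "mset (tuple N \<psi>) = mset_set (eig_lines d \<phi>)"
proof -
  have fin: "finite (eig_lines d \<phi>)" and card: "card (eig_lines d \<phi>) = N" using assms by (auto simp: exactly_def)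
  obtain L where L: "bij_betw L {0..<N} (eig_lines d \<phi>)" using ex_bij_betw_nat_finite[OF fin] card by blast
  obtain \<psi> where "eig_tuple d N \<phi> \<psi>"
    by (rule eig_tuple_exists[of L N d \<phi>]) (use L in \<open>auto simp: bij_betw_def atLeast0LessThan\<close>)
  with eig_tuple_mset[OF assms] show thesis using that by blast
qed

text \<open>\<open>Q k i\<close> holds the candidate equations for the i-th coordinate in the chart
  \<open>x k = 1\<close>; X stands for the image of \<open>tau\<close>, whose points come from forms
  supported in B0.\<close>

locale eig_classes =
  fixes d N :: nat and B0 :: "('n::finite \<Rightarrow>\<^sub>0 nat) set"
    and Q :: "'n \<Rightarrow> 'n \<Rightarrow> (nat \<times> ((('n \<Rightarrow>\<^sub>0 nat) option \<Rightarrow> complex) \<Rightarrow> complex poly)) set"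
    and X :: "(complex ^ 'n) set multiset set"
  assumes n: "CARD('n) \<ge> 2" and finB0: "finite B0"
    and finQ: "\<And>k i. finite (Q k i)" and polyfamQ: "\<And>k i n A. (n, A) \<in> Q k i \<Longrightarrow> polyfam n A"
    and Q: "\<And>k i \<phi> x. x k = 1 \<Longrightarrow> eigc d \<phi> x \<Longrightarrow> finite (eig_lines d \<phi>) \<Longrightarrow>
       \<exists>(n, A)\<in>Q k i. A (extend0 \<phi>) \<noteq> 0 \<and> poly (A (extend0 \<phi>)) (x i) = 0"
    and X: "\<And>z. z \<in> X \<Longrightarrow> \<exists>\<phi>. (\<forall>a. a \<notin> B0 \<longrightarrow> \<phi> a = 0) \<and> exactly d N \<phi> \<and> z = mset_set (eig_lines d \<phi>)"
begin

text \<open>The affine chart of coefficient vectors with \<open>\<phi> a0 = 1\<close>, together with the equation and the degree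
  chosen for each coordinate of the eigenpoints.\<close>

definition good :: "('n \<Rightarrow>\<^sub>0 nat) \<Rightarrow> (nat \<times> 'n \<Rightarrow> (nat \<times> ((('n \<Rightarrow>\<^sub>0 nat) option \<Rightarrow> complex) \<Rightarrow> complex poly)) \<times> nat) \<Rightarrow>
    (('n \<Rightarrow>\<^sub>0 nat) \<Rightarrow> complex) \<times> (nat \<times> 'n \<Rightarrow> complex) \<Rightarrow> bool" where
  "good a0 ch \<omega> \<longleftrightarrow> (\<forall>a. a \<notin> B0 \<longrightarrow> fst \<omega> a = 0) \<and> fst \<omega> a0 = 1 \<and> nz N (snd \<omega>) \<and>
     (\<forall>v. v \<notin> {..<N} \<times> UNIV \<longrightarrow> snd \<omega> v = 0) \<and>
     (\<forall>v\<in>{..<N} \<times> UNIV. snd (fst (ch v)) (extend0 (fst \<omega>)) \<noteq> 0 \<and>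
        degree (snd (fst (ch v)) (extend0 (fst \<omega>))) = snd (ch v) \<and>
        poly (snd (fst (ch v)) (extend0 (fst \<omega>))) (snd \<omega> v) = 0)"

text \<open>An equation is recorded with its actual degree: leading coefficients must not vanish on
  the part considered, and yet finitely many choices must cover everything.\<close>

definition choices :: "((nat \<times> ((('n \<Rightarrow>\<^sub>0 nat) option \<Rightarrow> complex) \<Rightarrow> complex poly)) \<times> nat) set" where
  "choices = (\<Union>k. \<Union>i. \<Union>z\<in>Q k i. {z} \<times> {..<fst z})"

lemma choices_polyfam: "z \<in> choices \<Longrightarrow> polyfam (fst (fst z)) (snd (fst z))"
  using polyfamQ by (fastforce simp: choices_def)

lemma finite_choices: "finite choices"
  unfolding choices_def using finQ by auto

definition class_part :: "('n \<Rightarrow>\<^sub>0 nat) \<times> (nat \<times> 'n \<Rightarrow> (nat \<times> ((('n \<Rightarrow>\<^sub>0 nat) option \<Rightarrow> complex) \<Rightarrow> complex poly)) \<times> nat) \<Rightarrow>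
   (complex ^ 'n) set multiset set" where
  "class_part \<kappa> = {mset (tuple N (snd \<omega>)) | \<omega>. good (fst \<kappa>) (snd \<kappa>) \<omega>}"

definition classes where
  "classes = B0 \<times> PiE ({..<N} \<times> (UNIV :: 'n set)) (\<lambda>_. choices)"

lemma finite_classes: "finite classes"
  unfolding classes_def using finB0 finite_choices by (intro finite_SigmaI finite_PiE) auto

lemma X_sym_power: "X \<subseteq> sym_power_PV N"
proof
  fix z assume "z \<in> X"
  then obtain \<phi> where "exactly d N \<phi>" "z = mset_set (eig_lines d \<phi>)" using X by blast
  then show "z \<in> sym_power_PV N" using exactly_tuple[of d N \<phi>] sym_power_PV_iff by metis
qed

text \<open>One coefficient of the form and one coordinate of each eigenpoint are scaled to 1; the
  finite sets Q then supply the equations. The parts being finite in number, one of them is dense in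
  a given irreducible set.\<close>

lemma X_classes: "X \<subseteq> (\<Union>\<kappa>\<in>classes. class_part \<kappa>)"
proof
  fix z assume "z \<in> X"
  then obtain \<phi> where \<phi>: "\<And>a. a \<notin> B0 \<Longrightarrow> \<phi> a = 0" "exactly d N \<phi>" "z = mset_set (eig_lines d \<phi>)"
    using X by blast
  have "\<exists>a0\<in>B0. \<phi> a0 \<noteq> 0"
  proof (rule ccontr)
    assume "\<not> ?thesis"
    then have "\<phi> a = 0" for a using \<phi>(1) by blast
    then have "eigc d \<phi> x" for x by (simp add: eigc_def gradc_def)
    then show False using not_exactly_trivial[OF n] \<phi>(2) by blast
  qed
  then obtain a0 where a0: "a0 \<in> B0" "\<phi> a0 \<noteq> 0" by blast
  define \<phi>' where "\<phi>' = (\<lambda>a. (1 / \<phi> a0) * \<phi> a)"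
  have lines: "eig_lines d \<phi>' = eig_lines d \<phi>" unfolding \<phi>'_def using a0 by (intro eig_lines_cmult) simp
  obtain \<psi> where \<psi>: "eig_tuple d N \<phi>' \<psi>" "nz N \<psi>" "mset (tuple N \<psi>) = z"
    using exactly_tuple[of d N \<phi>'] \<phi>(2,3) lines by (metis exactly_def)
  have "\<forall>k\<in>{..<N}. \<exists>i. \<psi> (k, i) \<noteq> 0" using \<psi>(2) by (auto simp: nz_def)
  from bchoice[OF this] obtain \<iota> where \<iota>: "\<And>k. k < N \<Longrightarrow> \<psi> (k, \<iota> k) \<noteq> 0" by auto
  define \<psi>' where "\<psi>' = (\<lambda>(k, i). if k < N then (1 / \<psi> (k, \<iota> k)) * \<psi> (k, i) else 0)"
  have nz': "nz N \<psi>'" using \<psi>(2) \<iota> by (auto simp: nz_def \<psi>'_def)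
  have "mset (tuple N \<psi>') = mset (tuple N \<psi>)"
    unfolding mset_tuple_eq_iff[OF nz' \<psi>(2)]
    using \<iota> by (intro exI[of _ id] exI[of _ "\<lambda>k. \<psi> (k, \<iota> k)"]) (auto simp: permutes_id \<psi>'_def)
  then have z: "z = mset (tuple N \<psi>')" using \<psi>(3) by simp
  have fin: "finite (eig_lines d \<phi>')" using \<phi>(2) lines by (simp add: exactly_def)
  have "\<forall>v\<in>{..<N} \<times> (UNIV :: 'n set). \<exists>c\<in>choices. snd (fst c) (extend0 \<phi>') \<noteq> 0 \<and>
      degree (snd (fst c) (extend0 \<phi>')) = snd c \<and> poly (snd (fst c) (extend0 \<phi>')) (\<psi>' v) = 0"
  proof
    fix v :: "nat \<times> 'n" assume "v \<in> {..<N} \<times> UNIV"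
    then obtain k i where v: "v = (k, i)" "k < N" by (cases v) auto
    have "eigc d \<phi>' (\<lambda>j. \<psi> (k, j))" using \<psi>(1) v(2) by (simp add: eig_tuple_def)
    from eigc_scale[OF this, of "1 / \<psi> (k, \<iota> k)"]
    have e: "eigc d \<phi>' (\<lambda>j. \<psi>' (k, j))" using v(2) by (simp add: \<psi>'_def)
    have "\<psi>' (k, \<iota> k) = 1" using v(2) \<iota> by (simp add: \<psi>'_def)
    from Q[of "\<lambda>j. \<psi>' (k, j)" "\<iota> k", OF this e fin, of i]
    obtain n A where A: "(n, A) \<in> Q (\<iota> k) i" "A (extend0 \<phi>') \<noteq> 0" "poly (A (extend0 \<phi>')) (\<psi>' (k, i)) = 0" by blast
    have "degree (A (extend0 \<phi>')) < n"
    proof (rule ccontr)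
      assume "\<not> ?thesis"
      then have "poly.coeff (A (extend0 \<phi>')) (degree (A (extend0 \<phi>'))) = 0"
        using polyfamQ[OF A(1)] by (auto simp: polyfam_def simp del: leading_coeff_0_iff)
      then show False using A(2) by simp
    qed
    then have "((n, A), degree (A (extend0 \<phi>'))) \<in> choices" using A(1) by (force simp: choices_def)
    then show "\<exists>c\<in>choices. snd (fst c) (extend0 \<phi>') \<noteq> 0 \<and>
      degree (snd (fst c) (extend0 \<phi>')) = snd c \<and> poly (snd (fst c) (extend0 \<phi>')) (\<psi>' v) = 0"
      using A(2,3) v(1) by (intro bexI[of _ "((n, A), degree (A (extend0 \<phi>')))"]) auto
  qed
  then have "\<forall>v\<in>{..<N} \<times> (UNIV :: 'n set). \<exists>c. c \<in> choices \<and> snd (fst c) (extend0 \<phi>') \<noteq> 0 \<and>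
      degree (snd (fst c) (extend0 \<phi>')) = snd c \<and> poly (snd (fst c) (extend0 \<phi>')) (\<psi>' v) = 0"
    unfolding Bex_def .
  from bchoice[OF this] obtain ch where "\<forall>v\<in>{..<N} \<times> (UNIV :: 'n set). ch v \<in> choices \<and> snd (fst (ch v)) (extend0 \<phi>') \<noteq> 0 \<and>
      degree (snd (fst (ch v)) (extend0 \<phi>')) = snd (ch v) \<and> poly (snd (fst (ch v)) (extend0 \<phi>')) (\<psi>' v) = 0" ..
  note ch = this[rule_format]
  let ?ch = "restrict ch ({..<N} \<times> UNIV)"
  have "(a0, ?ch) \<in> classes" using a0(1) ch by (auto simp: classes_def)
  moreover have "good a0 ?ch (\<phi>', \<psi>')"
    unfolding good_def using \<phi>(1) a0(2) nz' ch by (auto simp: \<phi>'_def \<psi>'_def)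
  then have "z \<in> class_part (a0, ?ch)" unfolding class_part_def using z by force
  ultimately show "z \<in> (\<Union>\<kappa>\<in>classes. class_part \<kappa>)" by blast
qed

sublocale sym_subspace N X
  by unfold_locales (rule X_sym_power)

text \<open>On a dense part the functions of the chain are polynomials in coordinates that are
  algebraic over card B0 - 1 parameters. If k is larger, Siegel's count gives a homogeneous relation
  among them on that part, hence on \<open>Z k\<close>, contrary to their independence.\<close>

lemma chain_length:
  assumes irr: "\<And>i. i \<le> k \<Longrightarrow> irreducible_closedin TX (Z i)" and chain: "\<And>i. i < k \<Longrightarrow> Z i \<subset> Z (Suc i)"
  shows "k \<le> card B0 - 1"
proof (rule ccontr)
  assume "\<not> ?thesis"
  then have k: "card B0 - 1 < k" by simp
  obtain e h where h: "\<And>i. i \<le> k \<Longrightarrow> symhom N e (h i)" "\<And>i. i \<le> k \<Longrightarrow> \<not> zero_on N (Z i) (h i)"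
    "\<And>i. i < k \<Longrightarrow> zero_on N (Z i) (h (Suc i))"
    by (rule chain_functions[of k Z]) (use irr chain in blast)+
  have "Z k \<subseteq> X" using irr[of k] closedin_TX_subset by (auto simp: irreducible_closedin_def)
  then have "Z k \<subseteq> (\<Union>\<kappa>\<in>classes. class_part \<kappa>)" using X_classes by blast
  from irreducible_dense_part[OF irr[of k] finite_classes this]
  obtain \<kappa> where \<kappa>: "\<kappa> \<in> classes" "\<And>e G. symhom N e G \<Longrightarrow> zero_on N (Z k \<inter> class_part \<kappa>) G \<Longrightarrow> zero_on N (Z k) G"
    by blast
  obtain a0 ch where \<kappa>eq: "\<kappa> = (a0, ch)" by (cases \<kappa>)
  have a0: "a0 \<in> B0" and ch: "\<And>v. v \<in> {..<N} \<times> UNIV \<Longrightarrow> ch v \<in> choices"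
    using \<kappa>(1) by (auto simp: \<kappa>eq classes_def)
  define \<Omega> where "\<Omega> = {\<omega>. good a0 ch \<omega> \<and> mset (tuple N (snd \<omega>)) \<in> Z k}"
  \<comment> \<open>The coefficient at a0 is scaled to 1, which leaves one parameter fewer.\<close>
  define B where "B = B0 - {a0}"
  have cardB: "card B = card B0 - 1" using a0 finB0 by (simp add: B_def)
  define I where "I = {..<N} \<times> (UNIV :: 'n set)"
  have finI: "finite I" by (simp add: I_def)
  define r where "r = (\<lambda>v. snd (ch v))"
  define a where "a = (\<lambda>v l (\<omega> :: (('n \<Rightarrow>\<^sub>0 nat) \<Rightarrow> complex) \<times> (nat \<times> 'n \<Rightarrow> complex)). poly.coeff (snd (fst (ch v)) (extend0 (fst \<omega>))) l)"
  have finB: "finite B" using finB0 by (simp add: B_def)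
  interpret siegel \<Omega> B "\<lambda>a \<omega>. fst \<omega> a" I "\<lambda>v \<omega>. snd \<omega> v" r a
    by unfold_locales (fact finB finI)+
  have rat: "rational (\<lambda>\<omega>. extend0 (fst \<omega>) v)" for v
  proof (cases v)
    case None
    then show ?thesis using rational_const[of 0] by simp
  next
    case (Some b)
    consider "b \<in> B" | "b = a0" | "b \<notin> B0" by (auto simp: B_def)
    then show ?thesis
    proof cases
      case 1
      then show ?thesis using mulby_b[of b] Some unfolding rational_def by auto
    next
      case 2
      then show ?thesis using mulby_cong[OF mulby_const[of 1], of "\<lambda>\<omega>. fst \<omega> a0"] Some
        unfolding rational_def by (auto simp: \<Omega>_def good_def)
    next
      case 3
      then show ?thesis using mulby_cong[OF mulby_const[of 0], of "\<lambda>\<omega>. fst \<omega> b"] Some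
        unfolding rational_def by (auto simp: \<Omega>_def good_def)
    qed
  qed
  interpret siegel_rel \<Omega> B "\<lambda>a \<omega>. fst \<omega> a" I "\<lambda>v \<omega>. snd \<omega> v" r a
  proof unfold_locales
    fix v l assume v: "v \<in> I"
    have "polyfun (\<lambda>\<Phi>. poly.coeff (snd (fst (ch v)) \<Phi>) l)"
      using choices_polyfam[OF ch[of v]] v by (auto simp: I_def)
    from rational_polyfun[OF this rat] show "rational (a v l)" by (simp add: a_def)
  next
    fix v \<omega> assume v: "v \<in> I" and \<omega>: "\<omega> \<in> \<Omega>"
    let ?p = "snd (fst (ch v)) (extend0 (fst \<omega>))"
    have p: "?p \<noteq> 0" "degree ?p = r v" "poly ?p (snd \<omega> v) = 0"
      using v \<omega> by (auto simp: \<Omega>_def good_def I_def r_def)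
    show "(\<Sum>l\<le>r v. a v l \<omega> * snd \<omega> v ^ l) = 0"
      using p(3) unfolding poly_altdef p(2) a_def .
    show "a v (r v) \<omega> \<noteq> 0" unfolding a_def p(2)[symmetric] using p(1) by simp
  next
    fix v \<omega> assume "v \<notin> I" "\<omega> \<in> \<Omega>"
    then show "snd \<omega> v = 0" unfolding \<Omega>_def good_def I_def by blast
  qed
  have "\<And>i. i \<le> k \<Longrightarrow> polyfun (h i)" using h(1) mhom_polyfun unfolding symhom_def by blast
  moreover have "card B < k" using k cardB by simp
  ultimately obtain L c where c: "\<exists>\<beta>\<in>PiE {1..k} (\<lambda>_. {..L}). c \<beta> \<noteq> 0" and
    rel: "\<And>\<omega>. \<omega> \<in> \<Omega> \<Longrightarrow> (\<Sum>\<beta>\<in>PiE {1..k} (\<lambda>_. {..L}). c \<beta> *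
       (h 0 (\<lambda>v. snd \<omega> v) ^ (k * L - (\<Sum>i\<in>{1..k}. \<beta> i)) * (\<Prod>i\<in>{1..k}. h i (\<lambda>v. snd \<omega> v) ^ \<beta> i))) = 0"
    using homogeneous_relation[of k h] by blast
  let ?A = "PiE {1..k} (\<lambda>_. {..L}) :: (nat \<Rightarrow> nat) set"
  \<comment> \<open>Completes exponents of \<open>h 1\<close>, ..., \<open>h k\<close> by that of
    \<open>h 0\<close> to total degree k L, to match the indexing by \<open>exps\<close>.\<close>
  let ?up = "\<lambda>\<beta> i. if i = 0 then k * L - (\<Sum>i\<in>{1..k}. \<beta> i) else if i \<le> k then \<beta> i else (0 :: nat)"
  have atMost_split: "{..k} = insert 0 {1..k}" by auto
  have up: "?up \<beta> \<in> exps k (k * L)" if "\<beta> \<in> ?A" for \<beta>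
  proof -
    have "(\<Sum>i\<in>{1..k}. \<beta> i) \<le> (\<Sum>i\<in>{1..k}. L)" using that by (intro sum_mono) (auto simp: PiE_iff)
    then have "(\<Sum>i\<in>{1..k}. \<beta> i) \<le> k * L" by simp
    moreover have "(\<Sum>i\<le>k. ?up \<beta> i) = (k * L - (\<Sum>i\<in>{1..k}. \<beta> i)) + (\<Sum>i\<in>{1..k}. \<beta> i)"
    proof -
      have "(\<Sum>i\<in>{1..k}. ?up \<beta> i) = (\<Sum>i\<in>{1..k}. \<beta> i)" by (intro sum.cong) auto
      then show ?thesis unfolding atMost_split by simp
    qed
    ultimately show ?thesis by (auto simp: exps_def)
  qed
  have restr: "restrict (?up \<beta>) {1..k} = \<beta>" if "\<beta> \<in> ?A" for \<beta>
    using that by (auto simp: PiE_iff extensional_def fun_eq_iff)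
  have inj: "inj_on ?up ?A" by (rule inj_on_inverseI[where g = "\<lambda>\<alpha>. restrict \<alpha> {1..k}"]) (rule restr)
  \<comment> \<open>Extension by 0 to all of \<open>exps k (k * L)\<close>.\<close>
  define c' where "c' = (\<lambda>\<alpha>. if \<alpha> \<in> ?up ` ?A then c (restrict \<alpha> {1..k}) else 0)"
  define G where "G = (\<lambda>\<psi>. \<Sum>\<alpha>\<in>exps k (k * L). c' \<alpha> * hmon h k \<alpha> \<psi>)"
  have mon: "hmon h k (?up \<beta>) \<psi> = h 0 \<psi> ^ (k * L - (\<Sum>i\<in>{1..k}. \<beta> i)) * (\<Prod>i\<in>{1..k}. h i \<psi> ^ \<beta> i)" for \<beta> \<psi>
  proof -
    have "(\<Prod>i\<in>{1..k}. h i \<psi> ^ ?up \<beta> i) = (\<Prod>i\<in>{1..k}. h i \<psi> ^ \<beta> i)" by (intro prod.cong) auto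
    then show ?thesis unfolding hmon_def atMost_split by simp
  qed
  have Gsum: "G \<psi> = (\<Sum>\<beta>\<in>?A. c \<beta> * hmon h k (?up \<beta>) \<psi>)" for \<psi>
  proof -
    have "G \<psi> = (\<Sum>\<alpha>\<in>?up ` ?A. c' \<alpha> * hmon h k \<alpha> \<psi>)"
      unfolding G_def using up by (intro sum.mono_neutral_right finite_exps) (auto simp: c'_def)
    also have "\<dots> = (\<Sum>\<beta>\<in>?A. c' (?up \<beta>) * hmon h k (?up \<beta>) \<psi>)" by (rule sum.reindex_cong[OF inj]) auto
    also have "\<dots> = (\<Sum>\<beta>\<in>?A. c \<beta> * hmon h k (?up \<beta>) \<psi>)"
    proof (intro sum.cong refl)
      fix \<beta> assume "\<beta> \<in> ?A"
      then have "c' (?up \<beta>) = c \<beta>" unfolding c'_def restr[OF \<open>\<beta> \<in> ?A\<close>] by simp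
      then show "c' (?up \<beta>) * hmon h k (?up \<beta>) \<psi> = c \<beta> * hmon h k (?up \<beta>) \<psi>" by simp
    qed
    finally show ?thesis .
  qed
  have Gsym: "symhom N (k * L * e) G"
    unfolding G_def by (intro symhom_sum symhom_cmult symhom_hmon h(1))
  have "zero_on N (Z k \<inter> class_part \<kappa>) G"
    unfolding zero_on_vanishes
  proof
    fix z assume z: "z \<in> Z k \<inter> class_part \<kappa>"
    then obtain \<omega> where \<omega>: "good a0 ch \<omega>" "z = mset (tuple N (snd \<omega>))" by (auto simp: class_part_def \<kappa>eq)
    then have "\<omega> \<in> \<Omega>" using z by (simp add: \<Omega>_def)
    from rel[OF this] have "G (snd \<omega>) = 0" unfolding Gsum mon by simp
    moreover have "nz N (snd \<omega>)" using \<omega>(1) by (simp add: good_def)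
    ultimately show "vanishes N G z" using symhom_vanishes_iff[OF Gsym] \<omega>(2) by blast
  qed
  from \<kappa>(2)[OF Gsym this] have Gz: "zero_on N (Z k) G" .
  have "c' \<alpha> = 0" if "\<alpha> \<in> exps k (k * L)" for \<alpha>
    by (rule chain_independent[OF irr h _ Gz[unfolded G_def] that]) (use chain in auto)
  then have "c' (?up \<beta>) = 0" if "\<beta> \<in> ?A" for \<beta> using up[OF that] by blast
  moreover have "c' (?up \<beta>) = c \<beta>" if "\<beta> \<in> ?A" for \<beta> unfolding c'_def restr[OF that] using that by simp
  moreover obtain \<beta> where "\<beta> \<in> ?A" "c \<beta> \<noteq> 0" using c by blast
  ultimately show False by simp
qed

lemma krull_dim_le: "krull_dim (subtopology (zariski_sym_power_PV N) X) \<le> enat (card B0 - 1)"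
  unfolding krull_dim_def
proof (rule Sup_least)
  fix x assume "x \<in> {enat n | n. \<exists>Z. (\<forall>i\<le>n. irreducible_closedin (subtopology (zariski_sym_power_PV N) X) (Z i)) \<and> (\<forall>i<n. Z i \<subset> Z (Suc i))}"
  then obtain n Z where "x = enat n" "\<And>i. i \<le> n \<Longrightarrow> irreducible_closedin TX (Z i)" "\<And>i. i < n \<Longrightarrow> Z i \<subset> Z (Suc i)"
    by (auto simp: TX_def)
  then show "x \<le> enat (card B0 - 1)" using chain_length[of n Z] by simp
qed

end

lemma krull_dim_upper:
  fixes X :: "(complex ^ 'n::finite) set multiset set"
  assumes "CARD('n) \<ge> 2" "finite B0"
    "\<And>z. z \<in> X \<Longrightarrow> \<exists>\<phi>. (\<forall>a. a \<notin> B0 \<longrightarrow> \<phi> a = 0) \<and> exactly d N \<phi> \<and> z = mset_set (eig_lines d \<phi>)"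
  shows "krull_dim (subtopology (zariski_sym_power_PV N) X) \<le> enat (card B0 - 1)"
proof -
  let ?P = "\<lambda>k i (Q :: (nat \<times> ((('n \<Rightarrow>\<^sub>0 nat) option \<Rightarrow> complex) \<Rightarrow> complex poly)) set).
    finite Q \<and> (\<forall>n A. (n, A) \<in> Q \<longrightarrow> polyfam n A) \<and>
    (\<forall>\<phi> x. x k = 1 \<longrightarrow> eigc d \<phi> x \<longrightarrow> finite (eig_lines d \<phi>) \<longrightarrow>
       (\<exists>(n, A)\<in>Q. A (extend0 \<phi>) \<noteq> 0 \<and> poly (A (extend0 \<phi>)) (x i) = 0))"
  define Q where "Q = (\<lambda>k i. SOME Q. ?P k i Q)"
  have Q: "?P k i (Q k i)" for k i :: 'n
  proof -
    have "\<exists>Q. ?P k i Q" by (rule coordinate_relation[of k d i]) blast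
    then show ?thesis unfolding Q_def by (rule someI_ex)
  qed
  interpret eig_classes d N B0 Q X
  proof unfold_locales
    show "2 \<le> CARD('n)" "finite B0" by (fact assms)+
    show "\<exists>\<phi>. (\<forall>a. a \<notin> B0 \<longrightarrow> \<phi> a = 0) \<and> exactly d N \<phi> \<and> z = mset_set (eig_lines d \<phi>)" if "z \<in> X" for z
      using assms(3)[OF that] .
    show "finite (Q k i)" for k i using Q[of k i] by (rule conjunct1)
    show "polyfam n A" if "(n, A) \<in> Q k i" for k i n A using Q[of k i] that by simp
    show "\<exists>(n, A)\<in>Q k i. A (extend0 \<phi>) \<noteq> 0 \<and> poly (A (extend0 \<phi>)) (x i) = 0"
      if "x k = 1" "eigc d \<phi> x" "finite (eig_lines d \<phi>)" for k i \<phi> x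
      using Q[of k i] that by simp
  qed
  show ?thesis by (rule krull_dim_le)
qed

section \<open>Lower bound for the dimension\<close>

lemma polyfun_tendsto:
  assumes "polyfun p" "\<And>v. ((\<lambda>x. \<psi> x v) \<longlongrightarrow> \<psi>0 v) F"
  shows "((\<lambda>x. p (\<psi> x)) \<longlongrightarrow> p \<psi>0) F"
  using assms by (induction) (auto intro: tendsto_add tendsto_mult)

lemma mhom_diff:
  assumes "mhom D F" "mhom D G" shows "mhom D (\<lambda>\<psi>. F \<psi> - G \<psi>)"
  using mhom_add[OF assms(1) mhom_cmult[OF assms(2), of "-1"]] by simp

lemma supp_below_add: "supp_below N D \<Longrightarrow> supp_below N D' \<Longrightarrow> supp_below N (\<lambda>k. D k + D' k)"
  by (simp add: supp_below_def)

text \<open>Gaussian elimination without denominators.\<close>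

lemma elimination:
  fixes e :: "'r \<Rightarrow> 'j \<Rightarrow> (nat \<times> 'n::finite \<Rightarrow> complex) \<Rightarrow> complex"
  assumes "finite J" "\<And>r. r \<in> R \<Longrightarrow> supp_below N (D r)" "\<And>r j. r \<in> R \<Longrightarrow> j \<in> J \<Longrightarrow> mhom (D r) (e r j)"
    and "\<And>c. (\<And>r. r \<in> R \<Longrightarrow> (\<Sum>j\<in>J. c j * e r j \<psi>0) = 0) \<Longrightarrow> (\<forall>j\<in>J. c j = 0)"
  shows "\<exists>E p. supp_below N E \<and> mhom E p \<and> p \<psi>0 \<noteq> 0 \<and>
    (\<forall>\<psi> c. (\<forall>r\<in>R. (\<Sum>j\<in>J. c j * e r j \<psi>) = 0) \<longrightarrow> (\<exists>j\<in>J. c j \<noteq> 0) \<longrightarrow> p \<psi> = 0)"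
  using assms
proof (induction J arbitrary: e D rule: finite_induct)
  case empty
  show ?case
    by (intro exI[of _ "\<lambda>_. 0"] exI[of _ "\<lambda>_. 1"] conjI mhom_const) (auto simp: supp_below_def)
next
  case (insert j0 J)
  obtain r0 where r0: "r0 \<in> R" "e r0 j0 \<psi>0 \<noteq> 0"
  proof -
    have False if "\<And>r. r \<in> R \<Longrightarrow> e r j0 \<psi>0 = 0"
    proof -
      have "(\<Sum>j\<in>insert j0 J. (if j = j0 then 1 else 0) * e r j \<psi>0) = 0" if "r \<in> R" for r
        by (rule sum.neutral) (use \<open>\<And>r. r \<in> R \<Longrightarrow> e r j0 \<psi>0 = 0\<close>[OF that] in auto)
      from insert.prems(3)[OF this] show False by simp
    qed
    then show thesis using that by blast
  qed
  \<comment> \<open>Cross-multiplication with the pivot \<open>e r0 j0\<close> removes the column j0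
    and keeps each row multihomogeneous.\<close>
  define e' where "e' = (\<lambda>r j \<psi>. e r0 j0 \<psi> * e r j \<psi> - e r j0 \<psi> * e r0 j \<psi>)"
  have sum_e': "(\<Sum>j\<in>J. c j * e' r j \<psi>) = e r0 j0 \<psi> * (\<Sum>j\<in>J. c j * e r j \<psi>) - e r j0 \<psi> * (\<Sum>j\<in>J. c j * e r0 j \<psi>)"
    for c r \<psi>
    unfolding e'_def by (simp add: sum_distrib_left sum_subtractf algebra_simps)
  have ins: "(\<Sum>j\<in>insert j0 J. c j * e r j \<psi>) = c j0 * e r j0 \<psi> + (\<Sum>j\<in>J. c j * e r j \<psi>)" for c r \<psi>
    using insert.hyps by simp
  have "\<exists>E p. supp_below N E \<and> mhom E p \<and> p \<psi>0 \<noteq> 0 \<and>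
    (\<forall>\<psi> c. (\<forall>r\<in>R. (\<Sum>j\<in>J. c j * e' r j \<psi>) = 0) \<longrightarrow> (\<exists>j\<in>J. c j \<noteq> 0) \<longrightarrow> p \<psi> = 0)"
  proof (rule insert.IH[of "\<lambda>r k. D r0 k + D r k"])
    show "supp_below N (\<lambda>k. D r0 k + D r k)" if "r \<in> R" for r
      by (intro supp_below_add insert.prems(1) that r0(1))
    show "mhom (\<lambda>k. D r0 k + D r k) (e' r j)" if "r \<in> R" "j \<in> J" for r j
      unfolding e'_def
    proof (rule mhom_diff)
      show "mhom (\<lambda>k. D r0 k + D r k) (\<lambda>\<psi>. e r0 j0 \<psi> * e r j \<psi>)"
        by (intro mhom_mult insert.prems(2)) (use that r0(1) in auto)
      have "mhom (\<lambda>k. D r k + D r0 k) (\<lambda>\<psi>. e r j0 \<psi> * e r0 j \<psi>)"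
        by (intro mhom_mult insert.prems(2)) (use that r0(1) in auto)
      then show "mhom (\<lambda>k. D r0 k + D r k) (\<lambda>\<psi>. e r j0 \<psi> * e r0 j \<psi>)" by (simp add: add.commute)
    qed
    fix c assume c: "\<And>r. r \<in> R \<Longrightarrow> (\<Sum>j\<in>J. c j * e' r j \<psi>0) = 0"
    define c' where "c' = c(j0 := - (\<Sum>j\<in>J. c j * e r0 j \<psi>0) / e r0 j0 \<psi>0)"
    have c'J: "(\<Sum>j\<in>J. c' j * e r j \<psi>0) = (\<Sum>j\<in>J. c j * e r j \<psi>0)" for r
      by (intro sum.cong) (use insert.hyps in \<open>auto simp: c'_def\<close>)
    have "(\<Sum>j\<in>insert j0 J. c' j * e r j \<psi>0) = 0" if "r \<in> R" for r
    proof -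
      have "e r0 j0 \<psi>0 * (\<Sum>j\<in>insert j0 J. c' j * e r j \<psi>0) = (\<Sum>j\<in>J. c j * e' r j \<psi>0)"
        unfolding ins c'J sum_e' using r0(2) by (simp add: c'_def algebra_simps)
      then show ?thesis using c[OF that] r0(2) by simp
    qed
    from insert.prems(3)[OF this] have "\<forall>j\<in>insert j0 J. c' j = 0" .
    moreover have "c' j = c j" if "j \<in> J" for j using that insert.hyps by (auto simp: c'_def)
    ultimately show "\<forall>j\<in>J. c j = 0" by simp
  qed
  then obtain E p where E: "supp_below N E" "mhom E p" "p \<psi>0 \<noteq> 0" and
    p: "\<And>\<psi> c. (\<forall>r\<in>R. (\<Sum>j\<in>J. c j * e' r j \<psi>) = 0) \<Longrightarrow> (\<exists>j\<in>J. c j \<noteq> 0) \<Longrightarrow> p \<psi> = 0"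
    by blast
  show ?case
  \<comment> \<open>The pivot enters the condition as a factor: where it vanishes, the elimination
    says nothing, and the condition has to hold anyway.\<close>
  proof (intro exI[of _ "\<lambda>k. E k + D r0 k"] exI[of _ "\<lambda>\<psi>. p \<psi> * e r0 j0 \<psi>"] conjI allI impI)
    show "supp_below N (\<lambda>k. E k + D r0 k)" by (intro supp_below_add E(1) insert.prems(1) r0(1))
    show "mhom (\<lambda>k. E k + D r0 k) (\<lambda>\<psi>. p \<psi> * e r0 j0 \<psi>)"
      by (intro mhom_mult E(2) insert.prems(2) r0(1)) simp
    show "p \<psi>0 * e r0 j0 \<psi>0 \<noteq> 0" using E(3) r0(2) by simp
    fix \<psi> c assume c: "\<forall>r\<in>R. (\<Sum>j\<in>insert j0 J. c j * e r j \<psi>) = 0" "\<exists>j\<in>insert j0 J. c j \<noteq> 0"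
    show "p \<psi> * e r0 j0 \<psi> = 0"
    proof (cases "e r0 j0 \<psi> = 0")
      case False
      have J: "(\<Sum>j\<in>J. c j * e r j \<psi>) = - (c j0 * e r j0 \<psi>)" if "r \<in> R" for r
        using c(1) that ins[of c r \<psi>] by (simp add: eq_neg_iff_add_eq_0 add.commute)
      have "\<forall>r\<in>R. (\<Sum>j\<in>J. c j * e' r j \<psi>) = 0"
      proof
        fix r assume r: "r \<in> R"
        show "(\<Sum>j\<in>J. c j * e' r j \<psi>) = 0" unfolding sum_e' J[OF r] J[OF r0(1)] by simp
      qed
      moreover have "\<exists>j\<in>J. c j \<noteq> 0"
      proof (rule ccontr)
        assume *: "\<not> ?thesis"
        then have "(\<Sum>j\<in>J. c j * e r0 j \<psi>) = 0" by (intro sum.neutral) auto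
        then have "c j0 = 0" using J[OF r0(1)] False by simp
        then show False using c(2) * by auto
      qed
      ultimately have "p \<psi> = 0" by (rule p)
      then show ?thesis by simp
    qed simp
  qed
qed

lemma mhom_mev:
  fixes b :: "'n::finite \<Rightarrow>\<^sub>0 nat"
  assumes "b \<in> Mon d" shows "mhom (\<lambda>l. if l = k then d else 0) (\<lambda>\<psi>. mev b (\<lambda>j. \<psi> (k, j)))"
proof -
  have "mhom (\<lambda>l. \<Sum>j\<in>UNIV. Poly_Mapping.lookup b j * (if l = k then 1 else 0))
      (\<lambda>\<psi>. \<Prod>j\<in>UNIV. \<psi> (k, j) ^ Poly_Mapping.lookup b j)"
    by (intro mhom_prod mhom_power mhom_var) simp
  moreover have "(\<lambda>l. \<Sum>j\<in>UNIV. Poly_Mapping.lookup b j * (if l = k then 1 else 0)) = (\<lambda>l. if l = k then d else 0)"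
    using assms by (intro HOL.ext) (simp add: Mon_def)
  ultimately show ?thesis by (simp add: mev_UNIV)
qed

lemma mhom_minor: "mhom (\<lambda>l. if l = k then d else 0) (\<lambda>\<psi>. minor d \<gamma> i j (\<lambda>m. \<psi> (k, m)))"
proof (cases "i = j")
  case True
  then show ?thesis using mhom_zero by (simp add: minor_def)
next
  case False
  show ?thesis unfolding minor_expand[OF False]
    by (intro mhom_sum mhom_cmult mhom_mev)
qed

lemma minor_zero: "minor d (\<lambda>a. 0) i j x = 0"
  by (simp add: minor_def gradc_def)

lemma minor_sum:
  "finite J \<Longrightarrow> minor d (\<lambda>a'. \<Sum>a\<in>J. c a * u a a') i j x = (\<Sum>a\<in>J. c a * minor d (u a) i j x)"
proof (induction J rule: finite_induct)
  case empty
  show ?case by (simp add: minor_zero)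
next
  case (insert b J)
  have "minor d (\<lambda>a'. \<Sum>a\<in>insert b J. c a * u a a') i j x = minor d (\<lambda>a'. (\<Sum>a\<in>J. c a * u a a') + c b * u b a') i j x"
    using insert.hyps by (simp add: add.commute)
  also have "\<dots> = (\<Sum>a\<in>insert b J. c a * minor d (u a) i j x)"
    unfolding minor_lin insert.IH using insert.hyps by (simp add: add.commute)
  finally show ?case .
qed

section \<open>Linear families of forms near the Fermat form\<close>

context fermat_star
begin

abbreviation points :: "(('n \<Rightarrow>\<^sub>0 nat) \<Rightarrow> complex) \<Rightarrow> (complex ^ 'n) set multiset" where
  "points \<phi> \<equiv> mset_set (eig_lines d \<phi>)"

text \<open>A polydisc around the Fermat form in the directions of B; for empty B only the Fermat
  form remains.\<close>

definition slice :: "('n \<Rightarrow>\<^sub>0 nat) set \<Rightarrow> (('n \<Rightarrow>\<^sub>0 nat) \<Rightarrow> complex) set" where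
  "slice B = {\<phi>. (\<forall>a. a \<notin> B \<longrightarrow> \<phi> a = fermat d a) \<and> (\<forall>a\<in>B. norm (\<phi> a - fermat d a) < \<delta>)}"

lemma slice_near: "\<phi> \<in> slice B \<Longrightarrow> near \<phi>"
  using delta by (auto simp: slice_def near_fermat_def)

lemma fermat_slice: "fermat d \<in> slice B"
  using delta by (simp add: slice_def)

lemma slice_mono: "B \<subseteq> B' \<Longrightarrow> slice B \<subseteq> slice B'"
  using delta unfolding slice_def by fastforce

text \<open>An ordering of the lines through the grid, with one representative on each, is fixed
  once and transported by \<open>sol\<close> to all nearby forms. This gives continuous coordinates
  of the eigenpoints.\<close>

lemma continuous_eig_tuple:
  obtains \<Psi> where "\<And>\<phi>. near \<phi> \<Longrightarrow> eig_tuple d (num_eig TYPE('n) d) \<phi> (\<Psi> \<phi>)"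
    "\<And>\<phi> \<phi>' \<kappa> v. near \<phi> \<Longrightarrow> near \<phi>' \<Longrightarrow> (\<And>a. a \<in> Mon d \<Longrightarrow> norm (\<phi>' a - \<phi> a) \<le> \<kappa>) \<Longrightarrow> 0 \<le> \<kappa> \<Longrightarrow>
       norm (\<Psi> \<phi>' v - \<Psi> \<phi> v) \<le> 2 * (real CARD('n) * (\<kappa> * C))"
proof -
  let ?G = "grid d - {0} :: (complex ^ 'n) set"
  have "finite ?G" using finite_grid[OF d] by simp
  then have "finite (pt ` ?G)" by (rule finite_imageI)
  from ex_bij_betw_nat_finite[OF this] obtain L where "bij_betw L {0..<(num_eig TYPE('n) d)} (pt ` ?G)"
    by (auto simp: num_eig_def)
  then have L: "inj_on L {..<num_eig TYPE('n) d}" "L ` {..<num_eig TYPE('n) d} = pt ` ?G" by (auto simp: bij_betw_def atLeast0LessThan)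
  have "\<forall>k\<in>{..<num_eig TYPE('n) d}. \<exists>r. r \<in> ?G \<and> L k = pt r" using L(2) by blast
  from bchoice[OF this] obtain r where "\<forall>k\<in>{..<num_eig TYPE('n) d}. r k \<in> ?G \<and> L k = pt (r k)" ..
  then have r: "\<And>k. k < num_eig TYPE('n) d \<Longrightarrow> r k \<in> ?G" "\<And>k. k < num_eig TYPE('n) d \<Longrightarrow> L k = pt (r k)" by auto
  define \<Psi> where "\<Psi> = (\<lambda>\<phi> (k, i). if k < num_eig TYPE('n) d then sol \<phi> (r k) $ i else 0)"
  have vec: "(\<chi> i. \<Psi> \<phi> (k, i)) = sol \<phi> (r k)" "(\<lambda>i. \<Psi> \<phi> (k, i)) = ($) (sol \<phi> (r k))" if "k < num_eig TYPE('n) d" for \<phi> k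
    using that by (auto simp: \<Psi>_def vec_eq_iff)
  show thesis
  proof (rule that[of \<Psi>])
    fix \<phi> assume near: "near \<phi>"
    have nz: "sol \<phi> (r k) \<noteq> 0" if "k < num_eig TYPE('n) d" for k using sol_nonzero[OF near] r(1)[OF that] by simp
    show "eig_tuple d (num_eig TYPE('n) d) \<phi> (\<Psi> \<phi>)"
      unfolding eig_tuple_def
    proof (intro ballI conjI)
      fix k assume "k \<in> {..<num_eig TYPE('n) d}"
      then have k: "k < num_eig TYPE('n) d" by simp
      show "\<exists>i\<in>UNIV. \<Psi> \<phi> (k, i) \<noteq> 0" using nz[OF k] k by (auto simp: \<Psi>_def vec_eq_iff)
      show "eigc d \<phi> (\<lambda>j. \<Psi> \<phi> (k, j))" unfolding vec(2)[OF k] using eigc_sol[OF near] r(1)[OF k] by simp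
      fix l assume "l \<in> {..<k}"
      then have l: "l < k" "l < num_eig TYPE('n) d" using k by auto
      have "L k \<noteq> L l" using inj_onD[OF L(1), of k l] k l by auto
      then have "pt (sol \<phi> (r k)) \<noteq> pt (sol \<phi> (r l))"
        using pt_sol_eq_iff[OF near r(1)[OF k] r(1)[OF l(2)]] r(2) k l(2) by simp
      then show "\<exists>i\<in>UNIV. \<exists>j\<in>UNIV. \<Psi> \<phi> (k, i) * \<Psi> \<phi> (l, j) \<noteq> \<Psi> \<phi> (k, j) * \<Psi> \<phi> (l, i)"
        using parallel_iff[OF nz[OF k] nz[OF l(2)]] k l(2) by (simp add: \<Psi>_def)
    qed
  next
    fix \<phi> \<phi>' :: "('n \<Rightarrow>\<^sub>0 nat) \<Rightarrow> complex" and \<kappa> :: real and v :: "nat \<times> 'n"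
    assume near: "near \<phi>" "near \<phi>'" and \<kappa>: "\<And>a. a \<in> Mon d \<Longrightarrow> norm (\<phi>' a - \<phi> a) \<le> \<kappa>" "0 \<le> \<kappa>"
    obtain k i where v: "v = (k, i)" by (cases v)
    show "norm (\<Psi> \<phi>' v - \<Psi> \<phi> v) \<le> 2 * (real CARD('n) * (\<kappa> * C))"
    proof (cases "k < num_eig TYPE('n) d")
      case True
      have "norm (\<Psi> \<phi>' v - \<Psi> \<phi> v) \<le> dist (sol \<phi>' (r k)) (sol \<phi> (r k))"
        using True Finite_Cartesian_Product.norm_nth_le[of "sol \<phi>' (r k) - sol \<phi> (r k)" i] by (simp add: v \<Psi>_def dist_norm)
      also have "\<dots> \<le> 2 * (real CARD('n) * (\<kappa> * C))"
        using sol_lipschitz[OF near _ \<kappa>(1), of "r k"] r(1)[OF True] by simp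
      finally show ?thesis .
    next
      case False
      then show ?thesis using \<kappa>(2) C by (simp add: v \<Psi>_def)
    qed
  qed
qed

lemma eig_tuple_near:
  assumes "near \<phi>" obtains \<psi> where "eig_tuple d (num_eig TYPE('n) d) \<phi> \<psi>"
proof -
  obtain \<Psi> where "\<And>\<phi>. near \<phi> \<Longrightarrow> eig_tuple d (num_eig TYPE('n) d) \<phi> (\<Psi> \<phi>)" by (rule continuous_eig_tuple) blast
  then show thesis using assms that by blast
qed

text \<open>A function G that separates the eigenpoints of \<open>\<phi>1\<close> from A stays
  nonzero near \<open>\<phi>1\<close> by continuity. That some ordering and scaling of the
  eigenpoints makes G nonzero is constructible in the form, so it holds generically on the
  family.\<close>

lemma generic_avoid:
  assumes B: "finite B" and A: "closedin (zariski_sym_power_PV (num_eig TYPE('n) d)) A" and \<phi>1: "\<phi>1 \<in> slice B" "points \<phi>1 \<notin> A"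
  shows "\<exists>F \<eta>. polyfun F \<and> (\<forall>a. a \<notin> B \<longrightarrow> \<eta> a = fermat d a) \<and> F \<eta> \<noteq> 0 \<and>
    (\<forall>\<phi>\<in>slice B. F \<phi> \<noteq> 0 \<longrightarrow> points \<phi> \<notin> A)"
proof -
  obtain \<Psi> where \<Psi>: "\<And>\<phi>. near \<phi> \<Longrightarrow> eig_tuple d (num_eig TYPE('n) d) \<phi> (\<Psi> \<phi>)"
    "\<And>\<phi> \<phi>' \<kappa> v. near \<phi> \<Longrightarrow> near \<phi>' \<Longrightarrow> (\<And>a. a \<in> Mon d \<Longrightarrow> norm (\<phi>' a - \<phi> a) \<le> \<kappa>) \<Longrightarrow> 0 \<le> \<kappa> \<Longrightarrow>
       norm (\<Psi> \<phi>' v - \<Psi> \<phi> v) \<le> 2 * (real CARD('n) * (\<kappa> * C))"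
    by (rule continuous_eig_tuple) blast
  note near1 = slice_near[OF \<phi>1(1)]
  note \<Psi>1 = eig_tuple_mset[OF exactly_near[OF near1] \<Psi>(1)[OF near1]]
  obtain D G where G: "supp_below (num_eig TYPE('n) d) D" "mhom D G" "G (\<Psi> \<phi>1) \<noteq> 0"
    "\<And>\<eta>. nz (num_eig TYPE('n) d) \<eta> \<Longrightarrow> mset (tuple (num_eig TYPE('n) d) \<eta>) \<in> A \<Longrightarrow> G \<eta> = 0"
    by (rule closed_sym_power_separate[OF A \<Psi>1(1)]) (use \<phi>1(2) \<Psi>1(2) in auto)
  define P where "P = (\<lambda>\<phi>. \<exists>\<psi>. eig_tuple d (num_eig TYPE('n) d) \<phi> \<psi> \<and> G \<psi> \<noteq> 0)"
  have "constructible (\<lambda>\<Phi> :: ('n \<Rightarrow>\<^sub>0 nat) + (nat \<times> 'n) \<Rightarrow> complex.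
      eig_tuple d (num_eig TYPE('n) d) (\<lambda>a. \<Phi> (Inl a)) (\<lambda>v. \<Phi> (Inr v)) \<and> G (\<lambda>v. \<Phi> (Inr v)) \<noteq> 0)"
    by (intro constructible_conj constructible_eig_tuple constructible_neq0 polyfun_var
        polyfun_subst[OF mhom_polyfun[OF G(2)]])
  from constructible_ex[OF this] have conP: "constructible P" by (simp add: P_def)
  have "\<exists>\<epsilon>>0. \<forall>\<phi>. (\<forall>a\<in>B. norm (\<phi> a - \<phi>1 a) < \<epsilon>) \<longrightarrow> (\<forall>a. a \<notin> B \<longrightarrow> \<phi> a = \<phi>1 a) \<longrightarrow> P \<phi>"
  proof (rule ccontr)
    assume no: "\<not> ?thesis"
    \<comment> \<open>Small enough for the box of this size around \<open>\<phi>1\<close> to stay in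
      the slice, where \<open>\<Psi>\<close> gives the eigenpoints.\<close>
    define \<epsilon> where "\<epsilon> = Min (insert 1 ((\<lambda>a. \<delta> - norm (\<phi>1 a - fermat d a)) ` B))"
    have \<epsilon>: "\<epsilon> > 0" "\<And>a. a \<in> B \<Longrightarrow> \<epsilon> \<le> \<delta> - norm (\<phi>1 a - fermat d a)"
      unfolding \<epsilon>_def using B \<phi>1(1) by (auto simp: slice_def)
    have "\<forall>n :: nat. \<exists>\<phi>. (\<forall>a\<in>B. norm (\<phi> a - \<phi>1 a) < \<epsilon> / real (Suc n)) \<and> (\<forall>a. a \<notin> B \<longrightarrow> \<phi> a = \<phi>1 a) \<and> \<not> P \<phi>"
    proof
      fix n :: nat
      have "\<epsilon> / real (Suc n) > 0" using \<epsilon>(1) by simp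
      then show "\<exists>\<phi>. (\<forall>a\<in>B. norm (\<phi> a - \<phi>1 a) < \<epsilon> / real (Suc n)) \<and> (\<forall>a. a \<notin> B \<longrightarrow> \<phi> a = \<phi>1 a) \<and> \<not> P \<phi>"
        using no by blast
    qed
    from choice[OF this] obtain \<phi> where "\<forall>n. (\<forall>a\<in>B. norm (\<phi> n a - \<phi>1 a) < \<epsilon> / real (Suc n)) \<and>
      (\<forall>a. a \<notin> B \<longrightarrow> \<phi> n a = \<phi>1 a) \<and> \<not> P (\<phi> n)" ..
    then have \<phi>: "\<And>n a. a \<in> B \<Longrightarrow> norm (\<phi> n a - \<phi>1 a) < \<epsilon> / real (Suc n)" "\<And>n a. a \<notin> B \<Longrightarrow> \<phi> n a = \<phi>1 a"
      "\<And>n. \<not> P (\<phi> n)" by blast+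
    have close: "norm (\<phi> n a - \<phi>1 a) \<le> \<epsilon> / real (Suc n)" for n a
      using \<phi>(1)[of a n] \<phi>(2)[of a n] \<epsilon>(1) by (cases "a \<in> B") (simp_all add: less_imp_le)
    have near: "near (\<phi> n)" for n
    proof (rule slice_near[of _ B], unfold slice_def, intro CollectI conjI ballI allI impI)
      show "\<phi> n a = fermat d a" if "a \<notin> B" for a using \<phi>(2)[OF that] \<phi>1(1) that by (simp add: slice_def)
      fix a assume a: "a \<in> B"
      have "\<epsilon> / real (Suc n) \<le> \<epsilon> / 1" using \<epsilon>(1) by (intro divide_left_mono) auto
      then have "norm (\<phi> n a - \<phi>1 a) < \<epsilon>" using \<phi>(1)[OF a, of n] by simp
      then show "norm (\<phi> n a - fermat d a) < \<delta>"
        using \<epsilon>(2)[OF a] norm_triangle_ineq[of "\<phi> n a - \<phi>1 a" "\<phi>1 a - fermat d a"] by simp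
    qed
    have lim: "((\<lambda>n. \<Psi> (\<phi> n) v) \<longlongrightarrow> \<Psi> \<phi>1 v) sequentially" for v
    proof (rule LIM_zero_cancel)
      have "(\<lambda>n. \<epsilon> / real (Suc n)) \<longlonglongrightarrow> 0"
        by (rule LIMSEQ_Suc[OF lim_const_over_n])
      then have lim: "(\<lambda>n. 2 * (real CARD('n) * (\<epsilon> / real (Suc n) * C))) \<longlonglongrightarrow> 0"
        by (intro tendsto_mult_right_zero tendsto_mult_left_zero)
      show "(\<lambda>n. \<Psi> (\<phi> n) v - \<Psi> \<phi>1 v) \<longlonglongrightarrow> 0"
        by (rule Lim_null_comparison[OF always_eventually lim]) (intro allI \<Psi>(2)[OF near1 near] close, use \<epsilon>(1) in simp)
    qed
    have "(\<lambda>n. G (\<Psi> (\<phi> n))) \<longlonglongrightarrow> G (\<Psi> \<phi>1)" by (rule polyfun_tendsto[OF mhom_polyfun[OF G(2)] lim])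
    moreover have "G (\<Psi> (\<phi> n)) = 0" for n using \<phi>(3)[of n] \<Psi>(1)[OF near[of n]] unfolding P_def by blast
    ultimately show False using G(3) LIMSEQ_unique[OF tendsto_const] by fastforce
  qed
  then obtain \<epsilon> where \<epsilon>: "\<epsilon> > 0" "\<And>\<phi>. (\<And>a. a \<in> B \<Longrightarrow> norm (\<phi> a - \<phi>1 a) < \<epsilon>) \<Longrightarrow> (\<And>a. a \<notin> B \<Longrightarrow> \<phi> a = \<phi>1 a) \<Longrightarrow> P \<phi>"
    by blast
  obtain F \<eta> where F: "polyfun F" "\<forall>a. a \<notin> B \<longrightarrow> \<eta> a = \<phi>1 a" "F \<eta> \<noteq> 0"
    "\<forall>\<phi>. (\<forall>a. a \<notin> B \<longrightarrow> \<phi> a = \<phi>1 a) \<longrightarrow> F \<phi> \<noteq> 0 \<longrightarrow> P \<phi>"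
    using constructible_box_generic[OF conP B \<epsilon>] by blast
  have off: "\<phi>1 a = fermat d a" if "a \<notin> B" for a using that \<phi>1(1) by (simp add: slice_def)
  show ?thesis
  proof (intro exI[of _ F] exI[of _ \<eta>] conjI allI impI ballI F(1))
    show "\<eta> a = fermat d a" if "a \<notin> B" for a using F(2) off that by simp
    show "F \<eta> \<noteq> 0" by (rule F(3))
    fix \<phi> assume \<phi>: "\<phi> \<in> slice B" "F \<phi> \<noteq> 0"
    then have "\<forall>a. a \<notin> B \<longrightarrow> \<phi> a = \<phi>1 a" using off by (simp add: slice_def)
    then have "P \<phi>" using F(4) \<phi>(2) by blast
    then obtain \<psi> where \<psi>: "eig_tuple d (num_eig TYPE('n) d) \<phi> \<psi>" "G \<psi> \<noteq> 0" unfolding P_def by blast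
    from eig_tuple_mset[OF exactly_near[OF slice_near[OF \<phi>(1)]] \<psi>(1)] show "points \<phi> \<notin> A"
      using G(4)[of \<psi>] \<psi>(2) by auto
  qed
qed

text \<open>On the line from the Fermat form to \<eta> the polynomial has finitely many zeros, while
  the slice contains all small real parameters.\<close>

lemma slice_nonvanishing:
  assumes B: "finite B" and p: "polyfun p" "p \<eta> \<noteq> 0" and \<eta>: "\<And>a. a \<notin> B \<Longrightarrow> \<eta> a = fermat d a"
  obtains \<phi> where "\<phi> \<in> slice B" "p \<phi> \<noteq> 0"
proof -
  define K where "K = 1 + (\<Sum>a\<in>B. norm (\<eta> a - fermat d a))"
  have K: "K > 0" "\<And>a. a \<in> B \<Longrightarrow> norm (\<eta> a - fermat d a) < K"
  proof -
    have nn: "(\<Sum>a\<in>B. norm (\<eta> a - fermat d a)) \<ge> 0" by (intro sum_nonneg) simp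
    then show "K > 0" by (simp add: K_def)
    fix a assume "a \<in> B"
    then have "norm (\<eta> a - fermat d a) \<le> (\<Sum>a\<in>B. norm (\<eta> a - fermat d a))" using B by (intro member_le_sum) auto
    then show "norm (\<eta> a - fermat d a) < K" by (simp add: K_def)
  qed
  let ?line = "\<lambda>t :: complex. \<lambda>a. fermat d a + t * (\<eta> a - fermat d a)"
  have "finite {t. p (?line t) = 0}" by (rule polyfun_line_finite[of p _ 1]) (use p in auto)
  moreover have "infinite (complex_of_real ` {0<..<\<delta> / K})"
  proof (subst finite_image_iff)
    show "inj_on complex_of_real {0<..<\<delta> / K}" by (auto intro: inj_onI)
    show "infinite {0<..<\<delta> / K}" using delta K(1) by (intro infinite_Ioo) simp
  qed
  ultimately obtain t where t: "t \<in> complex_of_real ` {0<..<\<delta> / K}" "p (?line t) \<noteq> 0"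
    by (metis (mono_tags, lifting) finite_subset mem_Collect_eq subsetI)
  then obtain s where s: "0 < s" "s < \<delta> / K" "t = complex_of_real s" by auto
  have "?line t \<in> slice B"
    unfolding slice_def
  proof (intro CollectI conjI allI impI ballI)
    show "?line t a = fermat d a" if "a \<notin> B" for a using \<eta>[OF that] by simp
    fix a assume a: "a \<in> B"
    have "norm (t * (\<eta> a - fermat d a)) = s * norm (\<eta> a - fermat d a)" using s by (simp add: norm_mult)
    also have "\<dots> \<le> s * K" using K(2)[OF a] s by (intro mult_left_mono) auto
    also have "\<dots> < \<delta>" using s(2) K(1) by (simp add: field_simps)
    finally show "norm (?line t a - fermat d a) < \<delta>" by simp
  qed
  then show thesis using t(2) by (rule that)
qed

text \<open>Avoiding a closed set that does not contain the image is a generic condition on the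
  slice. Two such conditions have a common solution, so two proper closed subsets cannot cover the
  closure.\<close>

lemma slice_closure_irreducible:
  assumes B: "finite B" and X: "points ` slice B \<subseteq> X" and topX: "X \<subseteq> sym_power_PV (num_eig TYPE('n) d)"
  shows "irreducible_closedin (subtopology (zariski_sym_power_PV (num_eig TYPE('n) d)) X)
    (subtopology (zariski_sym_power_PV (num_eig TYPE('n) d)) X closure_of points ` slice B)"
proof -
  let ?T = "subtopology (zariski_sym_power_PV (num_eig TYPE('n) d)) X"
  let ?Z = "?T closure_of points ` slice B"
  have sub: "points ` slice B \<subseteq> ?Z"
    using X topX by (intro closure_of_subset) (auto simp: topspace_zariski_sym_power)
  show ?thesis
    unfolding irreducible_closedin_def
  proof (intro conjI allI impI)
    show "closedin ?T ?Z" by simp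
    show "?Z \<noteq> {}" using sub fermat_slice by blast
    fix A1 A2 assume A: "closedin ?T A1 \<and> closedin ?T A2 \<and> ?Z \<subseteq> A1 \<union> A2"
    have avoid: "\<exists>F \<eta>. polyfun F \<and> (\<forall>a. a \<notin> B \<longrightarrow> \<eta> a = fermat d a) \<and> F \<eta> \<noteq> 0 \<and>
        (\<forall>\<phi>\<in>slice B. F \<phi> \<noteq> 0 \<longrightarrow> points \<phi> \<notin> A')" if A': "closedin ?T A'" "\<not> ?Z \<subseteq> A'" for A'
    proof -
      have "\<not> points ` slice B \<subseteq> A'" using closure_of_minimal[OF _ A'(1)] A'(2) by blast
      then obtain \<phi>1 where \<phi>1: "\<phi>1 \<in> slice B" "points \<phi>1 \<notin> A'" by blast
      obtain A'' where A'': "closedin (zariski_sym_power_PV (num_eig TYPE('n) d)) A''" "A' = A'' \<inter> X"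
        using A'(1) by (auto simp: closedin_subtopology)
      have "points \<phi>1 \<notin> A''" using \<phi>1 A''(2) X by blast
      show ?thesis using generic_avoid[OF B A''(1) \<phi>1(1) \<open>points \<phi>1 \<notin> A''\<close>] A''(2) by (elim exE conjE) blast
    qed
    show "?Z \<subseteq> A1 \<or> ?Z \<subseteq> A2"
    proof (rule ccontr)
      assume "\<not> ?thesis"
      then have "\<not> ?Z \<subseteq> A1" "\<not> ?Z \<subseteq> A2" by auto
      obtain F1 \<eta>1 where F1: "polyfun F1" "\<forall>a. a \<notin> B \<longrightarrow> \<eta>1 a = fermat d a" "F1 \<eta>1 \<noteq> 0"
        "\<forall>\<phi>\<in>slice B. F1 \<phi> \<noteq> 0 \<longrightarrow> points \<phi> \<notin> A1"
        using avoid[OF conjunct1[OF A] \<open>\<not> ?Z \<subseteq> A1\<close>] by (elim exE conjE)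
      obtain F2 \<eta>2 where F2: "polyfun F2" "\<forall>a. a \<notin> B \<longrightarrow> \<eta>2 a = fermat d a" "F2 \<eta>2 \<noteq> 0"
        "\<forall>\<phi>\<in>slice B. F2 \<phi> \<noteq> 0 \<longrightarrow> points \<phi> \<notin> A2"
        using avoid[OF conjunct1[OF conjunct2[OF A]] \<open>\<not> ?Z \<subseteq> A2\<close>] by (elim exE conjE)
      obtain t where t: "F1 (\<lambda>v. \<eta>1 v + t * (\<eta>2 v - \<eta>1 v)) \<noteq> 0" "F2 (\<lambda>v. \<eta>1 v + t * (\<eta>2 v - \<eta>1 v)) \<noteq> 0"
        using polyfun_mult_nonzero[of F1 F2 \<eta>1 \<eta>2, OF F1(1) F2(1) F1(3) F2(3)] by (elim exE conjE)
      have "polyfun (\<lambda>\<phi>. F1 \<phi> * F2 \<phi>)" by (intro polyfun_mult F1(1) F2(1))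
      moreover have "F1 (\<lambda>v. \<eta>1 v + t * (\<eta>2 v - \<eta>1 v)) * F2 (\<lambda>v. \<eta>1 v + t * (\<eta>2 v - \<eta>1 v)) \<noteq> 0"
        using t by simp
      moreover have "\<eta>1 a + t * (\<eta>2 a - \<eta>1 a) = fermat d a" if "a \<notin> B" for a
        using F1(2) F2(2) that by simp
      ultimately obtain \<phi> where \<phi>: "\<phi> \<in> slice B" "F1 \<phi> * F2 \<phi> \<noteq> 0"
        by (rule slice_nonvanishing[OF B])
      then have "points \<phi> \<in> ?Z" using sub by blast
      moreover have "points \<phi> \<notin> A1" "points \<phi> \<notin> A2" using F1(4) F2(4) \<phi> by auto
      ultimately show False using A by blast
    qed
  qed
qed

text \<open>The form g with the extra monomial b escapes the closed condition defined by B: a member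
  of the family sharing its eigenpoints is w g + w' q^(d/2), absence of the mixed monomial removes
  the second term, and comparison at b gives w = 0.\<close>

lemma slice_closed_separate:
  fixes B :: "('n \<Rightarrow>\<^sub>0 nat) set"
  assumes B: "finite B" "B \<subseteq> Mon d" and b: "b \<in> Mon d" "b \<notin> B"
    and O: "Poly_Mapping.single k d \<notin> insert b B"
    and S: "even d \<Longrightarrow> k \<noteq> l \<and> mixed_mon d k l \<notin> insert b B"
  obtains A g where "closedin (zariski_sym_power_PV (num_eig TYPE('n) d)) A" "points ` slice B \<subseteq> A" "g \<in> slice (insert b B)" "points g \<notin> A"
proof -
  let ?O = "Poly_Mapping.single k d :: 'n \<Rightarrow>\<^sub>0 nat"
  \<comment> \<open>The index x_k^d stands for the whole Fermat form; this is possible as that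
    monomial is not in B.\<close>
  define u where "u = (\<lambda>a a'. if a = ?O then fermat d a' else if a' = a then 1 else 0 :: complex)"
  define J where "J = insert ?O B"
  have finJ: "finite J" using B by (simp add: J_def)
  have comb: "(\<Sum>a\<in>J. c a * u a a') = c ?O * fermat d a' + (if a' \<in> B then c a' else 0)" for c a'
  proof -
    have "(\<Sum>a\<in>B. c a * u a a') = (\<Sum>a\<in>B. if a' = a then c a else 0)"
      using O by (intro sum.cong) (auto simp: u_def)
    also have "\<dots> = (if a' \<in> B then c a' else 0)" using B(1) by (simp add: sum.delta')
    finally show ?thesis using O B(1) by (simp add: J_def u_def)
  qed
  define g where "g = (\<lambda>a. fermat d a + (if a = b then of_real (\<delta> / 2) else 0))"
  have g: "g \<in> slice (insert b B)" using delta by (auto simp: slice_def g_def)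
  note near = slice_near[OF g]
  obtain \<psi>0 where \<psi>0: "eig_tuple d (num_eig TYPE('n) d) g \<psi>0" by (rule eig_tuple_near[OF near])
  note \<psi>0' = eig_tuple_mset[OF exactly_near[OF near] \<psi>0]
  define e where "e = (\<lambda>(k, i, j) a (\<psi> :: nat \<times> 'n \<Rightarrow> complex). minor d (u a) i j (\<lambda>m. \<psi> (k, m)))"
  let ?R = "{..<num_eig TYPE('n) d} \<times> (UNIV :: 'n set) \<times> (UNIV :: 'n set)"
  have esum: "(\<Sum>a\<in>J. c a * e (k, i, j) a \<psi>) = minor d (\<lambda>a'. \<Sum>a\<in>J. c a * u a a') i j (\<lambda>m. \<psi> (k, m))" for c k i j \<psi>
    unfolding minor_sum[OF finJ] by (simp add: e_def)
  have "\<exists>E p. supp_below (num_eig TYPE('n) d) E \<and> mhom E p \<and> p \<psi>0 \<noteq> 0 \<and>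
    (\<forall>\<psi> c. (\<forall>r\<in>?R. (\<Sum>j\<in>J. c j * e r j \<psi>) = 0) \<longrightarrow> (\<exists>j\<in>J. c j \<noteq> 0) \<longrightarrow> p \<psi> = 0)"
  proof (rule elimination[OF finJ, of _ _ "\<lambda>r l. if l = fst r then d else 0"])
    show "supp_below (num_eig TYPE('n) d) (\<lambda>l. if l = fst r then d else 0)" if "r \<in> ?R" for r
      using that by (auto simp: supp_below_def)
    show "mhom (\<lambda>l. if l = fst r then d else 0) (e r j)" for r j
      using mhom_minor by (cases r) (simp add: e_def)
    fix c assume c: "\<And>r. r \<in> ?R \<Longrightarrow> (\<Sum>j\<in>J. c j * e r j \<psi>0) = 0"
    define \<gamma> where "\<gamma> = (\<lambda>a'. \<Sum>a\<in>J. c a * u a a')"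
    have \<gamma>: "\<gamma> a' = c ?O * fermat d a' + (if a' \<in> B then c a' else 0)" for a' unfolding \<gamma>_def by (rule comb)
    have eig\<gamma>: "eigc d \<gamma> (\<lambda>m. \<psi>0 (k, m))" if "k < num_eig TYPE('n) d" for k
      unfolding eigc_minor
    proof (intro allI)
      fix i j
      show "minor d \<gamma> i j (\<lambda>m. \<psi>0 (k, m)) = 0" using c[of "(k, i, j)"] that unfolding esum \<gamma>_def[symmetric] by simp
    qed
    have "eig_lines d g \<subseteq> eig_lines d \<gamma>"
    proof
      fix L assume "L \<in> eig_lines d g"
      then have "L \<in># mset (tuple (num_eig TYPE('n) d) \<psi>0)" using exactly_near[OF near] by (simp add: \<psi>0'(2) exactly_def)
      then obtain k where k: "k < num_eig TYPE('n) d" "L = pt (\<chi> i. \<psi>0 (k, i))" by (auto simp: tuple_def)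
      have nz: "(\<chi> i. \<psi>0 (k, i)) \<noteq> 0" by (rule eig_tuple_lines(1)[OF \<psi>0 k(1)])
      show "L \<in> eig_lines d \<gamma>" unfolding k(2) pt_in_eig_lines[OF nz] using eig\<gamma>[OF k(1)] by (simp add: vec_lambda_inverse)
    qed
    then have "\<forall>x. eigc d g x \<longrightarrow> eigc d \<gamma> x" using eig_lines_subset_imp by blast
    from determined_near[OF near, unfolded determined_def, rule_format, of \<gamma>, OF this[rule_format]]
    obtain w :: "bool \<Rightarrow> complex" where w: "\<And>a. a \<in> Mon d \<Longrightarrow> \<gamma> a = w True * g a + w False * qcoeff d a" by blast
    have w2: "w False * qcoeff d a = 0" for a
    proof (cases "even d")
      case True
      let ?S = "mixed_mon d k l"
      have "\<gamma> ?S = 0" "g ?S = 0" using S[OF True] fermat_mixed[OF d, of k l] by (auto simp: \<gamma> g_def)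
      then show ?thesis using w[OF mixed_mon_in_Mon[OF d, of k l]] qcoeff_mixed_nonzero[OF True d, of k l] S[OF True] by simp
    qed (simp add: qcoeff_def)
    have OM: "?O \<in> Mon d" by (simp add: Mon_def lookup_single when_def)
    have "\<gamma> ?O = c ?O" "g ?O = 1" using O by (auto simp: \<gamma> g_def fermat_single)
    then have cO: "c ?O = w True" using w[OF OM] w2[of ?O] by simp
    have "\<gamma> b = c ?O * fermat d b" "g b = fermat d b + of_real (\<delta> / 2)" using b by (simp_all add: \<gamma> g_def)
    then have "w True * of_real (\<delta> / 2) = 0" using w[OF b(1)] w2[of b] cO by (simp add: algebra_simps)
    then have "w True = 0" using delta by simp
    then have "\<gamma> a = 0" if "a \<in> Mon d" for a using w[OF that] w2 by simp
    then show "\<forall>j\<in>J. c j = 0" using cO \<open>w True = 0\<close> \<gamma> B(2) by (fastforce simp: J_def)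
  qed
  then obtain E p where p: "supp_below (num_eig TYPE('n) d) E" "mhom E p" "p \<psi>0 \<noteq> 0"
    "\<And>\<psi> c. (\<forall>r\<in>?R. (\<Sum>j\<in>J. c j * e r j \<psi>) = 0) \<Longrightarrow> (\<exists>j\<in>J. c j \<noteq> 0) \<Longrightarrow> p \<psi> = 0" by blast
  let ?A = "{z \<in> sym_power_PV (num_eig TYPE('n) d). vanishes (num_eig TYPE('n) d) p z}"
  show thesis
  proof (rule that[OF closedin_vanishes[OF p(2,1)] _ g])
    show "points g \<notin> ?A" using \<psi>0' p(3) by (auto simp: vanishes_def)
    show "points ` slice B \<subseteq> ?A"
    proof (rule image_subsetI)
      fix f assume f: "f \<in> slice B"
      note nearf = slice_near[OF f]
      obtain \<psi>f where \<psi>f: "eig_tuple d (num_eig TYPE('n) d) f \<psi>f" by (rule eig_tuple_near[OF nearf])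
      have sp: "points f \<in> sym_power_PV (num_eig TYPE('n) d)"
        using eig_tuple_mset[OF exactly_near[OF nearf] \<psi>f] sym_power_PV_iff by metis
      have "p \<psi> = 0" if \<psi>: "nz (num_eig TYPE('n) d) \<psi>" "mset (tuple (num_eig TYPE('n) d) \<psi>) = points f" for \<psi>
      \<comment> \<open>The coordinates of f in the family: 1 at the Fermat form, the deviations
        from it at the monomials of B.\<close>
      proof (rule p(4)[of "\<lambda>a. if a = ?O then 1 else f a - fermat d a"])
        let ?c = "\<lambda>a. if a = ?O then 1 else f a - fermat d a"
        have "?c ?O \<noteq> 0" by simp
        then show "\<exists>j\<in>J. ?c j \<noteq> 0" unfolding J_def by blast
        have fc: "(\<lambda>a'. \<Sum>a\<in>J. ?c a * u a a') = f"
          unfolding comb using f O by (intro HOL.ext) (auto simp: slice_def)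
        show "\<forall>r\<in>?R. (\<Sum>j\<in>J. ?c j * e r j \<psi>) = 0"
        proof
          fix r assume "r \<in> ?R"
          then obtain k i j where r: "r = (k, i, j)" "k < num_eig TYPE('n) d" by auto
          have nz: "(\<chi> i. \<psi> (k, i)) \<noteq> 0" using \<psi>(1) r(2) by (auto simp: nz_def vec_eq_iff)
          have "pt (\<chi> i. \<psi> (k, i)) \<in> set (tuple (num_eig TYPE('n) d) \<psi>)" using r(2) by (auto simp: tuple_def)
          then have "pt (\<chi> i. \<psi> (k, i)) \<in># points f" using \<psi>(2) by (metis set_mset_mset)
          then have "pt (\<chi> i. \<psi> (k, i)) \<in> eig_lines d f"
            using exactly_near[OF nearf] by (simp add: exactly_def)
          then have "eigc d f (\<lambda>m. \<psi> (k, m))" unfolding pt_in_eig_lines[OF nz] by (simp add: vec_lambda_inverse)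
          then show "(\<Sum>j\<in>J. ?c j * e r j \<psi>) = 0" unfolding r(1) esum fc by (simp add: eigc_minor)
        qed
      qed
      then show "points f \<in> ?A" using sp by (simp add: vanishes_def)
    qed
  qed
qed

lemma krull_dim_lower:
  fixes B :: "('n \<Rightarrow>\<^sub>0 nat) set"
  assumes B: "finite B" "B \<subseteq> Mon d" and O: "Poly_Mapping.single k d \<notin> B"
    and S: "even d \<Longrightarrow> k \<noteq> l \<and> mixed_mon d k l \<notin> B"
    and X: "points ` slice B \<subseteq> X" and topX: "X \<subseteq> sym_power_PV (num_eig TYPE('n) d)"
  shows "enat (card B) \<le> krull_dim (subtopology (zariski_sym_power_PV (num_eig TYPE('n) d)) X)"
proof -
  let ?T = "subtopology (zariski_sym_power_PV (num_eig TYPE('n) d)) X"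
  obtain bs where bs: "set bs = B" "distinct bs" using finite_distinct_list[OF B(1)] by blast
  have len: "length bs = card B" using distinct_card[OF bs(2)] bs(1) by simp
  \<comment> \<open>Index 0 belongs to the Fermat form alone, so that card B + 1 sets occur.\<close>
  define Z where "Z = (\<lambda>i. ?T closure_of points ` slice (set (take i bs)))"
  have take: "set (take i bs) \<subseteq> B" for i using set_take_subset[of i bs] bs(1) by simp
  have sub: "points ` slice (set (take i bs)) \<subseteq> X" for i using slice_mono[OF take] X by blast
  have irr: "irreducible_closedin ?T (Z i)" for i
    unfolding Z_def by (rule slice_closure_irreducible[OF _ sub topX]) simp
  have strict: "Z i \<subset> Z (Suc i)" if i: "i < card B" for i
  proof -
    let ?b = "bs ! i"
    have Suc: "set (take (Suc i) bs) = insert ?b (set (take i bs))"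
      using i len by (simp add: take_Suc_conv_app_nth)
    have bB: "?b \<in> B" using i len bs(1) nth_mem[of i bs] by simp
    have "?b \<notin> set (take i bs)"
      using bs(2) i len by (auto simp: in_set_conv_nth nth_eq_iff_index_eq)
    note b = this
    have M: "set (take i bs) \<subseteq> Mon d" "?b \<in> Mon d" using take[of i] B(2) bB by auto
    have O': "Poly_Mapping.single k d \<notin> insert ?b (set (take i bs))" using O take[of i] bB by auto
    have S': "k \<noteq> l \<and> mixed_mon d k l \<notin> insert ?b (set (take i bs))" if "even d"
      using S[OF that] take[of i] bB by auto
    obtain A g where A: "closedin (zariski_sym_power_PV (num_eig TYPE('n) d)) A" "points ` slice (set (take i bs)) \<subseteq> A"
      "g \<in> slice (insert ?b (set (take i bs)))" "points g \<notin> A"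
      by (rule slice_closed_separate[OF _ M b O' S']) simp_all
    have "Z i \<subseteq> A \<inter> X"
      unfolding Z_def using A(1,2) sub by (intro closure_of_minimal) (auto simp: closedin_subtopology)
    moreover have "points g \<in> Z (Suc i)"
      unfolding Z_def
    proof (rule subsetD[OF closure_of_subset])
      show "points ` slice (set (take (Suc i) bs)) \<subseteq> topspace ?T"
        using sub topX by (simp add: topspace_zariski_sym_power) blast
      show "points g \<in> points ` slice (set (take (Suc i) bs))" using A(3) Suc by simp
    qed
    moreover have "Z i \<subseteq> Z (Suc i)"
      unfolding Z_def Suc by (intro closure_of_mono image_mono slice_mono) auto
    ultimately show ?thesis using A(4) by blast
  qed
  show ?thesis
    unfolding krull_dim_def
    by (rule Sup_upper) (use irr strict in blast)
qed

end

section \<open>The image of \<open>tau\<close>\<close>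

lemma tau_dom_exactly:
  assumes "d \<ge> 3" "CARD('n::finite) \<ge> 2" "z \<in> tau ` (tau_dom d :: 'n cpoly set set)"
  obtains f where "f \<in> Sym d" "exactly d (num_eig TYPE('n) d) (Poly_Mapping.lookup f)"
    "z = mset_set (eig_lines d (Poly_Mapping.lookup f))"
proof -
  obtain P where P: "P \<in> (tau_dom d :: 'n cpoly set set)" "z = tau P" using assms(3) by blast
  then obtain f where f: "P = form_pt f" "f \<in> Sym d" "f \<noteq> 0" "exactly d (num_eig TYPE('n) d) (Poly_Mapping.lookup f)"
    using tau_dom_iff[OF assms(1,2), of P] by blast
  have "z = mset_set (eig_lines d (Poly_Mapping.lookup f))"
    unfolding P(2) f(1) tau_form_pt[OF f(3)] Eig_eig_lines[OF f(2)] by simp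
  with f(2,4) show thesis by (rule that)
qed

lemma eig_lines_add_qcoeff:
  assumes "d > 0" shows "eig_lines d (\<lambda>a. \<phi> a + c * qcoeff d a) = eig_lines d \<phi>"
  unfolding eig_lines_def eigc_minor minor_lin minor_qcoeff[OF assms] by simp

text \<open>For even \<open>d\<close>, subtracting a multiple of \<open>q\<^bsup>d/2\<^esup>\<close> removes the monomial \<open>x\<^sub>k\<^bsup>d-2\<^esup>x\<^sub>l\<^sup>2\<close> without
  moving the eigenpoints.\<close>

lemma tau_image_normal_form:
  assumes d: "d \<ge> 3" and n: "CARD('n::finite) \<ge> 2" and "k \<noteq> l" and z: "z \<in> tau ` (tau_dom d :: 'n cpoly set set)"
  shows "\<exists>\<phi>. (\<forall>a. a \<notin> (if odd d then Mon d else Mon d - {mixed_mon d k l}) \<longrightarrow> \<phi> a = 0) \<and>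
    exactly d (num_eig TYPE('n) d) \<phi> \<and> z = mset_set (eig_lines d \<phi>)"
proof -
  obtain f :: "'n cpoly" where f: "f \<in> Sym d" "exactly d (num_eig TYPE('n) d) (Poly_Mapping.lookup f)"
    "z = mset_set (eig_lines d (Poly_Mapping.lookup f))" by (rule tau_dom_exactly[OF d n z])
  let ?\<phi> = "Poly_Mapping.lookup f" and ?S = "mixed_mon d k l"
  have out: "?\<phi> a = 0" if "a \<notin> Mon d" for a using f(1) that by (simp add: Sym_iff)
  show ?thesis
  proof (cases "odd d")
    case True
    then show ?thesis using out f by (intro exI[of _ ?\<phi>]) simp
  next
    case False
    define c where "c = - ?\<phi> ?S / qcoeff d ?S"
    let ?\<phi>' = "\<lambda>a. ?\<phi> a + c * qcoeff d a"
    have lines: "eig_lines d ?\<phi>' = eig_lines d ?\<phi>" using d by (intro eig_lines_add_qcoeff) simp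
    have "qcoeff d ?S \<noteq> 0" using qcoeff_mixed_nonzero False d \<open>k \<noteq> l\<close> by blast
    then have "?\<phi>' ?S = 0" by (simp add: c_def)
    then have "?\<phi>' a = 0" if "a \<notin> Mon d - {?S}" for a using that out[of a] qcoeff_outside[of a d] by auto
    then show ?thesis using f(2,3) False unfolding exactly_def
      by (intro exI[of _ ?\<phi>'] conjI allI impI) (simp_all add: lines)
  qed
qed

lemma tau_image_sym_power:
  assumes "d \<ge> 3" "CARD('n::finite) \<ge> 2"
  shows "tau ` (tau_dom d :: 'n cpoly set set) \<subseteq> sym_power_PV (num_eig TYPE('n) d)"
proof
  fix z assume "z \<in> tau ` (tau_dom d :: 'n cpoly set set)"
  then obtain f :: "'n cpoly" where f: "exactly d (num_eig TYPE('n) d) (Poly_Mapping.lookup f)"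
    "z = mset_set (eig_lines d (Poly_Mapping.lookup f))" by (rule tau_dom_exactly[OF assms])
  obtain \<psi> where "nz (num_eig TYPE('n) d) \<psi>" "mset (tuple (num_eig TYPE('n) d) \<psi>) = z"
    unfolding f(2) by (rule exactly_tuple[OF f(1)])
  then show "z \<in> sym_power_PV (num_eig TYPE('n) d)" using sym_power_PV_iff by blast
qed

lemma (in fermat_star) points_slice_tau:
  assumes "CARD('n) \<ge> 2" "B \<subseteq> Mon d"
  shows "points ` slice B \<subseteq> tau ` (tau_dom d :: 'n cpoly set set)"
proof (rule image_subsetI)
  fix \<phi> :: "('n \<Rightarrow>\<^sub>0 nat) \<Rightarrow> complex" assume \<phi>: "\<phi> \<in> slice B"
  have "\<phi> a = 0" if "a \<notin> Mon d" for a using \<phi> assms(2) that fermat_outside[OF that] by (auto simp: slice_def)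
  then obtain f where f: "f \<in> Sym d" "Poly_Mapping.lookup f = \<phi>" by (rule Sym_from_coeffs)
  have ex: "exactly d (num_eig TYPE('n) d) \<phi>" by (rule exactly_near[OF slice_near[OF \<phi>]])
  have "f \<noteq> 0"
  proof
    assume "f = 0"
    then have "eigc d \<phi> x" for x using f(2) by (auto simp: eigc_def gradc_def)
    then show False using not_exactly_trivial[OF assms(1)] ex by blast
  qed
  then have "form_pt f \<in> tau_dom d" using tau_dom_iff[OF d assms(1)] f ex by blast
  moreover have "points \<phi> = tau (form_pt f)" by (simp add: tau_form_pt[OF \<open>f \<noteq> 0\<close>] Eig_eig_lines[OF f(1)] f(2))
  ultimately show "points \<phi> \<in> tau ` tau_dom d" by blast
qed

lemma (in fermat_star) krull_dim_tau_image_lower: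
  fixes B :: "('n \<Rightarrow>\<^sub>0 nat) set"
  assumes n: "CARD('n) \<ge> 2" and B: "B \<subseteq> Mon d" "Poly_Mapping.single k d \<notin> B"
    and S: "even d \<Longrightarrow> k \<noteq> l \<and> mixed_mon d k l \<notin> B"
  shows "enat (card B) \<le> krull_dim (subtopology (zariski_sym_power_PV (num_eig TYPE('n) d)) (tau ` (tau_dom d :: 'n cpoly set set)))"
  by (rule krull_dim_lower[OF finite_subset[OF B(1) finite_Mon] B S points_slice_tau[OF n B(1)] tau_image_sym_power[OF d n]])

lemma krull_dim_tau_image:
  assumes d: "d \<ge> 3" and n: "CARD('n::finite) \<ge> 2"
  shows "krull_dim (subtopology (zariski_sym_power_PV (ed_degree TYPE('n) d)) (tau ` (tau_dom d :: 'n cpoly set set))) =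
    enat ((d + CARD('n) - 1 choose d) - (if odd d then 1 else 2))"
proof -
  obtain k l :: 'n where kl: "k \<noteq> l"
  proof -
    have "\<not> is_singleton (UNIV :: 'n set)" using n by (auto simp: is_singleton_altdef)
    then show thesis using that by (metis UNIV_I is_singletonI' emptyE)
  qed
  define B0 :: "('n \<Rightarrow>\<^sub>0 nat) set" where "B0 = (if odd d then Mon d else Mon d - {mixed_mon d k l})"
  let ?O = "Poly_Mapping.single k d"
  have finB0: "finite B0" and B0: "B0 \<subseteq> Mon d" by (auto simp: B0_def)
  have "?O \<in> Mon d" by (simp add: Mon_def lookup_single when_def)
  then have O: "?O \<in> B0" using mixed_mon_neq[OF d kl, of k] by (auto simp: B0_def)
  have card: "card B0 - 1 = (d + CARD('n) - 1 choose d) - (if odd d then 1 else 2)"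
    using mixed_mon_in_Mon[OF d, of k l] by (simp add: B0_def card_Mon numeral_2_eq_2)
  obtain \<rho> \<delta> C where star: "fermat_star TYPE('n) d \<rho> \<delta> C" using fermat_star_exists[OF d n] .
  \<comment> \<open>The monomial x_k^d is left out because the Fermat form takes its place; in the
    upper bound one coefficient is lost to scaling. Both bounds are therefore card B0 - 1.\<close>
  have "enat (card (B0 - {?O})) \<le> krull_dim (subtopology (zariski_sym_power_PV (num_eig TYPE('n) d)) (tau ` (tau_dom d :: 'n cpoly set set)))"
  proof (rule fermat_star.krull_dim_tau_image_lower[OF star n])
    show "k \<noteq> l \<and> mixed_mon d k l \<notin> B0 - {?O}" if "even d" using that kl by (simp add: B0_def)
  qed (use B0 in auto)
  moreover have "krull_dim (subtopology (zariski_sym_power_PV (num_eig TYPE('n) d)) (tau ` (tau_dom d :: 'n cpoly set set))) \<le> enat (card B0 - 1)"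
  proof (rule krull_dim_upper[OF n finB0])
    fix z assume "z \<in> tau ` (tau_dom d :: 'n cpoly set set)"
    from tau_image_normal_form[OF d n kl this]
    show "\<exists>\<phi>. (\<forall>a. a \<notin> B0 \<longrightarrow> \<phi> a = 0) \<and> exactly d (num_eig TYPE('n) d) \<phi> \<and> z = mset_set (eig_lines d \<phi>)"
      by (simp only: B0_def)
  qed
  ultimately show ?thesis unfolding ed_degree_eq[OF d n] card[symmetric] using O finB0 by simp
qed

theorem theorem1p1:
  fixes m d :: nat
  assumes "CARD('n::finite) = m + 1" and "m \<ge> 1" and "d \<ge> 3"
  shows "general_form d (\<lambda>f :: 'n cpoly.
           form_pt f \<in> tau_dom d \<and>
           {P \<in> tau_dom d. tau P = tau (form_pt f)} =
             (if odd d then {form_pt f}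
              else {form_pt (f + const_poly c * q_form ^ (d div 2)) | c. True}))
         \<and>
         krull_dim (subtopology (zariski_sym_power_PV (ed_degree TYPE('n) d))
             (tau ` (tau_dom d :: 'n cpoly set set))) =
           (if odd d then enat (((d + m) choose d) - 1) else enat (((d + m) choose d) - 2))"
proof
  have n: "CARD('n) \<ge> 2" using assms(1,2) by simp
  show "general_form d (\<lambda>f :: 'n cpoly.
           form_pt f \<in> tau_dom d \<and>
           {P \<in> tau_dom d. tau P = tau (form_pt f)} =
             (if odd d then {form_pt f}
              else {form_pt (f + const_poly c * q_form ^ (d div 2)) | c. True}))"
    by (rule general_form_mono[OF general_exactly_determined[OF assms(3) n]])
      (intro conjI fibre[OF assms(3) n]; elim conjE; assumption)
  show "krull_dim (subtopology (zariski_sym_power_PV (ed_degree TYPE('n) d))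
             (tau ` (tau_dom d :: 'n cpoly set set))) =
           (if odd d then enat (((d + m) choose d) - 1) else enat (((d + m) choose d) - 2))"
    unfolding krull_dim_tau_image[OF assms(3) n] using assms(1) by simp
qed

end
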